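(* Let $R$ be an algebra over $\mathbb{C}$ and let $G$ be a finite group acting on $R$ by automorphisms, with fixed point ring $R^G=\{r\in R: g(r)=r\text{ for all }g\in G\}$. Let $R^\lambda$ be a simple $R$-module and let $H$ be the inertia group of $R^\lambda$. The ring $R^G$ acts on $R^\lambda$ (by restriction) and $(\mathbb{C}H)_\alpha$ acts on $R^\lambda$ (by the $R$-module isomorphisms $\phi_h\colon R^\lambda\cong{}^{h^{-1}}R^\lambda$, $h\in H$), and these two actions commute. Thus there is a decomposition $$R^\lambda\cong\bigoplus_{\nu\in\hat H_\alpha}R^{\lambda,\nu}\otimes(H^\nu)^*,$$ where $\hat H_\alpha$ is an index set for the simple $(\mathbb{C}H)_\alpha$-modules, $(H^\nu)^*$ is the dual of the simple $(\mathbb{C}H)_{\alpha^{-1}}$-module $H^\nu$, and $R^{\lambda,\nu}$ is an $R^G$-module. (a) If $R^{\lambda,\mu}\neq0$ then it is a simple $R^G$-module. (b) Every simple $R^G$-module is isomorphic to some $R^{\lambda,\mu}$. (c) The nonzero $R^{\lambda,\mu}$ are pairwise nonisomorphic.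
   Context: Modules are (finite dimensional) left modules. For an $R$-module $N$ and $g\in G$, ${}^gN$ is the $R$-module with the same underlying vector space as $N$ and $R$-action $r\circ n=g^{-1}(r)n$. This gives an action of $G$ on the set of simple $R$-modules. The inertia group of a simple $R$-module $R^\lambda$ is $H=\{h\in G: R^\lambda\cong{}^hR^\lambda\}$. For each $h\in H$ fix an $R$-module isomorphism $\phi_h\colon R^\lambda\to{}^{h^{-1}}R^\lambda$ (by Schur's lemma it is unique up to constant multiples). As operators on $R^\lambda$, $\phi_hr=h(r)\phi_h$ for $r\in R$ and $\phi_g\phi_h=\alpha(g,h)\phi_{gh}$ with $\alpha(g,h)\in\mathbb{C}^*$; the function $\alpha\colon H\times H\to\mathbb{C}^*$ is the factor set determined by the choice of the $\phi_h$. $(\mathbb{C}H)_\alpha$ is the algebra with basis $\{b_h: h\in H\}$ and multiplication $b_gb_h=\alpha(g,h)b_{gh}$; it acts on $R^\lambda$ by letting $b_h$ act as $\phi_h$. $(\mathbb{C}H)_{\alpha^{-1}}$ is the algebra with basis $\{c_h: h\in H\}$ and multiplication $c_gc_h=\alpha(g,h)^{-1}c_{gh}$. The dual of a $(\mathbb{C}H)_{\alpha^{-1}}$-module $N$ is the $(\mathbb{C}H)_\alpha$-module $N^*=\mathrm{Hom}_{\mathbb{C}}(N,\mathbb{C})$ with $(b_h\psi)(n)=\psi(c_h^{-1}n)$. In (b) and (c), $R^{\lambda,\mu}$ denotes the $R^G$-modules obtained in this way from simple $R$-modules $R^\lambda$ (with $H$ and $\alpha$ depending on $\lambda$).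
   Formalization: In (b), the simple R^G-module is assumed to embed only in finite dimensional simple R-modules, and the R^λ cover all finite dimensional simple R-modules up to isomorphism and G-twist; in (c), different λ are assumed to lie in different G-orbits. Without these (b) and (c) fail. *)

theory Defs
  imports "HOL-Algebra.Algebra" "HOL-Algebra.Algebraic_Closure_Type" Complex_Main
begin

section \<open>Algebras over the complex numbers and their left modules\<close>

text \<open>
  The locale \<^locale>\<open>module\<close> insists on a commutative ring of scalars, so left modules over
  arbitrary unital rings are introduced here on the same record type, with the same laws.
  An algebra is also such a record: its ring operations are the multiplication of the algebra, and
  \<^const>\<open>module.smult\<close> is multiplication by complex scalars.  In records that only serve as modules the
  fields \<^const>\<open>monoid.mult\<close> and \<^const>\<open>one\<close> carry no information.
\<close>

abbreviation complex_field :: "complex ring"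
  where "complex_field \<equiv> ring_of_type_algebra"

locale complex_algebra = ring A + module complex_field A
  for A :: "(complex, 'a) module" (structure) +
  assumes smult_mult_left:
    "\<lbrakk>x \<in> carrier A; y \<in> carrier A\<rbrakk> \<Longrightarrow> (c \<odot> x) \<otimes> y = c \<odot> (x \<otimes> y)"
  and smult_mult_right:
    "\<lbrakk>x \<in> carrier A; y \<in> carrier A\<rbrakk> \<Longrightarrow> x \<otimes> (c \<odot> y) = c \<odot> (x \<otimes> y)"

locale left_module = A?: ring A + M?: abelian_group M
  for A :: "(complex, 'a) module" and M :: "('a, 'm) module" +
  assumes smult_closed:
    "\<lbrakk>a \<in> carrier A; x \<in> carrier M\<rbrakk> \<Longrightarrow> a \<odot>\<^bsub>M\<^esub> x \<in> carrier M"
  and smult_l_distr: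
    "\<lbrakk>a \<in> carrier A; b \<in> carrier A; x \<in> carrier M\<rbrakk> \<Longrightarrow>
      (a \<oplus>\<^bsub>A\<^esub> b) \<odot>\<^bsub>M\<^esub> x = a \<odot>\<^bsub>M\<^esub> x \<oplus>\<^bsub>M\<^esub> b \<odot>\<^bsub>M\<^esub> x"
  and smult_r_distr:
    "\<lbrakk>a \<in> carrier A; x \<in> carrier M; y \<in> carrier M\<rbrakk> \<Longrightarrow>
      a \<odot>\<^bsub>M\<^esub> (x \<oplus>\<^bsub>M\<^esub> y) = a \<odot>\<^bsub>M\<^esub> x \<oplus>\<^bsub>M\<^esub> a \<odot>\<^bsub>M\<^esub> y"
  and smult_assoc:
    "\<lbrakk>a \<in> carrier A; b \<in> carrier A; x \<in> carrier M\<rbrakk> \<Longrightarrow>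
      (a \<otimes>\<^bsub>A\<^esub> b) \<odot>\<^bsub>M\<^esub> x = a \<odot>\<^bsub>M\<^esub> (b \<odot>\<^bsub>M\<^esub> x)"
  and smult_one:
    "x \<in> carrier M \<Longrightarrow> \<one>\<^bsub>A\<^esub> \<odot>\<^bsub>M\<^esub> x = x"

text \<open>The complex vector space structure that a module over an algebra inherits from the algebra.\<close>

definition cscale :: "(complex, 'a) module \<Rightarrow> ('a, 'm) module \<Rightarrow> complex \<Rightarrow> 'm \<Rightarrow> 'm"
  where "cscale A M c x = (c \<odot>\<^bsub>A\<^esub> \<one>\<^bsub>A\<^esub>) \<odot>\<^bsub>M\<^esub> x"

definition fin_dim :: "(complex, 'a) module \<Rightarrow> ('a, 'm) module \<Rightarrow> bool"
  where "fin_dim A M \<longleftrightarrow>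
    (\<exists>B. finite B \<and> B \<subseteq> carrier M \<and>
      (\<forall>x\<in>carrier M. \<exists>c. x = (\<Oplus>\<^bsub>M\<^esub>b\<in>B. cscale A M (c b) b)))"

definition simple_module :: "(complex, 'a) module \<Rightarrow> ('a, 'm) module \<Rightarrow> bool"
  where "simple_module A M \<longleftrightarrow>
    left_module A M \<and> carrier M \<noteq> {\<zero>\<^bsub>M\<^esub>} \<and>
    (\<forall>U. submodule U A M \<longrightarrow> U = {\<zero>\<^bsub>M\<^esub>} \<or> U = carrier M)"

definition module_hom ::
  "(complex, 'a) module \<Rightarrow> ('a, 'm) module \<Rightarrow> ('a, 'n) module \<Rightarrow> ('m \<Rightarrow> 'n) set"
  where "module_hom A M N =
    {f \<in> carrier M \<rightarrow> carrier N.
      (\<forall>x\<in>carrier M. \<forall>y\<in>carrier M. f (x \<oplus>\<^bsub>M\<^esub> y) = f x \<oplus>\<^bsub>N\<^esub> f y) \<and>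
      (\<forall>a\<in>carrier A. \<forall>x\<in>carrier M. f (a \<odot>\<^bsub>M\<^esub> x) = a \<odot>\<^bsub>N\<^esub> f x)}"

definition module_iso ::
  "(complex, 'a) module \<Rightarrow> ('a, 'm) module \<Rightarrow> ('a, 'n) module \<Rightarrow> ('m \<Rightarrow> 'n) set"
  where "module_iso A M N = {f \<in> module_hom A M N. bij_betw f (carrier M) (carrier N)}"

definition isomorphic ::
  "(complex, 'a) module \<Rightarrow> ('a, 'm) module \<Rightarrow> ('a, 'n) module \<Rightarrow> bool"
  where "isomorphic A M N \<longleftrightarrow> module_iso A M N \<noteq> {}"

text \<open>
  A family of simple modules that contains each simple \<open>A\<close>-module exactly once up to isomorphism.
  Every simple \<open>A\<close>-module is isomorphic to a quotient of \<open>A\<close> by a left ideal, and the elements of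
  that quotient are cosets; so it suffices to test modules whose elements have type \<open>'a set\<close>.
\<close>

definition complete_simples ::
  "(complex, 'a) module \<Rightarrow> 'i set \<Rightarrow> ('i \<Rightarrow> ('a, 'n) module) \<Rightarrow> bool"
  where "complete_simples A I N \<longleftrightarrow>
    (\<forall>\<nu>\<in>I. simple_module A (N \<nu>)) \<and>
    (\<forall>\<nu>\<in>I. \<forall>\<nu>'\<in>I. isomorphic A (N \<nu>) (N \<nu>') \<longrightarrow> \<nu> = \<nu>') \<and>
    (\<forall>S :: ('a, 'a set) module. simple_module A S \<longrightarrow> (\<exists>\<nu>\<in>I. isomorphic A S (N \<nu>)))"

section \<open>Group actions, twisted modules and inertia groups\<close>

locale algebra_action = complex_algebra R + group G + group_action G "carrier R" act
  for R :: "(complex, 'r) module" and G :: "'g monoid" and act :: "'g \<Rightarrow> 'r \<Rightarrow> 'r" +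
  assumes act_ring_hom: "g \<in> carrier G \<Longrightarrow> act g \<in> ring_hom R R"
  and act_smult:
    "\<lbrakk>g \<in> carrier G; x \<in> carrier R\<rbrakk> \<Longrightarrow> act g (c \<odot>\<^bsub>R\<^esub> x) = c \<odot>\<^bsub>R\<^esub> act g x"

text \<open>
  An \<open>R\<close>-module is regarded as a module over the fixed ring without changing its record:
  \<^const>\<open>module.smult\<close> is then only applied to elements of the smaller carrier.
\<close>

definition fixed_ring ::
  "(complex, 'r) module \<Rightarrow> 'g monoid \<Rightarrow> ('g \<Rightarrow> 'r \<Rightarrow> 'r) \<Rightarrow> (complex, 'r) module"
  where "fixed_ring R G act =
    R\<lparr>carrier := {r \<in> carrier R. \<forall>g\<in>carrier G. act g r = r}\<rparr>"

definition twist ::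
  "'g monoid \<Rightarrow> ('g \<Rightarrow> 'r \<Rightarrow> 'r) \<Rightarrow> 'g \<Rightarrow> ('r, 'm) module \<Rightarrow> ('r, 'm) module"
  where "twist G act g M = M\<lparr>module.smult := \<lambda>r x. act (inv\<^bsub>G\<^esub> g) r \<odot>\<^bsub>M\<^esub> x\<rparr>"

definition inertia ::
  "(complex, 'r) module \<Rightarrow> 'g monoid \<Rightarrow> ('g \<Rightarrow> 'r \<Rightarrow> 'r) \<Rightarrow> ('r, 'm) module \<Rightarrow> 'g set"
  where "inertia R G act M = {h \<in> carrier G. isomorphic R M (twist G act h M)}"

text \<open>The scalar is unique because \<open>\<phi> (g \<otimes>\<^bsub>G\<^esub> h)\<close> is a nonzero operator.\<close>

definition factor_set ::
  "(complex, 'r) module \<Rightarrow> 'g monoid \<Rightarrow> ('r, 'm) module \<Rightarrow> ('g \<Rightarrow> 'm \<Rightarrow> 'm) \<Rightarrow>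
    'g \<Rightarrow> 'g \<Rightarrow> complex"
  where "factor_set R G M \<phi> g h =
    (THE c. \<forall>x\<in>carrier M. \<phi> g (\<phi> h x) = cscale R M c (\<phi> (g \<otimes>\<^bsub>G\<^esub> h) x))"

section \<open>Twisted group algebras\<close>

text \<open>
  Elements are the coefficient functions on \<open>H\<close>.  Since \<open>\<alpha> \<one> h = \<alpha> \<one> \<one>\<close> for a factor
  set that need not be normalised, the unit is \<open>\<alpha> \<one> \<one>\<close> inverted times the basis
  element at \<open>\<one>\<close>.
\<close>

definition twisted_group_algebra ::
  "'g monoid \<Rightarrow> 'g set \<Rightarrow> ('g \<Rightarrow> 'g \<Rightarrow> complex) \<Rightarrow> (complex, 'g \<Rightarrow> complex) module"
  where "twisted_group_algebra G H \<alpha> =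
    \<lparr>carrier = {a. \<forall>x. x \<notin> H \<longrightarrow> a x = 0},
     monoid.mult = (\<lambda>a b x. \<Sum>g\<in>H. \<Sum>h\<in>H. if g \<otimes>\<^bsub>G\<^esub> h = x then \<alpha> g h * a g * b h else 0),
     one = (\<lambda>x. if x = \<one>\<^bsub>G\<^esub> then inverse (\<alpha> \<one>\<^bsub>G\<^esub> \<one>\<^bsub>G\<^esub>) else 0),
     ring.zero = (\<lambda>x. 0),
     add = (\<lambda>a b x. a x + b x),
     module.smult = (\<lambda>c a x. c * a x)\<rparr>"

definition basis_element :: "'g \<Rightarrow> 'g \<Rightarrow> complex"
  where "basis_element h = (\<lambda>x. if x = h then 1 else 0)"

definition CH ::
  "(complex, 'r) module \<Rightarrow> 'g monoid \<Rightarrow> ('g \<Rightarrow> 'r \<Rightarrow> 'r) \<Rightarrow> ('r, 'm) module \<Rightarrow>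
    ('g \<Rightarrow> 'm \<Rightarrow> 'm) \<Rightarrow> (complex, 'g \<Rightarrow> complex) module"
  where "CH R G act M \<phi> =
    twisted_group_algebra G (inertia R G act M) (factor_set R G M \<phi>)"

definition CH_inv ::
  "(complex, 'r) module \<Rightarrow> 'g monoid \<Rightarrow> ('g \<Rightarrow> 'r \<Rightarrow> 'r) \<Rightarrow> ('r, 'm) module \<Rightarrow>
    ('g \<Rightarrow> 'm \<Rightarrow> 'm) \<Rightarrow> (complex, 'g \<Rightarrow> complex) module"
  where "CH_inv R G act M \<phi> =
    twisted_group_algebra G (inertia R G act M) (\<lambda>g h. inverse (factor_set R G M \<phi> g h))"

text \<open>The space of \<open>M\<close>, with the basis element at \<open>h\<close> acting as \<open>\<phi> h\<close>.\<close>

definition CH_module ::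
  "(complex, 'r) module \<Rightarrow> 'g monoid \<Rightarrow> ('g \<Rightarrow> 'r \<Rightarrow> 'r) \<Rightarrow> ('r, 'm) module \<Rightarrow>
    ('g \<Rightarrow> 'm \<Rightarrow> 'm) \<Rightarrow> ('g \<Rightarrow> complex, 'm) module"
  where "CH_module R G act M \<phi> =
    \<lparr>carrier = carrier M, monoid.mult = undefined, one = undefined,
     ring.zero = \<zero>\<^bsub>M\<^esub>, add = add M,
     module.smult = (\<lambda>a x. \<Oplus>\<^bsub>M\<^esub>h\<in>inertia R G act M. cscale R M (a h) (\<phi> h x))\<rparr>"

text \<open>
  The dual of a module \<open>N\<close> over \<open>A\<close>, a twisted group algebra of \<open>H\<close> for the inverse of a factor
  set \<open>\<alpha>\<close>; it is a module over the twisted group algebra for \<open>\<alpha>\<close> itself.  The inverse of the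
  basis element at \<open>h\<close> is taken in the algebra \<open>A\<close>; it is only a multiple of the basis element
  at the inverse of \<open>h\<close>.
\<close>

definition dual_module ::
  "'g set \<Rightarrow> (complex, 'g \<Rightarrow> complex) module \<Rightarrow> ('g \<Rightarrow> complex, 'n) module \<Rightarrow>
    ('g \<Rightarrow> complex, 'n \<Rightarrow> complex) module"
  where "dual_module H A N =
    \<lparr>carrier = {\<psi> \<in> extensional (carrier N).
        (\<forall>x\<in>carrier N. \<forall>y\<in>carrier N. \<psi> (x \<oplus>\<^bsub>N\<^esub> y) = \<psi> x + \<psi> y) \<and>
        (\<forall>c. \<forall>x\<in>carrier N. \<psi> (cscale A N c x) = c * \<psi> x)},
     monoid.mult = undefined, one = undefined,
     ring.zero = (\<lambda>x\<in>carrier N. 0),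
     add = (\<lambda>\<psi> \<chi>. \<lambda>x\<in>carrier N. \<psi> x + \<chi> x),
     module.smult = (\<lambda>a \<psi>. \<lambda>x\<in>carrier N.
        \<Sum>h\<in>H. a h * \<psi> ((inv\<^bsub>A\<^esub> (basis_element h)) \<odot>\<^bsub>N\<^esub> x))\<rparr>"

section \<open>Tensor products over the complex numbers and direct sums\<close>

text \<open>
  The tensor product of complex vector spaces, one carrying an \<open>A\<close>-module and the other a
  \<open>B\<close>-module structure.  It is realised inside the dual of the space of bilinear forms, with
  the pure tensor of \<open>x\<close> and \<open>y\<close> being evaluation at \<open>(x, y)\<close>: over a field, bilinear forms
  separate the elements of the algebraic tensor product, so the span of the pure tensors is
  the tensor product (in any dimension).
\<close>

definition bilinear_forms ::
  "(complex, 'a) module \<Rightarrow> ('a, 'm) module \<Rightarrow> (complex, 'b) module \<Rightarrow> ('b, 'n) module \<Rightarrow>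
    ('m \<Rightarrow> 'n \<Rightarrow> complex) set"
  where "bilinear_forms A M B N =
    {\<beta>. (\<forall>x\<in>carrier M. \<forall>x'\<in>carrier M. \<forall>y\<in>carrier N. \<beta> (x \<oplus>\<^bsub>M\<^esub> x') y = \<beta> x y + \<beta> x' y) \<and>
        (\<forall>x\<in>carrier M. \<forall>y\<in>carrier N. \<forall>y'\<in>carrier N. \<beta> x (y \<oplus>\<^bsub>N\<^esub> y') = \<beta> x y + \<beta> x y') \<and>
        (\<forall>c. \<forall>x\<in>carrier M. \<forall>y\<in>carrier N. \<beta> (cscale A M c x) y = c * \<beta> x y) \<and>
        (\<forall>c. \<forall>x\<in>carrier M. \<forall>y\<in>carrier N. \<beta> x (cscale B N c y) = c * \<beta> x y)}"

definition pure_tensor ::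
  "(complex, 'a) module \<Rightarrow> ('a, 'm) module \<Rightarrow> (complex, 'b) module \<Rightarrow> ('b, 'n) module \<Rightarrow>
    'm \<Rightarrow> 'n \<Rightarrow> ('m \<Rightarrow> 'n \<Rightarrow> complex) \<Rightarrow> complex"
  where "pure_tensor A M B N x y = (\<lambda>\<beta>. if \<beta> \<in> bilinear_forms A M B N then \<beta> x y else 0)"

definition tensor_carrier ::
  "(complex, 'a) module \<Rightarrow> ('a, 'm) module \<Rightarrow> (complex, 'b) module \<Rightarrow> ('b, 'n) module \<Rightarrow>
    (('m \<Rightarrow> 'n \<Rightarrow> complex) \<Rightarrow> complex) set"
  where "tensor_carrier A M B N =
    {\<lambda>\<beta>. \<Sum>i<k. pure_tensor A M B N (x i) (y i) \<beta> | (k :: nat) x y.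
      (\<forall>i<k. x i \<in> carrier M \<and> y i \<in> carrier N)}"

text \<open>
  The two module structures on the tensor product: \<open>a\<close> acts by \<open>a(x \<otimes> y) = (ax) \<otimes> y\<close>
  in the first and \<open>b\<close> acts by \<open>b(x \<otimes> y) = x \<otimes> (by)\<close> in the second.
\<close>

definition tensor_left ::
  "(complex, 'a) module \<Rightarrow> ('a, 'm) module \<Rightarrow> (complex, 'b) module \<Rightarrow> ('b, 'n) module \<Rightarrow>
    ('a, ('m \<Rightarrow> 'n \<Rightarrow> complex) \<Rightarrow> complex) module"
  where "tensor_left A M B N =
    \<lparr>carrier = tensor_carrier A M B N, monoid.mult = undefined, one = undefined,
     ring.zero = (\<lambda>\<beta>. 0), add = (\<lambda>t u \<beta>. t \<beta> + u \<beta>),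
     module.smult = (\<lambda>a t \<beta>. if \<beta> \<in> bilinear_forms A M B N then t (\<lambda>x y. \<beta> (a \<odot>\<^bsub>M\<^esub> x) y) else 0)\<rparr>"

definition tensor_right ::
  "(complex, 'a) module \<Rightarrow> ('a, 'm) module \<Rightarrow> (complex, 'b) module \<Rightarrow> ('b, 'n) module \<Rightarrow>
    ('b, ('m \<Rightarrow> 'n \<Rightarrow> complex) \<Rightarrow> complex) module"
  where "tensor_right A M B N =
    \<lparr>carrier = tensor_carrier A M B N, monoid.mult = undefined, one = undefined,
     ring.zero = (\<lambda>\<beta>. 0), add = (\<lambda>t u \<beta>. t \<beta> + u \<beta>),
     module.smult = (\<lambda>b t \<beta>. if \<beta> \<in> bilinear_forms A M B N then t (\<lambda>x y. \<beta> x (b \<odot>\<^bsub>N\<^esub> y)) else 0)\<rparr>"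

definition direct_sum :: "'i set \<Rightarrow> ('i \<Rightarrow> ('a, 'm) module) \<Rightarrow> ('a, 'i \<Rightarrow> 'm) module"
  where "direct_sum I F =
    \<lparr>carrier = {f \<in> \<Pi>\<^sub>E i\<in>I. carrier (F i). finite {i \<in> I. f i \<noteq> \<zero>\<^bsub>F i\<^esub>}},
     monoid.mult = undefined, one = undefined,
     ring.zero = (\<lambda>i\<in>I. \<zero>\<^bsub>F i\<^esub>),
     add = (\<lambda>f g. \<lambda>i\<in>I. f i \<oplus>\<^bsub>F i\<^esub> g i),
     module.smult = (\<lambda>a f. \<lambda>i\<in>I. a \<odot>\<^bsub>F i\<^esub> f i)\<rparr>"

section \<open>The decomposition of a simple module\<close>

text \<open>
  \<open>Y \<nu>\<close> (for \<open>\<nu> \<in> I\<close>) are modules over the fixed ring such that \<open>M\<close> is isomorphic to the direct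
  sum of the tensor products of \<open>Y \<nu>\<close> with the dual of \<open>N \<nu>\<close>, by one bijection that respects both
  the action of the fixed ring and the action of the twisted group algebra.
\<close>

definition clifford_decomposition ::
  "(complex, 'r) module \<Rightarrow> 'g monoid \<Rightarrow> ('g \<Rightarrow> 'r \<Rightarrow> 'r) \<Rightarrow> ('r, 'm) module \<Rightarrow>
    ('g \<Rightarrow> 'm \<Rightarrow> 'm) \<Rightarrow> 'i set \<Rightarrow> ('i \<Rightarrow> ('g \<Rightarrow> complex, 'n) module) \<Rightarrow>
    ('i \<Rightarrow> ('r, 'x) module) \<Rightarrow> bool"
  where "clifford_decomposition R G act M \<phi> I N Y \<longleftrightarrow>
    (let RG = fixed_ring R G act; C = CH R G act M \<phi>;
         D = (\<lambda>\<nu>. dual_module (inertia R G act M) (CH_inv R G act M \<phi>) (N \<nu>))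
     in (\<forall>\<nu>\<in>I. left_module RG (Y \<nu>)) \<and>
        module_iso RG M (direct_sum I (\<lambda>\<nu>. tensor_left RG (Y \<nu>) C (D \<nu>))) \<inter>
        module_iso C (CH_module R G act M \<phi>)
          (direct_sum I (\<lambda>\<nu>. tensor_right RG (Y \<nu>) C (D \<nu>))) \<noteq> {})"

section \<open>Families of simple modules\<close>

text \<open>
  Twisting \<open>M\<close> by a group element does not change its restriction to the fixed ring, so simple
  modules have to be taken up to isomorphism and twisting.  In \<open>covers_simples\<close> the elements of
  \<open>V\<close> can be assumed to have type \<open>'r set\<close> for the same reason as in
  \<^const>\<open>complete_simples\<close>.
\<close>

definition covers_simples ::
  "(complex, 'r) module \<Rightarrow> 'g monoid \<Rightarrow> ('g \<Rightarrow> 'r \<Rightarrow> 'r) \<Rightarrow> 'l set \<Rightarrow> ('l \<Rightarrow> ('r, 'm) module) \<Rightarrow> bool"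
  where "covers_simples R G act L M \<longleftrightarrow>
    (\<forall>V :: ('r, 'r set) module. simple_module R V \<and> fin_dim R V \<longrightarrow>
      (\<exists>l\<in>L. \<exists>g\<in>carrier G. isomorphic R V (twist G act g (M l))))"

definition distinct_orbits ::
  "(complex, 'r) module \<Rightarrow> 'g monoid \<Rightarrow> ('g \<Rightarrow> 'r \<Rightarrow> 'r) \<Rightarrow> 'l set \<Rightarrow> ('l \<Rightarrow> ('r, 'm) module) \<Rightarrow> bool"
  where "distinct_orbits R G act L M \<longleftrightarrow>
    (\<forall>l\<in>L. \<forall>l'\<in>L. \<forall>g\<in>carrier G. isomorphic R (M l') (twist G act g (M l)) \<longrightarrow> l = l')"

text \<open>
  The simple \<open>R\<close>-modules \<open>V\<close> whose restriction to the fixed ring contains a copy of \<open>S\<close> are all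
  finite dimensional.  This holds for every \<open>S\<close> if all simple \<open>R\<close>-modules are finite dimensional,
  for instance if \<open>R\<close> is; for finite dimensional \<open>S\<close> it also holds if \<open>R\<close> is a finitely generated
  right module over the fixed ring.  It fails, for example, if \<open>R = End V\<close> with \<open>V\<close> infinite
  dimensional and the group of order two acts by conjugation with an involution \<open>s\<close> of \<open>V\<close> whose
  \<open>1\<close>-eigenspace \<open>S\<close> is a line: \<open>S\<close> is then a simple module over the fixed ring, which is
  \<open>End S \<times> End S'\<close> for the other eigenspace \<open>S'\<close>, but \<open>R\<close> has no nonzero finite dimensional modules.
\<close>

definition only_in_fin_dim_simples ::
  "(complex, 'r) module \<Rightarrow> 'g monoid \<Rightarrow> ('g \<Rightarrow> 'r \<Rightarrow> 'r) \<Rightarrow> ('r, 's) module \<Rightarrow> bool"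
  where "only_in_fin_dim_simples R G act S \<longleftrightarrow>
    (\<forall>V :: ('r, 'r set) module. simple_module R V \<and>
      (\<exists>f\<in>module_hom (fixed_ring R G act) S V. inj_on f (carrier S)) \<longrightarrow> fin_dim R V)"

end

theory Submission
  imports Defs "HOL-Computational_Algebra.Fundamental_Theorem_Algebra"
begin

text \<open>
  Density makes \<open>R\<close> act by arbitrary operators on finitely many pairwise nonisomorphic finite
  dimensional simple modules.  Given an operator \<open>T\<close> on \<open>M\<close> that commutes with all \<open>\<phi>\<^sub>h\<close>, choose \<open>r\<close>
  acting as \<open>T / |H|\<close> on \<open>M\<close> and as zero on all twists of \<open>M\<close> that are not isomorphic to \<open>M\<close>; then
  \<open>\<Sum>g. g(r)\<close> lies in the fixed ring and acts as \<open>T\<close>.  So the fixed ring acts on \<open>M\<close> through the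
  whole commutant of the twisted group algebra, which is the product of the algebras of all operators
  on the multiplicity spaces \<open>Y \<nu>\<close>.  This yields (a), and also (c) since \<open>r\<close> can in addition be made
  to annihilate the modules of another orbit.  For (b), write a simple module of the fixed ring as
  its quotient by a maximal left ideal \<open>J\<close>.  The left ideal of those \<open>x \<in> R\<close> with \<open>\<Sum>g. g(r x) \<in> J\<close> for
  all \<open>r \<in> R\<close> is proper and contains \<open>J\<close>, and the quotient of \<open>R\<close> by a maximal left ideal containing it
  is a simple \<open>R\<close>-module into which the given module embeds.

  The decomposition itself comes from Maschke's theorem for the twisted group algebra \<open>C\<close>: it acts
  faithfully on the sum of its simple modules \<open>D \<nu>\<close>, hence contains, by density, elements acting as
  arbitrary operators of rank one on one \<open>D \<nu>\<close> and as zero on the others, and these provide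
  coordinates of \<open>M\<close> in the sum of the spaces \<open>Hom\<^sub>C(D \<nu>, M) \<otimes> D \<nu>\<close>.
\<close>

text \<open>Besides division, two properties of the complex numbers are used: an operator on a
  finite dimensional space has an eigenvector, which gives Schur's lemma, and |G| and |H| are
  nonzero scalars, which is what makes the averages work. Two obstacles shape the rest. First, the
  index set classifies modules over the algebra of the inverse factor set, while \<open>C\<close>
  acts on \<open>M\<close>. The anti-isomorphism
  \<open>b\<^sub>h \<mapsto> c\<^sub>h\<^sup>-\<^sup>1\<close> turns duals over the one algebra into
  modules over the other, and completeness of the dual family is checked through annihilators
  instead of biduals. Second, (a) to (c) concern an arbitrary family \<open>Y\<close> that admits an
  isomorphism, not just the constructed multiplicity spaces. Therefore each isomorphism is converted
  into coordinate maps \<kappa> \<nu> b from \<open>M\<close> to Y \<nu>: they are homomorphisms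
  over the fixed ring, jointly bijective, and \<open>C\<close> mixes them by complex matrices.
  Nonisomorphism is shown by an element that acts as the identity on one module and as zero on the
  other.\<close>

lemma complex_field_simps [simp]:
  "carrier complex_field = UNIV" "monoid.mult complex_field = (*)" "one complex_field = 1"
  "ring.zero complex_field = 0" "add complex_field = (+)"
  by (auto simp: ring_of_type_algebra_def)

subsection \<open>Additive maps\<close>

text \<open>Formulated for arbitrary ring records, so that the same lemmas apply to x \<mapsto> a x
  on a module and to a \<mapsto> a x from the algebra to a module. Homomorphisms and the group
  action on \<open>R\<close> are further instances.\<close>

definition additive_map :: "('m, 'u) ring_scheme \<Rightarrow> ('n, 'v) ring_scheme \<Rightarrow> ('m \<Rightarrow> 'n) \<Rightarrow> bool"
  where "additive_map M N f \<longleftrightarrow> f \<in> carrier M \<rightarrow> carrier N \<and>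
    (\<forall>x\<in>carrier M. \<forall>y\<in>carrier M. f (x \<oplus>\<^bsub>M\<^esub> y) = f x \<oplus>\<^bsub>N\<^esub> f y)"

lemma additive_map_zero:
  assumes "abelian_group M" "abelian_group N" "additive_map M N f"
  shows "f \<zero>\<^bsub>M\<^esub> = \<zero>\<^bsub>N\<^esub>"
proof -
  interpret M: abelian_group M by fact
  interpret N: abelian_group N by fact
  have c: "f \<zero>\<^bsub>M\<^esub> \<in> carrier N" using assms(3) by (auto simp: additive_map_def)
  have "f \<zero>\<^bsub>M\<^esub> \<oplus>\<^bsub>N\<^esub> f \<zero>\<^bsub>M\<^esub> = f \<zero>\<^bsub>M\<^esub>"
    using assms(3) unfolding additive_map_def by (metis M.l_zero M.zero_closed)
  then show ?thesis using c by (metis N.add.r_cancel_one)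
qed

lemma additive_map_finsum:
  assumes "abelian_group M" "abelian_group N" "additive_map M N f" "g \<in> J \<rightarrow> carrier M"
  shows "f (finsum M g J) = finsum N (\<lambda>j. f (g j)) J"
proof -
  interpret M: abelian_group M by fact
  interpret N: abelian_group N by fact
  show ?thesis using assms(4)
  proof (induction J rule: infinite_finite_induct)
    case (infinite A)
    then show ?case by (simp add: additive_map_zero[OF assms(1-3)])
  next
    case empty
    then show ?case by (simp add: additive_map_zero[OF assms(1-3)])
  next
    case (insert j J)
    then have "g \<in> J \<rightarrow> carrier M" "g j \<in> carrier M" by auto
    moreover have "(\<lambda>j. f (g j)) \<in> J \<rightarrow> carrier N" "f (g j) \<in> carrier N"
      using insert.prems assms(3) by (auto simp: additive_map_def)
    moreover have "f (g j \<oplus>\<^bsub>M\<^esub> finsum M g J) = f (g j) \<oplus>\<^bsub>N\<^esub> f (finsum M g J)"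
      using assms(3) calculation by (auto simp: additive_map_def)
    ultimately show ?case using insert by simp
  qed
qed

lemma additive_map_minus:
  assumes "abelian_group M" "abelian_group N" "additive_map M N f" "x \<in> carrier M"
  shows "f (\<ominus>\<^bsub>M\<^esub> x) = \<ominus>\<^bsub>N\<^esub> f x"
proof -
  interpret M: abelian_group M by fact
  interpret N: abelian_group N by fact
  have "f x \<oplus>\<^bsub>N\<^esub> f (\<ominus>\<^bsub>M\<^esub> x) = \<zero>\<^bsub>N\<^esub>"
    using assms(3,4) additive_map_zero[OF assms(1-3)] unfolding additive_map_def
    by (metis M.a_inv_closed M.r_neg)
  moreover have "f x \<in> carrier N" "f (\<ominus>\<^bsub>M\<^esub> x) \<in> carrier N"
    using assms(3,4) by (auto simp: additive_map_def)
  ultimately show ?thesis using N.minus_equality[of "f (\<ominus>\<^bsub>M\<^esub> x)" "f x"] by (simp add: N.a_comm)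
qed

lemma additive_map_diff:
  assumes "abelian_group M" "abelian_group N" "additive_map M N f" "x \<in> carrier M" "y \<in> carrier M"
  shows "f (x \<ominus>\<^bsub>M\<^esub> y) = f x \<ominus>\<^bsub>N\<^esub> f y"
proof -
  interpret M: abelian_group M by fact
  have "\<ominus>\<^bsub>M\<^esub> y \<in> carrier M" using assms(5) by simp
  then show ?thesis using assms(3,4) additive_map_minus[OF assms(1-3,5)]
    unfolding additive_map_def a_minus_def by simp
qed

lemma (in abelian_group) minus_eq_zero_iff:
  "x \<in> carrier G \<Longrightarrow> y \<in> carrier G \<Longrightarrow> x \<ominus> y = \<zero> \<longleftrightarrow> x = y"
  by (metis a_inv_closed a_minus_def add.inv_comm add.inv_inv minus_equality r_neg)

subsection \<open>Modules over complex algebras\<close>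

locale alg_module = Alg: complex_algebra A + Mod: left_module A M
  for A :: "(complex, 'a) module" and M :: "('a, 'm) module"
begin

lemma ab_group: "abelian_group M" by (rule Mod.M.abelian_group_axioms)

lemma ab_group_algebra: "abelian_group A" by unfold_locales

lemma ring_algebra: "ring A" by unfold_locales

lemma scalar_closed [simp]: "c \<odot>\<^bsub>A\<^esub> \<one>\<^bsub>A\<^esub> \<in> carrier A"
  by simp

lemma smult_closed' [simp]: "a \<in> carrier A \<Longrightarrow> x \<in> carrier M \<Longrightarrow> a \<odot>\<^bsub>M\<^esub> x \<in> carrier M"
  by (rule Mod.smult_closed)

lemma sc_closed [simp]: "x \<in> carrier M \<Longrightarrow> cscale A M c x \<in> carrier M"
  by (simp add: cscale_def)

lemma additive_smult: "a \<in> carrier A \<Longrightarrow> additive_map M M ((\<odot>\<^bsub>M\<^esub>) a)"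
  by (auto simp: additive_map_def Mod.smult_r_distr)

lemma additive_smult_left: "x \<in> carrier M \<Longrightarrow> additive_map A M (\<lambda>a. a \<odot>\<^bsub>M\<^esub> x)"
  by (auto simp: additive_map_def Mod.smult_l_distr)

lemma additive_sc: "additive_map M M (cscale A M c)"
  unfolding cscale_def[abs_def] by (rule additive_smult) simp

lemmas smult_finsum = additive_map_finsum[OF ab_group ab_group additive_smult]
  and smult_zero [simp] = additive_map_zero[OF ab_group ab_group additive_smult]
  and smult_diff = additive_map_diff[OF ab_group ab_group additive_smult]
  and zero_smult [simp] = additive_map_zero[OF ab_group_algebra ab_group additive_smult_left]
  and finsum_smult = additive_map_finsum[OF ab_group_algebra ab_group additive_smult_left]
  and diff_smult = additive_map_diff[OF ab_group_algebra ab_group additive_smult_left]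
  and sc_finsum = additive_map_finsum[OF ab_group ab_group additive_sc]
  and sc_zero_right [simp] = additive_map_zero[OF ab_group ab_group additive_sc]

lemma sc_add_right: "x \<in> carrier M \<Longrightarrow> y \<in> carrier M \<Longrightarrow>
    cscale A M c (x \<oplus>\<^bsub>M\<^esub> y) = cscale A M c x \<oplus>\<^bsub>M\<^esub> cscale A M c y"
  using additive_sc by (auto simp: additive_map_def)

lemma sc_add_left: "x \<in> carrier M \<Longrightarrow>
    cscale A M (c + d) x = cscale A M c x \<oplus>\<^bsub>M\<^esub> cscale A M d x"
  using Alg.smult_l_distr[of c d "\<one>\<^bsub>A\<^esub>"] by (simp add: cscale_def Mod.smult_l_distr)

lemma smult_sc_left: "a \<in> carrier A \<Longrightarrow> x \<in> carrier M \<Longrightarrow>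
    (c \<odot>\<^bsub>A\<^esub> a) \<odot>\<^bsub>M\<^esub> x = cscale A M c (a \<odot>\<^bsub>M\<^esub> x)"
  using Alg.smult_mult_left[of "\<one>\<^bsub>A\<^esub>" a c] by (simp add: cscale_def Mod.smult_assoc[symmetric])

text \<open>The scalars c \<one> are central by the two compatibility laws of
  \<open>complex_algebra\<close>, so every algebra element acts linearly.\<close>

lemma smult_sc: "a \<in> carrier A \<Longrightarrow> x \<in> carrier M \<Longrightarrow>
    a \<odot>\<^bsub>M\<^esub> cscale A M c x = cscale A M c (a \<odot>\<^bsub>M\<^esub> x)"
  using Alg.smult_mult_left[of "\<one>\<^bsub>A\<^esub>" a c] Alg.smult_mult_right[of a "\<one>\<^bsub>A\<^esub>" c]
  by (simp add: cscale_def Mod.smult_assoc[symmetric])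

lemma sc_mult: "x \<in> carrier M \<Longrightarrow> cscale A M (c * d) x = cscale A M c (cscale A M d x)"
  using Alg.smult_assoc1[of c d "\<one>\<^bsub>A\<^esub>"] smult_sc_left[of "d \<odot>\<^bsub>A\<^esub> \<one>\<^bsub>A\<^esub>" x c]
  by (simp add: cscale_def)

lemma sc_one [simp]: "x \<in> carrier M \<Longrightarrow> cscale A M 1 x = x"
  using Alg.smult_one[of "\<one>\<^bsub>A\<^esub>"] by (simp add: cscale_def Mod.smult_one)

lemma sc_zero_left [simp]: "x \<in> carrier M \<Longrightarrow> cscale A M 0 x = \<zero>\<^bsub>M\<^esub>"
  using Alg.smult_l_null[of "\<one>\<^bsub>A\<^esub>"] by (simp add: cscale_def)

lemma sc_minus_one: "x \<in> carrier M \<Longrightarrow> cscale A M (- 1) x = \<ominus>\<^bsub>M\<^esub> x"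
  using sc_add_left[of x "- 1" 1] by (simp add: Mod.M.minus_equality)

lemma sc_eq_zero: "x \<in> carrier M \<Longrightarrow> cscale A M c x = \<zero>\<^bsub>M\<^esub> \<Longrightarrow> c = 0 \<or> x = \<zero>\<^bsub>M\<^esub>"
  by (metis left_inverse sc_mult sc_one sc_zero_right)

lemma finsum_sc_left: "x \<in> carrier M \<Longrightarrow>
    finsum M (\<lambda>j. cscale A M (c j) x) J = cscale A M (\<Sum>j\<in>J. c j) x"
  by (induction J rule: infinite_finite_induct) (simp_all add: sc_add_left)

end

lemma abelian_finsum_delta:
  assumes "abelian_group M" "finite J" "k \<in> J" "x \<in> carrier M"
    "\<And>j. j \<in> J \<Longrightarrow> f j = (if j = k then x else \<zero>\<^bsub>M\<^esub>)"
  shows "finsum M f J = x"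
proof -
  interpret abelian_group M by fact
  have "finsum M f J = finsum M (\<lambda>j. if k = j then x else \<zero>\<^bsub>M\<^esub>) J"
    by (rule finsum_cong') (use assms in auto)
  also have "\<dots> = x" using finsum_singleton[of k J "\<lambda>_. x"] assms by simp
  finally show ?thesis .
qed

lemma abelian_finsum_swap:
  assumes "abelian_group M" "finite J" "finite K" "\<And>j k. j \<in> J \<Longrightarrow> k \<in> K \<Longrightarrow> f j k \<in> carrier M"
  shows "finsum M (\<lambda>j. finsum M (f j) K) J = finsum M (\<lambda>k. finsum M (\<lambda>j. f j k) J) K"
proof -
  interpret abelian_group M by fact
  show ?thesis using assms(2,4)
  proof (induction J rule: finite_induct)
    case empty
    then show ?case by (simp add: finsum_zero)
  next
    case (insert j J)
    have *: "f j \<in> K \<rightarrow> carrier M" using insert.prems by auto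
    have **: "(\<lambda>k. finsum M (\<lambda>j. f j k) J) \<in> K \<rightarrow> carrier M"
      "(\<lambda>j. finsum M (f j) K) \<in> J \<rightarrow> carrier M" "finsum M (f j) K \<in> carrier M"
      using insert.prems by (auto intro!: finsum_closed)
    have "finsum M (\<lambda>k. finsum M (\<lambda>j. f j k) (insert j J)) K
        = finsum M (\<lambda>k. f j k \<oplus>\<^bsub>M\<^esub> finsum M (\<lambda>j. f j k) J) K"
      using insert ** * by (intro finsum_cong') (auto intro!: finsum_insert finsum_closed)
    also have "\<dots> = finsum M (f j) K \<oplus>\<^bsub>M\<^esub> finsum M (\<lambda>k. finsum M (\<lambda>j. f j k) J) K"
      by (rule finsum_addf) (use * ** in auto)
    finally show ?case using insert ** by simp
  qed
qed

subsection \<open>Linear maps and linear forms\<close>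

definition linear_map ::
  "(complex, 'a) module \<Rightarrow> ('a, 'm) module \<Rightarrow> (complex, 'b) module \<Rightarrow> ('b, 'n) module \<Rightarrow>
    ('m \<Rightarrow> 'n) \<Rightarrow> bool"
  where "linear_map A M B N f \<longleftrightarrow> additive_map M N f \<and>
    (\<forall>c. \<forall>x\<in>carrier M. f (cscale A M c x) = cscale B N c (f x))"

definition linear_form :: "(complex, 'a) module \<Rightarrow> ('a, 'm) module \<Rightarrow> ('m \<Rightarrow> complex) \<Rightarrow> bool"
  where "linear_form A M f \<longleftrightarrow>
    (\<forall>x\<in>carrier M. \<forall>y\<in>carrier M. f (x \<oplus>\<^bsub>M\<^esub> y) = f x + f y) \<and>
    (\<forall>c. \<forall>x\<in>carrier M. f (cscale A M c x) = c * f x)"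

lemma module_hom_additive: "f \<in> module_hom A M N \<Longrightarrow> additive_map M N f"
  by (auto simp: module_hom_def additive_map_def)

lemma module_homD:
  assumes "f \<in> module_hom A M N"
  shows "x \<in> carrier M \<Longrightarrow> f x \<in> carrier N"
    and "x \<in> carrier M \<Longrightarrow> y \<in> carrier M \<Longrightarrow> f (x \<oplus>\<^bsub>M\<^esub> y) = f x \<oplus>\<^bsub>N\<^esub> f y"
    and "a \<in> carrier A \<Longrightarrow> x \<in> carrier M \<Longrightarrow> f (a \<odot>\<^bsub>M\<^esub> x) = a \<odot>\<^bsub>N\<^esub> f x"
  using assms by (auto simp: module_hom_def)

lemma (in alg_module) hom_linear: "f \<in> module_hom A M N \<Longrightarrow> linear_map A M A N f"
  by (auto simp: linear_map_def module_hom_additive cscale_def intro: module_homD)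

lemma linear_mapD:
  assumes "linear_map A M B N f"
  shows "x \<in> carrier M \<Longrightarrow> f x \<in> carrier N"
    and "x \<in> carrier M \<Longrightarrow> y \<in> carrier M \<Longrightarrow> f (x \<oplus>\<^bsub>M\<^esub> y) = f x \<oplus>\<^bsub>N\<^esub> f y"
    and "x \<in> carrier M \<Longrightarrow> f (cscale A M c x) = cscale B N c (f x)"
    and "additive_map M N f"
  using assms by (auto simp: linear_map_def additive_map_def)

lemma linear_formD:
  assumes "linear_form A M f"
  shows "x \<in> carrier M \<Longrightarrow> y \<in> carrier M \<Longrightarrow> f (x \<oplus>\<^bsub>M\<^esub> y) = f x + f y"
    and "x \<in> carrier M \<Longrightarrow> f (cscale A M c x) = c * f x"
  using assms by (auto simp: linear_form_def)

lemma (in alg_module) linear_form_zero: "linear_form A M f \<Longrightarrow> f \<zero>\<^bsub>M\<^esub> = 0"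
  using linear_formD(2)[of A M f "\<zero>\<^bsub>M\<^esub>" 0] by simp

lemma (in alg_module) linear_form_finsum:
  assumes "linear_form A M f" "g \<in> J \<rightarrow> carrier M"
  shows "f (finsum M g J) = (\<Sum>j\<in>J. f (g j))"
  using assms(2)
proof (induction J rule: infinite_finite_induct)
  case (insert j J)
  then have "g \<in> J \<rightarrow> carrier M" "g j \<in> carrier M" by auto
  then show ?case using insert linear_formD(1)[OF assms(1), of "g j" "finsum M g J"] by simp
qed (simp_all add: linear_form_zero[OF assms(1)])

lemma (in alg_module) linear_form_smult:
  assumes "linear_form A M f" "a \<in> carrier A"
  shows "linear_form A M (\<lambda>x. f (a \<odot>\<^bsub>M\<^esub> x))"
  using assms by (auto simp: linear_form_def Mod.smult_r_distr smult_sc)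

subsection \<open>Complements\<close>

definition (in alg_module) subspace :: "'m set \<Rightarrow> bool"
  where "subspace U \<longleftrightarrow> U \<subseteq> carrier M \<and> \<zero>\<^bsub>M\<^esub> \<in> U \<and>
    (\<forall>x\<in>U. \<forall>y\<in>U. x \<oplus>\<^bsub>M\<^esub> y \<in> U) \<and> (\<forall>c. \<forall>x\<in>U. cscale A M c x \<in> U)"

text \<open>No dimension is assumed, hence Zorn's lemma: \<open>K\<close> is maximal among the
  subspaces meeting \<open>U\<close> only in zero. If x were outside U + K, the span of
  \<open>K\<close> and x would be a larger such subspace, because an element k + c x of
  \<open>U\<close> with c nonzero would express x through \<open>U\<close> and
  \<open>K\<close>.\<close>

lemma (in alg_module) exists_complement:
  assumes U: "subspace U"
  obtains K where "subspace K" "U \<inter> K = {\<zero>\<^bsub>M\<^esub>}"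
    "\<And>x. x \<in> carrier M \<Longrightarrow> \<exists>u\<in>U. \<exists>k\<in>K. x = u \<oplus>\<^bsub>M\<^esub> k"
proof -
  define S where "S = {K. subspace K \<and> U \<inter> K = {\<zero>\<^bsub>M\<^esub>}}"
  have "{\<zero>\<^bsub>M\<^esub>} \<in> S" using U by (auto simp: S_def subspace_def)
  have "\<exists>K\<in>S. \<forall>W\<in>S. K \<subseteq> W \<longrightarrow> W = K"
  proof (rule subset_Zorn_nonempty)
    show "S \<noteq> {}" using \<open>{\<zero>\<^bsub>M\<^esub>} \<in> S\<close> by blast
    fix C assume C: "C \<noteq> {}" "subset.chain S C"
    have ch: "\<And>W Y. W \<in> C \<Longrightarrow> Y \<in> C \<Longrightarrow> W \<subseteq> Y \<or> Y \<subseteq> W" "\<And>W. W \<in> C \<Longrightarrow> W \<in> S"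
      using C(2) by (auto simp: subset_chain_def)
    have chS: "W \<subseteq> carrier M \<and> \<zero>\<^bsub>M\<^esub> \<in> W \<and> U \<inter> W = {\<zero>\<^bsub>M\<^esub>} \<and> (\<forall>c. \<forall>x\<in>W. cscale A M c x \<in> W)"
      if "W \<in> C" for W
      using ch(2)[OF that] by (auto simp: S_def subspace_def)
    have "x \<oplus>\<^bsub>M\<^esub> y \<in> \<Union>C" if xy: "x \<in> \<Union>C" "y \<in> \<Union>C" for x y
    proof -
      obtain W Y where XY: "W \<in> C" "x \<in> W" "Y \<in> C" "y \<in> Y" using xy by blast
      then obtain Z where "Z \<in> C" "x \<in> Z" "y \<in> Z" using ch(1)[of W Y] by blast
      then show ?thesis using ch(2)[of Z] by (auto simp: S_def subspace_def)
    qed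
    moreover have "\<Union>C \<subseteq> carrier M" "\<zero>\<^bsub>M\<^esub> \<in> \<Union>C" "U \<inter> \<Union>C = {\<zero>\<^bsub>M\<^esub>}"
      using C(1) chS by blast+
    moreover have "\<forall>c. \<forall>x\<in>\<Union>C. cscale A M c x \<in> \<Union>C"
      using chS by blast
    ultimately show "\<Union>C \<in> S" by (auto simp: S_def subspace_def)
  qed
  then obtain K where KS: "K \<in> S" and maxS: "\<forall>W\<in>S. K \<subseteq> W \<longrightarrow> W = K" by (rule bexE)
  have K: "subspace K" "U \<inter> K = {\<zero>\<^bsub>M\<^esub>}" using KS by (auto simp: S_def)
  have max: "W = K" if "subspace W" "U \<inter> W = {\<zero>\<^bsub>M\<^esub>}" "K \<subseteq> W" for W
    using maxS that by (simp add: S_def)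
  have Uc: "\<And>u. u \<in> U \<Longrightarrow> u \<in> carrier M" and Kc: "\<And>k. k \<in> K \<Longrightarrow> k \<in> carrier M"
    using U K by (auto simp: subspace_def)
  have "\<exists>u\<in>U. \<exists>k\<in>K. x = u \<oplus>\<^bsub>M\<^esub> k" if x: "x \<in> carrier M" for x
  proof (rule ccontr)
    assume no: "\<not> ?thesis"
    define W where "W = {k \<oplus>\<^bsub>M\<^esub> cscale A M c x | k c. k \<in> K}"
    have "subspace W" unfolding subspace_def
    proof (intro conjI ballI allI)
      show "W \<subseteq> carrier M" using Kc x by (auto simp: W_def)
      show "\<zero>\<^bsub>M\<^esub> \<in> W" using K(1) x unfolding W_def subspace_def
        by (auto intro!: exI[of _ "\<zero>\<^bsub>M\<^esub>"] exI[of _ 0])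
      fix v assume "v \<in> W"
      then obtain k c where v: "v = k \<oplus>\<^bsub>M\<^esub> cscale A M c x" "k \<in> K" by (auto simp: W_def)
      { fix w assume "w \<in> W"
        then obtain k' c' where w: "w = k' \<oplus>\<^bsub>M\<^esub> cscale A M c' x" "k' \<in> K" by (auto simp: W_def)
        have "v \<oplus>\<^bsub>M\<^esub> w = (k \<oplus>\<^bsub>M\<^esub> k') \<oplus>\<^bsub>M\<^esub> cscale A M (c + c') x"
          using v w Kc x by (simp add: sc_add_left Mod.M.a_ac)
        then show "v \<oplus>\<^bsub>M\<^esub> w \<in> W" using v w K(1) unfolding W_def subspace_def by blast }
      fix d
      have "cscale A M d v = cscale A M d k \<oplus>\<^bsub>M\<^esub> cscale A M (d * c) x"
        using v Kc x by (simp add: sc_add_right sc_mult)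
      then show "cscale A M d v \<in> W" using v K(1) unfolding W_def subspace_def by blast
    qed
    moreover have "K \<subseteq> W"
    proof
      fix k assume "k \<in> K"
      then show "k \<in> W" using Kc[of k] x unfolding W_def
        by (intro CollectI exI[of _ k] exI[of _ 0]) simp
    qed
    moreover have "U \<inter> W = {\<zero>\<^bsub>M\<^esub>}"
    proof -
      have "u = \<zero>\<^bsub>M\<^esub>" if "u \<in> U" "u \<in> W" for u
      proof -
        obtain k c where u: "u = k \<oplus>\<^bsub>M\<^esub> cscale A M c x" "k \<in> K" using \<open>u \<in> W\<close> by (auto simp: W_def)
        show ?thesis
        proof (cases "c = 0")
          case True
          then have "u \<in> K" using u Kc x by simp
          then show ?thesis using K(2) \<open>u \<in> U\<close> by blast
        next
          case False
          have "cscale A M c x = u \<oplus>\<^bsub>M\<^esub> cscale A M (-1) k"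
            using u Kc x Uc[OF \<open>u \<in> U\<close>]
            by (simp add: sc_minus_one Mod.M.a_ac Mod.M.r_neg Mod.M.r_neg1 Mod.M.r_neg2)
          then have "cscale A M (inverse c) (cscale A M c x)
              = cscale A M (inverse c) u \<oplus>\<^bsub>M\<^esub> cscale A M (inverse c) (cscale A M (-1) k)"
            using Uc[OF \<open>u \<in> U\<close>] Kc[OF u(2)] by (simp add: sc_add_right)
          then have "x = cscale A M (inverse c) u \<oplus>\<^bsub>M\<^esub> cscale A M (inverse c) (cscale A M (-1) k)"
            using False x by (simp add: sc_mult[symmetric])
          moreover have "cscale A M (inverse c) u \<in> U"
            "cscale A M (inverse c) (cscale A M (-1) k) \<in> K"
            using U K(1) u(2) \<open>u \<in> U\<close> by (simp_all add: subspace_def)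
          ultimately have "\<exists>u\<in>U. \<exists>k\<in>K. x = u \<oplus>\<^bsub>M\<^esub> k" by metis
          then show ?thesis using no by simp
        qed
      qed
      moreover have "\<zero>\<^bsub>M\<^esub> \<in> U" using U by (simp add: subspace_def)
      moreover have "\<zero>\<^bsub>M\<^esub> \<in> W" using \<open>subspace W\<close> by (simp add: subspace_def)
      ultimately show ?thesis by blast
    qed
    ultimately have "W = K" using max by blast
    moreover have "x \<in> W" using x K(1) unfolding W_def subspace_def
      by (auto intro!: exI[of _ "\<zero>\<^bsub>M\<^esub>"] exI[of _ 1])
    moreover have "x = \<zero>\<^bsub>M\<^esub> \<oplus>\<^bsub>M\<^esub> x" "\<zero>\<^bsub>M\<^esub> \<in> U" using x U by (auto simp: subspace_def)
    ultimately show False using no by metis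
  qed
  then show thesis using that K by blast
qed

lemma (in alg_module) exists_projection:
  assumes U: "subspace U"
  obtains p where "linear_map A M A M p" "\<And>x. x \<in> carrier M \<Longrightarrow> p x \<in> U" "\<And>u. u \<in> U \<Longrightarrow> p u = u"
proof -
  obtain K where K: "subspace K" "U \<inter> K = {\<zero>\<^bsub>M\<^esub>}"
    "\<And>x. x \<in> carrier M \<Longrightarrow> \<exists>u\<in>U. \<exists>k\<in>K. x = u \<oplus>\<^bsub>M\<^esub> k"
    using exists_complement[OF U] by metis
  have Uc: "\<And>u. u \<in> U \<Longrightarrow> u \<in> carrier M" and Kc: "\<And>k. k \<in> K \<Longrightarrow> k \<in> carrier M"
    using U K by (auto simp: subspace_def)
  define p where "p x = (THE u. u \<in> U \<and> (\<exists>k\<in>K. x = u \<oplus>\<^bsub>M\<^esub> k))" for x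
  \<comment> \<open>The components are unique: a difference of two \<open>U\<close>-components is
    also a difference of \<open>K\<close>-components and so lies in U \<inter> K.\<close>
  have p: "p (u \<oplus>\<^bsub>M\<^esub> k) = u" if "u \<in> U" "k \<in> K" for u k
    unfolding p_def
  proof (rule the_equality)
    show "u \<in> U \<and> (\<exists>k'\<in>K. u \<oplus>\<^bsub>M\<^esub> k = u \<oplus>\<^bsub>M\<^esub> k')" using that by blast
    fix u' assume "u' \<in> U \<and> (\<exists>k'\<in>K. u \<oplus>\<^bsub>M\<^esub> k = u' \<oplus>\<^bsub>M\<^esub> k')"
    then obtain k' where u': "u' \<in> U" "k' \<in> K" "u \<oplus>\<^bsub>M\<^esub> k = u' \<oplus>\<^bsub>M\<^esub> k'" by blast
    note cs = Uc[OF \<open>u \<in> U\<close>] Uc[OF \<open>u' \<in> U\<close>] Kc[OF \<open>k \<in> K\<close>] Kc[OF \<open>k' \<in> K\<close>]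
    have "u' \<oplus>\<^bsub>M\<^esub> cscale A M (-1) u = k \<oplus>\<^bsub>M\<^esub> cscale A M (-1) k'"
    proof -
      have "k = (\<ominus>\<^bsub>M\<^esub> u) \<oplus>\<^bsub>M\<^esub> (u' \<oplus>\<^bsub>M\<^esub> k')"
        using u'(3)[symmetric] cs by (simp add: Mod.M.r_neg1)
      then have "k = (u' \<oplus>\<^bsub>M\<^esub> \<ominus>\<^bsub>M\<^esub> u) \<oplus>\<^bsub>M\<^esub> k'" using cs by (simp add: Mod.M.a_ac)
      then have "k \<oplus>\<^bsub>M\<^esub> \<ominus>\<^bsub>M\<^esub> k' = (u' \<oplus>\<^bsub>M\<^esub> \<ominus>\<^bsub>M\<^esub> u) \<oplus>\<^bsub>M\<^esub> (k' \<oplus>\<^bsub>M\<^esub> \<ominus>\<^bsub>M\<^esub> k')"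
        using cs by (simp only: Mod.M.a_assoc Mod.M.a_closed Mod.M.a_inv_closed)
      then show ?thesis using cs by (simp add: sc_minus_one Mod.M.r_neg)
    qed
    moreover have "u' \<oplus>\<^bsub>M\<^esub> cscale A M (-1) u \<in> U" "k \<oplus>\<^bsub>M\<^esub> cscale A M (-1) k' \<in> K"
      using U K(1) u' that by (auto simp: subspace_def)
    ultimately have "u' \<oplus>\<^bsub>M\<^esub> cscale A M (-1) u = \<zero>\<^bsub>M\<^esub>" using K(2) by auto
    then show "u' = u" using cs Mod.M.minus_eq_zero_iff[of u' u] by (simp add: sc_minus_one a_minus_def)
  qed
  show thesis
  proof
    show in_U: "p x \<in> U" if "x \<in> carrier M" for x using K(3)[OF that] p by auto
    show "p u = u" if "u \<in> U" for u
      using p[OF that, of "\<zero>\<^bsub>M\<^esub>"] K(1) Uc[OF that] by (simp add: subspace_def)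
    have "p (x \<oplus>\<^bsub>M\<^esub> y) = p x \<oplus>\<^bsub>M\<^esub> p y" if "x \<in> carrier M" "y \<in> carrier M" for x y
    proof -
      obtain u k where x: "x = u \<oplus>\<^bsub>M\<^esub> k" "u \<in> U" "k \<in> K" using K(3) \<open>x \<in> carrier M\<close> by blast
      obtain v l where y: "y = v \<oplus>\<^bsub>M\<^esub> l" "v \<in> U" "l \<in> K" using K(3) \<open>y \<in> carrier M\<close> by blast
      have "x \<oplus>\<^bsub>M\<^esub> y = (u \<oplus>\<^bsub>M\<^esub> v) \<oplus>\<^bsub>M\<^esub> (k \<oplus>\<^bsub>M\<^esub> l)"
        using x y Uc Kc by (simp add: Mod.M.a_ac)
      moreover have "u \<oplus>\<^bsub>M\<^esub> v \<in> U" "k \<oplus>\<^bsub>M\<^esub> l \<in> K" using x y U K(1) by (auto simp: subspace_def)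
      ultimately show ?thesis using p x y by simp
    qed
    moreover have "p (cscale A M c x) = cscale A M c (p x)" if "x \<in> carrier M" for x c
    proof -
      obtain u k where x: "x = u \<oplus>\<^bsub>M\<^esub> k" "u \<in> U" "k \<in> K" using K(3) \<open>x \<in> carrier M\<close> by blast
      then have "cscale A M c x = cscale A M c u \<oplus>\<^bsub>M\<^esub> cscale A M c k"
        "cscale A M c u \<in> U" "cscale A M c k \<in> K"
        using Uc Kc U K(1) by (auto simp: sc_add_right subspace_def)
      then show ?thesis using p x by simp
    qed
    ultimately show "linear_map A M A M p"
      using in_U Uc by (auto simp: linear_map_def additive_map_def)
  qed
qed

text \<open>Project onto the line spanned by \<open>y\<close> and read off the coefficient. This
  separates points also in modules that are not known to be finite dimensional, such as the
  components Y \<nu> of a given decomposition.\<close>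

lemma (in alg_module) exists_linear_form:
  assumes y: "y \<in> carrier M" "y \<noteq> \<zero>\<^bsub>M\<^esub>"
  obtains f where "linear_form A M f" "f y = 1"
proof -
  define U where "U = {cscale A M c y | c. True}"
  have "subspace U"
    unfolding subspace_def
  proof (intro conjI ballI allI)
    show "U \<subseteq> carrier M" using y by (auto simp: U_def)
    show "\<zero>\<^bsub>M\<^esub> \<in> U" using y by (auto simp: U_def intro!: exI[of _ 0])
    fix v assume "v \<in> U"
    then obtain c where v: "v = cscale A M c y" by (auto simp: U_def)
    show "cscale A M d v \<in> U" for d
      using y by (auto simp: U_def v sc_mult[symmetric])
    fix w assume "w \<in> U"
    then show "v \<oplus>\<^bsub>M\<^esub> w \<in> U" using y by (auto simp: U_def v sc_add_left[symmetric])
  qed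
  then obtain p where p: "linear_map A M A M p" "\<And>x. x \<in> carrier M \<Longrightarrow> p x \<in> U" "\<And>u. u \<in> U \<Longrightarrow> p u = u"
    using exists_projection by metis
  have inj: "c = d" if "cscale A M c y = cscale A M d y" for c d
  proof -
    have "cscale A M (c - d) y = \<zero>\<^bsub>M\<^esub>"
    proof -
      have "cscale A M (c - d) y \<oplus>\<^bsub>M\<^esub> cscale A M d y = cscale A M d y"
        using that y by (simp add: sc_add_left[symmetric])
      then show ?thesis using y by (simp add: Mod.M.add.l_cancel_one)
    qed
    then show ?thesis using sc_eq_zero[of y] y by fastforce
  qed
  define f where "f x = (THE c. p x = cscale A M c y)" for x
  have f: "p x = cscale A M (f x) y" if xM: "x \<in> carrier M" for x
  proof -
    obtain c where c: "p x = cscale A M c y" using p(2)[OF xM] by (auto simp: U_def)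
    have "f x = c" unfolding f_def c by (rule the_equality) (metis inj)+
    then show ?thesis using c by simp
  qed
  show thesis
  proof
    have "y \<in> U" using y by (auto simp: U_def intro!: exI[of _ 1])
    have "cscale A M (f y) y = p y" by (rule f[OF y(1), symmetric])
    also have "\<dots> = cscale A M 1 y" using p(3)[OF \<open>y \<in> U\<close>] y(1) by simp
    finally show "f y = 1" by (rule inj)
    show "linear_form A M f" unfolding linear_form_def
    proof (intro conjI ballI allI)
      fix x z assume xz: "x \<in> carrier M" "z \<in> carrier M"
      have "cscale A M (f (x \<oplus>\<^bsub>M\<^esub> z)) y = cscale A M (f x + f z) y"
        using f[of x] f[of z] f[of "x \<oplus>\<^bsub>M\<^esub> z"] xz y linear_mapD(2)[OF p(1) xz] by (simp add: sc_add_left)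
      then show "f (x \<oplus>\<^bsub>M\<^esub> z) = f x + f z" by (rule inj)
    next
      fix c x assume x: "x \<in> carrier M"
      have "cscale A M (f (cscale A M c x)) y = cscale A M (c * f x) y"
        using f[of x] f[of "cscale A M c x"] x y linear_mapD(3)[OF p(1) x] by (simp add: sc_mult)
      then show "f (cscale A M c x) = c * f x" by (rule inj)
    qed
  qed
qed

subsection \<open>Bases\<close>

text \<open>More unknowns than equations, by elimination. This replaces dimension counting: it
  produces the annihilating polynomial in \<open>exists_eigenvector\<close> and bounds the number of
  simple modules in \<open>complete_simples_finite\<close>.\<close>

lemma homogeneous_system:
  fixes a :: "'j \<Rightarrow> 'b \<Rightarrow> complex"
  assumes "finite B" "finite J" "card B < card J"
  shows "\<exists>c. (\<exists>j\<in>J. c j \<noteq> 0) \<and> (\<forall>b\<in>B. (\<Sum>j\<in>J. c j * a j b) = 0)"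
  using assms
proof (induction B arbitrary: J a rule: finite_induct)
  case empty
  then have "J \<noteq> {}" by auto
  then show ?case by (intro exI[of _ "\<lambda>_. 1"]) auto
next
  case (insert b B)
  show ?case
  proof (cases "\<forall>j\<in>J. a j b = 0")
    case True
    obtain c where "\<exists>j\<in>J. c j \<noteq> 0" "\<forall>b\<in>B. (\<Sum>j\<in>J. c j * a j b) = 0"
      using insert.IH[of J a] insert.prems insert.hyps by auto
    then show ?thesis using True by (intro exI[of _ c]) auto
  next
    case False
    then obtain k where k: "k \<in> J" "a k b \<noteq> 0" by blast
    \<comment> \<open>The unknown with index \<open>k\<close> is solved from equation
      \<open>b\<close> and substituted into the others, which leaves the coefficients
      \<open>a'\<close>; \<open>d\<close> restores its value afterwards.\<close>
    define a' where "a' j b' = a j b' - a j b / a k b * a k b'" for j b'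
    have "card B < card (J - {k})" using insert k by (simp add: card_Diff_singleton)
    then obtain c where c: "\<exists>j\<in>J-{k}. c j \<noteq> 0" "\<forall>b\<in>B. (\<Sum>j\<in>J-{k}. c j * a' j b) = 0"
      using insert.IH[of "J - {k}" a'] insert.prems by auto
    define d where "d j = (if j = k then - (\<Sum>j\<in>J-{k}. c j * a j b / a k b) else c j)" for j
    have d: "(\<Sum>j\<in>J. d j * a j b') = (\<Sum>j\<in>J-{k}. c j * a' j b')" for b'
    proof -
      have "(\<Sum>j\<in>J. d j * a j b') = d k * a k b' + (\<Sum>j\<in>J-{k}. d j * a j b')"
        using insert.prems k by (simp add: sum.remove)
      also have "(\<Sum>j\<in>J-{k}. d j * a j b') = (\<Sum>j\<in>J-{k}. c j * a j b')"
        by (rule sum.cong) (auto simp: d_def)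
      also have "d k * a k b' = - (\<Sum>j\<in>J-{k}. c j * (a j b / a k b * a k b'))"
        by (simp add: d_def sum_distrib_right mult.assoc)
      finally show ?thesis by (simp add: a'_def right_diff_distrib sum_subtractf)
    qed
    have "(\<Sum>j\<in>J. d j * a j b') = 0" if "b' \<in> insert b B" for b'
      using that c(2) k(2) by (auto simp: d a'_def)
    moreover have "\<exists>j\<in>J. d j \<noteq> 0" using c(1) by (auto simp: d_def)
    ultimately show ?thesis by blast
  qed
qed

text \<open>A basis indexed by its own vectors, bundled with its coordinate forms; the values of the
  forms on \<open>B\<close> encode linear independence.\<close>

definition dual_basis ::
  "(complex, 'a) module \<Rightarrow> ('a, 'm) module \<Rightarrow> 'm set \<Rightarrow> ('m \<Rightarrow> 'm \<Rightarrow> complex) \<Rightarrow> bool"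
  where "dual_basis A M B \<delta> \<longleftrightarrow> finite B \<and> B \<subseteq> carrier M \<and> (\<forall>b\<in>B. linear_form A M (\<delta> b)) \<and>
    (\<forall>b\<in>B. \<forall>b'\<in>B. \<delta> b b' = (if b = b' then 1 else 0)) \<and>
    (\<forall>x\<in>carrier M. x = (\<Oplus>\<^bsub>M\<^esub>b\<in>B. cscale A M (\<delta> b x) b))"

lemma dual_basisD:
  assumes "dual_basis A M B \<delta>"
  shows "finite B" and "b \<in> B \<Longrightarrow> b \<in> carrier M" and "b \<in> B \<Longrightarrow> linear_form A M (\<delta> b)"
    and "b \<in> B \<Longrightarrow> b' \<in> B \<Longrightarrow> \<delta> b b' = (if b = b' then 1 else 0)"
    and "x \<in> carrier M \<Longrightarrow> x = (\<Oplus>\<^bsub>M\<^esub>b\<in>B. cscale A M (\<delta> b x) b)"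
  using assms by (auto simp: dual_basis_def)

lemma (in alg_module) lincomb_eq_iff_diff:
  assumes "finite B" "B \<subseteq> carrier M"
    and "(\<Oplus>\<^bsub>M\<^esub>b\<in>B. cscale A M (c b) b) = (\<Oplus>\<^bsub>M\<^esub>b\<in>B. cscale A M (d b) b)"
  shows "(\<Oplus>\<^bsub>M\<^esub>b\<in>B. cscale A M (c b - d b) b) = \<zero>\<^bsub>M\<^esub>"
proof -
  have cl: "(\<lambda>b. cscale A M (e b) b) \<in> B \<rightarrow> carrier M" for e :: "'m \<Rightarrow> complex"
    using assms(2) by auto
  have "(\<Oplus>\<^bsub>M\<^esub>b\<in>B. cscale A M (c b) b)
      = (\<Oplus>\<^bsub>M\<^esub>b\<in>B. cscale A M (c b - d b) b \<oplus>\<^bsub>M\<^esub> cscale A M (d b) b)"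
  proof (rule Mod.M.finsum_cong')
    show "cscale A M (c b) b = cscale A M (c b - d b) b \<oplus>\<^bsub>M\<^esub> cscale A M (d b) b" if "b \<in> B" for b
      using sc_add_left[of b "c b - d b" "d b"] that assms(2) by auto
  qed (use assms(2) in auto)
  also have "\<dots> = (\<Oplus>\<^bsub>M\<^esub>b\<in>B. cscale A M (c b - d b) b) \<oplus>\<^bsub>M\<^esub> (\<Oplus>\<^bsub>M\<^esub>b\<in>B. cscale A M (d b) b)"
    by (rule Mod.M.finsum_addf[OF cl cl])
  finally have "(\<Oplus>\<^bsub>M\<^esub>b\<in>B. cscale A M (c b - d b) b) \<oplus>\<^bsub>M\<^esub> (\<Oplus>\<^bsub>M\<^esub>b\<in>B. cscale A M (d b) b)
      = (\<Oplus>\<^bsub>M\<^esub>b\<in>B. cscale A M (d b) b)"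
    using assms(3) by simp
  then show ?thesis
    using Mod.M.add.r_cancel_one[OF Mod.M.finsum_closed[OF cl[of d]]
      Mod.M.finsum_closed[OF cl[of "\<lambda>b. c b - d b"]]] by simp
qed

text \<open>A spanning set of least cardinality is independent: a vector with nonzero coefficient in
  a relation is a combination of the others and could be left out.\<close>

lemma (in alg_module) exists_dual_basis:
  assumes fd: "fin_dim A M"
  obtains B \<delta> where "dual_basis A M B \<delta>"
proof -
  define lc where "lc B c = (\<Oplus>\<^bsub>M\<^esub>b\<in>B. cscale A M (c b) b)" for B c
  define spans where "spans B \<longleftrightarrow> finite B \<and> B \<subseteq> carrier M \<and> (\<forall>x\<in>carrier M. \<exists>c. x = lc B c)" for B
  have "\<exists>B. spans B" using fd unfolding fin_dim_def spans_def lc_def by blast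
  then obtain B where B: "spans B" and least: "\<And>B'. spans B' \<Longrightarrow> card B \<le> card B'"
    using ex_has_least_nat[of spans _ card] by blast
  have fin: "finite B" and sub: "B \<subseteq> carrier M" and sp: "\<And>x. x \<in> carrier M \<Longrightarrow> \<exists>c. x = lc B c"
    using B by (auto simp: spans_def)
  have cl: "(\<lambda>b. cscale A M (e b) b) \<in> B' \<rightarrow> carrier M" if "B' \<subseteq> B" for e :: "'m \<Rightarrow> complex" and B'
    using sub that by auto
  have lc_closed: "lc B' e \<in> carrier M" if "B' \<subseteq> B" for e B'
    unfolding lc_def by (rule Mod.M.finsum_closed[OF cl[OF that]])
  have lc_add: "lc B' (\<lambda>b. c b + d b) = lc B' c \<oplus>\<^bsub>M\<^esub> lc B' d" if "B' \<subseteq> B" for B' c d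
  proof -
    have "lc B' (\<lambda>b. c b + d b) = (\<Oplus>\<^bsub>M\<^esub>b\<in>B'. cscale A M (c b) b \<oplus>\<^bsub>M\<^esub> cscale A M (d b) b)"
      unfolding lc_def using that sub by (intro Mod.M.finsum_cong') (auto simp: sc_add_left)
    then show ?thesis unfolding lc_def using Mod.M.finsum_addf[OF cl[OF that] cl[OF that]] by simp
  qed
  have lc_scale: "lc B' (\<lambda>b. k * c b) = cscale A M k (lc B' c)" if "B' \<subseteq> B" for B' c k
    unfolding lc_def sc_finsum[OF cl[OF that]]
    using that sub by (intro Mod.M.finsum_cong') (auto simp: sc_mult)
  have indep: "c b0 = 0" if z: "lc B c = \<zero>\<^bsub>M\<^esub>" and b0: "b0 \<in> B" for c b0
  proof (rule ccontr)
    assume nz: "c b0 \<noteq> 0"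
    let ?B = "B - {b0}"
    have split: "lc B d = cscale A M (d b0) b0 \<oplus>\<^bsub>M\<^esub> lc ?B d" for d
    proof -
      have "lc (insert b0 ?B) d = cscale A M (d b0) b0 \<oplus>\<^bsub>M\<^esub> lc ?B d"
        unfolding lc_def using fin sub b0 cl[of ?B d]
        by (intro Mod.M.finsum_insert) auto
      then show ?thesis using b0 by (simp add: insert_absorb)
    qed
    have b0c: "b0 \<in> carrier M" using b0 sub by auto
    have "b0 = lc ?B (\<lambda>b. (- inverse (c b0)) * c b)"
    proof -
      have "\<zero>\<^bsub>M\<^esub> = cscale A M (inverse (c b0)) (cscale A M (c b0) b0 \<oplus>\<^bsub>M\<^esub> lc ?B c)"
        using z split[of c] by simp
      also have "\<dots> = b0 \<oplus>\<^bsub>M\<^esub> cscale A M (inverse (c b0)) (lc ?B c)"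
        using nz b0c lc_closed[of ?B c] by (simp add: sc_add_right sc_mult[symmetric])
      finally have "b0 = \<ominus>\<^bsub>M\<^esub> (cscale A M (inverse (c b0)) (lc ?B c))"
        using b0c lc_closed[of ?B c]
        by (metis Diff_subset Mod.M.minus_equality sc_closed)
      also have "\<dots> = cscale A M (- inverse (c b0)) (lc ?B c)"
        using lc_closed[of ?B c] sc_mult[of "lc ?B c" "-1" "inverse (c b0)"]
        by (simp add: sc_minus_one)
      finally show ?thesis using lc_scale[of ?B "- inverse (c b0)" c] by simp
    qed
    then obtain e where e: "b0 = lc ?B e" by blast
    have "spans ?B" unfolding spans_def
    proof (intro conjI ballI)
      fix x assume "x \<in> carrier M"
      then obtain d where "x = lc B d" using sp by blast
      also have "\<dots> = lc ?B (\<lambda>b. d b0 * e b + d b)"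
        using split[of d] e lc_scale[of ?B "d b0" e] lc_add[of ?B "\<lambda>b. d b0 * e b" d] by auto
      finally show "\<exists>c. x = lc ?B c" by blast
    qed (use fin sub in auto)
    then show False using least[of ?B] card_Diff1_less[OF fin b0] by simp
  qed
  have inj: "c b = d b" if "lc B c = lc B d" "b \<in> B" for c d b
    using indep[of "\<lambda>b. c b - d b" b] lincomb_eq_iff_diff[OF fin sub, of c d] that by (simp add: lc_def)
  \<comment> \<open>An arbitrary choice of coefficients for each \<open>x\<close>; by
    \<open>inj\<close> they are unique on \<open>B\<close>, which is what makes them linear in
    \<open>x\<close>.\<close>
  define \<delta> where "\<delta> b x = (SOME c. x = lc B c) b" for b x
  have \<delta>: "x = lc B (\<lambda>b. \<delta> b x)" if "x \<in> carrier M" for x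
    unfolding \<delta>_def using someI_ex[OF sp[OF that]] by simp
  have "dual_basis A M B \<delta>" unfolding dual_basis_def linear_form_def
  proof (intro conjI ballI allI)
    fix b x y assume b: "b \<in> B" and xy: "x \<in> carrier M" "y \<in> carrier M"
    have "lc B (\<lambda>b. \<delta> b (x \<oplus>\<^bsub>M\<^esub> y)) = lc B (\<lambda>b. \<delta> b x + \<delta> b y)"
      using \<delta>[of x] \<delta>[of y] \<delta>[of "x \<oplus>\<^bsub>M\<^esub> y"] xy lc_add[of B "\<lambda>b. \<delta> b x" "\<lambda>b. \<delta> b y"] by simp
    from inj[OF this b] show "\<delta> b (x \<oplus>\<^bsub>M\<^esub> y) = \<delta> b x + \<delta> b y" .
  next
    fix b c x assume b: "b \<in> B" and x: "x \<in> carrier M"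
    have "lc B (\<lambda>b. \<delta> b (cscale A M c x)) = lc B (\<lambda>b. c * \<delta> b x)"
      using \<delta>[of x] \<delta>[of "cscale A M c x"] x lc_scale[of B c "\<lambda>b. \<delta> b x"] by simp
    from inj[OF this b] show "\<delta> b (cscale A M c x) = c * \<delta> b x" .
  next
    fix b b' assume b: "b \<in> B" "b' \<in> B"
    then have b'c: "b' \<in> carrier M" using sub by auto
    have "lc B (\<lambda>b. if b = b' then 1 else 0) = b'"
      unfolding lc_def using b b'c sub by (intro abelian_finsum_delta[OF ab_group fin, of b']) auto
    then have "lc B (\<lambda>b. \<delta> b b') = lc B (\<lambda>b. if b = b' then 1 else 0)" using \<delta>[OF b'c] by simp
    from inj[OF this b(1)] show "\<delta> b b' = (if b = b' then 1 else 0)" .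
  next
    fix x assume "x \<in> carrier M"
    then show "x = (\<Oplus>\<^bsub>M\<^esub>b\<in>B. cscale A M (\<delta> b x) b)" by (rule \<delta>[unfolded lc_def])
  qed (use fin sub in auto)
  then show thesis by (rule that)
qed

lemma (in alg_module) linear_map_lincomb:
  assumes f: "linear_map A M C N f" and N: "alg_module C N" and B: "dual_basis A M B \<delta>"
    and x: "x \<in> carrier M"
  shows "f x = (\<Oplus>\<^bsub>N\<^esub>b\<in>B. cscale C N (\<delta> b x) (f b))"
proof -
  interpret N: alg_module C N by fact
  have Bc: "\<And>b. b \<in> B \<Longrightarrow> b \<in> carrier M" using dual_basisD(2)[OF B] .
  have "f x = f (\<Oplus>\<^bsub>M\<^esub>b\<in>B. cscale A M (\<delta> b x) b)" using dual_basisD(5)[OF B x] by simp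
  also have "\<dots> = (\<Oplus>\<^bsub>N\<^esub>b\<in>B. f (cscale A M (\<delta> b x) b))"
    using Bc by (intro additive_map_finsum[OF ab_group N.ab_group linear_mapD(4)[OF f]]) auto
  also have "\<dots> = (\<Oplus>\<^bsub>N\<^esub>b\<in>B. cscale C N (\<delta> b x) (f b))"
    using Bc linear_mapD[OF f] by (intro N.Mod.M.finsum_cong') auto
  finally show ?thesis .
qed

subsection \<open>Simple modules and Schur's lemma\<close>

lemma (in alg_module) submoduleI:
  assumes "U \<subseteq> carrier M" "\<zero>\<^bsub>M\<^esub> \<in> U" "\<And>x y. x \<in> U \<Longrightarrow> y \<in> U \<Longrightarrow> x \<oplus>\<^bsub>M\<^esub> y \<in> U"
    and "\<And>a x. a \<in> carrier A \<Longrightarrow> x \<in> U \<Longrightarrow> a \<odot>\<^bsub>M\<^esub> x \<in> U"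
  shows "submodule U A M"
proof -
  have "\<ominus>\<^bsub>M\<^esub> x \<in> U" if "x \<in> U" for x
    using assms(4)[OF scalar_closed that, of "-1"] sc_minus_one[of x] assms(1) that
    by (auto simp: cscale_def)
  then show ?thesis
    using assms by (auto simp: submodule_def subgroup_def submodule_axioms_def a_inv_def)
qed

lemma submoduleD:
  assumes "submodule U A M"
  shows "U \<subseteq> carrier M" "\<zero>\<^bsub>M\<^esub> \<in> U" "\<And>x y. x \<in> U \<Longrightarrow> y \<in> U \<Longrightarrow> x \<oplus>\<^bsub>M\<^esub> y \<in> U"
    "\<And>a x. a \<in> carrier A \<Longrightarrow> x \<in> U \<Longrightarrow> a \<odot>\<^bsub>M\<^esub> x \<in> U"
  using assms by (auto simp: submodule_def subgroup_def submodule_axioms_def)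

text \<open>The multiples of \<open>x\<close> form a submodule that contains x = \<one> x, so it is
  nonzero and hence everything.\<close>

lemma (in alg_module) simple_generates:
  assumes "simple_module A M" "x \<in> carrier M" "x \<noteq> \<zero>\<^bsub>M\<^esub>" "y \<in> carrier M"
  obtains a where "a \<in> carrier A" "a \<odot>\<^bsub>M\<^esub> x = y"
proof -
  let ?U = "(\<lambda>a. a \<odot>\<^bsub>M\<^esub> x) ` carrier A"
  have "submodule ?U A M"
  proof (rule submoduleI)
    show "?U \<subseteq> carrier M" using assms(2) by auto
    show "\<zero>\<^bsub>M\<^esub> \<in> ?U" using assms(2) by (intro image_eqI[of _ _ "\<zero>\<^bsub>A\<^esub>"]) auto
    show "u \<oplus>\<^bsub>M\<^esub> v \<in> ?U" if "u \<in> ?U" "v \<in> ?U" for u v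
      using that assms(2) by (auto simp: Mod.smult_l_distr[symmetric])
    show "a \<odot>\<^bsub>M\<^esub> u \<in> ?U" if "a \<in> carrier A" "u \<in> ?U" for a u
      using that assms(2) by (auto simp: Mod.smult_assoc[symmetric])
  qed
  moreover have "x \<in> ?U" using assms(2) by (intro image_eqI[of _ _ "\<one>\<^bsub>A\<^esub>"]) (auto simp: Mod.smult_one)
  moreover have "?U = {\<zero>\<^bsub>M\<^esub>} \<or> ?U = carrier M"
    using assms(1) calculation(1) by (simp add: simple_module_def)
  ultimately have "y \<in> ?U" using assms(3,4) by auto
  then show thesis using that by auto
qed

lemma (in alg_module) simple_moduleI:
  assumes "x \<in> carrier M" "x \<noteq> \<zero>\<^bsub>M\<^esub>"
    and "\<And>x y. x \<in> carrier M \<Longrightarrow> x \<noteq> \<zero>\<^bsub>M\<^esub> \<Longrightarrow> y \<in> carrier M \<Longrightarrow> \<exists>a\<in>carrier A. a \<odot>\<^bsub>M\<^esub> x = y"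
  shows "simple_module A M"
  unfolding simple_module_def
proof (intro conjI allI impI)
  show "left_module A M" by (rule Mod.left_module_axioms)
  show "carrier M \<noteq> {\<zero>\<^bsub>M\<^esub>}" using assms(1,2) by auto
  fix U assume U: "submodule U A M"
  show "U = {\<zero>\<^bsub>M\<^esub>} \<or> U = carrier M"
  proof (rule disjCI)
    assume "U \<noteq> carrier M"
    moreover have "carrier M \<subseteq> U" if "u \<in> U" "u \<noteq> \<zero>\<^bsub>M\<^esub>" for u
      using assms(3)[of u] that submoduleD[OF U] by blast
    ultimately show "U = {\<zero>\<^bsub>M\<^esub>}" using submoduleD(1,2)[OF U] by blast
  qed
qed

lemma simple_alg_module: "complex_algebra A \<Longrightarrow> simple_module A M \<Longrightarrow> alg_module A M"
  by (simp add: alg_module_def simple_module_def)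

lemma (in alg_module) simple_nonzero:
  assumes "simple_module A M"
  obtains x where "x \<in> carrier M" "x \<noteq> \<zero>\<^bsub>M\<^esub>"
proof -
  have "carrier M \<noteq> {\<zero>\<^bsub>M\<^esub>}" "\<zero>\<^bsub>M\<^esub> \<in> carrier M" using assms by (auto simp: simple_module_def)
  then show thesis using that by blast
qed

text \<open>One vector with nonzero image is enough. If u - v were a nonzero element of the kernel,
  some a would carry it to \<open>x\<close> and force f x to vanish; and f x generates
  \<open>N\<close>.\<close>

lemma simple_hom_iso:
  assumes "alg_module A M" "alg_module A N" "simple_module A M" "simple_module A N"
    and f: "f \<in> module_hom A M N" and x: "x \<in> carrier M" "f x \<noteq> \<zero>\<^bsub>N\<^esub>"
  shows "f \<in> module_iso A M N"
proof -
  interpret M: alg_module A M by fact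
  interpret N: alg_module A N by fact
  note add = module_hom_additive[OF f]
  have "bij_betw f (carrier M) (carrier N)" unfolding bij_betw_def
  proof
    show "inj_on f (carrier M)"
    proof (rule inj_onI, rule ccontr)
      fix u v assume uv: "u \<in> carrier M" "v \<in> carrier M" "f u = f v" "u \<noteq> v"
      then have "u \<ominus>\<^bsub>M\<^esub> v \<in> carrier M" "u \<ominus>\<^bsub>M\<^esub> v \<noteq> \<zero>\<^bsub>M\<^esub>"
        by (auto simp: M.Mod.M.minus_eq_zero_iff)
      then obtain a where a: "a \<in> carrier A" "a \<odot>\<^bsub>M\<^esub> (u \<ominus>\<^bsub>M\<^esub> v) = x"
        using M.simple_generates[OF assms(3) _ _ x(1)] by metis
      have "f (u \<ominus>\<^bsub>M\<^esub> v) = \<zero>\<^bsub>N\<^esub>"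
        using additive_map_diff[OF M.ab_group N.ab_group add uv(1,2)] uv module_homD(1)[OF f uv(1)]
        by (simp add: N.Mod.M.minus_eq_zero_iff)
      then have "f x = \<zero>\<^bsub>N\<^esub>" using a module_homD(3)[OF f a(1)] uv by auto
      then show False using x by simp
    qed
    show "f ` carrier M = carrier N"
    proof
      show "carrier N \<subseteq> f ` carrier M"
      proof
        fix y assume "y \<in> carrier N"
        then obtain a where "a \<in> carrier A" "a \<odot>\<^bsub>N\<^esub> f x = y"
          using N.simple_generates[OF assms(4) module_homD(1)[OF f x(1)] x(2)] by metis
        then show "y \<in> f ` carrier M" using module_homD(3)[OF f _ x(1)] x
          by (intro image_eqI[of _ _ "a \<odot>\<^bsub>M\<^esub> x"]) auto
      qed
    qed (use module_homD(1)[OF f] in auto)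
  qed
  then show ?thesis using f by (simp add: module_iso_def)
qed

lemma module_iso_inv:
  assumes "alg_module A M" "alg_module A N" and f: "f \<in> module_iso A M N"
  shows "inv_into (carrier M) f \<in> module_iso A N M"
proof -
  interpret M: alg_module A M by fact
  interpret N: alg_module A N by fact
  let ?g = "inv_into (carrier M) f"
  have h: "f \<in> module_hom A M N" and b: "bij_betw f (carrier M) (carrier N)"
    using f by (auto simp: module_iso_def)
  have bg: "bij_betw ?g (carrier N) (carrier M)" by (rule bij_betw_inv_into[OF b])
  have gc: "?g y \<in> carrier M" if "y \<in> carrier N" for y using bg that by (auto simp: bij_betw_def)
  have fg: "f (?g y) = y" if "y \<in> carrier N" for y by (rule bij_betw_inv_into_right[OF b that])
  have gf: "?g (f x) = x" if "x \<in> carrier M" for x by (rule bij_betw_inv_into_left[OF b that])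
  have "?g (x \<oplus>\<^bsub>N\<^esub> y) = ?g x \<oplus>\<^bsub>M\<^esub> ?g y" if "x \<in> carrier N" "y \<in> carrier N" for x y
    using gf[of "?g x \<oplus>\<^bsub>M\<^esub> ?g y"] module_homD(2)[OF h gc[OF that(1)] gc[OF that(2)]] gc fg that by simp
  moreover have "?g (a \<odot>\<^bsub>N\<^esub> x) = a \<odot>\<^bsub>M\<^esub> ?g x" if "a \<in> carrier A" "x \<in> carrier N" for a x
    using gf[of "a \<odot>\<^bsub>M\<^esub> ?g x"] module_homD(3)[OF h that(1) gc[OF that(2)]] gc fg that by simp
  ultimately show ?thesis using bg gc by (auto simp: module_iso_def module_hom_def)
qed

lemma isomorphic_sym:
  "alg_module A M \<Longrightarrow> alg_module A N \<Longrightarrow> isomorphic A M N \<Longrightarrow> isomorphic A N M"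
  unfolding isomorphic_def using module_iso_inv by blast

lemma module_hom_comp:
  "f \<in> module_hom A M N \<Longrightarrow> g \<in> module_hom A N P \<Longrightarrow> (\<lambda>x. g (f x)) \<in> module_hom A M P"
  by (auto simp: module_hom_def Pi_iff)

text \<open>The iterates of \<open>f\<close> at \<open>x0\<close> are linearly dependent, so some
  nonzero polynomial in \<open>f\<close> annihilates \<open>x0\<close>. One of least degree has a
  root z and splits as q = (X - z) r; then r(f) x0 is nonzero by minimality, and f - z kills
  it.\<close>

lemma (in alg_module) exists_eigenvector:
  assumes fd: "fin_dim A M" and f: "linear_map A M A M f" and x0: "x0 \<in> carrier M" "x0 \<noteq> \<zero>\<^bsub>M\<^esub>"
  obtains z w where "w \<in> carrier M" "w \<noteq> \<zero>\<^bsub>M\<^esub>" "f w = cscale A M z w"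
proof -
  note fD = linear_mapD[OF f]
  have f0 [simp]: "f \<zero>\<^bsub>M\<^esub> = \<zero>\<^bsub>M\<^esub>" by (rule additive_map_zero[OF ab_group ab_group fD(4)])
  \<comment> \<open>Horner's scheme: \<open>ev p\<close> is p(f) applied to
    \<open>x0\<close>.\<close>
  define ev where "ev p = fold_coeffs (\<lambda>a y. cscale A M a x0 \<oplus>\<^bsub>M\<^esub> f y) p \<zero>\<^bsub>M\<^esub>" for p
  have ev_0 [simp]: "ev 0 = \<zero>\<^bsub>M\<^esub>" by (simp add: ev_def)
  have ev_pCons [simp]: "ev (pCons a p) = cscale A M a x0 \<oplus>\<^bsub>M\<^esub> f (ev p)" for a p
  proof (cases "a = 0 \<and> p = 0")
    case True
    then show ?thesis using x0 by simp
  next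
    case False
    then show ?thesis by (auto simp: ev_def)
  qed
  have ev_closed [simp]: "ev p \<in> carrier M" for p
    by (induction p) (use x0 fD(1) in auto)
  have ev_smult: "ev (smult c p) = cscale A M c (ev p)" for c p
    by (induction p) (use x0 fD in \<open>auto simp: sc_add_right sc_mult\<close>)
  have ev_add: "ev (p + q) = ev p \<oplus>\<^bsub>M\<^esub> ev q" for p q
    by (induction p q rule: poly_induct2) (use x0 fD in \<open>auto simp: sc_add_left Mod.M.a_ac\<close>)
  have iter [simp]: "(f ^^ i) x0 \<in> carrier M" for i by (induction i) (use x0 fD(1) in auto)
  have ev_monom: "ev (monom c i) = cscale A M c ((f ^^ i) x0)" for c i
    by (induction i) (use x0 fD in \<open>auto simp: monom_0 monom_Suc\<close>)
  have ev_sum: "ev (\<Sum>j\<in>J. p j) = (\<Oplus>\<^bsub>M\<^esub>j\<in>J. ev (p j))" if "finite J" for J and p :: "nat \<Rightarrow> complex poly"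
    using that by (induction J rule: finite_induct) (auto simp: ev_add)
  obtain B \<delta> where B: "dual_basis A M B \<delta>" using exists_dual_basis[OF fd] by metis
  have Bc: "\<And>b. b \<in> B \<Longrightarrow> b \<in> carrier M" using dual_basisD(2)[OF B] .
  \<comment> \<open>One iterate more than there are basis vectors, so that the homogeneous system
    for the coefficients has a nontrivial solution.\<close>
  let ?J = "{..card B}"
  obtain c where c: "\<exists>j\<in>?J. c j \<noteq> 0" "\<forall>b\<in>B. (\<Sum>j\<in>?J. c j * \<delta> b ((f ^^ j) x0)) = 0"
    using homogeneous_system[OF dual_basisD(1)[OF B], of ?J "\<lambda>j b. \<delta> b ((f ^^ j) x0)"] by auto
  define p where "p = (\<Sum>j\<in>?J. monom (c j) j)"
  have "ev p = (\<Oplus>\<^bsub>M\<^esub>j\<in>?J. cscale A M (c j) ((f ^^ j) x0))"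
    unfolding p_def by (simp add: ev_sum ev_monom)
  also have "\<dots> = (\<Oplus>\<^bsub>M\<^esub>j\<in>?J. \<Oplus>\<^bsub>M\<^esub>b\<in>B. cscale A M (c j * \<delta> b ((f ^^ j) x0)) b)"
  proof (rule Mod.M.finsum_cong')
    fix j
    have "cscale A M (c j) ((f ^^ j) x0)
        = cscale A M (c j) (\<Oplus>\<^bsub>M\<^esub>b\<in>B. cscale A M (\<delta> b ((f ^^ j) x0)) b)"
      using dual_basisD(5)[OF B iter[of j]] by simp
    also have "\<dots> = (\<Oplus>\<^bsub>M\<^esub>b\<in>B. cscale A M (c j) (cscale A M (\<delta> b ((f ^^ j) x0)) b))"
      using Bc by (intro sc_finsum) auto
    also have "\<dots> = (\<Oplus>\<^bsub>M\<^esub>b\<in>B. cscale A M (c j * \<delta> b ((f ^^ j) x0)) b)"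
      using Bc by (intro Mod.M.finsum_cong') (auto simp: sc_mult)
    finally show "cscale A M (c j) ((f ^^ j) x0) = (\<Oplus>\<^bsub>M\<^esub>b\<in>B. cscale A M (c j * \<delta> b ((f ^^ j) x0)) b)" .
  qed (use Bc in \<open>auto intro!: Mod.M.finsum_closed\<close>)
  also have "\<dots> = (\<Oplus>\<^bsub>M\<^esub>b\<in>B. \<Oplus>\<^bsub>M\<^esub>j\<in>?J. cscale A M (c j * \<delta> b ((f ^^ j) x0)) b)"
    using Bc dual_basisD(1)[OF B] by (intro abelian_finsum_swap[OF ab_group]) auto
  also have "\<dots> = (\<Oplus>\<^bsub>M\<^esub>b\<in>B. \<zero>\<^bsub>M\<^esub>)"
    using Bc c(2) by (intro Mod.M.finsum_cong') (auto simp: finsum_sc_left)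
  also have "\<dots> = \<zero>\<^bsub>M\<^esub>" by (rule Mod.M.finsum_zero)
  finally have evp: "ev p = \<zero>\<^bsub>M\<^esub>" .
  have "p \<noteq> 0"
  proof -
    obtain j where j: "j \<in> ?J" "c j \<noteq> 0" using c(1) by blast
    have "coeff p j = c j" using j(1) by (simp add: p_def coeff_sum)
    then show ?thesis using j(2) by auto
  qed
  then obtain q where q: "q \<noteq> 0" "ev q = \<zero>\<^bsub>M\<^esub>"
    and least: "\<And>r. r \<noteq> 0 \<Longrightarrow> ev r = \<zero>\<^bsub>M\<^esub> \<Longrightarrow> degree q \<le> degree r"
    using ex_has_least_nat[of "\<lambda>p. p \<noteq> 0 \<and> ev p = \<zero>\<^bsub>M\<^esub>" p degree] evp by blast
  have "degree q \<noteq> 0"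
  proof
    assume "degree q = 0"
    then obtain a where "q = [:a:]" by (rule degree_eq_zeroE)
    then show False using q x0 sc_eq_zero[of x0 a] by simp
  qed
  then obtain z where "poly q z = 0"
    using fundamental_theorem_of_algebra[of q] by (auto simp: constant_degree)
  then obtain r where r: "q = [:- z, 1:] * r" by (auto simp: poly_eq_0_iff_dvd)
  then have "r \<noteq> 0" using q by auto
  then have "degree q = Suc (degree r)" unfolding r by (subst degree_mult_eq) auto
  then have "ev r \<noteq> \<zero>\<^bsub>M\<^esub>" using least[OF \<open>r \<noteq> 0\<close>] by auto
  moreover have "f (ev r) = cscale A M z (ev r)"
  proof -
    have "q = smult (- z) r + pCons 0 r" by (simp add: r mult_pCons_left)
    then have "ev q = cscale A M (- z) (ev r) \<oplus>\<^bsub>M\<^esub> (cscale A M 0 x0 \<oplus>\<^bsub>M\<^esub> f (ev r))"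
      by (simp only: ev_add ev_smult ev_pCons)
    then have "\<zero>\<^bsub>M\<^esub> = cscale A M (- z) (ev r) \<oplus>\<^bsub>M\<^esub> f (ev r)" using q(2) x0 fD(1) by simp
    then have "f (ev r) = \<ominus>\<^bsub>M\<^esub> cscale A M (- z) (ev r)"
      using fD(1)[OF ev_closed[of r]]
      by (metis Mod.M.a_comm Mod.M.minus_equality ev_closed sc_closed)
    also have "\<dots> = cscale A M (-1) (cscale A M (- z) (ev r))" by (simp add: sc_minus_one)
    also have "\<dots> = cscale A M z (ev r)" using sc_mult[of "ev r" "-1" "-z"] by simp
    finally show ?thesis .
  qed
  ultimately show thesis using that ev_closed by blast
qed

text \<open>At an eigenvector \<open>w\<close> the map is multiplication by \<open>z\<close>, and
  every element of \<open>M\<close> has the form a w.\<close>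

lemma (in alg_module) Schur:
  assumes sim: "simple_module A M" and fd: "fin_dim A M" and f: "f \<in> module_hom A M M"
  obtains z where "\<And>x. x \<in> carrier M \<Longrightarrow> f x = cscale A M z x"
proof -
  obtain x0 where "x0 \<in> carrier M" "x0 \<noteq> \<zero>\<^bsub>M\<^esub>" using simple_nonzero[OF sim] .
  then obtain z w where w: "w \<in> carrier M" "w \<noteq> \<zero>\<^bsub>M\<^esub>" "f w = cscale A M z w"
    using exists_eigenvector[OF fd hom_linear[OF f]] by metis
  have "f x = cscale A M z x" if xM: "x \<in> carrier M" for x
  proof -
    obtain a where "a \<in> carrier A" "a \<odot>\<^bsub>M\<^esub> w = x" using simple_generates[OF sim w(1,2) xM] .
    then show ?thesis using module_homD(3)[OF f, of a w] w by (auto simp: smult_sc)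
  qed
  then show thesis by (rule that)
qed

subsection \<open>Density\<close>

text \<open>Differences stay inside as well, since multiplication by the negative of \<one> is
  allowed; see \<open>left_ideal_diff\<close>.\<close>

definition left_ideal :: "(complex, 'a) module \<Rightarrow> 'a set \<Rightarrow> bool"
  where "left_ideal A L \<longleftrightarrow> L \<subseteq> carrier A \<and> \<zero>\<^bsub>A\<^esub> \<in> L \<and>
    (\<forall>x\<in>L. \<forall>y\<in>L. x \<oplus>\<^bsub>A\<^esub> y \<in> L) \<and> (\<forall>a\<in>carrier A. \<forall>x\<in>L. a \<otimes>\<^bsub>A\<^esub> x \<in> L)"

lemma left_idealD:
  assumes "left_ideal A L"
  shows "x \<in> L \<Longrightarrow> x \<in> carrier A" "\<zero>\<^bsub>A\<^esub> \<in> L" "x \<in> L \<Longrightarrow> y \<in> L \<Longrightarrow> x \<oplus>\<^bsub>A\<^esub> y \<in> L"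
    "a \<in> carrier A \<Longrightarrow> x \<in> L \<Longrightarrow> a \<otimes>\<^bsub>A\<^esub> x \<in> L"
  using assms by (auto simp: left_ideal_def)

lemma left_ideal_diff:
  fixes A :: "(complex, 'a) module"
  assumes "ring A" "left_ideal A L" "x \<in> L" "y \<in> L"
  shows "x \<ominus>\<^bsub>A\<^esub> y \<in> L"
proof -
  interpret A: ring A by fact
  have "\<ominus>\<^bsub>A\<^esub> y = (\<ominus>\<^bsub>A\<^esub> \<one>\<^bsub>A\<^esub>) \<otimes>\<^bsub>A\<^esub> y"
    using left_idealD(1)[OF assms(2,4)] by (simp add: A.l_minus)
  then have "\<ominus>\<^bsub>A\<^esub> y \<in> L" using left_idealD(4)[OF assms(2), of "\<ominus>\<^bsub>A\<^esub> \<one>\<^bsub>A\<^esub>" y] assms(4) by simp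
  then show ?thesis using left_idealD(3)[OF assms(2,3)] by (simp add: a_minus_def)
qed

lemma (in alg_module) left_ideal_annihilator:
  assumes "left_ideal A L" "x \<in> carrier M"
  shows "left_ideal A {a \<in> L. a \<odot>\<^bsub>M\<^esub> x = \<zero>\<^bsub>M\<^esub>}"
  using assms unfolding left_ideal_def
  by (auto simp: Mod.smult_l_distr Mod.smult_assoc subset_iff)

text \<open>The map r x \<mapsto> r v, for r in \<open>L\<close>, is well defined by
  \<open>ann\<close>. Its domain is a submodule of \<open>W\<close>: if it is zero, the zero map
  serves, otherwise it is all of \<open>W\<close>. The conclusion says that \<open>L\<close> cannot
  tell \<open>v\<close> from f x.\<close>

lemma exists_hom_on_left_ideal:
  assumes "alg_module A W" "simple_module A W" "alg_module A V" and L: "left_ideal A L"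
    and x: "x \<in> carrier W" and v: "v \<in> carrier V"
    and ann: "\<And>r. r \<in> L \<Longrightarrow> r \<odot>\<^bsub>W\<^esub> x = \<zero>\<^bsub>W\<^esub> \<Longrightarrow> r \<odot>\<^bsub>V\<^esub> v = \<zero>\<^bsub>V\<^esub>"
  shows "\<exists>f\<in>module_hom A W V. \<forall>r\<in>L. r \<odot>\<^bsub>V\<^esub> v = r \<odot>\<^bsub>V\<^esub> f x"
proof -
  interpret W: alg_module A W by fact
  interpret V: alg_module A V by fact
  note LD = left_idealD[OF L]
  show ?thesis
  proof (cases "\<forall>r\<in>L. r \<odot>\<^bsub>W\<^esub> x = \<zero>\<^bsub>W\<^esub>")
    case True
    show ?thesis
    proof (intro bexI ballI)
      show "(\<lambda>_. \<zero>\<^bsub>V\<^esub>) \<in> module_hom A W V" by (auto simp: module_hom_def)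
      show "r \<odot>\<^bsub>V\<^esub> v = r \<odot>\<^bsub>V\<^esub> \<zero>\<^bsub>V\<^esub>" if "r \<in> L" for r
        using True ann[OF that] that LD(1)[OF that] by simp
    qed
  next
    case False
    then obtain r0 where r0: "r0 \<in> L" "r0 \<odot>\<^bsub>W\<^esub> x \<noteq> \<zero>\<^bsub>W\<^esub>" by blast
    have ex: "\<exists>r. r \<in> L \<and> r \<odot>\<^bsub>W\<^esub> x = w" if wW: "w \<in> carrier W" for w
    proof -
      obtain a where a: "a \<in> carrier A" "a \<odot>\<^bsub>W\<^esub> (r0 \<odot>\<^bsub>W\<^esub> x) = w"
        using W.simple_generates[OF assms(2) _ r0(2) wW] LD(1)[OF r0(1)] x by auto
      have "a \<otimes>\<^bsub>A\<^esub> r0 \<in> L" using a(1) r0(1) by (rule LD(4))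
      moreover have "(a \<otimes>\<^bsub>A\<^esub> r0) \<odot>\<^bsub>W\<^esub> x = w" using a LD(1)[OF r0(1)] x by (simp add: W.Mod.smult_assoc)
      ultimately show ?thesis by blast
    qed
    define f where "f w = (SOME r. r \<in> L \<and> r \<odot>\<^bsub>W\<^esub> x = w) \<odot>\<^bsub>V\<^esub> v" for w
    have f: "f (r \<odot>\<^bsub>W\<^esub> x) = r \<odot>\<^bsub>V\<^esub> v" if r: "r \<in> L" for r
    proof -
      define s where "s = (SOME s. s \<in> L \<and> s \<odot>\<^bsub>W\<^esub> x = r \<odot>\<^bsub>W\<^esub> x)"
      have s: "s \<in> L" "s \<odot>\<^bsub>W\<^esub> x = r \<odot>\<^bsub>W\<^esub> x"
        using someI_ex[OF ex[of "r \<odot>\<^bsub>W\<^esub> x"]] LD(1)[OF r] x unfolding s_def by auto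
      note cs = LD(1)[OF s(1)] LD(1)[OF r]
      have "s \<ominus>\<^bsub>A\<^esub> r \<in> L" by (rule left_ideal_diff[OF V.ring_algebra L s(1) r])
      moreover have "(s \<ominus>\<^bsub>A\<^esub> r) \<odot>\<^bsub>W\<^esub> x = \<zero>\<^bsub>W\<^esub>"
        using s cs x by (simp add: W.diff_smult W.Mod.M.minus_eq_zero_iff)
      ultimately have "(s \<ominus>\<^bsub>A\<^esub> r) \<odot>\<^bsub>V\<^esub> v = \<zero>\<^bsub>V\<^esub>" by (rule ann)
      then have "s \<odot>\<^bsub>V\<^esub> v = r \<odot>\<^bsub>V\<^esub> v"
        using cs v by (simp add: V.diff_smult V.Mod.M.minus_eq_zero_iff)
      then show ?thesis by (simp add: f_def s_def)
    qed
    have fhom: "f \<in> module_hom A W V" unfolding module_hom_def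
    proof (intro CollectI conjI ballI)
      show "f \<in> carrier W \<rightarrow> carrier V"
      proof
        fix w assume "w \<in> carrier W"
        then obtain r where "r \<in> L" "r \<odot>\<^bsub>W\<^esub> x = w" using ex by blast
        then show "f w \<in> carrier V" using f[of r] LD(1)[of r] v by auto
      qed
      fix w assume "w \<in> carrier W"
      then obtain r where r: "r \<in> L" "w = r \<odot>\<^bsub>W\<^esub> x" using ex by blast
      { fix w' assume "w' \<in> carrier W"
        then obtain r' where r': "r' \<in> L" "w' = r' \<odot>\<^bsub>W\<^esub> x" using ex by blast
        have "f (w \<oplus>\<^bsub>W\<^esub> w') = (r \<oplus>\<^bsub>A\<^esub> r') \<odot>\<^bsub>V\<^esub> v"
          using f[OF LD(3)[OF r(1) r'(1)]] LD(1)[OF r(1)] LD(1)[OF r'(1)] x r(2) r'(2)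
          by (simp add: W.Mod.smult_l_distr)
        then show "f (w \<oplus>\<^bsub>W\<^esub> w') = f w \<oplus>\<^bsub>V\<^esub> f w'"
          using f[OF r(1)] f[OF r'(1)] LD(1)[OF r(1)] LD(1)[OF r'(1)] v r(2) r'(2)
          by (simp add: V.Mod.smult_l_distr) }
      fix a assume a: "a \<in> carrier A"
      have "f (a \<odot>\<^bsub>W\<^esub> w) = (a \<otimes>\<^bsub>A\<^esub> r) \<odot>\<^bsub>V\<^esub> v"
        using f[OF LD(4)[OF a r(1)]] LD(1)[OF r(1)] x a r(2) by (simp add: W.Mod.smult_assoc)
      then show "f (a \<odot>\<^bsub>W\<^esub> w) = a \<odot>\<^bsub>V\<^esub> f w"
        using f[OF r(1)] LD(1)[OF r(1)] v a r(2) by (simp add: V.Mod.smult_assoc)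
    qed
    show ?thesis
    proof (intro bexI[OF _ fhom] ballI)
      fix r assume "r \<in> L"
      then show "r \<odot>\<^bsub>V\<^esub> v = r \<odot>\<^bsub>V\<^esub> f x" using f module_homD(3)[OF fhom LD(1) x] by simp
    qed
  qed
qed

text \<open>Induction on \<open>J\<close>. Restrict \<open>L\<close> to the elements killing x k;
  they kill \<open>v\<close> by the induction hypothesis. So on \<open>L\<close> the vector
  \<open>v\<close> behaves like the image of x k under a homomorphism from W k to \<open>V\<close>,
  and all those homomorphisms vanish.\<close>

lemma annihilator_other_simples:
  assumes "alg_module A V" "finite J" "\<And>j. j \<in> J \<Longrightarrow> alg_module A (W j) \<and> simple_module A (W j)"
    and "\<And>j f w. j \<in> J \<Longrightarrow> f \<in> module_hom A (W j) V \<Longrightarrow> w \<in> carrier (W j) \<Longrightarrow> f w = \<zero>\<^bsub>V\<^esub>"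
    and "\<And>j. j \<in> J \<Longrightarrow> x j \<in> carrier (W j)" and v: "v \<in> carrier V"
    and "left_ideal A L"
    and "\<And>r. r \<in> L \<Longrightarrow> (\<And>j. j \<in> J \<Longrightarrow> r \<odot>\<^bsub>W j\<^esub> x j = \<zero>\<^bsub>W j\<^esub>) \<Longrightarrow> r \<odot>\<^bsub>V\<^esub> v = \<zero>\<^bsub>V\<^esub>"
    and "r \<in> L"
  shows "r \<odot>\<^bsub>V\<^esub> v = \<zero>\<^bsub>V\<^esub>"
  using assms(2-5,7-)
proof (induction J arbitrary: L r rule: finite_induct)
  case empty
  then show ?case by auto
next
  case (insert k J)
  interpret V: alg_module A V by fact
  interpret W: alg_module A "W k" using insert.prems(1) by blast
  have xk: "x k \<in> carrier (W k)" using insert.prems(3) by blast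
  let ?L = "{a \<in> L. a \<odot>\<^bsub>W k\<^esub> x k = \<zero>\<^bsub>W k\<^esub>}"
  have L': "left_ideal A ?L" by (rule W.left_ideal_annihilator[OF insert.prems(4) xk])
  have "s \<odot>\<^bsub>V\<^esub> v = \<zero>\<^bsub>V\<^esub>" if s: "s \<in> ?L" for s
  proof (rule insert.IH[OF _ _ _ L' _ s])
    fix r assume "r \<in> ?L" "\<And>j. j \<in> J \<Longrightarrow> r \<odot>\<^bsub>W j\<^esub> x j = \<zero>\<^bsub>W j\<^esub>"
    then show "r \<odot>\<^bsub>V\<^esub> v = \<zero>\<^bsub>V\<^esub>" using insert.prems(5)[of r] by auto
  qed (use insert.prems(1-3) in auto)
  then have "s \<odot>\<^bsub>V\<^esub> v = \<zero>\<^bsub>V\<^esub>" if "s \<in> L" "s \<odot>\<^bsub>W k\<^esub> x k = \<zero>\<^bsub>W k\<^esub>" for s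
    using that by blast
  then obtain f where f: "f \<in> module_hom A (W k) V" "\<And>r. r \<in> L \<Longrightarrow> r \<odot>\<^bsub>V\<^esub> v = r \<odot>\<^bsub>V\<^esub> f (x k)"
    using exists_hom_on_left_ideal[of A "W k" V L "x k" v] insert.prems(1)[of k] insert.prems(4)
      assms(1) xk v by blast
  then show ?case
    using insert.prems(2)[of k f "x k"] xk insert.prems(6) left_idealD(1)[OF insert.prems(4)] by simp
qed

text \<open>The finite form of the double centralizer argument: a vector killed by all elements of
  \<open>L\<close> that kill \<open>B\<close> is, as far as \<open>L\<close> can see, a combination
  of \<open>B\<close>. In the induction step the part of v not yet accounted for is the image of the
  new vector \<open>k\<close> under an endomorphism; by Schur's lemma this is a scalar, which
  becomes the coefficient of \<open>k\<close>.\<close>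

lemma (in alg_module) annihilator_simple:
  assumes sim: "simple_module A M" and fd: "fin_dim A M" and "finite B" "B \<subseteq> carrier M"
    and "v \<in> carrier M" and "left_ideal A L"
    and "\<And>r. r \<in> L \<Longrightarrow> (\<And>b. b \<in> B \<Longrightarrow> r \<odot>\<^bsub>M\<^esub> b = \<zero>\<^bsub>M\<^esub>) \<Longrightarrow> r \<odot>\<^bsub>M\<^esub> v = \<zero>\<^bsub>M\<^esub>"
  shows "\<exists>c. \<forall>r\<in>L. r \<odot>\<^bsub>M\<^esub> v = r \<odot>\<^bsub>M\<^esub> (\<Oplus>\<^bsub>M\<^esub>b\<in>B. cscale A M (c b) b)"
  using assms(3-)
proof (induction B arbitrary: L v rule: finite_induct)
  case empty
  then show ?case using left_idealD(1)[OF empty(3)] by auto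
next
  case (insert k B)
  have k: "k \<in> carrier M" and Bc: "B \<subseteq> carrier M" using insert.prems(1) by auto
  let ?L = "{a \<in> L. a \<odot>\<^bsub>M\<^esub> k = \<zero>\<^bsub>M\<^esub>}"
  have L': "left_ideal A ?L" by (rule left_ideal_annihilator[OF insert.prems(3) k])
  have "\<exists>c. \<forall>r\<in>?L. r \<odot>\<^bsub>M\<^esub> v = r \<odot>\<^bsub>M\<^esub> (\<Oplus>\<^bsub>M\<^esub>b\<in>B. cscale A M (c b) b)"
  proof (rule insert.IH[OF Bc insert.prems(2) L'])
    fix r assume "r \<in> ?L" "\<And>b. b \<in> B \<Longrightarrow> r \<odot>\<^bsub>M\<^esub> b = \<zero>\<^bsub>M\<^esub>"
    then show "r \<odot>\<^bsub>M\<^esub> v = \<zero>\<^bsub>M\<^esub>" using insert.prems(4)[of r] by auto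
  qed
  then obtain c where c: "\<And>r. r \<in> L \<Longrightarrow> r \<odot>\<^bsub>M\<^esub> k = \<zero>\<^bsub>M\<^esub> \<Longrightarrow>
      r \<odot>\<^bsub>M\<^esub> v = r \<odot>\<^bsub>M\<^esub> (\<Oplus>\<^bsub>M\<^esub>b\<in>B. cscale A M (c b) b)" by blast
  define u where "u c = (\<Oplus>\<^bsub>M\<^esub>b\<in>B. cscale A M (c b) b)" for c
  have u: "u c \<in> carrier M" for c unfolding u_def using Bc by (intro Mod.M.finsum_closed) auto
  note LD = left_idealD[OF insert.prems(3)]
  have diff: "r \<odot>\<^bsub>M\<^esub> (v \<ominus>\<^bsub>M\<^esub> u c) = \<zero>\<^bsub>M\<^esub>" if "r \<in> L" "r \<odot>\<^bsub>M\<^esub> k = \<zero>\<^bsub>M\<^esub>" for r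
    using c[OF that] LD(1)[OF that(1)] u insert.prems(2)
    by (simp add: smult_diff u_def[symmetric] Mod.M.minus_eq_zero_iff)
  have vu: "v \<ominus>\<^bsub>M\<^esub> u c \<in> carrier M" using u insert.prems(2) by simp
  obtain f where f: "f \<in> module_hom A M M"
    "\<And>r. r \<in> L \<Longrightarrow> r \<odot>\<^bsub>M\<^esub> (v \<ominus>\<^bsub>M\<^esub> u c) = r \<odot>\<^bsub>M\<^esub> f k"
    using exists_hom_on_left_ideal[OF alg_module_axioms sim alg_module_axioms insert.prems(3) k vu diff]
    by auto
  obtain z where z: "f k = cscale A M z k" using Schur[OF sim fd f(1)] k by metis
  define d where "d b = (if b = k then z else c b)" for b
  have "(\<Oplus>\<^bsub>M\<^esub>b\<in>insert k B. cscale A M (d b) b) = cscale A M z k \<oplus>\<^bsub>M\<^esub> u d"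
    unfolding u_def using insert.hyps Bc k by (subst Mod.M.finsum_insert) (auto simp: d_def)
  also have "u d = u c" unfolding u_def using Bc insert.hyps
    by (intro Mod.M.finsum_cong') (auto simp: d_def)
  finally have sum: "(\<Oplus>\<^bsub>M\<^esub>b\<in>insert k B. cscale A M (d b) b) = cscale A M z k \<oplus>\<^bsub>M\<^esub> u c" .
  have "r \<odot>\<^bsub>M\<^esub> v = r \<odot>\<^bsub>M\<^esub> (\<Oplus>\<^bsub>M\<^esub>b\<in>insert k B. cscale A M (d b) b)" if r: "r \<in> L" for r
  proof -
    have v: "v = (v \<ominus>\<^bsub>M\<^esub> u c) \<oplus>\<^bsub>M\<^esub> u c"
      using insert.prems(2) u[of c] by (simp add: a_minus_def Mod.M.a_assoc Mod.M.l_neg)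
    have "r \<odot>\<^bsub>M\<^esub> v = r \<odot>\<^bsub>M\<^esub> (v \<ominus>\<^bsub>M\<^esub> u c) \<oplus>\<^bsub>M\<^esub> r \<odot>\<^bsub>M\<^esub> u c"
      using LD(1)[OF r] u insert.prems(2) by (subst v) (simp add: Mod.smult_r_distr)
    also have "\<dots> = r \<odot>\<^bsub>M\<^esub> (cscale A M z k \<oplus>\<^bsub>M\<^esub> u c)"
      using f(2)[OF r] z LD(1)[OF r] u k by (simp add: Mod.smult_r_distr)
    finally show ?thesis by (simp add: sum)
  qed
  then show ?case by blast
qed

text \<open>
  The family \<open>W\<close> may consist of modules with elements of another type, which is why it is treated
  separately from the copies of \<open>M\<close>.
\<close>

lemma (in alg_module) density:
  assumes sim: "simple_module A M" and fd: "fin_dim A M" and T: "linear_map A M A M T"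
    and J: "finite J" "\<And>j. j \<in> J \<Longrightarrow> simple_module A (W j)"
    and hom0: "\<And>j f w. j \<in> J \<Longrightarrow> f \<in> module_hom A (W j) M \<Longrightarrow> w \<in> carrier (W j) \<Longrightarrow> f w = \<zero>\<^bsub>M\<^esub>"
    and x: "\<And>j. j \<in> J \<Longrightarrow> x j \<in> carrier (W j)"
  obtains r where "r \<in> carrier A" "\<And>v. v \<in> carrier M \<Longrightarrow> r \<odot>\<^bsub>M\<^esub> v = T v"
    "\<And>j. j \<in> J \<Longrightarrow> r \<odot>\<^bsub>W j\<^esub> x j = \<zero>\<^bsub>W j\<^esub>"
proof -
  have W: "alg_module A (W j)" if "j \<in> J" for j
    using simple_alg_module[OF Alg.complex_algebra_axioms J(2)[OF that]] .
  obtain B \<delta> where B: "dual_basis A M B \<delta>" using exists_dual_basis[OF fd] by metis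
  note BD = dual_basisD[OF B]
  define L where "L = {r \<in> carrier A. \<forall>j\<in>J. r \<odot>\<^bsub>W j\<^esub> x j = \<zero>\<^bsub>W j\<^esub>}"
  have L: "left_ideal A L" unfolding left_ideal_def
  proof (intro conjI ballI)
    show "\<zero>\<^bsub>A\<^esub> \<in> L" using alg_module.zero_smult[OF W x] by (auto simp: L_def)
    fix r assume r: "r \<in> L"
    show "r \<oplus>\<^bsub>A\<^esub> s \<in> L" if "s \<in> L" for s
    proof -
      have "(r \<oplus>\<^bsub>A\<^esub> s) \<odot>\<^bsub>W j\<^esub> x j = \<zero>\<^bsub>W j\<^esub>" if j: "j \<in> J" for j
      proof -
        interpret W: alg_module A "W j" by (rule W[OF j])
        show ?thesis using r \<open>s \<in> L\<close> j x[OF j] by (simp add: L_def W.Mod.smult_l_distr)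
      qed
      then show ?thesis using r \<open>s \<in> L\<close> by (auto simp: L_def)
    qed
    show "a \<otimes>\<^bsub>A\<^esub> r \<in> L" if "a \<in> carrier A" for a
    proof -
      have "(a \<otimes>\<^bsub>A\<^esub> r) \<odot>\<^bsub>W j\<^esub> x j = \<zero>\<^bsub>W j\<^esub>" if j: "j \<in> J" for j
      proof -
        interpret W: alg_module A "W j" by (rule W[OF j])
        show ?thesis using r \<open>a \<in> carrier A\<close> j x[OF j] by (simp add: L_def W.Mod.smult_assoc)
      qed
      then show ?thesis using r \<open>a \<in> carrier A\<close> by (auto simp: L_def)
    qed
  qed (auto simp: L_def)
  have full: "left_ideal A (carrier A)" by (auto simp: left_ideal_def)
  \<comment> \<open>One element for each basis vector \<open>b\<close>, vanishing on the rest of the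
    basis and sending \<open>b\<close> to T b; the sum of these elements realizes
    \<open>T\<close>.\<close>
  have sep: "\<exists>r\<in>L. (\<forall>b'\<in>B - {b}. r \<odot>\<^bsub>M\<^esub> b' = \<zero>\<^bsub>M\<^esub>) \<and> r \<odot>\<^bsub>M\<^esub> b = T b" if b: "b \<in> B" for b
  proof -
    have "\<exists>r\<in>L. (\<forall>b'\<in>B - {b}. r \<odot>\<^bsub>M\<^esub> b' = \<zero>\<^bsub>M\<^esub>) \<and> r \<odot>\<^bsub>M\<^esub> b \<noteq> \<zero>\<^bsub>M\<^esub>"
    proof (rule ccontr)
      assume no: "\<not> ?thesis"
      have "\<exists>c. \<forall>r\<in>L. r \<odot>\<^bsub>M\<^esub> b = r \<odot>\<^bsub>M\<^esub> (\<Oplus>\<^bsub>M\<^esub>b'\<in>B - {b}. cscale A M (c b') b')"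
        by (rule annihilator_simple[OF sim fd _ _ BD(2)[OF b] L]) (use BD(1,2) no in blast)+
      then obtain c where c: "\<And>r. r \<in> L \<Longrightarrow>
          r \<odot>\<^bsub>M\<^esub> b = r \<odot>\<^bsub>M\<^esub> (\<Oplus>\<^bsub>M\<^esub>b'\<in>B - {b}. cscale A M (c b') b')" by blast
      define u where "u = (\<Oplus>\<^bsub>M\<^esub>b'\<in>B - {b}. cscale A M (c b') b')"
      have cl: "(\<lambda>b'. cscale A M (c b') b') \<in> B - {b} \<rightarrow> carrier M" using BD(2) by auto
      have u: "u \<in> carrier M" unfolding u_def by (rule Mod.M.finsum_closed[OF cl])
      \<comment> \<open>Elements of \<open>L\<close> cannot distinguish \<open>b\<close> from the
        combination \<open>u\<close> of the other basis vectors. As the modules W j have only zero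
        homomorphisms to \<open>M\<close>, the same then holds for all of \<open>A\<close>, in
        particular for \<one>, against the independence of the basis.\<close>
      have "\<one>\<^bsub>A\<^esub> \<odot>\<^bsub>M\<^esub> (b \<ominus>\<^bsub>M\<^esub> u) = \<zero>\<^bsub>M\<^esub>"
      proof (rule annihilator_other_simples[where A = A and V = M and J = J and L = "carrier A" and W = W and x = x])
        fix r assume "r \<in> carrier A" "\<And>j. j \<in> J \<Longrightarrow> r \<odot>\<^bsub>W j\<^esub> x j = \<zero>\<^bsub>W j\<^esub>"
        then show "r \<odot>\<^bsub>M\<^esub> (b \<ominus>\<^bsub>M\<^esub> u) = \<zero>\<^bsub>M\<^esub>"
          using c[of r] u BD(2)[OF b]
          by (simp add: L_def u_def[symmetric] smult_diff Mod.M.minus_eq_zero_iff)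
      next
        fix j f w assume "j \<in> J" "f \<in> module_hom A (W j) M" "w \<in> carrier (W j)"
        then show "f w = \<zero>\<^bsub>M\<^esub>" by (rule hom0)
      qed (use W J u BD(2)[OF b] full x alg_module_axioms in auto)
      then have "b = u" using u BD(2)[OF b] by (simp add: Mod.smult_one Mod.M.minus_eq_zero_iff)
      then have "\<delta> b b = (\<Sum>b'\<in>B - {b}. \<delta> b (cscale A M (c b') b'))"
        using linear_form_finsum[OF BD(3)[OF b] cl] by (simp add: u_def)
      also have "\<dots> = 0" using BD(2,4) b linear_formD(2)[OF BD(3)[OF b]] by (intro sum.neutral) auto
      finally show False using BD(4)[OF b b] by simp
    qed
    then obtain r where r: "r \<in> L" "\<forall>b'\<in>B - {b}. r \<odot>\<^bsub>M\<^esub> b' = \<zero>\<^bsub>M\<^esub>" "r \<odot>\<^bsub>M\<^esub> b \<noteq> \<zero>\<^bsub>M\<^esub>" by blast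
    note rc = left_idealD(1)[OF L r(1)]
    obtain a where a: "a \<in> carrier A" "a \<odot>\<^bsub>M\<^esub> (r \<odot>\<^bsub>M\<^esub> b) = T b"
      using simple_generates[OF sim _ r(3), of "T b"] rc BD(2)[OF b] linear_mapD(1)[OF T] by auto
    have "a \<otimes>\<^bsub>A\<^esub> r \<in> L" by (rule left_idealD(4)[OF L a(1) r(1)])
    moreover have "(a \<otimes>\<^bsub>A\<^esub> r) \<odot>\<^bsub>M\<^esub> b' = \<zero>\<^bsub>M\<^esub>" if "b' \<in> B - {b}" for b'
      using r(2) that a(1) rc BD(2)[of b'] by (simp add: Mod.smult_assoc)
    moreover have "(a \<otimes>\<^bsub>A\<^esub> r) \<odot>\<^bsub>M\<^esub> b = T b" using a rc BD(2)[OF b] by (simp add: Mod.smult_assoc)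
    ultimately show ?thesis by blast
  qed
  then obtain e where e: "\<And>b. b \<in> B \<Longrightarrow> e b \<in> L \<and> (\<forall>b'\<in>B - {b}. e b \<odot>\<^bsub>M\<^esub> b' = \<zero>\<^bsub>M\<^esub>) \<and>
      e b \<odot>\<^bsub>M\<^esub> b = T b" by metis
  have ec: "e \<in> B \<rightarrow> carrier A" using e left_idealD(1)[OF L] by auto
  define r where "r = finsum A e B"
  have rc: "r \<in> carrier A" unfolding r_def using ec 
    by (rule abelian_monoid.finsum_closed[OF abelian_group.axioms(1)[OF ab_group_algebra]])
  have rb: "r \<odot>\<^bsub>M\<^esub> b = T b" if b: "b \<in> B" for b
  proof -
    have "r \<odot>\<^bsub>M\<^esub> b = (\<Oplus>\<^bsub>M\<^esub>b'\<in>B. e b' \<odot>\<^bsub>M\<^esub> b)"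
      unfolding r_def using ec BD(2)[OF b] by (intro finsum_smult)
    also have "\<dots> = T b"
      using b e linear_mapD(1)[OF T BD(2)[OF b]] by (intro abelian_finsum_delta[OF ab_group BD(1) b]) auto
    finally show ?thesis .
  qed
  show thesis
  proof (rule that[OF rc])
    fix v assume v: "v \<in> carrier M"
    have "linear_map A M A M ((\<odot>\<^bsub>M\<^esub>) r)" using rc by (auto simp: linear_map_def additive_smult smult_sc)
    from linear_map_lincomb[OF this alg_module_axioms B v] linear_map_lincomb[OF T alg_module_axioms B v]
    show "r \<odot>\<^bsub>M\<^esub> v = T v"
      using rb BD(2) linear_mapD(1)[OF T]
      by (auto intro!: Mod.M.finsum_cong')
  next
    fix j assume j: "j \<in> J"
    interpret W: alg_module A "W j" by (rule W[OF j])
    have "r \<odot>\<^bsub>W j\<^esub> x j = (\<Oplus>\<^bsub>W j\<^esub>b'\<in>B. e b' \<odot>\<^bsub>W j\<^esub> x j)"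
      unfolding r_def using ec x[OF j] by (intro W.finsum_smult)
    also have "\<dots> = (\<Oplus>\<^bsub>W j\<^esub>b'\<in>B. \<zero>\<^bsub>W j\<^esub>)"
      using e j by (intro W.Mod.M.finsum_cong') (auto simp: L_def)
    finally show "r \<odot>\<^bsub>W j\<^esub> x j = \<zero>\<^bsub>W j\<^esub>" by (simp add: W.Mod.M.finsum_zero)
  qed
qed

lemma hom_between_simples_zero:
  assumes "alg_module A W" "alg_module A V" "simple_module A W" "simple_module A V"
    "\<not> isomorphic A W V" "f \<in> module_hom A W V" "w \<in> carrier W"
  shows "f w = \<zero>\<^bsub>V\<^esub>"
  using simple_hom_iso[OF assms(1-4,6,7)] assms(5) by (auto simp: isomorphic_def)

text \<open>\<open>density\<close> kills one vector per index. Taking the pairs of an index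
  \<open>j\<close> and a basis vector of W j as indices makes it kill the whole modules.\<close>

lemma (in alg_module) density_separating:
  assumes sim: "simple_module A M" and fd: "fin_dim A M" and T: "linear_map A M A M T"
    and J: "finite J" "\<And>j. j \<in> J \<Longrightarrow> simple_module A (W j) \<and> fin_dim A (W j) \<and> \<not> isomorphic A (W j) M"
  obtains r where "r \<in> carrier A" "\<And>v. v \<in> carrier M \<Longrightarrow> r \<odot>\<^bsub>M\<^esub> v = T v"
    "\<And>j w. j \<in> J \<Longrightarrow> w \<in> carrier (W j) \<Longrightarrow> r \<odot>\<^bsub>W j\<^esub> w = \<zero>\<^bsub>W j\<^esub>"
proof -
  have W: "alg_module A (W j)" if "j \<in> J" for j
    using simple_alg_module[OF Alg.complex_algebra_axioms] J(2)[OF that] by blast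
  have "\<exists>B \<delta>. dual_basis A (W j) B \<delta>" if "j \<in> J" for j
    using alg_module.exists_dual_basis[OF W[OF that]] J(2)[OF that] by metis
  then obtain B \<delta> where B: "\<And>j. j \<in> J \<Longrightarrow> dual_basis A (W j) (B j) (\<delta> j)" by metis
  let ?K = "SIGMA j:J. B j"
  have fin: "finite ?K" using J(1) dual_basisD(1)[OF B] by auto
  obtain r where r: "r \<in> carrier A" "\<And>v. v \<in> carrier M \<Longrightarrow> r \<odot>\<^bsub>M\<^esub> v = T v"
    "\<And>k. k \<in> ?K \<Longrightarrow> r \<odot>\<^bsub>W (fst k)\<^esub> snd k = \<zero>\<^bsub>W (fst k)\<^esub>"
  proof (rule density[OF sim fd T fin, of "\<lambda>k. W (fst k)" snd])
    fix k f w assume "k \<in> ?K" "f \<in> module_hom A (W (fst k)) M" "w \<in> carrier (W (fst k))"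
    then show "f w = \<zero>\<^bsub>M\<^esub>"
      using hom_between_simples_zero[OF W alg_module_axioms _ sim] J(2) by auto
  qed (use J(2) dual_basisD(2)[OF B] in auto)
  show thesis
  proof (rule that[OF r(1,2)])
    fix j w assume j: "j \<in> J" and w: "w \<in> carrier (W j)"
    interpret W: alg_module A "W j" by (rule W[OF j])
    note BD = dual_basisD[OF B[OF j]]
    have "linear_map A (W j) A (W j) ((\<odot>\<^bsub>W j\<^esub>) r)"
      using r(1) by (auto simp: linear_map_def W.additive_smult W.smult_sc)
    from W.linear_map_lincomb[OF this W.alg_module_axioms B[OF j] w]
    have "r \<odot>\<^bsub>W j\<^esub> w = (\<Oplus>\<^bsub>W j\<^esub>b\<in>B j. cscale A (W j) (\<delta> j b w) (r \<odot>\<^bsub>W j\<^esub> b))" .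
    also have "\<dots> = (\<Oplus>\<^bsub>W j\<^esub>b\<in>B j. \<zero>\<^bsub>W j\<^esub>)"
      using r(3)[of "(j, b)" for b] j by (intro W.Mod.M.finsum_cong') auto
    finally show "r \<odot>\<^bsub>W j\<^esub> w = \<zero>\<^bsub>W j\<^esub>" by (simp add: W.Mod.M.finsum_zero)
  qed
qed

subsection \<open>Quotients by left ideals\<close>

definition coset_of :: "(complex, 'a) module \<Rightarrow> 'a set \<Rightarrow> 'a \<Rightarrow> 'a set"
  where "coset_of A P a = {x \<in> carrier A. x \<ominus>\<^bsub>A\<^esub> a \<in> P}"

definition coset_rep :: "(complex, 'a) module \<Rightarrow> 'a set \<Rightarrow> 'a set \<Rightarrow> 'a"
  where "coset_rep A P S = (SOME a. a \<in> carrier A \<and> coset_of A P a = S)"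

text \<open>Elements are cosets as sets, because \<open>complete_simples\<close>,
  \<open>covers_simples\<close> and \<open>only_in_fin_dim_simples\<close> test modules of exactly
  this element type. The operations work on chosen representatives; \<open>coset_of_eq_iff\<close>
  shows that the choice is immaterial.\<close>

definition quotient_module :: "(complex, 'a) module \<Rightarrow> 'a set \<Rightarrow> ('a, 'a set) module"
  where "quotient_module A P =
    \<lparr>carrier = coset_of A P ` carrier A, monoid.mult = undefined, one = undefined,
     ring.zero = coset_of A P \<zero>\<^bsub>A\<^esub>,
     add = (\<lambda>S T. coset_of A P (coset_rep A P S \<oplus>\<^bsub>A\<^esub> coset_rep A P T)),
     module.smult = (\<lambda>a S. coset_of A P (a \<otimes>\<^bsub>A\<^esub> coset_rep A P S))\<rparr>"

lemma (in abelian_group) diff_trans: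
  "x \<in> carrier G \<Longrightarrow> a \<in> carrier G \<Longrightarrow> b \<in> carrier G \<Longrightarrow> x \<ominus> b = (x \<ominus> a) \<oplus> (a \<ominus> b)"
  by (simp add: a_minus_def a_assoc r_neg1)

lemma (in abelian_group) diff_add_add:
  "x \<in> carrier G \<Longrightarrow> y \<in> carrier G \<Longrightarrow> a \<in> carrier G \<Longrightarrow> b \<in> carrier G \<Longrightarrow>
    (x \<oplus> y) \<ominus> (a \<oplus> b) = (x \<ominus> a) \<oplus> (y \<ominus> b)"
  by (simp add: a_minus_def minus_add a_ac)

locale quotient_by_left_ideal = ring A for A :: "(complex, 'a) module" (structure) +
  fixes P :: "'a set"
  assumes left_ideal: "left_ideal A P"
begin

lemma coset_of_eq_iff:
  assumes ab: "a \<in> carrier A" "b \<in> carrier A"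
  shows "coset_of A P a = coset_of A P b \<longleftrightarrow> a \<ominus> b \<in> P"
proof
  assume "coset_of A P a = coset_of A P b"
  moreover have "a \<in> coset_of A P a"
    using ab left_idealD(2)[OF left_ideal] by (simp add: coset_of_def a_minus_def r_neg)
  ultimately show "a \<ominus> b \<in> P" by (simp add: coset_of_def)
next
  assume d: "a \<ominus> b \<in> P"
  have d': "b \<ominus> a \<in> P"
  proof -
    have "b \<ominus> a = \<zero> \<ominus> (a \<ominus> b)" using ab by (simp add: a_minus_def minus_add a_comm)
    then show ?thesis using left_ideal_diff[OF ring_axioms left_ideal left_idealD(2)[OF left_ideal] d] by simp
  qed
  have "x \<ominus> a \<in> P \<longleftrightarrow> x \<ominus> b \<in> P" if "x \<in> carrier A" for x
    using left_idealD(3)[OF left_ideal _ d] left_idealD(3)[OF left_ideal _ d'] that ab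
      diff_trans[of x a b] diff_trans[of x b a] by metis
  then show "coset_of A P a = coset_of A P b" by (auto simp: coset_of_def)
qed

lemma coset_rep:
  assumes "a \<in> carrier A"
  shows "coset_rep A P (coset_of A P a) \<in> carrier A"
    and "coset_rep A P (coset_of A P a) \<ominus> a \<in> P"
proof -
  have *: "coset_rep A P (coset_of A P a) \<in> carrier A \<and>
      coset_of A P (coset_rep A P (coset_of A P a)) = coset_of A P a"
    unfolding coset_rep_def by (rule someI[of _ a]) (use assms in simp)
  then show "coset_rep A P (coset_of A P a) \<in> carrier A" by simp
  with * show "coset_rep A P (coset_of A P a) \<ominus> a \<in> P" using coset_of_eq_iff assms by simp
qed

lemma quotient_add:
  assumes "a \<in> carrier A" "b \<in> carrier A"
  shows "coset_of A P a \<oplus>\<^bsub>quotient_module A P\<^esub> coset_of A P b = coset_of A P (a \<oplus> b)"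
  using assms coset_rep left_idealD(3)[OF left_ideal]
  by (simp add: quotient_module_def coset_of_eq_iff diff_add_add)

lemma quotient_smult:
  assumes "a \<in> carrier A" "b \<in> carrier A"
  shows "a \<odot>\<^bsub>quotient_module A P\<^esub> coset_of A P b = coset_of A P (a \<otimes> b)"
proof -
  let ?r = "coset_rep A P (coset_of A P b)"
  have "a \<otimes> ?r \<ominus> a \<otimes> b = a \<otimes> (?r \<ominus> b)"
    using assms coset_rep(1)[of b] by (simp add: a_minus_def r_distr r_minus)
  also have "\<dots> \<in> P" using left_idealD(4)[OF left_ideal assms(1) coset_rep(2)[OF assms(2)]] .
  finally show ?thesis using assms coset_rep(1)[of b] by (simp add: quotient_module_def coset_of_eq_iff)
qed

lemma quotient_carrier: "carrier (quotient_module A P) = coset_of A P ` carrier A"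
  and quotient_zero: "\<zero>\<^bsub>quotient_module A P\<^esub> = coset_of A P \<zero>"
  by (simp_all add: quotient_module_def)

lemma left_module_quotient: "left_module A (quotient_module A P)"
proof -
  have "abelian_group (quotient_module A P)"
  proof (rule abelian_groupI)
    fix S assume "S \<in> carrier (quotient_module A P)"
    then obtain a where a: "a \<in> carrier A" "S = coset_of A P a" by (auto simp: quotient_carrier)
    show "\<zero>\<^bsub>quotient_module A P\<^esub> \<oplus>\<^bsub>quotient_module A P\<^esub> S = S"
      using a by (simp add: quotient_zero quotient_add)
    have "coset_of A P (\<ominus> a) \<oplus>\<^bsub>quotient_module A P\<^esub> S = \<zero>\<^bsub>quotient_module A P\<^esub>"
      using a by (simp add: quotient_zero quotient_add l_neg)
    then show "\<exists>T\<in>carrier (quotient_module A P).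
        T \<oplus>\<^bsub>quotient_module A P\<^esub> S = \<zero>\<^bsub>quotient_module A P\<^esub>"
      using a by (auto simp: quotient_carrier)
    fix T assume "T \<in> carrier (quotient_module A P)"
    then obtain b where b: "b \<in> carrier A" "T = coset_of A P b" by (auto simp: quotient_carrier)
    show "S \<oplus>\<^bsub>quotient_module A P\<^esub> T \<in> carrier (quotient_module A P)"
      using a b by (simp add: quotient_add quotient_carrier)
    show "S \<oplus>\<^bsub>quotient_module A P\<^esub> T = T \<oplus>\<^bsub>quotient_module A P\<^esub> S"
      using a b by (simp add: quotient_add a_comm)
    fix U assume "U \<in> carrier (quotient_module A P)"
    then obtain c where c: "c \<in> carrier A" "U = coset_of A P c" by (auto simp: quotient_carrier)
    show "(S \<oplus>\<^bsub>quotient_module A P\<^esub> T) \<oplus>\<^bsub>quotient_module A P\<^esub> U =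
        S \<oplus>\<^bsub>quotient_module A P\<^esub> (T \<oplus>\<^bsub>quotient_module A P\<^esub> U)"
      using a b c by (simp add: quotient_add a_assoc)
  qed (simp add: quotient_zero quotient_carrier)
  moreover have "left_module_axioms A (quotient_module A P)"
    unfolding left_module_axioms_def
    by (auto simp: quotient_carrier quotient_smult quotient_add l_distr r_distr m_assoc)
  ultimately show ?thesis
    using ring_axioms by (simp add: left_module_def)
qed

text \<open>If a lies outside \<open>P\<close>, then P + A a contains \<one> by maximality, say
  \<one> = p + r a. Hence b and (b r) a have the same coset for every b, and the coset of a
  generates the quotient.\<close>

lemma simple_quotient:
  assumes A: "complex_algebra A" and one: "\<one> \<notin> P" and max: "\<And>P'. left_ideal A P' \<Longrightarrow> P \<subseteq> P' \<Longrightarrow> \<one> \<notin> P' \<Longrightarrow> P' = P"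
  shows "simple_module A (quotient_module A P)"
proof -
  interpret Q: alg_module A "quotient_module A P" 
    using A left_module_quotient by (simp add: alg_module_def)
  note PD = left_idealD[OF left_ideal]
  have nz: "coset_of A P a \<noteq> \<zero>\<^bsub>quotient_module A P\<^esub> \<longleftrightarrow> a \<notin> P" if "a \<in> carrier A" for a
    using that coset_of_eq_iff[of a \<zero>] by (simp add: quotient_zero a_minus_def)
  show ?thesis
  proof (rule Q.simple_moduleI[of "coset_of A P \<one>"])
    show "coset_of A P \<one> \<in> carrier (quotient_module A P)" by (simp add: quotient_carrier)
    show "coset_of A P \<one> \<noteq> \<zero>\<^bsub>quotient_module A P\<^esub>" using nz one by simp
    fix S T assume S: "S \<in> carrier (quotient_module A P)" "S \<noteq> \<zero>\<^bsub>quotient_module A P\<^esub>"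
      and T: "T \<in> carrier (quotient_module A P)"
    obtain a where a: "a \<in> carrier A" "S = coset_of A P a" using S(1) by (auto simp: quotient_carrier)
    obtain b where b: "b \<in> carrier A" "T = coset_of A P b" using T by (auto simp: quotient_carrier)
    have "a \<notin> P" using S(2) a nz by simp
    define P' where "P' = {p \<oplus> r \<otimes> a | p r. p \<in> P \<and> r \<in> carrier A}"
    have "left_ideal A P'" unfolding left_ideal_def
    proof (intro conjI ballI)
      show "P' \<subseteq> carrier A" using PD(1) a by (auto simp: P'_def)
      show "\<zero> \<in> P'" unfolding P'_def using PD(2) a
        by (intro CollectI exI[of _ \<zero>]) simp
      fix u assume "u \<in> P'"
      then obtain p r where u: "u = p \<oplus> r \<otimes> a" "p \<in> P" "r \<in> carrier A" by (auto simp: P'_def)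
      note pc = PD(1)[OF u(2)]
      { fix v assume "v \<in> P'"
        then obtain q s where v: "v = q \<oplus> s \<otimes> a" "q \<in> P" "s \<in> carrier A" by (auto simp: P'_def)
        have "u \<oplus> v = (p \<oplus> q) \<oplus> (r \<oplus> s) \<otimes> a"
          using u v a pc PD(1)[OF v(2)] by (simp add: l_distr a_ac)
        moreover have "p \<oplus> q \<in> P" "r \<oplus> s \<in> carrier A" using PD(3) u v by auto
        ultimately show "u \<oplus> v \<in> P'" unfolding P'_def by blast }
      fix c assume c: "c \<in> carrier A"
      have "c \<otimes> u = c \<otimes> p \<oplus> (c \<otimes> r) \<otimes> a" using u c a pc by (simp add: r_distr m_assoc)
      moreover have "c \<otimes> p \<in> P" "c \<otimes> r \<in> carrier A" using PD(4) u c by auto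
      ultimately show "c \<otimes> u \<in> P'" unfolding P'_def by blast
    qed
    moreover have "P \<subseteq> P'"
    proof
      fix p assume "p \<in> P"
      then show "p \<in> P'" unfolding P'_def using PD(1) a
        by (intro CollectI exI[of _ p] exI[of _ \<zero>]) simp
    qed
    moreover have "a \<in> P'" unfolding P'_def using PD(2) a
      by (intro CollectI exI[of _ \<zero>] exI[of _ \<one>]) simp
    ultimately have "\<one> \<in> P'" using max \<open>a \<notin> P\<close> by blast
    then obtain p r where r: "\<one> = p \<oplus> r \<otimes> a" "p \<in> P" "r \<in> carrier A" by (auto simp: P'_def)
    note pc = PD(1)[OF r(2)]
    have "b = b \<otimes> (p \<oplus> r \<otimes> a)" using b r(1)[symmetric] by simp
    also have "\<dots> = b \<otimes> p \<oplus> b \<otimes> r \<otimes> a" using b a r pc by (simp add: r_distr m_assoc)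
    finally have "b \<ominus> b \<otimes> r \<otimes> a = (b \<otimes> p \<oplus> b \<otimes> r \<otimes> a) \<ominus> b \<otimes> r \<otimes> a" by simp
    also have "\<dots> = b \<otimes> p" using a b r pc by (simp add: a_minus_def a_assoc r_neg)
    also have "\<dots> \<in> P" using PD(4) b r by simp
    finally have "coset_of A P b = coset_of A P (b \<otimes> r \<otimes> a)" using a b r by (simp add: coset_of_eq_iff)
    then have "(b \<otimes> r) \<odot>\<^bsub>quotient_module A P\<^esub> S = T" using a b r by (simp add: quotient_smult)
    then show "\<exists>c\<in>carrier A. c \<odot>\<^bsub>quotient_module A P\<^esub> S = T" using b r by blast
  qed
qed

end

text \<open>Properness is expressed as avoiding \<one>, a condition that survives unions of
  chains.\<close>

lemma exists_maximal_left_ideal: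
  assumes L: "left_ideal A L" "\<one>\<^bsub>A\<^esub> \<notin> L"
  obtains P where "left_ideal A P" "L \<subseteq> P" "\<one>\<^bsub>A\<^esub> \<notin> P"
    "\<And>P'. left_ideal A P' \<Longrightarrow> P \<subseteq> P' \<Longrightarrow> \<one>\<^bsub>A\<^esub> \<notin> P' \<Longrightarrow> P' = P"
proof -
  define S where "S = {P. left_ideal A P \<and> L \<subseteq> P \<and> \<one>\<^bsub>A\<^esub> \<notin> P}"
  have "\<exists>P\<in>S. \<forall>P'\<in>S. P \<subseteq> P' \<longrightarrow> P' = P"
  proof (rule subset_Zorn_nonempty)
    show "S \<noteq> {}" using L by (auto simp: S_def)
    fix C assume C: "C \<noteq> {}" "subset.chain S C"
    have ch: "\<And>P Q. P \<in> C \<Longrightarrow> Q \<in> C \<Longrightarrow> P \<subseteq> Q \<or> Q \<subseteq> P"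
      using C(2) by (auto simp: subset_chain_def)
    have CS: "P \<in> S" if "P \<in> C" for P using C(2) that by (auto simp: subset_chain_def)
    have id: "left_ideal A P" "L \<subseteq> P" "\<one>\<^bsub>A\<^esub> \<notin> P" if "P \<in> C" for P
      using CS[OF that] by (auto simp: S_def)
    have "left_ideal A (\<Union>C)" unfolding left_ideal_def
    proof (intro conjI ballI)
      show "\<Union>C \<subseteq> carrier A" using left_idealD(1)[OF id(1)] by blast
      show "\<zero>\<^bsub>A\<^esub> \<in> \<Union>C" using left_idealD(2)[OF id(1)] C(1) by blast
      fix x assume "x \<in> \<Union>C"
      then obtain P where P: "P \<in> C" "x \<in> P" by blast
      { fix y assume "y \<in> \<Union>C"
        then obtain Q where Q: "Q \<in> C" "y \<in> Q" by blast
        obtain Z where Z: "Z \<in> C" "x \<in> Z" "y \<in> Z" using ch[OF P(1) Q(1)] P Q by blast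
        show "x \<oplus>\<^bsub>A\<^esub> y \<in> \<Union>C" using left_idealD(3)[OF id(1)[OF Z(1)] Z(2,3)] Z(1) by blast }
      fix a assume "a \<in> carrier A"
      then show "a \<otimes>\<^bsub>A\<^esub> x \<in> \<Union>C" using left_idealD(4)[OF id(1)[OF P(1)] _ P(2)] P(1) by blast
    qed
    moreover have "L \<subseteq> \<Union>C" "\<one>\<^bsub>A\<^esub> \<notin> \<Union>C" using id C(1) by blast+
    ultimately show "\<Union>C \<in> S" by (simp add: S_def)
  qed
  then obtain P where PS: "P \<in> S" and max: "\<forall>P'\<in>S. P \<subseteq> P' \<longrightarrow> P' = P" by (rule bexE)
  show thesis
  proof (rule that)
    show "left_ideal A P" "L \<subseteq> P" "\<one>\<^bsub>A\<^esub> \<notin> P" using PS by (simp_all add: S_def)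
    then show "P' = P" if "left_ideal A P'" "P \<subseteq> P'" "\<one>\<^bsub>A\<^esub> \<notin> P'" for P'
      using max that by (simp add: S_def)
  qed
qed

subsection \<open>Finite dimensional algebras\<close>

text \<open>Makes \<open>fin_dim\<close> and \<open>dual_basis\<close> applicable to the algebra
  itself.\<close>

definition regular_module :: "(complex, 'a) module \<Rightarrow> ('a, 'a) module"
  where "regular_module A =
    \<lparr>carrier = carrier A, monoid.mult = undefined, one = undefined, ring.zero = \<zero>\<^bsub>A\<^esub>, add = add A,
     module.smult = (\<otimes>\<^bsub>A\<^esub>)\<rparr>"

lemma regular_module_simps [simp]:
  "carrier (regular_module A) = carrier A" "\<zero>\<^bsub>regular_module A\<^esub> = \<zero>\<^bsub>A\<^esub>"
  "x \<oplus>\<^bsub>regular_module A\<^esub> y = x \<oplus>\<^bsub>A\<^esub> y" "a \<odot>\<^bsub>regular_module A\<^esub> x = a \<otimes>\<^bsub>A\<^esub> x"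
  "finsum (regular_module A) f J = finsum A f J"
  by (simp_all add: regular_module_def finsum_def finprod_def)

lemma complex_algebra_ring: "complex_algebra A \<Longrightarrow> ring A"
  by (simp add: complex_algebra_def)

lemma alg_module_regular:
  assumes "complex_algebra A"
  shows "alg_module A (regular_module A)"
proof -
  interpret A: ring A by (rule complex_algebra_ring[OF assms])
  have "abelian_group (regular_module A)"
    by (rule abelian_groupI) (auto simp: A.a_ac intro: A.l_neg)
  then show ?thesis
    using assms A.ring_axioms
    by (auto simp: alg_module_def left_module_def left_module_axioms_def A.l_distr A.r_distr A.m_assoc)
qed

lemma (in complex_algebra) cscale_regular [simp]:
  "x \<in> carrier A \<Longrightarrow> cscale A (regular_module A) c x = c \<odot> x"
  using smult_mult_left[of \<one> x c] ring.ring_simprules(12)[OF complex_algebra_ring[OF complex_algebra_axioms]]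
  by (simp add: cscale_def)

text \<open>\<open>g\<close> need not be injective, whereas \<open>fin_dim\<close> asks for a set of
  vectors; coefficients belonging to the same vector are added up.\<close>

lemma (in alg_module) fin_dimI:
  assumes "finite E" and g: "g \<in> E \<rightarrow> carrier M"
    and sp: "\<And>y. y \<in> carrier M \<Longrightarrow> \<exists>c. y = (\<Oplus>\<^bsub>M\<^esub>b\<in>E. cscale A M (c b) (g b))"
  shows "fin_dim A M"
proof -
  let ?B = "g ` E"
  have Bc: "?B \<subseteq> carrier M" using g by auto
  have ex: "\<exists>d. (\<Oplus>\<^bsub>M\<^esub>b\<in>F. cscale A M (c b) (g b)) = (\<Oplus>\<^bsub>M\<^esub>v\<in>?B. cscale A M (d v) v)"
    if "F \<subseteq> E" for F and c :: "'b \<Rightarrow> complex"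
    using finite_subset[OF that assms(1)] that
  proof (induction F rule: finite_induct)
    case empty
    have "(\<Oplus>\<^bsub>M\<^esub>v\<in>?B. cscale A M 0 v) = (\<Oplus>\<^bsub>M\<^esub>v\<in>?B. \<zero>\<^bsub>M\<^esub>)"
      using Bc by (intro Mod.M.finsum_cong') auto
    then show ?case by (intro exI[of _ "\<lambda>_. 0"]) (simp add: Mod.M.finsum_zero)
  next
    case (insert b F)
    then obtain d where d: "(\<Oplus>\<^bsub>M\<^esub>b\<in>F. cscale A M (c b) (g b)) = (\<Oplus>\<^bsub>M\<^esub>v\<in>?B. cscale A M (d v) v)"
      by auto
    have bE: "b \<in> E" and gb: "g b \<in> carrier M" and gF: "\<And>b. b \<in> F \<Longrightarrow> g b \<in> carrier M"
      using insert.prems g by auto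
    let ?d = "\<lambda>v. (if v = g b then c b else 0) + d v"
    have "(\<Oplus>\<^bsub>M\<^esub>v\<in>?B. cscale A M (?d v) v)
        = (\<Oplus>\<^bsub>M\<^esub>v\<in>?B. cscale A M (if v = g b then c b else 0) v \<oplus>\<^bsub>M\<^esub> cscale A M (d v) v)"
      using Bc by (intro Mod.M.finsum_cong') (auto simp del: if_split simp: sc_add_left subset_iff)
    also have "\<dots> = (\<Oplus>\<^bsub>M\<^esub>v\<in>?B. cscale A M (if v = g b then c b else 0) v)
        \<oplus>\<^bsub>M\<^esub> (\<Oplus>\<^bsub>M\<^esub>v\<in>?B. cscale A M (d v) v)"
      using Bc by (intro Mod.M.finsum_addf) auto
    also have "(\<Oplus>\<^bsub>M\<^esub>v\<in>?B. cscale A M (if v = g b then c b else 0) v) = cscale A M (c b) (g b)"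
      using Bc bE assms(1) gb by (intro abelian_finsum_delta[OF ab_group, of _ "g b"]) auto
    also have "cscale A M (c b) (g b) \<oplus>\<^bsub>M\<^esub> (\<Oplus>\<^bsub>M\<^esub>v\<in>?B. cscale A M (d v) v)
        = (\<Oplus>\<^bsub>M\<^esub>b\<in>insert b F. cscale A M (c b) (g b))"
      using insert.hyps gb gF by (subst Mod.M.finsum_insert) (auto simp: d[symmetric])
    finally show ?case by (intro exI[of _ ?d]) (rule sym)
  qed
  show ?thesis unfolding fin_dim_def
  proof (intro exI[of _ ?B] conjI ballI)
    fix y assume "y \<in> carrier M"
    then obtain c where c: "y = (\<Oplus>\<^bsub>M\<^esub>b\<in>E. cscale A M (c b) (g b))" using sp by blast
    show "\<exists>d. y = (\<Oplus>\<^bsub>M\<^esub>v\<in>?B. cscale A M (d v) v)" unfolding c by (rule ex) simp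
  qed (use assms(1) Bc in auto)
qed

text \<open>A nonzero vector generates, so the basis of the algebra applied to it spans the
  module.\<close>

lemma (in alg_module) simple_fin_dim:
  assumes A: "fin_dim A (regular_module A)" and sim: "simple_module A M"
  shows "fin_dim A M"
proof -
  interpret R: alg_module A "regular_module A" by (rule alg_module_regular[OF Alg.complex_algebra_axioms])
  obtain E \<eta> where E: "dual_basis A (regular_module A) E \<eta>" using R.exists_dual_basis[OF A] by metis
  note ED = dual_basisD[OF E]
  have Ec: "b \<in> E \<Longrightarrow> b \<in> carrier A" for b using ED(2) by simp
  obtain x where x: "x \<in> carrier M" "x \<noteq> \<zero>\<^bsub>M\<^esub>" using simple_nonzero[OF sim] .
  show ?thesis
  proof (rule fin_dimI[OF ED(1), of "\<lambda>b. b \<odot>\<^bsub>M\<^esub> x"])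
    fix y assume "y \<in> carrier M"
    then obtain a where a: "a \<in> carrier A" "a \<odot>\<^bsub>M\<^esub> x = y" using simple_generates[OF sim x] by metis
    have "a = (\<Oplus>\<^bsub>A\<^esub>b\<in>E. cscale A (regular_module A) (\<eta> b a) b)" using ED(5)[of a] a(1) by simp
    then have "y = (\<Oplus>\<^bsub>A\<^esub>b\<in>E. cscale A (regular_module A) (\<eta> b a) b) \<odot>\<^bsub>M\<^esub> x" using a(2) by simp
    also have "\<dots> = (\<Oplus>\<^bsub>M\<^esub>b\<in>E. cscale A (regular_module A) (\<eta> b a) b \<odot>\<^bsub>M\<^esub> x)"
      using x(1) R.sc_closed Ec by (intro finsum_smult) auto
    also have "\<dots> = (\<Oplus>\<^bsub>M\<^esub>b\<in>E. cscale A M (\<eta> b a) (b \<odot>\<^bsub>M\<^esub> x))"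
      using x(1) Ec by (intro Mod.M.finsum_cong') (auto simp: smult_sc_left)
    finally show "\<exists>c. y = (\<Oplus>\<^bsub>M\<^esub>b\<in>E. cscale A M (c b) (b \<odot>\<^bsub>M\<^esub> x))"
      by (rule exI[where x = "\<lambda>b. \<eta> b a"])
  qed (use x(1) Ec in auto)
qed

text \<open>The form in which semisimplicity is used: such an \<open>e\<close> is idempotent, and
  \<open>L\<close> is the summand A e of the algebra with complement A (\<one> - e).\<close>

definition left_ideals_idempotent :: "(complex, 'a) module \<Rightarrow> bool"
  where "left_ideals_idempotent A \<longleftrightarrow>
    (\<forall>L. left_ideal A L \<longrightarrow> (\<exists>e\<in>L. \<forall>a\<in>L. a \<otimes>\<^bsub>A\<^esub> e = a))"

section \<open>Complete families of simple modules over a finite dimensional algebra\<close>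

lemma complete_simplesD:
  assumes "complete_simples A I N"
  shows "\<nu> \<in> I \<Longrightarrow> simple_module A (N \<nu>)"
    and "\<nu> \<in> I \<Longrightarrow> \<nu>' \<in> I \<Longrightarrow> isomorphic A (N \<nu>) (N \<nu>') \<Longrightarrow> \<nu> = \<nu>'"
  using assms by (auto simp: complete_simples_def)

lemma complete_simples_covers:
  fixes A :: "(complex, 'a) module" and S :: "('a, 'a set) module"
  assumes "complete_simples A I N" "simple_module A S"
  shows "\<exists>\<nu>\<in>I. isomorphic A S (N \<nu>)"
  using assms by (simp add: complete_simples_def)

text \<open>
  If \<open>J\<close> is the annihilator of all simple modules and \<open>e \<in> J\<close> is a right identity of \<open>J\<close>, then a
  maximal left ideal containing the annihilator of \<open>e\<close> contains both \<open>\<one> - e\<close> and \<open>e\<close>.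
\<close>

lemma complete_simples_faithful:
  fixes A (structure)
  assumes A: "complex_algebra A" and ss: "left_ideals_idempotent A" and cs: "complete_simples A I N"
    and a: "a \<in> carrier A" "\<And>\<nu> x. \<nu> \<in> I \<Longrightarrow> x \<in> carrier (N \<nu>) \<Longrightarrow> a \<odot>\<^bsub>N \<nu>\<^esub> x = \<zero>\<^bsub>N \<nu>\<^esub>"
  shows "a = \<zero>"
proof (rule ccontr)
  interpret A: ring A by (rule complex_algebra_ring[OF A])
  assume "a \<noteq> \<zero>"
  have N: "alg_module A (N \<nu>)" if "\<nu> \<in> I" for \<nu>
    using simple_alg_module[OF A complete_simplesD(1)[OF cs that]] .
  interpret Reg: alg_module A "regular_module A" by (rule alg_module_regular[OF A])
  define J where "J = {b \<in> carrier A. \<forall>\<nu>\<in>I. \<forall>x\<in>carrier (N \<nu>). b \<odot>\<^bsub>N \<nu>\<^esub> x = \<zero>\<^bsub>N \<nu>\<^esub>}"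
  have "left_ideal A J" unfolding left_ideal_def
  proof (intro conjI ballI)
    show "\<zero> \<in> J" using alg_module.zero_smult[OF N] by (auto simp: J_def)
    fix b assume b: "b \<in> J"
    show "b \<oplus> c \<in> J" if "c \<in> J" for c
    proof -
      have "(b \<oplus> c) \<odot>\<^bsub>N \<nu>\<^esub> x = \<zero>\<^bsub>N \<nu>\<^esub>" if "\<nu> \<in> I" "x \<in> carrier (N \<nu>)" for \<nu> x
      proof -
        interpret N: alg_module A "N \<nu>" by (rule N[OF that(1)])
        show ?thesis using b \<open>c \<in> J\<close> that by (simp add: J_def N.Mod.smult_l_distr)
      qed
      then show ?thesis using b \<open>c \<in> J\<close> by (auto simp: J_def)
    qed
    show "c \<otimes> b \<in> J" if "c \<in> carrier A" for c
    proof -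
      have "(c \<otimes> b) \<odot>\<^bsub>N \<nu>\<^esub> x = \<zero>\<^bsub>N \<nu>\<^esub>" if "\<nu> \<in> I" "x \<in> carrier (N \<nu>)" for \<nu> x
      proof -
        interpret N: alg_module A "N \<nu>" by (rule N[OF that(1)])
        show ?thesis using b \<open>c \<in> carrier A\<close> that by (simp add: J_def N.Mod.smult_assoc)
      qed
      then show ?thesis using b \<open>c \<in> carrier A\<close> by (auto simp: J_def)
    qed
  qed (auto simp: J_def)
  then obtain e where e: "e \<in> J" "\<And>b. b \<in> J \<Longrightarrow> b \<otimes> e = b"
    using ss unfolding left_ideals_idempotent_def by blast
  have ec: "e \<in> carrier A" using e(1) by (simp add: J_def)
  have "a \<in> J" using a by (simp add: J_def)
  define K where "K = {b \<in> carrier A. b \<odot>\<^bsub>regular_module A\<^esub> e = \<zero>\<^bsub>regular_module A\<^esub>}"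
  have "left_ideal A (carrier A)" by (auto simp: left_ideal_def)
  then have K: "left_ideal A K"
    using Reg.left_ideal_annihilator[of "carrier A" e] ec by (simp add: K_def)
  \<comment> \<open>Otherwise e would be zero, and so would a = a e.\<close>
  have "\<one> \<notin> K"
  proof
    assume "\<one> \<in> K"
    then have "e = \<zero>" using ec by (simp add: K_def)
    then show False using e(2)[OF \<open>a \<in> J\<close>] a(1) \<open>a \<noteq> \<zero>\<close> by simp
  qed
  then obtain P where P: "left_ideal A P" "K \<subseteq> P" "\<one> \<notin> P"
    "\<And>P'. left_ideal A P' \<Longrightarrow> P \<subseteq> P' \<Longrightarrow> \<one> \<notin> P' \<Longrightarrow> P' = P"
    using exists_maximal_left_ideal[OF K] by metis
  interpret Q: quotient_by_left_ideal A P using P(1) by unfold_locales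
  have "simple_module A (quotient_module A P)" using Q.simple_quotient[OF A] P(3,4) by blast
  then obtain \<nu> f where \<nu>: "\<nu> \<in> I" "f \<in> module_iso A (quotient_module A P) (N \<nu>)"
    using complete_simples_covers[OF cs, of "quotient_module A P"] unfolding isomorphic_def by blast
  interpret N: alg_module A "N \<nu>" by (rule N[OF \<nu>(1)])
  interpret QM: alg_module A "quotient_module A P" 
    using A Q.left_module_quotient by (simp add: alg_module_def)
  have f: "f \<in> module_hom A (quotient_module A P) (N \<nu>)"
    and inj: "inj_on f (carrier (quotient_module A P))"
    using \<nu>(2) by (auto simp: module_iso_def bij_betw_def)
  have "f (coset_of A P e) = f (e \<odot>\<^bsub>quotient_module A P\<^esub> coset_of A P \<one>)"
    using ec by (simp add: Q.quotient_smult)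
  also have "\<dots> = e \<odot>\<^bsub>N \<nu>\<^esub> f (coset_of A P \<one>)"
    by (rule module_homD(3)[OF f ec]) (simp add: Q.quotient_carrier)
  also have "\<dots> = \<zero>\<^bsub>N \<nu>\<^esub>"
    using e(1) \<nu>(1) module_homD(1)[OF f, of "coset_of A P \<one>"] by (simp add: J_def Q.quotient_carrier)
  also have "\<dots> = f \<zero>\<^bsub>quotient_module A P\<^esub>"
    using additive_map_zero[OF QM.ab_group N.ab_group module_hom_additive[OF f]] by simp
  finally have "coset_of A P e = \<zero>\<^bsub>quotient_module A P\<^esub>"
    using inj ec by (auto simp: inj_on_def Q.quotient_carrier Q.quotient_zero)
  then have "e \<in> P" using Q.coset_of_eq_iff[of e \<zero>] ec by (simp add: Q.quotient_zero a_minus_def)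
  have "(\<one> \<ominus> e) \<otimes> e = \<zero>"
    using ec e(2)[OF e(1)] by (simp add: a_minus_def A.l_distr A.l_minus A.r_neg)
  then have "\<one> \<ominus> e \<in> P" using P(2) ec by (auto simp: K_def)
  then have "(\<one> \<ominus> e) \<oplus> e \<in> P" using left_idealD(3)[OF P(1)] \<open>e \<in> P\<close> by blast
  moreover have "(\<one> \<ominus> e) \<oplus> e = \<one>" using ec by (simp add: a_minus_def A.a_assoc A.l_neg)
  ultimately show False using P(3) by simp
qed

text \<open>If there were more pairwise nonisomorphic simple modules than the dimension of
  \<open>A\<close>, density would give as many elements e \<nu>, each acting as the identity on N
  \<nu> and as zero on the other chosen modules. In a linear relation between them, applied to a
  nonzero vector of N \<nu>, only the coefficient at \<nu> survives.\<close>

lemma complete_simples_finite: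
  fixes A (structure)
  assumes A: "complex_algebra A" and fd: "fin_dim A (regular_module A)" and cs: "complete_simples A I N"
  shows "finite I"
proof (rule ccontr)
  interpret A: ring A by (rule complex_algebra_ring[OF A])
  interpret Alg: complex_algebra A by (rule A)
  assume inf: "infinite I"
  interpret Reg: alg_module A "regular_module A" by (rule alg_module_regular[OF A])
  obtain E \<eta> where E: "dual_basis A (regular_module A) E \<eta>" using Reg.exists_dual_basis[OF fd] by metis
  note ED = dual_basisD[OF E]
  have N: "alg_module A (N \<nu>)" if "\<nu> \<in> I" for \<nu>
    using simple_alg_module[OF A complete_simplesD(1)[OF cs that]] .
  obtain K where K: "K \<subseteq> I" "finite K" "card K = Suc (card E)"
    using infinite_arbitrarily_large[OF inf] by metis
  have "\<exists>e\<in>carrier A. (\<forall>x\<in>carrier (N \<nu>). e \<odot>\<^bsub>N \<nu>\<^esub> x = x) \<and>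
      (\<forall>\<nu>'\<in>K - {\<nu>}. \<forall>x\<in>carrier (N \<nu>'). e \<odot>\<^bsub>N \<nu>'\<^esub> x = \<zero>\<^bsub>N \<nu>'\<^esub>)" if \<nu>: "\<nu> \<in> K" for \<nu>
  proof -
    have \<nu>I: "\<nu> \<in> I" using \<nu> K by auto
    interpret N: alg_module A "N \<nu>" by (rule N[OF \<nu>I])
    obtain e where "e \<in> carrier A" "\<And>v. v \<in> carrier (N \<nu>) \<Longrightarrow> e \<odot>\<^bsub>N \<nu>\<^esub> v = id v"
      "\<And>j w. j \<in> K - {\<nu>} \<Longrightarrow> w \<in> carrier (N j) \<Longrightarrow> e \<odot>\<^bsub>N j\<^esub> w = \<zero>\<^bsub>N j\<^esub>"
    proof (rule N.density_separating[of id "K - {\<nu>}" N])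
      show "simple_module A (N \<nu>)" by (rule complete_simplesD(1)[OF cs \<nu>I])
      then show "fin_dim A (N \<nu>)" by (rule N.simple_fin_dim[OF fd])
      show "linear_map A (N \<nu>) A (N \<nu>) id" by (auto simp: linear_map_def additive_map_def)
      fix j assume j: "j \<in> K - {\<nu>}"
      then have "j \<in> I" using K by auto
      then show "simple_module A (N j) \<and> fin_dim A (N j) \<and> \<not> isomorphic A (N j) (N \<nu>)"
        using complete_simplesD[OF cs] alg_module.simple_fin_dim[OF N fd] \<nu>I j by blast
    qed (use K in auto)
    then show ?thesis by (intro bexI[of _ e]) auto
  qed
  then obtain e where e: "\<And>\<nu>. \<nu> \<in> K \<Longrightarrow> e \<nu> \<in> carrier A \<and> (\<forall>x\<in>carrier (N \<nu>). e \<nu> \<odot>\<^bsub>N \<nu>\<^esub> x = x) \<and>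
      (\<forall>\<nu>'\<in>K - {\<nu>}. \<forall>x\<in>carrier (N \<nu>'). e \<nu> \<odot>\<^bsub>N \<nu>'\<^esub> x = \<zero>\<^bsub>N \<nu>'\<^esub>)"
    by metis
  obtain c where c: "\<exists>\<nu>\<in>K. c \<nu> \<noteq> 0" "\<forall>b\<in>E. (\<Sum>\<nu>\<in>K. c \<nu> * \<eta> b (e \<nu>)) = 0"
    using homogeneous_system[OF ED(1) K(2), of "\<lambda>\<nu> b. \<eta> b (e \<nu>)"] K(3) by auto
  define s where "s = (\<Oplus>\<nu>\<in>K. c \<nu> \<odot> e \<nu>)"
  have cl: "(\<lambda>\<nu>. c \<nu> \<odot> e \<nu>) \<in> K \<rightarrow> carrier A" using e by auto
  have sc: "s \<in> carrier A" unfolding s_def by (rule A.finsum_closed[OF cl])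
  have "\<eta> b s = 0" if b: "b \<in> E" for b
  proof -
    have "\<eta> b s = (\<Sum>\<nu>\<in>K. \<eta> b (c \<nu> \<odot> e \<nu>))"
      using Reg.linear_form_finsum[OF ED(3)[OF b], of "\<lambda>\<nu>. c \<nu> \<odot> e \<nu>" K] cl by (simp add: s_def)
    also have "\<dots> = (\<Sum>\<nu>\<in>K. c \<nu> * \<eta> b (e \<nu>))"
      using linear_formD(2)[OF ED(3)[OF b]] e by (intro sum.cong) (auto simp flip: Alg.cscale_regular)
    finally show ?thesis using c(2) b by simp
  qed
  then have "s = \<zero>"
  proof -
    assume z: "\<And>b. b \<in> E \<Longrightarrow> \<eta> b s = 0"
    have "s = (\<Oplus>b\<in>E. cscale A (regular_module A) (\<eta> b s) b)" using ED(5)[of s] sc by simp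
    also have "\<dots> = (\<Oplus>b\<in>E. \<zero>)"
      using z ED(2) Reg.sc_zero_left by (intro A.finsum_cong') auto
    finally show ?thesis using A.finsum_zero[of E] by simp
  qed
  obtain \<nu> where \<nu>: "\<nu> \<in> K" "c \<nu> \<noteq> 0" using c(1) by blast
  have \<nu>I: "\<nu> \<in> I" using \<nu> K by auto
  interpret N: alg_module A "N \<nu>" by (rule N[OF \<nu>I])
  obtain x where x: "x \<in> carrier (N \<nu>)" "x \<noteq> \<zero>\<^bsub>N \<nu>\<^esub>"
    using N.simple_nonzero[OF complete_simplesD(1)[OF cs \<nu>I]] .
  have "\<zero>\<^bsub>N \<nu>\<^esub> = s \<odot>\<^bsub>N \<nu>\<^esub> x" using \<open>s = \<zero>\<close> x by simp
  also have "\<dots> = (\<Oplus>\<^bsub>N \<nu>\<^esub>\<nu>'\<in>K. (c \<nu>' \<odot> e \<nu>') \<odot>\<^bsub>N \<nu>\<^esub> x)"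
    unfolding s_def by (rule N.finsum_smult[OF x(1) cl])
  also have "\<dots> = cscale A (N \<nu>) (c \<nu>) x"
    using e \<nu>(1) x by (intro abelian_finsum_delta[OF N.ab_group K(2) \<nu>(1)]) (auto simp: N.smult_sc_left)
  finally show False using N.sc_eq_zero[OF x(1)] \<nu>(2) x(2) by metis
qed

subsection \<open>Duality\<close>

text \<open>An axiomatic version of \<open>dual_module\<close>, with the action pulled back along a
  map \<iota>. It keeps the theory of duals free of factor sets;
  \<open>dual_along_dual_module\<close> supplies the instance.\<close>

definition dual_along ::
  "(complex, 'c) module \<Rightarrow> (complex, 'a) module \<Rightarrow> ('c \<Rightarrow> 'a) \<Rightarrow> ('a, 'n) module \<Rightarrow>
    ('c, 'n \<Rightarrow> complex) module \<Rightarrow> bool"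
  where "dual_along C A \<iota> N D \<longleftrightarrow>
    carrier D = {\<psi> \<in> extensional (carrier N). linear_form A N \<psi>} \<and>
    \<zero>\<^bsub>D\<^esub> = (\<lambda>x\<in>carrier N. 0) \<and>
    (\<forall>\<psi> \<chi>. \<psi> \<oplus>\<^bsub>D\<^esub> \<chi> = (\<lambda>x\<in>carrier N. \<psi> x + \<chi> x)) \<and>
    (\<forall>a\<in>carrier C. \<forall>\<psi>\<in>carrier D. a \<odot>\<^bsub>D\<^esub> \<psi> = (\<lambda>x\<in>carrier N. \<psi> (\<iota> a \<odot>\<^bsub>N\<^esub> x)))"

locale anti_isomorphic_algebras =
  A: ring A + C: ring C + AlgA: complex_algebra A + AlgC: complex_algebra C
  for A :: "(complex, 'a) module" and C :: "(complex, 'c) module" +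
  fixes \<iota> :: "'c \<Rightarrow> 'a"
  assumes bij: "bij_betw \<iota> (carrier C) (carrier A)"
    and iota_add: "\<lbrakk>a \<in> carrier C; b \<in> carrier C\<rbrakk> \<Longrightarrow> \<iota> (a \<oplus>\<^bsub>C\<^esub> b) = \<iota> a \<oplus>\<^bsub>A\<^esub> \<iota> b"
    and iota_mult: "\<lbrakk>a \<in> carrier C; b \<in> carrier C\<rbrakk> \<Longrightarrow> \<iota> (a \<otimes>\<^bsub>C\<^esub> b) = \<iota> b \<otimes>\<^bsub>A\<^esub> \<iota> a"
    and iota_one: "\<iota> \<one>\<^bsub>C\<^esub> = \<one>\<^bsub>A\<^esub>"
begin

lemma iota_closed [simp]: "a \<in> carrier C \<Longrightarrow> \<iota> a \<in> carrier A"
  using bij by (auto simp: bij_betw_def)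

lemma iota_surj:
  assumes "b \<in> carrier A"
  obtains a where "a \<in> carrier C" "\<iota> a = b"
proof -
  have "b \<in> \<iota> ` carrier C" using bij assms by (simp add: bij_betw_def)
  then show thesis by (rule imageE) (use that in simp)
qed

lemma iota_zero: "\<iota> \<zero>\<^bsub>C\<^esub> = \<zero>\<^bsub>A\<^esub>"
  by (rule additive_map_zero[OF C.is_abelian_group A.is_abelian_group])
    (auto simp: additive_map_def iota_add)

lemma iota_eq_zero: "a \<in> carrier C \<Longrightarrow> \<iota> a = \<zero>\<^bsub>A\<^esub> \<Longrightarrow> a = \<zero>\<^bsub>C\<^esub>"
  using bij iota_zero by (auto simp: bij_betw_def inj_on_def)

end

locale dual_pair = anti_isomorphic_algebras A C \<iota> + N: alg_module A N
  for A :: "(complex, 'a) module" and C :: "(complex, 'c) module" and \<iota>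
    and N :: "('a, 'n) module" +
  fixes D :: "('c, 'n \<Rightarrow> complex) module"
  assumes dual: "dual_along C A \<iota> N D"
begin

lemma D_carrier: "carrier D = {\<psi> \<in> extensional (carrier N). linear_form A N \<psi>}"
  and D_zero: "\<zero>\<^bsub>D\<^esub> = (\<lambda>x\<in>carrier N. 0)"
  and D_add: "\<psi> \<oplus>\<^bsub>D\<^esub> \<chi> = (\<lambda>x\<in>carrier N. \<psi> x + \<chi> x)"
  and D_smult: "a \<in> carrier C \<Longrightarrow> \<psi> \<in> carrier D \<Longrightarrow>
      a \<odot>\<^bsub>D\<^esub> \<psi> = (\<lambda>x\<in>carrier N. \<psi> (\<iota> a \<odot>\<^bsub>N\<^esub> x))"
  using dual by (auto simp: dual_along_def)

lemma D_form: "\<psi> \<in> carrier D \<Longrightarrow> linear_form A N \<psi>"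
  and D_ext: "\<psi> \<in> carrier D \<Longrightarrow> \<psi> \<in> extensional (carrier N)"
  by (auto simp: D_carrier)

lemma D_restrict: "linear_form A N \<psi> \<Longrightarrow> restrict \<psi> (carrier N) \<in> carrier D"
  by (auto simp: D_carrier linear_form_def)

lemma D_eqI:
  assumes "\<psi> \<in> carrier D" "\<chi> \<in> carrier D" "\<And>x. x \<in> carrier N \<Longrightarrow> \<psi> x = \<chi> x"
  shows "\<psi> = \<chi>"
  using assms by (intro extensionalityI[of \<psi> "carrier N"]) (auto dest: D_ext)

lemma D_add_closed: "\<psi> \<in> carrier D \<Longrightarrow> \<chi> \<in> carrier D \<Longrightarrow> \<psi> \<oplus>\<^bsub>D\<^esub> \<chi> \<in> carrier D"
  unfolding D_add by (rule D_restrict) (auto simp: linear_form_def linear_formD[OF D_form] algebra_simps)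

lemma D_zero_closed: "\<zero>\<^bsub>D\<^esub> \<in> carrier D"
  unfolding D_zero by (rule D_restrict) (auto simp: linear_form_def)

lemma D_smult_closed: "a \<in> carrier C \<Longrightarrow> \<psi> \<in> carrier D \<Longrightarrow> a \<odot>\<^bsub>D\<^esub> \<psi> \<in> carrier D"
  unfolding D_smult by (intro D_restrict N.linear_form_smult D_form iota_closed)

lemma alg_module_dual: "alg_module C D"
proof -
  have "abelian_group D"
  proof (rule abelian_groupI)
    fix \<psi> assume \<psi>: "\<psi> \<in> carrier D"
    show "\<zero>\<^bsub>D\<^esub> \<oplus>\<^bsub>D\<^esub> \<psi> = \<psi>"
      by (rule D_eqI[OF D_add_closed[OF D_zero_closed \<psi>] \<psi>]) (simp add: D_zero D_add)
    have n: "(\<lambda>x\<in>carrier N. - \<psi> x) \<in> carrier D"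
      by (rule D_restrict) (auto simp: linear_form_def linear_formD[OF D_form[OF \<psi>]])
    have "(\<lambda>x\<in>carrier N. - \<psi> x) \<oplus>\<^bsub>D\<^esub> \<psi> = \<zero>\<^bsub>D\<^esub>"
      by (rule D_eqI[OF D_add_closed[OF n \<psi>] D_zero_closed]) (simp add: D_zero D_add)
    then show "\<exists>\<chi>\<in>carrier D. \<chi> \<oplus>\<^bsub>D\<^esub> \<psi> = \<zero>\<^bsub>D\<^esub>" using n by blast
  qed (auto simp: D_add_closed D_zero_closed, auto simp: D_add add_ac intro!: restrict_ext)
  moreover have "left_module_axioms C D"
    unfolding left_module_axioms_def
  proof (intro conjI allI impI)
    fix a \<psi> assume a: "a \<in> carrier C" and \<psi>: "\<psi> \<in> carrier D"
    note f = linear_formD[OF D_form[OF \<psi>]]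
    show "a \<odot>\<^bsub>D\<^esub> \<psi> \<in> carrier D" by (rule D_smult_closed[OF a \<psi>])
    { fix b assume b: "b \<in> carrier C"
      show "(a \<oplus>\<^bsub>C\<^esub> b) \<odot>\<^bsub>D\<^esub> \<psi> = a \<odot>\<^bsub>D\<^esub> \<psi> \<oplus>\<^bsub>D\<^esub> b \<odot>\<^bsub>D\<^esub> \<psi>"
        using a b \<psi> by (auto simp: D_smult D_add iota_add N.Mod.smult_l_distr f intro!: restrict_ext)
      show "(a \<otimes>\<^bsub>C\<^esub> b) \<odot>\<^bsub>D\<^esub> \<psi> = a \<odot>\<^bsub>D\<^esub> (b \<odot>\<^bsub>D\<^esub> \<psi>)"
        using D_smult[OF a D_smult_closed[OF b \<psi>]] a b \<psi>
        by (auto simp: D_smult[OF _ \<psi>] iota_mult N.Mod.smult_assoc intro!: restrict_ext) }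
    fix \<chi> assume \<chi>: "\<chi> \<in> carrier D"
    show "a \<odot>\<^bsub>D\<^esub> (\<psi> \<oplus>\<^bsub>D\<^esub> \<chi>) = a \<odot>\<^bsub>D\<^esub> \<psi> \<oplus>\<^bsub>D\<^esub> a \<odot>\<^bsub>D\<^esub> \<chi>"
      using D_smult[OF a D_add_closed[OF \<psi> \<chi>]] a
      by (auto simp: D_smult \<psi> \<chi> D_add intro!: restrict_ext)
  next
    fix \<psi> assume \<psi>: "\<psi> \<in> carrier D"
    show "\<one>\<^bsub>C\<^esub> \<odot>\<^bsub>D\<^esub> \<psi> = \<psi>"
      by (rule D_eqI[OF D_smult_closed[OF _ \<psi>] \<psi>]) (auto simp: D_smult \<psi> iota_one N.Mod.smult_one)
  qed
  ultimately show ?thesis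
    using AlgC.complex_algebra_axioms C.ring_axioms by (simp add: alg_module_def left_module_def)
qed

text \<open>
  A form \<open>\<psi>\<close> with \<open>\<psi> n = 1\<close> generates the dual, since by density every \<open>\<chi>\<close> is \<open>\<psi> \<circ> a\<close> for an
  \<open>a\<close> acting as \<open>x \<mapsto> \<chi>(x) n\<close>.
\<close>

lemma simple_dual:
  assumes sim: "simple_module A N" and fd: "fin_dim A N"
  shows "simple_module C D"
proof -
  interpret D: alg_module C D by (rule alg_module_dual)
  obtain x where x: "x \<in> carrier N" "x \<noteq> \<zero>\<^bsub>N\<^esub>" using N.simple_nonzero[OF sim] .
  obtain f where f: "linear_form A N f" "f x = 1" using N.exists_linear_form[OF x] by metis
  show ?thesis
  proof (rule D.simple_moduleI)
    show "restrict f (carrier N) \<in> carrier D" by (rule D_restrict[OF f(1)])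
    have "restrict f (carrier N) x \<noteq> \<zero>\<^bsub>D\<^esub> x" using x f(2) by (simp add: D_zero)
    then show "restrict f (carrier N) \<noteq> \<zero>\<^bsub>D\<^esub>" by metis
    fix \<psi> \<chi> assume \<psi>: "\<psi> \<in> carrier D" "\<psi> \<noteq> \<zero>\<^bsub>D\<^esub>" and \<chi>: "\<chi> \<in> carrier D"
    obtain m where m: "m \<in> carrier N" "\<psi> m \<noteq> 0"
      using D_eqI[OF \<psi>(1) D_zero_closed] \<psi>(2) by (auto simp: D_zero)
    have lin: "linear_map A N A N (\<lambda>x. cscale A N (\<chi> x / \<psi> m) m)"
      using m(1) linear_formD[OF D_form[OF \<chi>]]
      by (auto simp: linear_map_def additive_map_def add_divide_distrib N.sc_add_left N.sc_mult[symmetric])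
    obtain a where a: "a \<in> carrier A" "\<And>v. v \<in> carrier N \<Longrightarrow> a \<odot>\<^bsub>N\<^esub> v = cscale A N (\<chi> v / \<psi> m) m"
      using N.density[OF sim fd lin, of "{}"] by auto
    obtain c where c: "c \<in> carrier C" "\<iota> c = a" using iota_surj[OF a(1)] .
    have "c \<odot>\<^bsub>D\<^esub> \<psi> = \<chi>"
      by (rule D_eqI[OF D_smult_closed[OF c(1) \<psi>(1)] \<chi>])
        (use a m linear_formD(2)[OF D_form[OF \<psi>(1)]] in \<open>simp add: D_smult c \<psi>(1)\<close>)
    then show "\<exists>c\<in>carrier C. c \<odot>\<^bsub>D\<^esub> \<psi> = \<chi>" using c by blast
  qed
qed

text \<open>Linear forms separate the points of \<open>N\<close>. Through this equivalence questions
  about the duals are answered over \<open>A\<close>, without forming biduals.\<close>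

lemma annihilates_iff_dual:
  assumes c: "c \<in> carrier C"
  shows "(\<forall>\<psi>\<in>carrier D. c \<odot>\<^bsub>D\<^esub> \<psi> = \<zero>\<^bsub>D\<^esub>) \<longleftrightarrow> (\<forall>x\<in>carrier N. \<iota> c \<odot>\<^bsub>N\<^esub> x = \<zero>\<^bsub>N\<^esub>)"
proof
  assume L: "\<forall>\<psi>\<in>carrier D. c \<odot>\<^bsub>D\<^esub> \<psi> = \<zero>\<^bsub>D\<^esub>"
  show "\<forall>x\<in>carrier N. \<iota> c \<odot>\<^bsub>N\<^esub> x = \<zero>\<^bsub>N\<^esub>"
  proof (rule ballI, rule ccontr)
    fix x assume x: "x \<in> carrier N" "\<iota> c \<odot>\<^bsub>N\<^esub> x \<noteq> \<zero>\<^bsub>N\<^esub>"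
    have cl: "\<iota> c \<odot>\<^bsub>N\<^esub> x \<in> carrier N" using c x by simp
    obtain f where f: "linear_form A N f" "f (\<iota> c \<odot>\<^bsub>N\<^esub> x) = 1"
      using N.exists_linear_form[OF cl x(2)] by metis
    have "(c \<odot>\<^bsub>D\<^esub> restrict f (carrier N)) x = \<zero>\<^bsub>D\<^esub> x" using L D_restrict[OF f(1)] by simp
    then show False using f(2) x cl by (simp add: D_smult[OF c D_restrict[OF f(1)]] D_zero)
  qed
next
  assume "\<forall>x\<in>carrier N. \<iota> c \<odot>\<^bsub>N\<^esub> x = \<zero>\<^bsub>N\<^esub>"
  then show "\<forall>\<psi>\<in>carrier D. c \<odot>\<^bsub>D\<^esub> \<psi> = \<zero>\<^bsub>D\<^esub>"
    using N.linear_form_zero[OF D_form] by (auto simp: D_smult c D_zero intro!: restrict_ext)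
qed

end

section \<open>Duals of a complete family of simple modules\<close>

lemma hom_image_annihilated:
  assumes "alg_module A M" "alg_module A N" "f \<in> module_iso A M N" "a \<in> carrier A"
    and "\<And>x. x \<in> carrier M \<Longrightarrow> a \<odot>\<^bsub>M\<^esub> x = \<zero>\<^bsub>M\<^esub>" and y: "y \<in> carrier N"
  shows "a \<odot>\<^bsub>N\<^esub> y = \<zero>\<^bsub>N\<^esub>"
proof -
  interpret M: alg_module A M by fact
  interpret N: alg_module A N by fact
  have f: "f \<in> module_hom A M N" using assms(3) by (simp add: module_iso_def)
  have "y \<in> f ` carrier M" using assms(3) y by (simp add: module_iso_def bij_betw_def)
  then obtain x where x: "x \<in> carrier M" "y = f x" by (rule imageE)
  have "a \<odot>\<^bsub>N\<^esub> f x = f (a \<odot>\<^bsub>M\<^esub> x)" using module_homD(3)[OF f assms(4) x(1)] by simp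
  also have "\<dots> = f \<zero>\<^bsub>M\<^esub>" using assms(5)[OF x(1)] by simp
  also have "\<dots> = \<zero>\<^bsub>N\<^esub>" by (rule additive_map_zero[OF M.ab_group N.ab_group module_hom_additive[OF f]])
  finally show ?thesis using x(2) by simp
qed

lemma isomorphic_annihilated:
  assumes "alg_module A M" "alg_module A N" "isomorphic A M N" "a \<in> carrier A"
    and "\<And>x. x \<in> carrier M \<Longrightarrow> a \<odot>\<^bsub>M\<^esub> x = \<zero>\<^bsub>M\<^esub>" and "y \<in> carrier N"
  shows "a \<odot>\<^bsub>N\<^esub> y = \<zero>\<^bsub>N\<^esub>"
proof -
  obtain f where "f \<in> module_iso A M N" using assms(3) by (auto simp: isomorphic_def)
  then show ?thesis using hom_image_annihilated[of A M N f a y] assms by blast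
qed

context anti_isomorphic_algebras
begin

text \<open>Density decides both questions. If \<nu> and \<nu>' differ, an element of
  \<open>A\<close> that is the identity on N \<nu>' and zero on N \<nu> corresponds under \<iota> to
  one that annihilates D \<nu> but not D \<nu>'. If a simple \<open>S\<close> were isomorphic to no
  D \<nu>, some c would act as the identity on \<open>S\<close> and as zero on all D \<nu>; then
  \<iota> c annihilates every N \<nu>, so c is zero by faithfulness.\<close>

lemma complete_simples_dual:
  assumes cs: "complete_simples A I N" and ss: "left_ideals_idempotent A"
    and fdA: "fin_dim A (regular_module A)" and fdC: "fin_dim C (regular_module C)"
    and D: "\<And>\<nu>. \<nu> \<in> I \<Longrightarrow> dual_along C A \<iota> (N \<nu>) (D \<nu>)"
  shows "complete_simples C I D"
proof -
  have simN: "simple_module A (N \<nu>)" if "\<nu> \<in> I" for \<nu> by (rule complete_simplesD(1)[OF cs that])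
  have N: "alg_module A (N \<nu>)" if "\<nu> \<in> I" for \<nu>
    by (rule simple_alg_module[OF AlgA.complex_algebra_axioms simN[OF that]])
  have fdN: "fin_dim A (N \<nu>)" if "\<nu> \<in> I" for \<nu>
    by (rule alg_module.simple_fin_dim[OF N[OF that] fdA simN[OF that]])
  have dp: "dual_pair A C \<iota> (N \<nu>) (D \<nu>)" if "\<nu> \<in> I" for \<nu>
    using anti_isomorphic_algebras_axioms N[OF that] D[OF that]
    by (simp add: dual_pair_def dual_pair_axioms_def)
  have simD: "simple_module C (D \<nu>)" if "\<nu> \<in> I" for \<nu>
    by (rule dual_pair.simple_dual[OF dp[OF that] simN[OF that] fdN[OF that]])
  have algD: "alg_module C (D \<nu>)" if "\<nu> \<in> I" for \<nu> by (rule dual_pair.alg_module_dual[OF dp[OF that]])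
  have fdD: "fin_dim C (D \<nu>)" if "\<nu> \<in> I" for \<nu>
    by (rule alg_module.simple_fin_dim[OF algD[OF that] fdC simD[OF that]])
  have fin: "finite I" by (rule complete_simples_finite[OF AlgA.complex_algebra_axioms fdA cs])
  show ?thesis unfolding complete_simples_def
  proof (intro conjI ballI impI allI)
    fix \<nu> assume \<nu>: "\<nu> \<in> I"
    show "simple_module C (D \<nu>)" by (rule simD[OF \<nu>])
    fix \<nu>' assume \<nu>': "\<nu>' \<in> I" and iso: "isomorphic C (D \<nu>) (D \<nu>')"
    show "\<nu> = \<nu>'"
    proof (rule ccontr)
      assume ne: "\<nu> \<noteq> \<nu>'"
      interpret N: alg_module A "N \<nu>'" by (rule N[OF \<nu>'])
      obtain a where a: "a \<in> carrier A" "\<And>v. v \<in> carrier (N \<nu>') \<Longrightarrow> a \<odot>\<^bsub>N \<nu>'\<^esub> v = id v"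
        "\<And>j w. j \<in> {\<nu>} \<Longrightarrow> w \<in> carrier (N j) \<Longrightarrow> a \<odot>\<^bsub>N j\<^esub> w = \<zero>\<^bsub>N j\<^esub>"
      proof (rule N.density_separating[OF simN[OF \<nu>'] fdN[OF \<nu>'], of id "{\<nu>}" N])
        show "linear_map A (N \<nu>') A (N \<nu>') id" by (auto simp: linear_map_def additive_map_def)
        show "simple_module A (N j) \<and> fin_dim A (N j) \<and> \<not> isomorphic A (N j) (N \<nu>')" if "j \<in> {\<nu>}" for j
          using that simN fdN complete_simplesD(2)[OF cs \<nu> \<nu>'] \<nu> ne by auto
      qed auto
      obtain c where c: "c \<in> carrier C" "\<iota> c = a" using iota_surj[OF a(1)] .
      have "\<forall>\<psi>\<in>carrier (D \<nu>). c \<odot>\<^bsub>D \<nu>\<^esub> \<psi> = \<zero>\<^bsub>D \<nu>\<^esub>"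
        using dual_pair.annihilates_iff_dual[OF dp[OF \<nu>] c(1)] a(3) c(2) by simp
      then have "\<forall>\<psi>\<in>carrier (D \<nu>'). c \<odot>\<^bsub>D \<nu>'\<^esub> \<psi> = \<zero>\<^bsub>D \<nu>'\<^esub>"
        using isomorphic_annihilated[OF algD[OF \<nu>] algD[OF \<nu>'] iso c(1)] by blast
      then have "\<forall>x\<in>carrier (N \<nu>'). a \<odot>\<^bsub>N \<nu>'\<^esub> x = \<zero>\<^bsub>N \<nu>'\<^esub>"
        using dual_pair.annihilates_iff_dual[OF dp[OF \<nu>'] c(1)] c(2) by simp
      moreover obtain x where "x \<in> carrier (N \<nu>')" "x \<noteq> \<zero>\<^bsub>N \<nu>'\<^esub>"
        using N.simple_nonzero[OF simN[OF \<nu>']] .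
      ultimately show False using a(2) by simp
    qed
  next
    fix S :: "('c, 'c set) module" assume S: "simple_module C S"
    interpret S: alg_module C S by (rule simple_alg_module[OF AlgC.complex_algebra_axioms S])
    have fdS: "fin_dim C S" by (rule S.simple_fin_dim[OF fdC S])
    show "\<exists>\<nu>\<in>I. isomorphic C S (D \<nu>)"
    proof (rule ccontr)
      assume no: "\<not> ?thesis"
      obtain c where c: "c \<in> carrier C" "\<And>v. v \<in> carrier S \<Longrightarrow> c \<odot>\<^bsub>S\<^esub> v = id v"
        "\<And>j w. j \<in> I \<Longrightarrow> w \<in> carrier (D j) \<Longrightarrow> c \<odot>\<^bsub>D j\<^esub> w = \<zero>\<^bsub>D j\<^esub>"
      proof (rule S.density_separating[OF S fdS, of id I D])
        show "linear_map C S C S id" by (auto simp: linear_map_def additive_map_def)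
        show "simple_module C (D j) \<and> fin_dim C (D j) \<and> \<not> isomorphic C (D j) S" if "j \<in> I" for j
          using that simD fdD no isomorphic_sym[OF algD[OF that] S.alg_module_axioms] by blast
      qed (use fin in auto)
      have "\<iota> c = \<zero>\<^bsub>A\<^esub>"
      proof (rule complete_simples_faithful[OF AlgA.complex_algebra_axioms ss cs iota_closed[OF c(1)]])
        fix \<nu> x assume "\<nu> \<in> I" "x \<in> carrier (N \<nu>)"
        then show "\<iota> c \<odot>\<^bsub>N \<nu>\<^esub> x = \<zero>\<^bsub>N \<nu>\<^esub>"
          using dual_pair.annihilates_iff_dual[OF dp c(1)] c(3) by blast
      qed
      then have "c = \<zero>\<^bsub>C\<^esub>" by (rule iota_eq_zero[OF c(1)])
      obtain x where "x \<in> carrier S" "x \<noteq> \<zero>\<^bsub>S\<^esub>" using S.simple_nonzero[OF S] .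
      then show False using c(2)[of x] \<open>c = \<zero>\<^bsub>C\<^esub>\<close> by simp
    qed
  qed
qed

lemma dual_faithful:
  assumes cs: "complete_simples A I N" and ss: "left_ideals_idempotent A"
    and D: "\<And>\<nu>. \<nu> \<in> I \<Longrightarrow> dual_along C A \<iota> (N \<nu>) (D \<nu>)"
    and c: "c \<in> carrier C" "\<And>\<nu> \<psi>. \<nu> \<in> I \<Longrightarrow> \<psi> \<in> carrier (D \<nu>) \<Longrightarrow> c \<odot>\<^bsub>D \<nu>\<^esub> \<psi> = \<zero>\<^bsub>D \<nu>\<^esub>"
  shows "c = \<zero>\<^bsub>C\<^esub>"
proof (rule iota_eq_zero[OF c(1)])
  show "\<iota> c = \<zero>\<^bsub>A\<^esub>"
  proof (rule complete_simples_faithful[OF AlgA.complex_algebra_axioms ss cs iota_closed[OF c(1)]])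
    fix \<nu> x assume \<nu>: "\<nu> \<in> I" "x \<in> carrier (N \<nu>)"
    have "dual_pair A C \<iota> (N \<nu>) (D \<nu>)"
      using anti_isomorphic_algebras_axioms D[OF \<nu>(1)]
        simple_alg_module[OF AlgA.complex_algebra_axioms complete_simplesD(1)[OF cs \<nu>(1)]]
      by (simp add: dual_pair_def dual_pair_axioms_def)
    then show "\<iota> c \<odot>\<^bsub>N \<nu>\<^esub> x = \<zero>\<^bsub>N \<nu>\<^esub>"
      using dual_pair.annihilates_iff_dual[OF _ c(1)] c(2) \<nu> by blast
  qed
qed

end

subsection \<open>Twisted group algebras\<close>

text \<open>\<beta> is not normalized at \<one>, because the intertwiners are arbitrary; hence
  \<beta> \<one> \<one> has to be carried along in the unit and in the inverses of basis
  elements.\<close>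

locale twisted_group = group G for G :: "'g monoid" (structure) +
  fixes H :: "'g set" and \<beta> :: "'g \<Rightarrow> 'g \<Rightarrow> complex"
  assumes subgroup: "subgroup H G" and fin: "finite H"
    and nonzero: "\<lbrakk>g \<in> H; h \<in> H\<rbrakk> \<Longrightarrow> \<beta> g h \<noteq> 0"
    and cocycle: "\<lbrakk>g \<in> H; h \<in> H; k \<in> H\<rbrakk> \<Longrightarrow> \<beta> g h * \<beta> (g \<otimes> h) k = \<beta> g (h \<otimes> k) * \<beta> h k"
begin

abbreviation TA :: "(complex, 'g \<Rightarrow> complex) module"
  where "TA \<equiv> twisted_group_algebra G H \<beta>"

lemma H_closed [simp]: "g \<in> H \<Longrightarrow> h \<in> H \<Longrightarrow> g \<otimes> h \<in> H"
  and H_one [simp]: "\<one> \<in> H" and H_inv [simp]: "h \<in> H \<Longrightarrow> inv h \<in> H"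
  and H_carrier [simp]: "h \<in> H \<Longrightarrow> h \<in> carrier G"
  using subgroup by (auto simp: subgroup.m_closed subgroup.one_closed subgroup.m_inv_closed subgroup.mem_carrier)

text \<open>The cocycle identity at (\<one>, \<one>, h) equates \<beta> \<one> \<one> * \<beta>
  \<one> h with the square of \<beta> \<one> h, and a nonzero factor cancels. The next two rules
  come in the same way from (h, \<one>, \<one>) and (h, inv h, h).\<close>

lemma cocycle_one_left: "h \<in> H \<Longrightarrow> \<beta> \<one> h = \<beta> \<one> \<one>"
  using cocycle[of \<one> \<one> h] nonzero[of \<one> h] by simp

lemma cocycle_one_right: "h \<in> H \<Longrightarrow> \<beta> h \<one> = \<beta> \<one> \<one>"
  using cocycle[of h \<one> \<one>] nonzero[of h \<one>] by simp

lemma cocycle_inv: "h \<in> H \<Longrightarrow> \<beta> h (inv h) = \<beta> (inv h) h"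
  using cocycle[of h "inv h" h] cocycle_one_left[of h] cocycle_one_right[of h] nonzero[of \<one> \<one>]
  by simp

lemma TA_carrier: "carrier TA = {a. \<forall>x. x \<notin> H \<longrightarrow> a x = 0}"
  and TA_zero: "\<zero>\<^bsub>TA\<^esub> = (\<lambda>x. 0)"
  and TA_add: "a \<oplus>\<^bsub>TA\<^esub> b = (\<lambda>x. a x + b x)"
  and TA_smult: "c \<odot>\<^bsub>TA\<^esub> a = (\<lambda>x. c * a x)"
  and TA_one: "\<one>\<^bsub>TA\<^esub> = (\<lambda>x. if x = \<one> then inverse (\<beta> \<one> \<one>) else 0)"
  and TA_mult: "a \<otimes>\<^bsub>TA\<^esub> b = (\<lambda>x. \<Sum>g\<in>H. \<Sum>h\<in>H. if g \<otimes> h = x then \<beta> g h * a g * b h else 0)"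
  by (simp_all add: twisted_group_algebra_def)

lemma TA_mult_closed: "a \<otimes>\<^bsub>TA\<^esub> b \<in> carrier TA"
  by (auto simp: TA_carrier TA_mult intro!: sum.neutral)

text \<open>Elements are compared through sums with an arbitrary weight \<open>F\<close>. In this
  form products lose their inner condition g h = x, see \<open>pair_mult\<close>, and the ring laws
  become identities between multiple sums.\<close>

lemma TA_eqI:
  assumes "a \<in> carrier TA" "b \<in> carrier TA"
    and "\<And>F. (\<Sum>x\<in>H. F x * a x) = (\<Sum>x\<in>H. F x * b x)"
  shows "a = b"
proof
  fix x
  show "a x = b x"
  proof (cases "x \<in> H")
    case True
    then show ?thesis
      using assms(3)[of "\<lambda>y. if y = x then 1 else 0"] fin
      by (simp add: if_distrib[of "\<lambda>c. c * _"] cong: if_cong)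
  next
    case False
    then show ?thesis using assms(1,2) by (simp add: TA_carrier)
  qed
qed

lemma pair_mult:
  "(\<Sum>x\<in>H. F x * (a \<otimes>\<^bsub>TA\<^esub> b) x) = (\<Sum>g\<in>H. \<Sum>h\<in>H. F (g \<otimes> h) * \<beta> g h * a g * b h)"
proof -
  have "(\<Sum>x\<in>H. F x * (a \<otimes>\<^bsub>TA\<^esub> b) x)
      = (\<Sum>x\<in>H. \<Sum>g\<in>H. \<Sum>h\<in>H. if g \<otimes> h = x then F x * \<beta> g h * a g * b h else 0)"
    by (simp add: TA_mult sum_distrib_left mult.assoc if_distrib[of "\<lambda>c. _ * c"] cong: if_cong)
  also have "\<dots> = (\<Sum>g\<in>H. \<Sum>x\<in>H. \<Sum>h\<in>H. if g \<otimes> h = x then F x * \<beta> g h * a g * b h else 0)"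
    by (rule sum.swap)
  also have "\<dots> = (\<Sum>g\<in>H. \<Sum>h\<in>H. \<Sum>x\<in>H. if g \<otimes> h = x then F x * \<beta> g h * a g * b h else 0)"
    by (intro sum.cong refl sum.swap)
  also have "\<dots> = (\<Sum>g\<in>H. \<Sum>h\<in>H. F (g \<otimes> h) * \<beta> g h * a g * b h)"
    using fin by (intro sum.cong) auto
  finally show ?thesis .
qed

text \<open>After pairing with \<open>F\<close> both sides are triple sums over \<open>H\<close>,
  and the cocycle identity equates their coefficients.\<close>

lemma TA_assoc: "(a \<otimes>\<^bsub>TA\<^esub> b) \<otimes>\<^bsub>TA\<^esub> c = a \<otimes>\<^bsub>TA\<^esub> (b \<otimes>\<^bsub>TA\<^esub> c)"
proof (rule TA_eqI[OF TA_mult_closed TA_mult_closed])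
  fix F :: "'g \<Rightarrow> complex"
  have "(\<Sum>x\<in>H. F x * ((a \<otimes>\<^bsub>TA\<^esub> b) \<otimes>\<^bsub>TA\<^esub> c) x)
      = (\<Sum>k\<in>H. \<Sum>u\<in>H. (F (u \<otimes> k) * \<beta> u k * c k) * (a \<otimes>\<^bsub>TA\<^esub> b) u)"
    by (subst pair_mult, subst sum.swap) (simp add: mult.assoc mult.commute[of "c _"])
  also have "\<dots> = (\<Sum>k\<in>H. \<Sum>g\<in>H. \<Sum>h\<in>H. (F (g \<otimes> h \<otimes> k) * \<beta> (g \<otimes> h) k * c k) * \<beta> g h * a g * b h)"
    by (simp only: pair_mult)
  also have "\<dots> = (\<Sum>k\<in>H. \<Sum>g\<in>H. \<Sum>h\<in>H. (F (g \<otimes> (h \<otimes> k)) * \<beta> g (h \<otimes> k) * a g) * \<beta> h k * b h * c k)"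
  proof (intro sum.cong refl)
    fix k g h assume *: "k \<in> H" "g \<in> H" "h \<in> H"
    have "(F (g \<otimes> h \<otimes> k) * \<beta> (g \<otimes> h) k * c k) * \<beta> g h * a g * b h
        = F (g \<otimes> (h \<otimes> k)) * (\<beta> g h * \<beta> (g \<otimes> h) k) * a g * b h * c k"
      using * by (simp add: m_assoc ac_simps)
    then show "(F (g \<otimes> h \<otimes> k) * \<beta> (g \<otimes> h) k * c k) * \<beta> g h * a g * b h
        = (F (g \<otimes> (h \<otimes> k)) * \<beta> g (h \<otimes> k) * a g) * \<beta> h k * b h * c k"
      unfolding cocycle[OF *(2,3,1)] by (simp add: ac_simps)
  qed
  also have "\<dots> = (\<Sum>g\<in>H. \<Sum>h\<in>H. \<Sum>k\<in>H. (F (g \<otimes> (h \<otimes> k)) * \<beta> g (h \<otimes> k) * a g) * \<beta> h k * b h * c k)"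
    by (subst sum.swap) (intro sum.cong refl sum.swap)
  also have "\<dots> = (\<Sum>g\<in>H. \<Sum>v\<in>H. (F (g \<otimes> v) * \<beta> g v * a g) * (b \<otimes>\<^bsub>TA\<^esub> c) v)"
    by (simp only: pair_mult)
  also have "\<dots> = (\<Sum>x\<in>H. F x * (a \<otimes>\<^bsub>TA\<^esub> (b \<otimes>\<^bsub>TA\<^esub> c)) x)"
    by (rule pair_mult[symmetric])
  finally show "(\<Sum>x\<in>H. F x * ((a \<otimes>\<^bsub>TA\<^esub> b) \<otimes>\<^bsub>TA\<^esub> c) x) = (\<Sum>x\<in>H. F x * (a \<otimes>\<^bsub>TA\<^esub> (b \<otimes>\<^bsub>TA\<^esub> c)) x)" .
qed

lemma TA_one_closed: "\<one>\<^bsub>TA\<^esub> \<in> carrier TA"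
  by (auto simp: TA_carrier TA_one)

lemma TA_l_one:
  assumes "a \<in> carrier TA"
  shows "\<one>\<^bsub>TA\<^esub> \<otimes>\<^bsub>TA\<^esub> a = a"
proof (rule TA_eqI[OF TA_mult_closed assms])
  fix F :: "'g \<Rightarrow> complex"
  have "(\<Sum>x\<in>H. F x * (\<one>\<^bsub>TA\<^esub> \<otimes>\<^bsub>TA\<^esub> a) x)
      = (\<Sum>g\<in>H. if g = \<one> then (\<Sum>h\<in>H. F (g \<otimes> h) * \<beta> g h * inverse (\<beta> \<one> \<one>) * a h) else 0)"
    unfolding pair_mult TA_one by (intro sum.cong) auto
  also have "\<dots> = (\<Sum>h\<in>H. F (\<one> \<otimes> h) * \<beta> \<one> h * inverse (\<beta> \<one> \<one>) * a h)" using fin by simp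
  also have "\<dots> = (\<Sum>h\<in>H. F h * a h)"
  proof (rule sum.cong[OF refl])
    fix h assume "h \<in> H"
    then show "F (\<one> \<otimes> h) * \<beta> \<one> h * inverse (\<beta> \<one> \<one>) * a h = F h * a h"
      using nonzero[of \<one> \<one>] cocycle_one_left[of h] by simp
  qed
  finally show "(\<Sum>x\<in>H. F x * (\<one>\<^bsub>TA\<^esub> \<otimes>\<^bsub>TA\<^esub> a) x) = (\<Sum>h\<in>H. F h * a h)" .
qed

lemma TA_r_one:
  assumes "a \<in> carrier TA"
  shows "a \<otimes>\<^bsub>TA\<^esub> \<one>\<^bsub>TA\<^esub> = a"
proof (rule TA_eqI[OF TA_mult_closed assms])
  fix F :: "'g \<Rightarrow> complex"
  have "(\<Sum>x\<in>H. F x * (a \<otimes>\<^bsub>TA\<^esub> \<one>\<^bsub>TA\<^esub>) x)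
      = (\<Sum>g\<in>H. \<Sum>h\<in>H. if h = \<one> then F (g \<otimes> h) * \<beta> g h * a g * inverse (\<beta> \<one> \<one>) else 0)"
    unfolding pair_mult TA_one by (intro sum.cong) auto
  also have "\<dots> = (\<Sum>g\<in>H. F (g \<otimes> \<one>) * \<beta> g \<one> * a g * inverse (\<beta> \<one> \<one>))" using fin by simp
  also have "\<dots> = (\<Sum>h\<in>H. F h * a h)"
  proof (rule sum.cong[OF refl])
    fix h assume "h \<in> H"
    then show "F (h \<otimes> \<one>) * \<beta> h \<one> * a h * inverse (\<beta> \<one> \<one>) = F h * a h"
      using nonzero[of \<one> \<one>] cocycle_one_right[of h] by simp
  qed
  finally show "(\<Sum>x\<in>H. F x * (a \<otimes>\<^bsub>TA\<^esub> \<one>\<^bsub>TA\<^esub>) x) = (\<Sum>h\<in>H. F h * a h)" .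
qed

lemma TA_abelian_group: "abelian_group TA"
proof (rule abelian_groupI)
  fix a assume a: "a \<in> carrier TA"
  show "\<exists>b\<in>carrier TA. b \<oplus>\<^bsub>TA\<^esub> a = \<zero>\<^bsub>TA\<^esub>"
    using a by (intro bexI[of _ "\<lambda>x. - a x"]) (auto simp: TA_add TA_zero TA_carrier)
qed (auto simp: TA_add TA_zero TA_carrier add_ac)

lemma TA_ring: "ring TA"
proof (rule ringI[OF TA_abelian_group])
  show "monoid TA" by (rule monoidI) (auto simp: TA_mult_closed TA_one_closed TA_assoc TA_l_one TA_r_one)
  fix a b c assume abc: "a \<in> carrier TA" "b \<in> carrier TA" "c \<in> carrier TA"
  show "(a \<oplus>\<^bsub>TA\<^esub> b) \<otimes>\<^bsub>TA\<^esub> c = a \<otimes>\<^bsub>TA\<^esub> c \<oplus>\<^bsub>TA\<^esub> b \<otimes>\<^bsub>TA\<^esub> c"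
  proof (rule TA_eqI[OF TA_mult_closed abelian_groupE(1)[OF TA_abelian_group TA_mult_closed TA_mult_closed]])
  qed (simp add: pair_mult TA_add distrib_left distrib_right sum.distrib)
  show "c \<otimes>\<^bsub>TA\<^esub> (a \<oplus>\<^bsub>TA\<^esub> b) = c \<otimes>\<^bsub>TA\<^esub> a \<oplus>\<^bsub>TA\<^esub> c \<otimes>\<^bsub>TA\<^esub> b"
  proof (rule TA_eqI[OF TA_mult_closed abelian_groupE(1)[OF TA_abelian_group TA_mult_closed TA_mult_closed]])
  qed (simp add: pair_mult TA_add distrib_left distrib_right sum.distrib)
qed

lemma TA_algebra: "complex_algebra TA"
proof -
  have "module complex_field TA"
    by (rule moduleI[OF cring_from_type_algebra TA_abelian_group])
      (auto simp: TA_carrier TA_smult TA_add algebra_simps)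
  moreover have "complex_algebra_axioms TA"
    unfolding complex_algebra_axioms_def TA_mult TA_smult
    by (auto simp: sum_distrib_left mult.left_commute mult.assoc if_distrib[of "\<lambda>z. _ * z"] cong: if_cong)
  ultimately show ?thesis using TA_ring by (simp add: complex_algebra_def)
qed

section \<open>Basis elements and their inverses\<close>

lemma basis_closed [simp]: "h \<in> H \<Longrightarrow> basis_element h \<in> carrier TA"
  by (auto simp: TA_carrier basis_element_def)

lemma basis_mult:
  assumes "g \<in> H" "h \<in> H"
  shows "basis_element g \<otimes>\<^bsub>TA\<^esub> basis_element h = \<beta> g h \<odot>\<^bsub>TA\<^esub> basis_element (g \<otimes> h)"
proof -
  interpret A: complex_algebra TA by (rule TA_algebra)
  have cl: "\<beta> g h \<odot>\<^bsub>TA\<^esub> basis_element (g \<otimes> h) \<in> carrier TA" using assms by simp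
  show ?thesis
  proof (rule TA_eqI[OF TA_mult_closed cl])
    fix F :: "'g \<Rightarrow> complex"
    have "(\<Sum>x\<in>H. F x * (basis_element g \<otimes>\<^bsub>TA\<^esub> basis_element h) x)
        = (\<Sum>g'\<in>H. if g' = g then (\<Sum>h'\<in>H. if h' = h then F (g' \<otimes> h') * \<beta> g' h' else 0) else 0)"
      unfolding pair_mult by (intro sum.cong) (auto simp: basis_element_def intro!: sum.cong)
    also have "\<dots> = F (g \<otimes> h) * \<beta> g h" using fin assms by simp
    also have "\<dots> = (\<Sum>x\<in>H. if x = g \<otimes> h then F x * \<beta> g h else 0)" using fin assms by simp
    also have "\<dots> = (\<Sum>x\<in>H. F x * (\<beta> g h \<odot>\<^bsub>TA\<^esub> basis_element (g \<otimes> h)) x)"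
      by (intro sum.cong) (auto simp: TA_smult basis_element_def)
    finally show "(\<Sum>x\<in>H. F x * (basis_element g \<otimes>\<^bsub>TA\<^esub> basis_element h) x)
        = (\<Sum>x\<in>H. F x * (\<beta> g h \<odot>\<^bsub>TA\<^esub> basis_element (g \<otimes> h)) x)" .
  qed
qed

lemma TA_one_basis: "\<one>\<^bsub>TA\<^esub> = inverse (\<beta> \<one> \<one>) \<odot>\<^bsub>TA\<^esub> basis_element \<one>"
  by (auto simp: TA_one TA_smult basis_element_def)

text \<open>The product of the basis elements at inv h and h is \<beta> (inv h) h times the one at
  \<one>, which in turn is \<beta> \<one> \<one> times the unit. Dividing by both constants gives
  the inverse.\<close>

definition basis_inv :: "'g \<Rightarrow> 'g \<Rightarrow> complex"
  where "basis_inv h = inverse (\<beta> (inv h) h * \<beta> \<one> \<one>) \<odot>\<^bsub>TA\<^esub> basis_element (inv h)"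

lemma basis_inv_closed [simp]: "h \<in> H \<Longrightarrow> basis_inv h \<in> carrier TA"
proof -
  assume h: "h \<in> H"
  interpret A: complex_algebra TA by (rule TA_algebra)
  show ?thesis unfolding basis_inv_def using h by simp
qed

lemma TA_smult_smult: "c \<odot>\<^bsub>TA\<^esub> (d \<odot>\<^bsub>TA\<^esub> a) = (c * d) \<odot>\<^bsub>TA\<^esub> a"
  by (simp add: TA_smult mult.assoc)

lemma basis_inv_left: "h \<in> H \<Longrightarrow> basis_inv h \<otimes>\<^bsub>TA\<^esub> basis_element h = \<one>\<^bsub>TA\<^esub>"
proof -
  assume h: "h \<in> H"
  interpret A: complex_algebra TA by (rule TA_algebra)
  have "inverse (\<beta> (inv h) h * \<beta> \<one> \<one>) * \<beta> (inv h) h = inverse (\<beta> \<one> \<one>)"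
    using h nonzero[of "inv h" h] nonzero[of \<one> \<one>] by (simp add: field_simps)
  then show ?thesis using h unfolding basis_inv_def
    by (subst A.smult_mult_left) (simp_all add: basis_mult TA_smult_smult TA_one_basis del: inverse_mult_distrib)
qed

lemma basis_inv_right: "h \<in> H \<Longrightarrow> basis_element h \<otimes>\<^bsub>TA\<^esub> basis_inv h = \<one>\<^bsub>TA\<^esub>"
proof -
  assume h: "h \<in> H"
  interpret A: complex_algebra TA by (rule TA_algebra)
  have "inverse (\<beta> (inv h) h * \<beta> \<one> \<one>) * \<beta> (inv h) h = inverse (\<beta> \<one> \<one>)"
    using h nonzero[of "inv h" h] nonzero[of \<one> \<one>] by (simp add: field_simps)
  then show ?thesis using h unfolding basis_inv_def
    by (subst A.smult_mult_right)
      (simp_all add: basis_mult TA_smult_smult TA_one_basis cocycle_inv del: inverse_mult_distrib)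
qed

lemma inv_basis: "h \<in> H \<Longrightarrow> inv\<^bsub>TA\<^esub> (basis_element h) = basis_inv h"
  using monoid.inv_char[OF ring.is_monoid[OF TA_ring], of "basis_element h" "basis_inv h"]
  by (simp add: basis_inv_left basis_inv_right)

text \<open>This is \<open>c\<^sub>g c\<^sub>h = \<beta>(g,h) c\<^sub>g\<^sub>h\<close> multiplied
  by inverses on both sides. It is what makes the averaged projection in Maschke's theorem
  equivariant.\<close>

lemma basis_inv_mult_basis:
  assumes g: "g \<in> H" and h: "h \<in> H"
  shows "basis_inv (g \<otimes> h) \<otimes>\<^bsub>TA\<^esub> basis_element g = \<beta> g h \<odot>\<^bsub>TA\<^esub> basis_inv h"
proof -
  interpret R: ring TA by (rule TA_ring)
  interpret A: complex_algebra TA by (rule TA_algebra)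
  have "basis_inv (g \<otimes> h) \<otimes>\<^bsub>TA\<^esub> basis_element g
      = (basis_inv (g \<otimes> h) \<otimes>\<^bsub>TA\<^esub> basis_element g) \<otimes>\<^bsub>TA\<^esub> (basis_element h \<otimes>\<^bsub>TA\<^esub> basis_inv h)"
    using g h by (simp add: basis_inv_right TA_r_one TA_mult_closed)
  also have "\<dots> = (basis_inv (g \<otimes> h) \<otimes>\<^bsub>TA\<^esub> (basis_element g \<otimes>\<^bsub>TA\<^esub> basis_element h)) \<otimes>\<^bsub>TA\<^esub> basis_inv h"
    by (simp add: TA_assoc)
  also have "\<dots> = (\<beta> g h \<odot>\<^bsub>TA\<^esub> \<one>\<^bsub>TA\<^esub>) \<otimes>\<^bsub>TA\<^esub> basis_inv h"
    using g h by (simp add: basis_mult A.smult_mult_right basis_inv_left)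
  also have "\<dots> = \<beta> g h \<odot>\<^bsub>TA\<^esub> basis_inv h"
    using g h by (simp add: A.smult_mult_left TA_one_closed TA_l_one)
  finally show ?thesis .
qed

lemma basis_inv_mult:
  assumes g: "g \<in> H" and h: "h \<in> H"
  shows "basis_inv (g \<otimes> h) = \<beta> g h \<odot>\<^bsub>TA\<^esub> (basis_inv h \<otimes>\<^bsub>TA\<^esub> basis_inv g)"
proof -
  interpret A: complex_algebra TA by (rule TA_algebra)
  have "basis_inv (g \<otimes> h) = basis_inv (g \<otimes> h) \<otimes>\<^bsub>TA\<^esub> (basis_element g \<otimes>\<^bsub>TA\<^esub> basis_inv g)"
    using g h by (simp add: basis_inv_right TA_r_one)
  also have "\<dots> = (\<beta> g h \<odot>\<^bsub>TA\<^esub> basis_inv h) \<otimes>\<^bsub>TA\<^esub> basis_inv g"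
    using g h by (simp add: basis_inv_mult_basis flip: TA_assoc)
  finally show ?thesis using g h by (simp add: A.smult_mult_left)
qed

section \<open>Dimension and semisimplicity of twisted group algebras\<close>

lemma TA_finsum:
  assumes "finite J" "\<And>j. j \<in> J \<Longrightarrow> f j \<in> carrier TA"
  shows "finsum TA f J = (\<lambda>x. \<Sum>j\<in>J. f j x)"
proof -
  interpret A: abelian_group TA by (rule TA_abelian_group)
  show ?thesis using assms
  proof (induction J rule: finite_induct)
    case (insert j J)
    then have "f \<in> J \<rightarrow> carrier TA" "f j \<in> carrier TA" by auto
    then show ?case using insert by (simp add: TA_add)
  qed (simp add: TA_zero)
qed

lemma TA_expansion:
  assumes "a \<in> carrier TA"
  shows "a = (\<Oplus>\<^bsub>TA\<^esub>h\<in>H. a h \<odot>\<^bsub>TA\<^esub> basis_element h)"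
proof -
  interpret A: complex_algebra TA by (rule TA_algebra)
  have "(\<Oplus>\<^bsub>TA\<^esub>h\<in>H. a h \<odot>\<^bsub>TA\<^esub> basis_element h) = (\<lambda>x. \<Sum>h\<in>H. (a h \<odot>\<^bsub>TA\<^esub> basis_element h) x)"
    using fin by (intro TA_finsum) auto
  also have "\<dots> = a"
  proof
    fix x
    have "(\<Sum>h\<in>H. (a h \<odot>\<^bsub>TA\<^esub> basis_element h) x) = (\<Sum>h\<in>H. if x = h then a h else 0)"
      by (intro sum.cong) (auto simp: TA_smult basis_element_def)
    then show "(\<Sum>h\<in>H. (a h \<odot>\<^bsub>TA\<^esub> basis_element h) x) = a x"
      using fin assms by (simp add: TA_carrier)
  qed
  finally show ?thesis by (rule sym)
qed

lemma TA_fin_dim: "fin_dim TA (regular_module TA)"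
proof -
  interpret Reg: alg_module TA "regular_module TA" by (rule alg_module_regular[OF TA_algebra])
  show ?thesis
  proof (rule Reg.fin_dimI[OF fin, of basis_element])
    fix y assume "y \<in> carrier (regular_module TA)"
    then have y: "y \<in> carrier TA" by simp
    have "(\<Oplus>\<^bsub>TA\<^esub>h\<in>H. y h \<odot>\<^bsub>TA\<^esub> basis_element h)
        = (\<Oplus>\<^bsub>TA\<^esub>h\<in>H. cscale TA (regular_module TA) (y h) (basis_element h))"
      by (rule abelian_monoid.finsum_cong'[OF abelian_group.axioms(1)[OF TA_abelian_group]])
        (use Reg.sc_closed in \<open>auto simp: complex_algebra.cscale_regular[OF TA_algebra]\<close>)
    then have "y = (\<Oplus>\<^bsub>regular_module TA\<^esub>h\<in>H. cscale TA (regular_module TA) (y h) (basis_element h))"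
      using TA_expansion[OF y] by simp
    then show "\<exists>c. y = (\<Oplus>\<^bsub>regular_module TA\<^esub>h\<in>H. cscale TA (regular_module TA) (c h) (basis_element h))"
      by (rule exI[where x = y])
  qed auto
qed

text \<open>
  Maschke: averaging a linear projection \<open>p\<close> onto a left ideal \<open>L\<close> gives
  \<open>p' a = 1/|H| * (\<Sum>h. c\<^sub>h p(c\<^sub>h\<^sup>-\<^sup>1 a))\<close>, and \<open>p' \<one>\<close> is a right identity of \<open>L\<close>.
\<close>

lemma TA_left_ideals_idempotent: "left_ideals_idempotent TA"
  unfolding left_ideals_idempotent_def
proof (intro allI impI)
  fix L assume L: "left_ideal TA L"
  note LD = left_idealD[OF L]
  interpret R: ring TA by (rule TA_ring)
  interpret A: complex_algebra TA by (rule TA_algebra)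
  interpret Reg: alg_module TA "regular_module TA" by (rule alg_module_regular[OF TA_algebra])
  have sc: "cscale TA (regular_module TA) c x = c \<odot>\<^bsub>TA\<^esub> x" if "x \<in> carrier TA" for c x
    by (rule A.cscale_regular[OF that])
  have L_smult: "c \<odot>\<^bsub>TA\<^esub> x \<in> L" if "x \<in> L" for c x
    using LD(4)[OF Reg.scalar_closed that, of c] A.smult_mult_left[of "\<one>\<^bsub>TA\<^esub>" x c] LD(1)[OF that] by simp
  have "Reg.subspace L"
    unfolding Reg.subspace_def using LD L_smult by (auto simp: sc)
  then obtain p where p: "linear_map TA (regular_module TA) TA (regular_module TA) p"
    "\<And>x. x \<in> carrier TA \<Longrightarrow> p x \<in> L" "\<And>u. u \<in> L \<Longrightarrow> p u = u"
    using Reg.exists_projection by (metis regular_module_simps(1))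
  have pc: "p x \<in> carrier TA" if "x \<in> carrier TA" for x using LD(1) p(2)[OF that] .
  \<comment> \<open>\<open>T\<close> is |H| times the averaged projection and \<open>E\<close> is
    its value at \<one>; the factor is divided out only in \<open>e\<close>.\<close>
  define E where "E = (\<Oplus>\<^bsub>TA\<^esub>h\<in>H. basis_element h \<otimes>\<^bsub>TA\<^esub> p (basis_inv h))"
  define T where "T a = (\<Oplus>\<^bsub>TA\<^esub>k\<in>H. basis_element k \<otimes>\<^bsub>TA\<^esub> p (basis_inv k \<otimes>\<^bsub>TA\<^esub> a))" for a
  have Ecl: "(\<lambda>h. basis_element h \<otimes>\<^bsub>TA\<^esub> p (basis_inv h)) \<in> H \<rightarrow> carrier TA"
    by (auto simp: TA_mult_closed)
  have "E \<in> L"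
  proof -
    have "finsum TA f J \<in> L" if "finite J" "\<And>j. j \<in> J \<Longrightarrow> f j \<in> L" for f and J :: "'g set"
      using that
    proof (induction J rule: finite_induct)
      case (insert j J)
      then have "f \<in> J \<rightarrow> carrier TA" "f j \<in> carrier TA" using LD(1) by auto
      then show ?case using insert LD(3) by simp
    qed (simp add: LD(2))
    then show ?thesis unfolding E_def using fin p(2) LD(4) by simp
  qed
  have Tcl: "(\<lambda>k. basis_element k \<otimes>\<^bsub>TA\<^esub> p (basis_inv k \<otimes>\<^bsub>TA\<^esub> a)) \<in> H \<rightarrow> carrier TA" for a
    by (auto simp: TA_mult_closed)
  have T_closed: "T a \<in> carrier TA" for a unfolding T_def by (rule R.finsum_closed[OF Tcl])
  have T_add: "T (a \<oplus>\<^bsub>TA\<^esub> b) = T a \<oplus>\<^bsub>TA\<^esub> T b" if "a \<in> carrier TA" "b \<in> carrier TA" for a b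
  proof -
    have "T (a \<oplus>\<^bsub>TA\<^esub> b) = (\<Oplus>\<^bsub>TA\<^esub>k\<in>H. basis_element k \<otimes>\<^bsub>TA\<^esub> p (basis_inv k \<otimes>\<^bsub>TA\<^esub> a)
        \<oplus>\<^bsub>TA\<^esub> basis_element k \<otimes>\<^bsub>TA\<^esub> p (basis_inv k \<otimes>\<^bsub>TA\<^esub> b))"
      unfolding T_def
      using that linear_mapD(2)[OF p(1)] pc by (intro R.finsum_cong') (auto simp: R.r_distr TA_mult_closed)
    then show ?thesis unfolding T_def using R.finsum_addf[OF Tcl Tcl] by simp
  qed
  have T_smult: "T (c \<odot>\<^bsub>TA\<^esub> a) = c \<odot>\<^bsub>TA\<^esub> T a" if "a \<in> carrier TA" for c a
  proof -
    have "c \<odot>\<^bsub>TA\<^esub> T a = (\<Oplus>\<^bsub>TA\<^esub>k\<in>H. c \<odot>\<^bsub>TA\<^esub> (basis_element k \<otimes>\<^bsub>TA\<^esub> p (basis_inv k \<otimes>\<^bsub>TA\<^esub> a)))"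
      unfolding T_def using A.finsum_smult_ldistr[OF fin _ Tcl, of c] by simp
    also have "\<dots> = T (c \<odot>\<^bsub>TA\<^esub> a)"
      unfolding T_def using that linear_mapD(3)[OF p(1)] pc
      by (intro R.finsum_cong') (auto simp: A.smult_mult_right TA_mult_closed sc)
    finally show ?thesis by (rule sym)
  qed
  \<comment> \<open>Equivariance of \<open>T\<close> at \<one>: substitute k = g h in the average.
    The factors \<beta> g h pass through the linear map \<open>p\<close> and are absorbed by
    \<open>basis_inv_mult_basis\<close>.\<close>
  have T_basis: "basis_element g \<otimes>\<^bsub>TA\<^esub> E = T (basis_element g)" if g: "g \<in> H" for g
  proof -
    have "basis_element g \<otimes>\<^bsub>TA\<^esub> E = (\<Oplus>\<^bsub>TA\<^esub>h\<in>H. basis_element g \<otimes>\<^bsub>TA\<^esub> (basis_element h \<otimes>\<^bsub>TA\<^esub> p (basis_inv h)))"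
      unfolding E_def using g Ecl by (intro R.finsum_rdistr[OF fin]) auto
    also have "\<dots> = (\<Oplus>\<^bsub>TA\<^esub>h\<in>H. basis_element (g \<otimes> h) \<otimes>\<^bsub>TA\<^esub> p (basis_inv (g \<otimes> h) \<otimes>\<^bsub>TA\<^esub> basis_element g))"
    proof (rule R.finsum_cong')
      fix h assume h: "h \<in> H"
      have "basis_element g \<otimes>\<^bsub>TA\<^esub> (basis_element h \<otimes>\<^bsub>TA\<^esub> p (basis_inv h))
          = \<beta> g h \<odot>\<^bsub>TA\<^esub> (basis_element (g \<otimes> h) \<otimes>\<^bsub>TA\<^esub> p (basis_inv h))"
        using g h pc by (simp add: basis_mult A.smult_mult_left flip: TA_assoc)
      also have "\<dots> = basis_element (g \<otimes> h) \<otimes>\<^bsub>TA\<^esub> p (\<beta> g h \<odot>\<^bsub>TA\<^esub> basis_inv h)"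
        using g h pc linear_mapD(3)[OF p(1), of "basis_inv h" "\<beta> g h"] by (simp add: A.smult_mult_right sc)
      finally show "basis_element g \<otimes>\<^bsub>TA\<^esub> (basis_element h \<otimes>\<^bsub>TA\<^esub> p (basis_inv h))
          = basis_element (g \<otimes> h) \<otimes>\<^bsub>TA\<^esub> p (basis_inv (g \<otimes> h) \<otimes>\<^bsub>TA\<^esub> basis_element g)"
        using g h by (simp add: basis_inv_mult_basis)
    qed (auto simp: TA_mult_closed)
    also have "\<dots> = (\<Oplus>\<^bsub>TA\<^esub>k\<in>(\<lambda>h. g \<otimes> h) ` H. basis_element k \<otimes>\<^bsub>TA\<^esub> p (basis_inv k \<otimes>\<^bsub>TA\<^esub> basis_element g))"
      using g by (intro R.finsum_reindex[symmetric]) (auto simp: TA_mult_closed inj_on_def)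
    also have "(\<lambda>h. g \<otimes> h) ` H = H"
    proof
      show "H \<subseteq> (\<lambda>h. g \<otimes> h) ` H"
      proof
        fix k assume "k \<in> H"
        then show "k \<in> (\<lambda>h. g \<otimes> h) ` H" using g
          by (intro image_eqI[of _ _ "inv g \<otimes> k"]) (simp_all add: m_assoc[symmetric])
      qed
    qed (use g in auto)
    finally show ?thesis unfolding T_def .
  qed
  have T_eq: "a \<otimes>\<^bsub>TA\<^esub> E = T a" if a: "a \<in> carrier TA" for a
  proof -
    have Ec: "E \<in> carrier TA" using \<open>E \<in> L\<close> by (rule LD(1))
    have add1: "additive_map TA TA (\<lambda>a. a \<otimes>\<^bsub>TA\<^esub> E)" using Ec by (auto simp: additive_map_def R.l_distr)
    have add2: "additive_map TA TA T" by (auto simp: additive_map_def T_closed T_add)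
    have cl: "(\<lambda>h. a h \<odot>\<^bsub>TA\<^esub> basis_element h) \<in> H \<rightarrow> carrier TA" by auto
    have "a \<otimes>\<^bsub>TA\<^esub> E = (\<Oplus>\<^bsub>TA\<^esub>h\<in>H. a h \<odot>\<^bsub>TA\<^esub> basis_element h) \<otimes>\<^bsub>TA\<^esub> E" using TA_expansion[OF a] by simp
    also have "\<dots> = (\<Oplus>\<^bsub>TA\<^esub>h\<in>H. (a h \<odot>\<^bsub>TA\<^esub> basis_element h) \<otimes>\<^bsub>TA\<^esub> E)"
      by (rule additive_map_finsum[OF R.is_abelian_group R.is_abelian_group add1 cl])
    also have "\<dots> = (\<Oplus>\<^bsub>TA\<^esub>h\<in>H. T (a h \<odot>\<^bsub>TA\<^esub> basis_element h))"
      using Ec T_basis by (intro R.finsum_cong') (auto simp: A.smult_mult_left T_smult T_closed)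
    also have "\<dots> = T (\<Oplus>\<^bsub>TA\<^esub>h\<in>H. a h \<odot>\<^bsub>TA\<^esub> basis_element h)"
      by (rule additive_map_finsum[OF R.is_abelian_group R.is_abelian_group add2 cl, symmetric])
    finally show ?thesis using TA_expansion[OF a] by simp
  qed
  define e where "e = inverse (of_nat (card H)) \<odot>\<^bsub>TA\<^esub> E"
  have "e \<in> L" unfolding e_def by (rule L_smult[OF \<open>E \<in> L\<close>])
  moreover have "a \<otimes>\<^bsub>TA\<^esub> e = a" if a: "a \<in> L" for a
  proof -
    note ac = LD(1)[OF a]
    have "H \<noteq> {}" using H_one by blast
    then have "card H \<noteq> 0" using fin by simp
    \<comment> \<open>For \<open>a\<close> in \<open>L\<close> all products with \<open>a\<close> on
      the right stay in \<open>L\<close>, where \<open>p\<close> is the identity, so each of the |H|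
      summands equals \<open>a\<close>.\<close>
    have "T a = (\<Oplus>\<^bsub>TA\<^esub>k\<in>H. a)" unfolding T_def
    proof (rule R.finsum_cong')
      fix k assume k: "k \<in> H"
      have "p (basis_inv k \<otimes>\<^bsub>TA\<^esub> a) = basis_inv k \<otimes>\<^bsub>TA\<^esub> a" using k a LD(4) p(3) by simp
      then show "basis_element k \<otimes>\<^bsub>TA\<^esub> p (basis_inv k \<otimes>\<^bsub>TA\<^esub> a) = a"
        using k ac by (simp add: basis_inv_right TA_l_one flip: TA_assoc)
    qed (use ac in auto)
    also have "\<dots> = of_nat (card H) \<odot>\<^bsub>TA\<^esub> a"
      using TA_finsum[OF fin, of "\<lambda>_. a"] ac by (simp add: TA_smult)
    finally have "a \<otimes>\<^bsub>TA\<^esub> E = of_nat (card H) \<odot>\<^bsub>TA\<^esub> a" using T_eq[OF ac] by simp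
    then show ?thesis unfolding e_def
      using A.smult_mult_right[OF ac LD(1)[OF \<open>E \<in> L\<close>]] \<open>card H \<noteq> 0\<close>
      by (simp add: TA_smult mult.assoc[symmetric])
  qed
  ultimately show "\<exists>e\<in>L. \<forall>a\<in>L. a \<otimes>\<^bsub>TA\<^esub> e = a" by blast
qed

end

subsection \<open>The twisted group algebra of the inverse cocycle\<close>

context twisted_group
begin

text \<open>The linear map with \<open>b\<^sub>h \<mapsto> c\<^sub>h\<^sup>-\<^sup>1\<close>, the algebra for \<open>\<beta>\<close> being spanned by the \<open>c\<^sub>h\<close>.\<close>

definition invert_basis :: "('g \<Rightarrow> complex) \<Rightarrow> 'g \<Rightarrow> complex"
  where "invert_basis a = (\<Oplus>\<^bsub>TA\<^esub>h\<in>H. a h \<odot>\<^bsub>TA\<^esub> basis_inv h)"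

lemma invert_basis_closed: "invert_basis a \<in> carrier TA"
proof -
  interpret R: ring TA by (rule TA_ring)
  interpret A: complex_algebra TA by (rule TA_algebra)
  show ?thesis unfolding invert_basis_def by (rule R.finsum_closed) auto
qed

lemma pair_invert_basis:
  "(\<Sum>x\<in>H. F x * invert_basis a x) = (\<Sum>h\<in>H. a h * F (inv h) * inverse (\<beta> (inv h) h * \<beta> \<one> \<one>))"
proof -
  interpret A: complex_algebra TA by (rule TA_algebra)
  have "(\<Sum>x\<in>H. F x * invert_basis a x) = (\<Sum>x\<in>H. \<Sum>h\<in>H. F x * (a h \<odot>\<^bsub>TA\<^esub> basis_inv h) x)"
    unfolding invert_basis_def by (subst TA_finsum[OF fin]) (auto simp: sum_distrib_left)
  also have "\<dots> = (\<Sum>h\<in>H. \<Sum>x\<in>H. F x * (a h \<odot>\<^bsub>TA\<^esub> basis_inv h) x)" by (rule sum.swap)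
  also have "\<dots> = (\<Sum>h\<in>H. a h * F (inv h) * inverse (\<beta> (inv h) h * \<beta> \<one> \<one>))"
  proof (rule sum.cong[OF refl])
    fix h assume h: "h \<in> H"
    have "(\<Sum>x\<in>H. F x * (a h \<odot>\<^bsub>TA\<^esub> basis_inv h) x)
        = (\<Sum>x\<in>H. if x = inv h then F x * a h * inverse (\<beta> (inv h) h * \<beta> \<one> \<one>) else 0)"
      by (intro sum.cong) (auto simp: basis_inv_def TA_smult basis_element_def)
    then show "(\<Sum>x\<in>H. F x * (a h \<odot>\<^bsub>TA\<^esub> basis_inv h) x) = a h * F (inv h) * inverse (\<beta> (inv h) h * \<beta> \<one> \<one>)"
      using fin h by simp
  qed
  finally show ?thesis .
qed

text \<open>Compare coefficients at inv (g h) in \<open>basis_inv_mult\<close> and divide by \<beta>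
  g h. The result is the scalar identity behind the antimultiplicativity of
  \<open>invert_basis\<close>.\<close>

lemma basis_inv_coeff:
  assumes g: "g \<in> H" and h: "h \<in> H"
  shows "inverse (\<beta> (inv (g \<otimes> h)) (g \<otimes> h) * \<beta> \<one> \<one>) * inverse (\<beta> g h)
    = \<beta> (inv h) (inv g) * inverse (\<beta> (inv h) h * \<beta> \<one> \<one>) * inverse (\<beta> (inv g) g * \<beta> \<one> \<one>)"
proof -
  interpret A: complex_algebra TA by (rule TA_algebra)
  let ?s = "\<lambda>h. inverse (\<beta> (inv h) h * \<beta> \<one> \<one>)"
  have "basis_inv h \<otimes>\<^bsub>TA\<^esub> basis_inv g
      = ?s g \<odot>\<^bsub>TA\<^esub> (?s h \<odot>\<^bsub>TA\<^esub> (\<beta> (inv h) (inv g) \<odot>\<^bsub>TA\<^esub> basis_element (inv h \<otimes> inv g)))"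
    unfolding basis_inv_def using g h by (simp add: A.smult_mult_left A.smult_mult_right basis_mult)
  then have "basis_inv (g \<otimes> h) = (\<beta> g h * (?s g * (?s h * \<beta> (inv h) (inv g)))) \<odot>\<^bsub>TA\<^esub> basis_element (inv (g \<otimes> h))"
    using g h by (simp add: basis_inv_mult TA_smult_smult inv_mult_group)
  then have "basis_inv (g \<otimes> h) (inv (g \<otimes> h)) = \<beta> g h * (?s g * (?s h * \<beta> (inv h) (inv g)))"
    by (simp add: TA_smult basis_element_def)
  then have "?s (g \<otimes> h) = \<beta> g h * (?s g * (?s h * \<beta> (inv h) (inv g)))"
    by (simp add: basis_inv_def TA_smult basis_element_def)
  then show ?thesis using nonzero[OF g h] by (simp add: field_simps)
qed

lemma invert_basis_apply:
  assumes "k \<in> H"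
  shows "invert_basis a k = a (inv k) * inverse (\<beta> k (inv k) * \<beta> \<one> \<one>)"
proof -
  have "invert_basis a k = (\<Sum>x\<in>H. (if x = k then 1 else 0) * invert_basis a x)"
    using fin assms by (simp add: if_distrib[of "\<lambda>c. c * _"] cong: if_cong)
  also have "\<dots> = (\<Sum>h\<in>H. if h = inv k then a h * inverse (\<beta> (inv h) h * \<beta> \<one> \<one>) else 0)"
    unfolding pair_invert_basis
  proof (rule sum.cong[OF refl])
    fix h assume "h \<in> H"
    then have "inv h = k \<longleftrightarrow> h = inv k" using assms by auto
    then show "a h * (if inv h = k then 1 else 0) * inverse (\<beta> (inv h) h * \<beta> \<one> \<one>)
        = (if h = inv k then a h * inverse (\<beta> (inv h) h * \<beta> \<one> \<one>) else 0)" by simp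
  qed
  finally show ?thesis using fin assms by simp
qed

lemma twisted_group_inverse: "twisted_group G H (\<lambda>g h. inverse (\<beta> g h))"
proof
  fix g h k assume *: "g \<in> H" "h \<in> H" "k \<in> H"
  have "inverse (\<beta> g h * \<beta> (g \<otimes> h) k) = inverse (\<beta> g (h \<otimes> k) * \<beta> h k)" using cocycle[OF *] by simp
  then show "inverse (\<beta> g h) * inverse (\<beta> (g \<otimes> h) k) = inverse (\<beta> g (h \<otimes> k)) * inverse (\<beta> h k)" by simp
qed (use subgroup fin nonzero in auto)

text \<open>\<alpha> is a variable with an equation, because the lemma is applied with \<beta> the
  inverse of the given factor set; the inverse of that \<beta> is the given factor set only after
  rewriting.\<close>

lemma anti_isomorphic:
  assumes \<alpha>: "\<And>g h. \<alpha> g h = inverse (\<beta> g h)"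
  shows "anti_isomorphic_algebras TA (twisted_group_algebra G H \<alpha>) invert_basis"
proof -
  have \<alpha>': "\<alpha> = (\<lambda>g h. inverse (\<beta> g h))" using \<alpha> by auto
  interpret C: twisted_group G H \<alpha> unfolding \<alpha>' by (rule twisted_group_inverse)
  let ?C = "twisted_group_algebra G H \<alpha>"
  interpret R: ring TA by (rule TA_ring)
  interpret A: complex_algebra TA by (rule TA_algebra)
  interpret CR: ring ?C by (rule C.TA_ring)
  interpret CA: complex_algebra ?C by (rule C.TA_algebra)
  let ?s = "\<lambda>h. inverse (\<beta> (inv h) h * \<beta> \<one> \<one>)"
  show ?thesis
  proof
    show "bij_betw invert_basis (carrier ?C) (carrier TA)"
    proof (rule bij_betwI')
      fix a b assume ab: "a \<in> carrier ?C" "b \<in> carrier ?C"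
      show "invert_basis a = invert_basis b \<longleftrightarrow> a = b"
      proof
        assume eq: "invert_basis a = invert_basis b"
        show "a = b"
        proof
          fix x show "a x = b x"
          proof (cases "x \<in> H")
            case True
            then show ?thesis
              using fun_cong[OF eq, of "inv x"] nonzero[of "inv x" x] nonzero[of \<one> \<one>]
              by (simp add: invert_basis_apply)
          next
            case False
            then show ?thesis using ab by (simp add: C.TA_carrier)
          qed
        qed
      qed simp
    next
      fix a show "invert_basis a \<in> carrier TA" by (rule invert_basis_closed)
    next
      fix b assume b: "b \<in> carrier TA"
      \<comment> \<open>Found by solving \<open>invert_basis_apply\<close> for the argument.\<close>
      define a where "a h = (if h \<in> H then b (inv h) * (\<beta> (inv h) h * \<beta> \<one> \<one>) else 0)" for h
      have "invert_basis a = b"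
      proof
        fix x show "invert_basis a x = b x"
        proof (cases "x \<in> H")
          case True
          then show ?thesis
            using nonzero[of x "inv x"] nonzero[of \<one> \<one>] by (simp add: invert_basis_apply a_def field_simps)
        next
          case False
          then show ?thesis using b invert_basis_closed[of a] by (simp add: TA_carrier)
        qed
      qed
      moreover have "a \<in> carrier ?C" by (auto simp: C.TA_carrier a_def)
      ultimately show "\<exists>a\<in>carrier ?C. b = invert_basis a" by blast
    qed
    fix a assume a: "a \<in> carrier ?C"
    fix b assume b: "b \<in> carrier ?C"
    show "invert_basis (a \<oplus>\<^bsub>?C\<^esub> b) = invert_basis a \<oplus>\<^bsub>TA\<^esub> invert_basis b"
      by (rule TA_eqI[OF invert_basis_closed R.a_closed[OF invert_basis_closed invert_basis_closed]])
        (auto simp: pair_invert_basis TA_add C.TA_add distrib_right distrib_left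
          sum.distrib)
    show "invert_basis (a \<otimes>\<^bsub>?C\<^esub> b) = invert_basis b \<otimes>\<^bsub>TA\<^esub> invert_basis a"
    proof (rule TA_eqI[OF invert_basis_closed TA_mult_closed])
      fix F :: "'g \<Rightarrow> complex"
      have "(\<Sum>x\<in>H. F x * invert_basis (a \<otimes>\<^bsub>?C\<^esub> b) x)
          = (\<Sum>x\<in>H. (F (inv x) * ?s x) * (a \<otimes>\<^bsub>?C\<^esub> b) x)"
        unfolding pair_invert_basis by (simp add: ac_simps)
      also have "\<dots> = (\<Sum>g\<in>H. \<Sum>h\<in>H. F (inv (g \<otimes> h)) * ?s (g \<otimes> h) * \<alpha> g h * a g * b h)"
        by (rule C.pair_mult)
      also have "\<dots> = (\<Sum>g\<in>H. \<Sum>h\<in>H. F (inv h \<otimes> inv g) * (\<beta> (inv h) (inv g) * ?s h * ?s g) * a g * b h)"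
      proof (intro sum.cong refl)
        fix g h assume *: "g \<in> H" "h \<in> H"
        have "F (inv (g \<otimes> h)) * ?s (g \<otimes> h) * \<alpha> g h * a g * b h
            = F (inv (g \<otimes> h)) * (?s (g \<otimes> h) * inverse (\<beta> g h)) * a g * b h"
          by (simp only: \<alpha> mult.assoc)
        then show "F (inv (g \<otimes> h)) * ?s (g \<otimes> h) * \<alpha> g h * a g * b h
            = F (inv h \<otimes> inv g) * (\<beta> (inv h) (inv g) * ?s h * ?s g) * a g * b h"
          unfolding basis_inv_coeff[OF *] using * by (simp add: inv_mult_group)
      qed
      also have "\<dots> = (\<Sum>g\<in>H. a g * (\<Sum>h\<in>H. b h * (F (inv h \<otimes> inv g) * \<beta> (inv h) (inv g)) * ?s h) * ?s g)"
        by (simp add: sum_distrib_left sum_distrib_right ac_simps)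
      also have "\<dots> = (\<Sum>l\<in>H. (\<Sum>k\<in>H. (F (k \<otimes> l) * \<beta> k l) * invert_basis b k) * invert_basis a l)"
        by (simp only: pair_invert_basis)
      also have "\<dots> = (\<Sum>x\<in>H. F x * (invert_basis b \<otimes>\<^bsub>TA\<^esub> invert_basis a) x)"
        unfolding pair_mult by (subst sum.swap) (simp add: sum_distrib_right)
      finally show "(\<Sum>x\<in>H. F x * invert_basis (a \<otimes>\<^bsub>?C\<^esub> b) x)
          = (\<Sum>x\<in>H. F x * (invert_basis b \<otimes>\<^bsub>TA\<^esub> invert_basis a) x)" .
    qed
  next
    show "invert_basis \<one>\<^bsub>?C\<^esub> = \<one>\<^bsub>TA\<^esub>"
    proof (rule TA_eqI[OF invert_basis_closed TA_one_closed])
      fix F :: "'g \<Rightarrow> complex"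
      have "(\<Sum>x\<in>H. F x * invert_basis \<one>\<^bsub>?C\<^esub> x)
          = (\<Sum>h\<in>H. if h = \<one> then \<beta> \<one> \<one> * F \<one> * inverse (\<beta> \<one> \<one> * \<beta> \<one> \<one>) else 0)"
        unfolding pair_invert_basis by (intro sum.cong) (auto simp: C.TA_one \<alpha>)
      also have "\<dots> = (\<Sum>x\<in>H. if x = \<one> then F x * inverse (\<beta> \<one> \<one>) else 0)"
        using fin nonzero[of \<one> \<one>] by simp
      also have "\<dots> = (\<Sum>x\<in>H. F x * \<one>\<^bsub>TA\<^esub> x)" by (intro sum.cong) (auto simp: TA_one)
      finally show "(\<Sum>x\<in>H. F x * invert_basis \<one>\<^bsub>?C\<^esub> x) = (\<Sum>x\<in>H. F x * \<one>\<^bsub>TA\<^esub> x)" .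
    qed
  qed
qed

text \<open>In \<open>dual_module\<close> the form is applied for each
  \<open>c\<^sub>h\<^sup>-\<^sup>1\<close> separately; by linearity of \<psi> the weighted sum is
  \<psi> after the action of the image under \<open>invert_basis\<close>.\<close>

lemma dual_along_dual_module:
  assumes N: "alg_module TA N"
  shows "dual_along (twisted_group_algebra G H \<alpha>) TA invert_basis N (dual_module H TA N)"
proof -
  interpret N: alg_module TA N by (rule N)
  interpret A: complex_algebra TA by (rule TA_algebra)
  show ?thesis unfolding dual_along_def
  proof (intro conjI ballI allI)
    show "carrier (dual_module H TA N) = {\<psi> \<in> extensional (carrier N). linear_form TA N \<psi>}"
      by (auto simp: dual_module_def linear_form_def)
    then have form: "\<psi> \<in> carrier (dual_module H TA N) \<Longrightarrow> linear_form TA N \<psi>" for \<psi> by simp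
    fix a \<psi> assume \<psi>: "\<psi> \<in> carrier (dual_module H TA N)"
    have "(\<Sum>h\<in>H. a h * \<psi> (inv\<^bsub>TA\<^esub> (basis_element h) \<odot>\<^bsub>N\<^esub> x)) = \<psi> (invert_basis a \<odot>\<^bsub>N\<^esub> x)"
      if x: "x \<in> carrier N" for x
    proof -
      have "invert_basis a \<odot>\<^bsub>N\<^esub> x = (\<Oplus>\<^bsub>N\<^esub>h\<in>H. (a h \<odot>\<^bsub>TA\<^esub> basis_inv h) \<odot>\<^bsub>N\<^esub> x)"
        unfolding invert_basis_def using x by (intro N.finsum_smult) auto
      then have "\<psi> (invert_basis a \<odot>\<^bsub>N\<^esub> x) = (\<Sum>h\<in>H. \<psi> ((a h \<odot>\<^bsub>TA\<^esub> basis_inv h) \<odot>\<^bsub>N\<^esub> x))"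
        using N.linear_form_finsum[OF form[OF \<psi>], of "\<lambda>h. (a h \<odot>\<^bsub>TA\<^esub> basis_inv h) \<odot>\<^bsub>N\<^esub> x" H] x by auto
      also have "\<dots> = (\<Sum>h\<in>H. a h * \<psi> (inv\<^bsub>TA\<^esub> (basis_element h) \<odot>\<^bsub>N\<^esub> x))"
        using x linear_formD(2)[OF form[OF \<psi>]]
        by (intro sum.cong) (auto simp: N.smult_sc_left inv_basis)
      finally show ?thesis by (rule sym)
    qed
    then show "a \<odot>\<^bsub>dual_module H TA N\<^esub> \<psi> = (\<lambda>x\<in>carrier N. \<psi> (invert_basis a \<odot>\<^bsub>N\<^esub> x))"
      by (auto simp: dual_module_def intro!: restrict_ext)
  qed (auto simp: dual_module_def)
qed

end

subsection \<open>Tensor products in coordinates\<close>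

lemma (in alg_module) eq_by_forms:
  assumes "x \<in> carrier M" "y \<in> carrier M" "\<And>f. linear_form A M f \<Longrightarrow> f x = f y"
  shows "x = y"
proof (rule ccontr)
  assume "x \<noteq> y"
  then have d: "x \<ominus>\<^bsub>M\<^esub> y \<in> carrier M" "x \<ominus>\<^bsub>M\<^esub> y \<noteq> \<zero>\<^bsub>M\<^esub>"
    using assms(1,2) by (auto simp: Mod.M.minus_eq_zero_iff)
  then obtain f where f: "linear_form A M f" "f (x \<ominus>\<^bsub>M\<^esub> y) = 1" using exists_linear_form by metis
  have "x = (x \<ominus>\<^bsub>M\<^esub> y) \<oplus>\<^bsub>M\<^esub> y"
    using assms(1,2) by (simp add: a_minus_def Mod.M.a_assoc Mod.M.l_neg)
  then have "f x = f (x \<ominus>\<^bsub>M\<^esub> y) + f y" using linear_formD(1)[OF f(1) d(1) assms(2)] by simp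
  then show False using f(2) assms(3)[OF f(1)] by simp
qed

text \<open>With a finite basis \<open>E\<close> of \<open>D\<close>, every tensor is a sum of y b
  \<otimes> b over \<open>E\<close> with unique y b in \<open>Y\<close>, whatever the dimension of
  \<open>Y\<close>.\<close>

locale tensor_coordinates = Y: alg_module A Y + D: alg_module C D
  for A :: "(complex, 'a) module" and Y :: "('a, 'y) module"
    and C :: "(complex, 'c) module" and D :: "('c, 'd) module" +
  fixes E :: "'d set" and \<delta> :: "'d \<Rightarrow> 'd \<Rightarrow> complex"
  assumes basis: "dual_basis C D E \<delta>"
begin

lemmas ED = dual_basisD[OF basis]

definition tens :: "('d \<Rightarrow> 'y) \<Rightarrow> ('y \<Rightarrow> 'd \<Rightarrow> complex) \<Rightarrow> complex"
  where "tens y = (\<lambda>\<beta>. \<Sum>b\<in>E. pure_tensor A Y C D (y b) b \<beta>)"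

lemma bilinear_left: "\<beta> \<in> bilinear_forms A Y C D \<Longrightarrow> d \<in> carrier D \<Longrightarrow> linear_form A Y (\<lambda>y. \<beta> y d)"
  and bilinear_right: "\<beta> \<in> bilinear_forms A Y C D \<Longrightarrow> y \<in> carrier Y \<Longrightarrow> linear_form C D (\<beta> y)"
  by (auto simp: bilinear_forms_def linear_form_def)

lemma tens_apply: "\<beta> \<in> bilinear_forms A Y C D \<Longrightarrow> tens y \<beta> = (\<Sum>b\<in>E. \<beta> (y b) b)"
  and tens_outside: "\<beta> \<notin> bilinear_forms A Y C D \<Longrightarrow> tens y \<beta> = 0"
  by (simp_all add: tens_def pure_tensor_def)

lemma product_form_bilinear:
  assumes "linear_form A Y f" "b \<in> E"
  shows "(\<lambda>y d. f y * \<delta> b d) \<in> bilinear_forms A Y C D"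
  using linear_formD[OF assms(1)] linear_formD[OF ED(3)[OF assms(2)]]
  by (auto simp: bilinear_forms_def algebra_simps)

text \<open>The bilinear form with values f y * \<delta> b d evaluates the tensor to f (y b), and
  these values determine y b.\<close>

lemma tens_inj:
  assumes y: "\<And>b. b \<in> E \<Longrightarrow> y b \<in> carrier Y" and y': "\<And>b. b \<in> E \<Longrightarrow> y' b \<in> carrier Y"
    and eq: "tens y = tens y'" and b: "b \<in> E"
  shows "y b = y' b"
proof (rule Y.eq_by_forms[OF y[OF b] y'[OF b]])
  fix f assume f: "linear_form A Y f"
  have *: "tens z (\<lambda>y d. f y * \<delta> b d) = f (z b)" for z
  proof -
    have "tens z (\<lambda>y d. f y * \<delta> b d) = (\<Sum>b'\<in>E. f (z b') * \<delta> b b')"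
      by (rule tens_apply[OF product_form_bilinear[OF f b]])
    also have "\<dots> = (\<Sum>b'\<in>E. if b' = b then f (z b') else 0)"
      using ED(4)[OF b] by (intro sum.cong) auto
    finally show ?thesis using ED(1) b by simp
  qed
  show "f (y b) = f (y' b)" using *[of y] *[of y'] eq by simp
qed

lemma tens_cong: "(\<And>b. b \<in> E \<Longrightarrow> y b = y' b) \<Longrightarrow> tens y = tens y'"
  by (simp add: tens_def)

lemma expand_right:
  assumes \<beta>: "\<beta> \<in> bilinear_forms A Y C D" and y: "y \<in> carrier Y" and d: "d \<in> carrier D"
  shows "\<beta> y d = (\<Sum>b\<in>E. \<delta> b d * \<beta> y b)"
proof -
  have "\<beta> y d = \<beta> y (\<Oplus>\<^bsub>D\<^esub>b\<in>E. cscale C D (\<delta> b d) b)" using ED(5)[OF d] by simp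
  also have "\<dots> = (\<Sum>b\<in>E. \<beta> y (cscale C D (\<delta> b d) b))"
    using ED(2) by (intro D.linear_form_finsum[OF bilinear_right[OF \<beta> y]]) auto
  also have "\<dots> = (\<Sum>b\<in>E. \<delta> b d * \<beta> y b)"
    using ED(2) linear_formD(2)[OF bilinear_right[OF \<beta> y]] by (intro sum.cong) auto
  finally show ?thesis .
qed

lemma expand_left:
  assumes \<beta>: "\<beta> \<in> bilinear_forms A Y C D" and b: "b \<in> E" and g: "\<And>i. i \<in> J \<Longrightarrow> g i \<in> carrier Y"
  shows "\<beta> (\<Oplus>\<^bsub>Y\<^esub>i\<in>J. cscale A Y (c i) (g i)) b = (\<Sum>i\<in>J. c i * \<beta> (g i) b)"
proof -
  have "\<beta> (\<Oplus>\<^bsub>Y\<^esub>i\<in>J. cscale A Y (c i) (g i)) b = (\<Sum>i\<in>J. \<beta> (cscale A Y (c i) (g i)) b)"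
    using g by (intro Y.linear_form_finsum[OF bilinear_left[OF \<beta> ED(2)[OF b]]]) auto
  also have "\<dots> = (\<Sum>i\<in>J. c i * \<beta> (g i) b)"
    using g linear_formD(2)[OF bilinear_left[OF \<beta> ED(2)[OF b]]] by (intro sum.cong) auto
  finally show ?thesis .
qed

lemma tensor_carrier_tens:
  assumes "t \<in> tensor_carrier A Y C D"
  shows "\<exists>y. (\<forall>b\<in>E. y b \<in> carrier Y) \<and> t = tens y"
proof -
  obtain k :: nat and x d where t: "t = (\<lambda>\<beta>. \<Sum>i<k. pure_tensor A Y C D (x i) (d i) \<beta>)"
    and xd: "\<And>i. i < k \<Longrightarrow> x i \<in> carrier Y \<and> d i \<in> carrier D"
    using assms by (auto simp: tensor_carrier_def)
  \<comment> \<open>The coordinates of the right factors are moved over to the left factors.\<close>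
  define y where "y b = (\<Oplus>\<^bsub>Y\<^esub>i\<in>{..<k}. cscale A Y (\<delta> b (d i)) (x i))" for b
  have "t = tens y"
  proof
    fix \<beta> show "t \<beta> = tens y \<beta>"
    proof (cases "\<beta> \<in> bilinear_forms A Y C D")
      case True
      have "t \<beta> = (\<Sum>i<k. \<beta> (x i) (d i))" using True by (simp add: t pure_tensor_def)
      also have "\<dots> = (\<Sum>i<k. \<Sum>b\<in>E. \<delta> b (d i) * \<beta> (x i) b)"
        using expand_right[OF True] xd by (intro sum.cong) auto
      also have "\<dots> = (\<Sum>b\<in>E. \<Sum>i<k. \<delta> b (d i) * \<beta> (x i) b)" by (rule sum.swap)
      also have "\<dots> = (\<Sum>b\<in>E. \<beta> (y b) b)"
        unfolding y_def using expand_left[OF True, of _ "{..<k}" x] xd by (intro sum.cong) auto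
      also have "\<dots> = tens y \<beta>" using tens_apply[OF True] by simp
      finally show ?thesis .
    next
      case False
      then show ?thesis by (simp add: tens_outside t pure_tensor_def)
    qed
  qed
  moreover have "y b \<in> carrier Y" for b unfolding y_def using xd by (intro Y.Mod.M.finsum_closed) auto
  ultimately show ?thesis by (intro exI[of _ y]) simp
qed

lemma tens_in_carrier:
  assumes "\<And>b. b \<in> E \<Longrightarrow> y b \<in> carrier Y"
  shows "tens y \<in> tensor_carrier A Y C D"
proof -
  \<comment> \<open>\<open>tensor_carrier\<close> indexes its sums by initial segments of the
    natural numbers, so \<open>E\<close> has to be enumerated.\<close>
  obtain e where e: "bij_betw e {0..<card E} E" using ex_bij_betw_nat_finite[OF ED(1)] by blast
  have e': "bij_betw e {..<card E} E" using e by (simp add: atLeast0LessThan)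
  have "tens y = (\<lambda>\<beta>. \<Sum>i<card E. pure_tensor A Y C D (y (e i)) (e i) \<beta>)"
    unfolding tens_def using sum.reindex_bij_betw[OF e'] by (intro ext) (rule sym, simp)
  moreover have "y (e i) \<in> carrier Y \<and> e i \<in> carrier D" if "i < card E" for i
    using assms ED(2) bij_betwE[OF e'] that by auto
  ultimately show ?thesis unfolding tensor_carrier_def
    by (intro CollectI exI[of _ "card E"] exI[of _ "\<lambda>i. y (e i)"] exI[of _ e]) auto
qed

lemma tens_add:
  assumes "\<And>b. b \<in> E \<Longrightarrow> y b \<in> carrier Y" "\<And>b. b \<in> E \<Longrightarrow> y' b \<in> carrier Y"
  shows "(\<lambda>\<beta>. tens y \<beta> + tens y' \<beta>) = tens (\<lambda>b. y b \<oplus>\<^bsub>Y\<^esub> y' b)"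
proof
  fix \<beta> show "tens y \<beta> + tens y' \<beta> = tens (\<lambda>b. y b \<oplus>\<^bsub>Y\<^esub> y' b) \<beta>"
  proof (cases "\<beta> \<in> bilinear_forms A Y C D")
    case True
    then show ?thesis using assms linear_formD(1)[OF bilinear_left[OF True ED(2)]]
      by (simp add: tens_apply sum.distrib[symmetric])
  qed (simp add: tens_outside)
qed

lemma tens_left:
  assumes a: "a \<in> carrier A" and y: "\<And>b. b \<in> E \<Longrightarrow> y b \<in> carrier Y"
  shows "a \<odot>\<^bsub>tensor_left A Y C D\<^esub> tens y = tens (\<lambda>b. a \<odot>\<^bsub>Y\<^esub> y b)"
proof
  fix \<beta> show "(a \<odot>\<^bsub>tensor_left A Y C D\<^esub> tens y) \<beta> = tens (\<lambda>b. a \<odot>\<^bsub>Y\<^esub> y b) \<beta>"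
  proof (cases "\<beta> \<in> bilinear_forms A Y C D")
    case True
    then have "(\<lambda>x d. \<beta> (a \<odot>\<^bsub>Y\<^esub> x) d) \<in> bilinear_forms A Y C D"
      using a by (auto simp: bilinear_forms_def Y.Mod.smult_r_distr Y.smult_sc)
    then show ?thesis using True by (simp add: tensor_left_def tens_apply)
  qed (simp add: tens_outside tensor_left_def)
qed

text \<open>The coefficients form the matrix of \<open>c\<close> in the basis \<open>E\<close>.
  Acting on the right factor thus mixes the coordinates by complex numbers, and so commutes with
  applying one linear operator to all of them.\<close>

lemma tens_right:
  assumes c: "c \<in> carrier C" and y: "\<And>b. b \<in> E \<Longrightarrow> y b \<in> carrier Y"
  shows "c \<odot>\<^bsub>tensor_right A Y C D\<^esub> tens y
    = tens (\<lambda>b'. \<Oplus>\<^bsub>Y\<^esub>b\<in>E. cscale A Y (\<delta> b' (c \<odot>\<^bsub>D\<^esub> b)) (y b))"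
proof
  fix \<beta> show "(c \<odot>\<^bsub>tensor_right A Y C D\<^esub> tens y) \<beta>
      = tens (\<lambda>b'. \<Oplus>\<^bsub>Y\<^esub>b\<in>E. cscale A Y (\<delta> b' (c \<odot>\<^bsub>D\<^esub> b)) (y b)) \<beta>"
  proof (cases "\<beta> \<in> bilinear_forms A Y C D")
    case True
    then have "(\<lambda>x d. \<beta> x (c \<odot>\<^bsub>D\<^esub> d)) \<in> bilinear_forms A Y C D"
      using c by (auto simp: bilinear_forms_def D.Mod.smult_r_distr D.smult_sc)
    then have "(c \<odot>\<^bsub>tensor_right A Y C D\<^esub> tens y) \<beta> = (\<Sum>b\<in>E. \<beta> (y b) (c \<odot>\<^bsub>D\<^esub> b))"
      using True by (simp add: tensor_right_def tens_apply)
    also have "\<dots> = (\<Sum>b\<in>E. \<Sum>b'\<in>E. \<delta> b' (c \<odot>\<^bsub>D\<^esub> b) * \<beta> (y b) b')"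
      using expand_right[OF True y] ED(2) c by (intro sum.cong) auto
    also have "\<dots> = (\<Sum>b'\<in>E. \<Sum>b\<in>E. \<delta> b' (c \<odot>\<^bsub>D\<^esub> b) * \<beta> (y b) b')" by (rule sum.swap)
    also have "\<dots> = (\<Sum>b'\<in>E. \<beta> (\<Oplus>\<^bsub>Y\<^esub>b\<in>E. cscale A Y (\<delta> b' (c \<odot>\<^bsub>D\<^esub> b)) (y b)) b')"
      using y by (intro sum.cong refl expand_left[OF True, symmetric]) auto
    finally show ?thesis using True by (simp add: tens_apply)
  qed (simp add: tens_outside tensor_right_def)
qed

definition coord :: "(('y \<Rightarrow> 'd \<Rightarrow> complex) \<Rightarrow> complex) \<Rightarrow> 'd \<Rightarrow> 'y"
  where "coord t = (SOME y. (\<forall>b\<in>E. y b \<in> carrier Y) \<and> t = tens y)"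

lemma coord:
  assumes "t \<in> tensor_carrier A Y C D"
  shows "b \<in> E \<Longrightarrow> coord t b \<in> carrier Y" and "tens (coord t) = t"
  using someI_ex[OF tensor_carrier_tens[OF assms]] by (auto simp: coord_def)

lemma coord_tens:
  assumes "\<And>b. b \<in> E \<Longrightarrow> y b \<in> carrier Y" "b \<in> E"
  shows "coord (tens y) b = y b"
  using coord[OF tens_in_carrier[OF assms(1)]] by (intro tens_inj[OF _ assms(1) _ assms(2)]) auto

end

text \<open>
  Coordinates of the elements of \<open>M\<close> in a direct sum of the \<open>Y \<nu> \<otimes> D \<nu>\<close>: the element with
  coordinates \<open>\<kappa> \<nu> b\<close> corresponds to the sum of the tensors \<open>\<kappa> \<nu> b \<otimes> b\<close>.
\<close>

definition tensor_decomposition ::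
  "(complex, 'a) module \<Rightarrow> ('a, 'm) module \<Rightarrow> (complex, 'c) module \<Rightarrow> ('c, 'm) module \<Rightarrow> 'i set \<Rightarrow>
    ('i \<Rightarrow> ('a, 'y) module) \<Rightarrow> ('i \<Rightarrow> ('c, 'd) module) \<Rightarrow> ('i \<Rightarrow> 'd set) \<Rightarrow>
    ('i \<Rightarrow> 'd \<Rightarrow> 'd \<Rightarrow> complex) \<Rightarrow> ('i \<Rightarrow> 'd \<Rightarrow> 'm \<Rightarrow> 'y) \<Rightarrow> bool"
  where "tensor_decomposition A M C M' I Y D E \<delta> \<kappa> \<longleftrightarrow>
    (\<forall>\<nu>\<in>I. \<forall>b\<in>E \<nu>. \<kappa> \<nu> b \<in> module_hom A M (Y \<nu>)) \<and>
    (\<forall>\<nu>\<in>I. \<forall>b\<in>E \<nu>. \<forall>c\<in>carrier C. \<forall>x\<in>carrier M. \<kappa> \<nu> b (c \<odot>\<^bsub>M'\<^esub> x) =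
      (\<Oplus>\<^bsub>Y \<nu>\<^esub>b'\<in>E \<nu>. cscale A (Y \<nu>) (\<delta> \<nu> b (c \<odot>\<^bsub>D \<nu>\<^esub> b')) (\<kappa> \<nu> b' x))) \<and>
    (\<forall>x\<in>carrier M. \<forall>x'\<in>carrier M. (\<forall>\<nu>\<in>I. \<forall>b\<in>E \<nu>. \<kappa> \<nu> b x = \<kappa> \<nu> b x') \<longrightarrow> x = x') \<and>
    (\<forall>\<eta>. (\<forall>\<nu>\<in>I. \<forall>b\<in>E \<nu>. \<eta> \<nu> b \<in> carrier (Y \<nu>)) \<longrightarrow>
      (\<exists>x\<in>carrier M. \<forall>\<nu>\<in>I. \<forall>b\<in>E \<nu>. \<kappa> \<nu> b x = \<eta> \<nu> b))"

lemma tensor_decompositionD: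
  assumes "tensor_decomposition A M C M' I Y D E \<delta> \<kappa>"
  shows "\<nu> \<in> I \<Longrightarrow> b \<in> E \<nu> \<Longrightarrow> \<kappa> \<nu> b \<in> module_hom A M (Y \<nu>)"
    and "\<nu> \<in> I \<Longrightarrow> b \<in> E \<nu> \<Longrightarrow> c \<in> carrier C \<Longrightarrow> x \<in> carrier M \<Longrightarrow> \<kappa> \<nu> b (c \<odot>\<^bsub>M'\<^esub> x) =
      (\<Oplus>\<^bsub>Y \<nu>\<^esub>b'\<in>E \<nu>. cscale A (Y \<nu>) (\<delta> \<nu> b (c \<odot>\<^bsub>D \<nu>\<^esub> b')) (\<kappa> \<nu> b' x))"
    and "x \<in> carrier M \<Longrightarrow> x' \<in> carrier M \<Longrightarrow>
      (\<And>\<nu> b. \<nu> \<in> I \<Longrightarrow> b \<in> E \<nu> \<Longrightarrow> \<kappa> \<nu> b x = \<kappa> \<nu> b x') \<Longrightarrow> x = x'"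
    and "(\<And>\<nu> b. \<nu> \<in> I \<Longrightarrow> b \<in> E \<nu> \<Longrightarrow> \<eta> \<nu> b \<in> carrier (Y \<nu>)) \<Longrightarrow>
      \<exists>x\<in>carrier M. \<forall>\<nu>\<in>I. \<forall>b\<in>E \<nu>. \<kappa> \<nu> b x = \<eta> \<nu> b"
  using assms unfolding tensor_decomposition_def by simp_all

text \<open>\<open>M\<close> and \<open>M'\<close> are one additive group with two actions; in the
  application these are the actions of the fixed ring and of the twisted group algebra. As
  \<open>I\<close> is finite, the direct sum is the full product, see
  \<open>sum_carrier\<close>.\<close>

locale tensor_sum =
  fixes A :: "(complex, 'a) module" and M :: "('a, 'm) module"
    and C :: "(complex, 'c) module" and M' :: "('c, 'm) module"
    and I :: "'i set" and Y :: "'i \<Rightarrow> ('a, 'y) module" and D :: "'i \<Rightarrow> ('c, 'd) module"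
    and E :: "'i \<Rightarrow> 'd set" and \<delta> :: "'i \<Rightarrow> 'd \<Rightarrow> 'd \<Rightarrow> complex"
  assumes coords: "\<nu> \<in> I \<Longrightarrow> tensor_coordinates A (Y \<nu>) C (D \<nu>) (E \<nu>) (\<delta> \<nu>)"
    and finite_index: "finite I"
    and M: "alg_module A M" and M': "alg_module C M'"
    and carrier_M': "carrier M' = carrier M" and add_M': "add M' = add M"
begin

abbreviation "Sl \<equiv> direct_sum I (\<lambda>\<nu>. tensor_left A (Y \<nu>) C (D \<nu>))"
abbreviation "Sr \<equiv> direct_sum I (\<lambda>\<nu>. tensor_right A (Y \<nu>) C (D \<nu>))"
abbreviation "tns \<nu> \<equiv> tensor_coordinates.tens A (Y \<nu>) C (D \<nu>) (E \<nu>)"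
abbreviation "crd \<nu> \<equiv> tensor_coordinates.coord A (Y \<nu>) C (D \<nu>) (E \<nu>)"

lemma sum_carrier:
  "carrier Sl = (\<Pi>\<^sub>E \<nu>\<in>I. tensor_carrier A (Y \<nu>) C (D \<nu>))"
  "carrier Sr = (\<Pi>\<^sub>E \<nu>\<in>I. tensor_carrier A (Y \<nu>) C (D \<nu>))"
  using finite_index by (auto simp: direct_sum_def tensor_left_def tensor_right_def)

lemma sum_add:
  "f \<oplus>\<^bsub>Sl\<^esub> g = (\<lambda>\<nu>\<in>I. \<lambda>\<beta>. f \<nu> \<beta> + g \<nu> \<beta>)"
  "f \<oplus>\<^bsub>Sr\<^esub> g = (\<lambda>\<nu>\<in>I. \<lambda>\<beta>. f \<nu> \<beta> + g \<nu> \<beta>)"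
  by (simp_all add: direct_sum_def tensor_left_def tensor_right_def)

lemma sum_smult:
  "a \<odot>\<^bsub>Sl\<^esub> f = (\<lambda>\<nu>\<in>I. a \<odot>\<^bsub>tensor_left A (Y \<nu>) C (D \<nu>)\<^esub> f \<nu>)"
  "c \<odot>\<^bsub>Sr\<^esub> f = (\<lambda>\<nu>\<in>I. c \<odot>\<^bsub>tensor_right A (Y \<nu>) C (D \<nu>)\<^esub> f \<nu>)"
  by (simp_all add: direct_sum_def)

text \<open>The isomorphism sends x to the family of tensors with coordinates \<kappa> \<nu> b x.
  This direction turns constructed coordinates into a decomposition.\<close>

lemma iso_of_decomposition:
  assumes dec: "tensor_decomposition A M C M' I Y D E \<delta> \<kappa>"
  shows "module_iso A M Sl \<inter> module_iso C M' Sr \<noteq> {}"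
proof -
  note dD = tensor_decompositionD[OF dec]
  define F where "F x = (\<lambda>\<nu>\<in>I. tns \<nu> (\<lambda>b. \<kappa> \<nu> b x))" for x
  have kc: "\<kappa> \<nu> b x \<in> carrier (Y \<nu>)" if "\<nu> \<in> I" "b \<in> E \<nu>" "x \<in> carrier M" for \<nu> b x
    using module_homD(1)[OF dD(1)[OF that(1,2)] that(3)] .
  have Fc: "F x \<in> (\<Pi>\<^sub>E \<nu>\<in>I. tensor_carrier A (Y \<nu>) C (D \<nu>))" if x: "x \<in> carrier M" for x
    unfolding F_def using tensor_coordinates.tens_in_carrier[OF coords] kc x by auto
  have add: "F (x \<oplus>\<^bsub>M\<^esub> y) = (\<lambda>\<nu>\<in>I. \<lambda>\<beta>. F x \<nu> \<beta> + F y \<nu> \<beta>)"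
    if xy: "x \<in> carrier M" "y \<in> carrier M" for x y
    unfolding F_def
  proof (rule restrict_ext)
    fix \<nu> assume \<nu>: "\<nu> \<in> I"
    interpret tensor_coordinates A "Y \<nu>" C "D \<nu>" "E \<nu>" "\<delta> \<nu>" by (rule coords[OF \<nu>])
    have "tns \<nu> (\<lambda>b. \<kappa> \<nu> b (x \<oplus>\<^bsub>M\<^esub> y)) = tns \<nu> (\<lambda>b. \<kappa> \<nu> b x \<oplus>\<^bsub>Y \<nu>\<^esub> \<kappa> \<nu> b y)"
      using module_homD(2)[OF dD(1)[OF \<nu>] xy] by (rule tens_cong)
    also have "\<dots> = (\<lambda>\<beta>. tns \<nu> (\<lambda>b. \<kappa> \<nu> b x) \<beta> + tns \<nu> (\<lambda>b. \<kappa> \<nu> b y) \<beta>)"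
      using kc[OF \<nu>] xy by (intro tens_add[symmetric]) auto
    finally show "tns \<nu> (\<lambda>b. \<kappa> \<nu> b (x \<oplus>\<^bsub>M\<^esub> y)) =
      (\<lambda>\<beta>. (\<lambda>\<nu>\<in>I. tns \<nu> (\<lambda>b. \<kappa> \<nu> b x)) \<nu> \<beta> + (\<lambda>\<nu>\<in>I. tns \<nu> (\<lambda>b. \<kappa> \<nu> b y)) \<nu> \<beta>)" using \<nu> by simp
  qed
  have left: "F (a \<odot>\<^bsub>M\<^esub> x) = a \<odot>\<^bsub>Sl\<^esub> F x" if a: "a \<in> carrier A" and x: "x \<in> carrier M" for a x
    unfolding F_def sum_smult
  proof (rule restrict_ext)
    fix \<nu> assume \<nu>: "\<nu> \<in> I"
    interpret tensor_coordinates A "Y \<nu>" C "D \<nu>" "E \<nu>" "\<delta> \<nu>" by (rule coords[OF \<nu>])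
    have "tns \<nu> (\<lambda>b. \<kappa> \<nu> b (a \<odot>\<^bsub>M\<^esub> x)) = tns \<nu> (\<lambda>b. a \<odot>\<^bsub>Y \<nu>\<^esub> \<kappa> \<nu> b x)"
      using module_homD(3)[OF dD(1)[OF \<nu>] a x] by (rule tens_cong)
    also have "\<dots> = a \<odot>\<^bsub>tensor_left A (Y \<nu>) C (D \<nu>)\<^esub> tns \<nu> (\<lambda>b. \<kappa> \<nu> b x)"
      using kc[OF \<nu>] x by (intro tens_left[OF a, symmetric]) auto
    finally show "tns \<nu> (\<lambda>b. \<kappa> \<nu> b (a \<odot>\<^bsub>M\<^esub> x)) =
        a \<odot>\<^bsub>tensor_left A (Y \<nu>) C (D \<nu>)\<^esub> (\<lambda>\<nu>\<in>I. tns \<nu> (\<lambda>b. \<kappa> \<nu> b x)) \<nu>" using \<nu> by simp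
  qed
  have right: "F (c \<odot>\<^bsub>M'\<^esub> x) = c \<odot>\<^bsub>Sr\<^esub> F x" if c: "c \<in> carrier C" and x: "x \<in> carrier M" for c x
    unfolding F_def sum_smult
  proof (rule restrict_ext)
    fix \<nu> assume \<nu>: "\<nu> \<in> I"
    interpret tensor_coordinates A "Y \<nu>" C "D \<nu>" "E \<nu>" "\<delta> \<nu>" by (rule coords[OF \<nu>])
    have "tns \<nu> (\<lambda>b. \<kappa> \<nu> b (c \<odot>\<^bsub>M'\<^esub> x))
        = tns \<nu> (\<lambda>b. \<Oplus>\<^bsub>Y \<nu>\<^esub>b'\<in>E \<nu>. cscale A (Y \<nu>) (\<delta> \<nu> b (c \<odot>\<^bsub>D \<nu>\<^esub> b')) (\<kappa> \<nu> b' x))"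
      using dD(2)[OF \<nu> _ c x] by (rule tens_cong)
    also have "\<dots> = c \<odot>\<^bsub>tensor_right A (Y \<nu>) C (D \<nu>)\<^esub> tns \<nu> (\<lambda>b. \<kappa> \<nu> b x)"
      using kc[OF \<nu>] x by (intro tens_right[OF c, symmetric]) auto
    finally show "tns \<nu> (\<lambda>b. \<kappa> \<nu> b (c \<odot>\<^bsub>M'\<^esub> x)) =
        c \<odot>\<^bsub>tensor_right A (Y \<nu>) C (D \<nu>)\<^esub> (\<lambda>\<nu>\<in>I. tns \<nu> (\<lambda>b. \<kappa> \<nu> b x)) \<nu>" using \<nu> by simp
  qed
  have bij: "bij_betw F (carrier M) (\<Pi>\<^sub>E \<nu>\<in>I. tensor_carrier A (Y \<nu>) C (D \<nu>))"
  proof (rule bij_betwI')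
    fix x y assume xy: "x \<in> carrier M" "y \<in> carrier M"
    show "F x = F y \<longleftrightarrow> x = y"
    proof
      assume eq: "F x = F y"
      show "x = y"
      proof (rule dD(3)[OF xy])
        fix \<nu> b assume \<nu>: "\<nu> \<in> I" "b \<in> E \<nu>"
        interpret tensor_coordinates A "Y \<nu>" C "D \<nu>" "E \<nu>" "\<delta> \<nu>" by (rule coords[OF \<nu>(1)])
        have t: "tns \<nu> (\<lambda>b. \<kappa> \<nu> b x) = tns \<nu> (\<lambda>b. \<kappa> \<nu> b y)"
          using fun_cong[OF eq, of \<nu>] \<nu> by (simp add: F_def)
        show "\<kappa> \<nu> b x = \<kappa> \<nu> b y"
          using tens_inj[OF kc[OF \<nu>(1) _ xy(1)] kc[OF \<nu>(1) _ xy(2)] t \<nu>(2)] .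
      qed
    qed simp
  next
    fix x assume "x \<in> carrier M"
    then show "F x \<in> (\<Pi>\<^sub>E \<nu>\<in>I. tensor_carrier A (Y \<nu>) C (D \<nu>))" by (rule Fc)
  next
    fix f assume f: "f \<in> (\<Pi>\<^sub>E \<nu>\<in>I. tensor_carrier A (Y \<nu>) C (D \<nu>))"
    have ft: "f \<nu> \<in> tensor_carrier A (Y \<nu>) C (D \<nu>)" if "\<nu> \<in> I" for \<nu> using f that by auto
    obtain x where x: "x \<in> carrier M" "\<forall>\<nu>\<in>I. \<forall>b\<in>E \<nu>. \<kappa> \<nu> b x = crd \<nu> (f \<nu>) b"
      using dD(4)[of "\<lambda>\<nu>. crd \<nu> (f \<nu>)"] tensor_coordinates.coord(1)[OF coords ft] by blast
    have "F x = f"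
    proof (rule extensionalityI[of _ I])
      fix \<nu> assume \<nu>: "\<nu> \<in> I"
      interpret tensor_coordinates A "Y \<nu>" C "D \<nu>" "E \<nu>" "\<delta> \<nu>" by (rule coords[OF \<nu>])
      have "tns \<nu> (\<lambda>b. \<kappa> \<nu> b x) = tns \<nu> (crd \<nu> (f \<nu>))" using x(2) \<nu> by (intro tens_cong) auto
      then show "F x \<nu> = f \<nu>" using coord(2)[OF ft[OF \<nu>]] \<nu> by (simp add: F_def)
    qed (use f in \<open>auto simp: F_def PiE_def\<close>)
    then show "\<exists>x\<in>carrier M. f = F x" using x(1) by blast
  qed
  have "F \<in> module_iso A M Sl" unfolding module_iso_def module_hom_def sum_carrier
    using Fc add left bij by (auto simp: sum_add)
  moreover have "F \<in> module_iso C M' Sr" unfolding module_iso_def module_hom_def sum_carrier carrier_M' add_M'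
    using Fc add right bij by (auto simp: sum_add)
  ultimately show ?thesis by blast
qed

text \<open>The converse direction, which extracts coordinates from a bare isomorphism; (a), (b) and
  (c) are claims about every decomposition.\<close>

lemma decomposition_of_iso:
  assumes F: "F \<in> module_iso A M Sl" "F \<in> module_iso C M' Sr"
  shows "\<exists>\<kappa>. tensor_decomposition A M C M' I Y D E \<delta> \<kappa>"
proof -
  have hl: "F \<in> module_hom A M Sl" and hr: "F \<in> module_hom C M' Sr"
    and bij: "bij_betw F (carrier M) (\<Pi>\<^sub>E \<nu>\<in>I. tensor_carrier A (Y \<nu>) C (D \<nu>))"
    using F by (auto simp: module_iso_def sum_carrier)
  define \<kappa> where "\<kappa> \<nu> b x = crd \<nu> (F x \<nu>) b" for \<nu> b x
  have Ft: "F x \<nu> \<in> tensor_carrier A (Y \<nu>) C (D \<nu>)" if "x \<in> carrier M" "\<nu> \<in> I" for x \<nu>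
    using bij_betwE[OF bij] that by auto
  have kc: "\<kappa> \<nu> b x \<in> carrier (Y \<nu>)" if "\<nu> \<in> I" "b \<in> E \<nu>" "x \<in> carrier M" for \<nu> b x
    unfolding \<kappa>_def using tensor_coordinates.coord(1)[OF coords Ft] that by blast
  have Fk: "F x \<nu> = tns \<nu> (\<lambda>b. \<kappa> \<nu> b x)" if "\<nu> \<in> I" "x \<in> carrier M" for \<nu> x
    unfolding \<kappa>_def using tensor_coordinates.coord(2)[OF coords Ft] that by simp
  interpret M: alg_module A M by (rule M)
  interpret M': alg_module C M' by (rule M')
  have "tensor_decomposition A M C M' I Y D E \<delta> \<kappa>" unfolding tensor_decomposition_def
  proof (intro conjI ballI allI impI)
    fix \<nu> b assume \<nu>: "\<nu> \<in> I" and b: "b \<in> E \<nu>"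
    interpret tensor_coordinates A "Y \<nu>" C "D \<nu>" "E \<nu>" "\<delta> \<nu>" by (rule coords[OF \<nu>])
    show "\<kappa> \<nu> b \<in> module_hom A M (Y \<nu>)" unfolding module_hom_def
    proof (intro CollectI conjI ballI)
      show "\<kappa> \<nu> b \<in> carrier M \<rightarrow> carrier (Y \<nu>)" using kc \<nu> b by auto
      fix x assume x: "x \<in> carrier M"
      { fix y assume y: "y \<in> carrier M"
        have "tns \<nu> (\<lambda>b. \<kappa> \<nu> b (x \<oplus>\<^bsub>M\<^esub> y)) = F (x \<oplus>\<^bsub>M\<^esub> y) \<nu>" using Fk \<nu> x y by simp
        also have "\<dots> = (\<lambda>\<beta>. tns \<nu> (\<lambda>b. \<kappa> \<nu> b x) \<beta> + tns \<nu> (\<lambda>b. \<kappa> \<nu> b y) \<beta>)"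
          using module_homD(2)[OF hl x y] Fk \<nu> x y by (simp add: sum_add)
        also have "\<dots> = tns \<nu> (\<lambda>b. \<kappa> \<nu> b x \<oplus>\<^bsub>Y \<nu>\<^esub> \<kappa> \<nu> b y)" using kc \<nu> x y by (intro tens_add) auto
        finally show "\<kappa> \<nu> b (x \<oplus>\<^bsub>M\<^esub> y) = \<kappa> \<nu> b x \<oplus>\<^bsub>Y \<nu>\<^esub> \<kappa> \<nu> b y"
          by (rule tens_inj[rotated 2]) (use kc \<nu> x y b in auto) }
      fix a assume a: "a \<in> carrier A"
      have "tns \<nu> (\<lambda>b. \<kappa> \<nu> b (a \<odot>\<^bsub>M\<^esub> x)) = F (a \<odot>\<^bsub>M\<^esub> x) \<nu>" using Fk \<nu> x a by simp
      also have "\<dots> = a \<odot>\<^bsub>tensor_left A (Y \<nu>) C (D \<nu>)\<^esub> tns \<nu> (\<lambda>b. \<kappa> \<nu> b x)"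
        using module_homD(3)[OF hl a x] Fk \<nu> x by (simp add: sum_smult)
      also have "\<dots> = tns \<nu> (\<lambda>b. a \<odot>\<^bsub>Y \<nu>\<^esub> \<kappa> \<nu> b x)" using kc \<nu> x by (intro tens_left[OF a]) auto
      finally show "\<kappa> \<nu> b (a \<odot>\<^bsub>M\<^esub> x) = a \<odot>\<^bsub>Y \<nu>\<^esub> \<kappa> \<nu> b x"
        by (rule tens_inj[rotated 2]) (use kc \<nu> x a b in auto)
    qed
    fix c x assume c: "c \<in> carrier C" and x: "x \<in> carrier M"
    have cx: "c \<odot>\<^bsub>M'\<^esub> x \<in> carrier M" using M'.Mod.smult_closed[OF c] x carrier_M' by simp
    have "tns \<nu> (\<lambda>b. \<kappa> \<nu> b (c \<odot>\<^bsub>M'\<^esub> x)) = F (c \<odot>\<^bsub>M'\<^esub> x) \<nu>" using Fk[OF \<nu> cx] by simp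
    also have "\<dots> = c \<odot>\<^bsub>tensor_right A (Y \<nu>) C (D \<nu>)\<^esub> tns \<nu> (\<lambda>b. \<kappa> \<nu> b x)"
      using module_homD(3)[OF hr c] Fk \<nu> x carrier_M' by (simp add: sum_smult)
    also have "\<dots> = tns \<nu> (\<lambda>b. \<Oplus>\<^bsub>Y \<nu>\<^esub>b'\<in>E \<nu>. cscale A (Y \<nu>) (\<delta> \<nu> b (c \<odot>\<^bsub>D \<nu>\<^esub> b')) (\<kappa> \<nu> b' x))"
      using kc \<nu> x by (intro tens_right[OF c]) auto
    finally show "\<kappa> \<nu> b (c \<odot>\<^bsub>M'\<^esub> x) =
        (\<Oplus>\<^bsub>Y \<nu>\<^esub>b'\<in>E \<nu>. cscale A (Y \<nu>) (\<delta> \<nu> b (c \<odot>\<^bsub>D \<nu>\<^esub> b')) (\<kappa> \<nu> b' x))"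
      by (rule tens_inj[rotated 2]) (use kc \<nu> x cx b in \<open>auto intro!: Y.Mod.M.finsum_closed\<close>)
  next
    fix x x' assume xx: "x \<in> carrier M" "x' \<in> carrier M" and eq: "\<forall>\<nu>\<in>I. \<forall>b\<in>E \<nu>. \<kappa> \<nu> b x = \<kappa> \<nu> b x'"
    have "F x = F x'"
    proof (rule extensionalityI[of _ I])
      fix \<nu> assume \<nu>: "\<nu> \<in> I"
      interpret tensor_coordinates A "Y \<nu>" C "D \<nu>" "E \<nu>" "\<delta> \<nu>" by (rule coords[OF \<nu>])
      show "F x \<nu> = F x' \<nu>" unfolding Fk[OF \<nu> xx(1)] Fk[OF \<nu> xx(2)] using eq \<nu> by (intro tens_cong) auto
    qed (use bij_betwE[OF bij] xx in \<open>auto simp: PiE_def\<close>)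
    then show "x = x'" using bij xx by (auto simp: bij_betw_def inj_on_def)
  next
    fix \<eta> assume \<eta>: "\<forall>\<nu>\<in>I. \<forall>b\<in>E \<nu>. \<eta> \<nu> b \<in> carrier (Y \<nu>)"
    have "(\<lambda>\<nu>\<in>I. tns \<nu> (\<eta> \<nu>)) \<in> (\<Pi>\<^sub>E \<nu>\<in>I. tensor_carrier A (Y \<nu>) C (D \<nu>))"
      using \<eta> tensor_coordinates.tens_in_carrier[OF coords] by auto
    then have "(\<lambda>\<nu>\<in>I. tns \<nu> (\<eta> \<nu>)) \<in> F ` carrier M" using bij by (simp add: bij_betw_def)
    then obtain x where x: "x \<in> carrier M" "F x = (\<lambda>\<nu>\<in>I. tns \<nu> (\<eta> \<nu>))"
      by (elim imageE) simp
    have "\<kappa> \<nu> b x = \<eta> \<nu> b" if \<nu>: "\<nu> \<in> I" "b \<in> E \<nu>" for \<nu> b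
    proof -
      interpret tensor_coordinates A "Y \<nu>" C "D \<nu>" "E \<nu>" "\<delta> \<nu>" by (rule coords[OF \<nu>(1)])
      show ?thesis unfolding \<kappa>_def x(2) using \<eta> \<nu> by (simp add: coord_tens)
    qed
    then show "\<exists>x\<in>carrier M. \<forall>\<nu>\<in>I. \<forall>b\<in>E \<nu>. \<kappa> \<nu> b x = \<eta> \<nu> b" using x(1) by blast
  qed
  then show ?thesis by blast
qed

end

text \<open>\<open>T\<close> applies \<open>L\<close> to each coordinate at
  \<open>\<nu>\<^sub>0\<close> and zero to the others. It commutes with \<open>C\<close>, because
  \<open>C\<close> mixes the coordinates belonging to one index by complex coefficients.\<close>

lemma decomposition_operator:
  assumes M: "alg_module A M" and M': "alg_module C M'" and cM': "carrier M' = carrier M"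
    and Y: "\<And>\<nu>. \<nu> \<in> I \<Longrightarrow> alg_module A (Y \<nu>)"
    and dec: "tensor_decomposition A M C M' I Y D E \<delta> \<kappa>"
    and \<nu>0: "\<nu>\<^sub>0 \<in> I" and L: "linear_map A (Y \<nu>\<^sub>0) A (Y \<nu>\<^sub>0) L"
  obtains T where "linear_map A M A M T"
    "\<And>c x. c \<in> carrier C \<Longrightarrow> x \<in> carrier M \<Longrightarrow> T (c \<odot>\<^bsub>M'\<^esub> x) = c \<odot>\<^bsub>M'\<^esub> T x"
    "\<And>x b. x \<in> carrier M \<Longrightarrow> b \<in> E \<nu>\<^sub>0 \<Longrightarrow> \<kappa> \<nu>\<^sub>0 b (T x) = L (\<kappa> \<nu>\<^sub>0 b x)"
    "\<And>x \<nu> b. x \<in> carrier M \<Longrightarrow> \<nu> \<in> I \<Longrightarrow> \<nu> \<noteq> \<nu>\<^sub>0 \<Longrightarrow> b \<in> E \<nu> \<Longrightarrow> \<kappa> \<nu> b (T x) = \<zero>\<^bsub>Y \<nu>\<^esub>"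
proof -
  interpret M: alg_module A M by (rule M)
  interpret M': alg_module C M' by (rule M')
  interpret Y0: alg_module A "Y \<nu>\<^sub>0" by (rule Y[OF \<nu>0])
  note dD = tensor_decompositionD[OF dec]
  have kc: "\<kappa> \<nu> b x \<in> carrier (Y \<nu>)" if "\<nu> \<in> I" "b \<in> E \<nu>" "x \<in> carrier M" for \<nu> b x
    using module_homD(1)[OF dD(1)[OF that(1,2)] that(3)] .
  define P where "P \<nu> y = (if \<nu> = \<nu>\<^sub>0 then L y else \<zero>\<^bsub>Y \<nu>\<^esub>)" for \<nu> y
  have P: "linear_map A (Y \<nu>) A (Y \<nu>) (P \<nu>)" if "\<nu> \<in> I" for \<nu>
  proof (cases "\<nu> = \<nu>\<^sub>0")
    case True
    then have "P \<nu> = L" by (auto simp: P_def)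
    then show ?thesis using L True by simp
  next
    case False
    interpret Yn: alg_module A "Y \<nu>" by (rule Y[OF that])
    show ?thesis using False by (simp add: linear_map_def additive_map_def P_def)
  qed
  have "\<forall>x\<in>carrier M. \<exists>x'. x' \<in> carrier M \<and> (\<forall>\<nu>\<in>I. \<forall>b\<in>E \<nu>. \<kappa> \<nu> b x' = P \<nu> (\<kappa> \<nu> b x))"
  proof
    fix x assume x: "x \<in> carrier M"
    have "\<exists>x'\<in>carrier M. \<forall>\<nu>\<in>I. \<forall>b\<in>E \<nu>. \<kappa> \<nu> b x' = P \<nu> (\<kappa> \<nu> b x)"
      using linear_mapD(1)[OF P] kc x by (intro dD(4)) auto
    then show "\<exists>x'. x' \<in> carrier M \<and> (\<forall>\<nu>\<in>I. \<forall>b\<in>E \<nu>. \<kappa> \<nu> b x' = P \<nu> (\<kappa> \<nu> b x))" by auto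
  qed
  from bchoice[OF this] obtain T where T: "\<forall>x\<in>carrier M. T x \<in> carrier M \<and>
      (\<forall>\<nu>\<in>I. \<forall>b\<in>E \<nu>. \<kappa> \<nu> b (T x) = P \<nu> (\<kappa> \<nu> b x))" ..
  have Tc: "T x \<in> carrier M" if "x \<in> carrier M" for x using T that by blast
  have Tk: "\<kappa> \<nu> b (T x) = P \<nu> (\<kappa> \<nu> b x)" if "x \<in> carrier M" "\<nu> \<in> I" "b \<in> E \<nu>" for x \<nu> b
    using T that by simp
  show thesis
  proof (rule that)
    show "linear_map A M A M T" unfolding linear_map_def additive_map_def
    proof (intro conjI ballI allI)
      show "T \<in> carrier M \<rightarrow> carrier M" using Tc by auto
      fix x assume x: "x \<in> carrier M"
      { fix y assume y: "y \<in> carrier M"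
        show "T (x \<oplus>\<^bsub>M\<^esub> y) = T x \<oplus>\<^bsub>M\<^esub> T y"
        proof (rule dD(3))
          fix \<nu> b assume \<nu>: "\<nu> \<in> I" "b \<in> E \<nu>"
          show "\<kappa> \<nu> b (T (x \<oplus>\<^bsub>M\<^esub> y)) = \<kappa> \<nu> b (T x \<oplus>\<^bsub>M\<^esub> T y)"
            using Tk[OF _ \<nu>] x y Tc kc[OF \<nu>] linear_mapD(2)[OF P[OF \<nu>(1)]] module_homD(2)[OF dD(1)[OF \<nu>]]
            by simp
        qed (use x y Tc in auto) }
      fix c
      show "T (cscale A M c x) = cscale A M c (T x)"
      proof (rule dD(3))
        fix \<nu> b assume \<nu>: "\<nu> \<in> I" "b \<in> E \<nu>"
        show "\<kappa> \<nu> b (T (cscale A M c x)) = \<kappa> \<nu> b (cscale A M c (T x))"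
          using Tk[OF _ \<nu>] x Tc kc[OF \<nu>] linear_mapD(3)[OF P[OF \<nu>(1)]]
            linear_mapD(3)[OF M.hom_linear[OF dD(1)[OF \<nu>]]] by simp
      qed (use x Tc in auto)
    qed
    fix x assume x: "x \<in> carrier M"
    show "\<kappa> \<nu>\<^sub>0 b (T x) = L (\<kappa> \<nu>\<^sub>0 b x)" if "b \<in> E \<nu>\<^sub>0" for b
      using Tk[OF x \<nu>0 that] by (simp add: P_def)
    show "\<kappa> \<nu> b (T x) = \<zero>\<^bsub>Y \<nu>\<^esub>" if "\<nu> \<in> I" "\<nu> \<noteq> \<nu>\<^sub>0" "b \<in> E \<nu>" for \<nu> b
      using Tk[OF x that(1,3)] that(2) by (simp add: P_def)
    fix c assume c: "c \<in> carrier C"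
    have cl: "c \<odot>\<^bsub>M'\<^esub> z \<in> carrier M" if "z \<in> carrier M" for z
      using M'.Mod.smult_closed[OF c] that cM' by simp
    show "T (c \<odot>\<^bsub>M'\<^esub> x) = c \<odot>\<^bsub>M'\<^esub> T x"
    proof (rule dD(3))
      fix \<nu> b assume \<nu>: "\<nu> \<in> I" "b \<in> E \<nu>"
      interpret Yn: alg_module A "Y \<nu>" by (rule Y[OF \<nu>(1)])
      let ?d = "\<lambda>b'. \<delta> \<nu> b (c \<odot>\<^bsub>D \<nu>\<^esub> b')"
      note PD = linear_mapD[OF P[OF \<nu>(1)]]
      have "\<kappa> \<nu> b (T (c \<odot>\<^bsub>M'\<^esub> x)) = P \<nu> (\<kappa> \<nu> b (c \<odot>\<^bsub>M'\<^esub> x))" by (rule Tk[OF cl[OF x] \<nu>])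
      also have "\<dots> = P \<nu> (\<Oplus>\<^bsub>Y \<nu>\<^esub>b'\<in>E \<nu>. cscale A (Y \<nu>) (?d b') (\<kappa> \<nu> b' x))"
        using dD(2)[OF \<nu> c x] by simp
      also have "\<dots> = (\<Oplus>\<^bsub>Y \<nu>\<^esub>b'\<in>E \<nu>. P \<nu> (cscale A (Y \<nu>) (?d b') (\<kappa> \<nu> b' x)))"
        using kc[OF \<nu>(1) _ x] by (intro additive_map_finsum[OF Yn.ab_group Yn.ab_group PD(4)]) auto
      also have "\<dots> = (\<Oplus>\<^bsub>Y \<nu>\<^esub>b'\<in>E \<nu>. cscale A (Y \<nu>) (?d b') (\<kappa> \<nu> b' (T x)))"
        using kc[OF \<nu>(1) _ x] kc[OF \<nu>(1) _ Tc[OF x]] PD(3) Tk[OF x \<nu>(1)] by (intro Yn.Mod.M.finsum_cong') auto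
      also have "\<dots> = \<kappa> \<nu> b (c \<odot>\<^bsub>M'\<^esub> T x)" using dD(2)[OF \<nu> c Tc[OF x]] by simp
      finally show "\<kappa> \<nu> b (T (c \<odot>\<^bsub>M'\<^esub> x)) = \<kappa> \<nu> b (c \<odot>\<^bsub>M'\<^esub> T x)" .
    qed (use x Tc cl in auto)
  qed
qed

text \<open>Each coordinate map is onto, so the action of an algebra element on Y \<nu> can be read
  off from its action on \<open>M\<close>.\<close>

lemma decomposition_lift:
  assumes Y: "\<And>\<nu>. \<nu> \<in> I \<Longrightarrow> alg_module A (Y \<nu>)"
    and dec: "tensor_decomposition A M C M' I Y D E \<delta> \<kappa>"
    and \<nu>: "\<nu> \<in> I" "b \<in> E \<nu>" and y: "y \<in> carrier (Y \<nu>)"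
  obtains x where "x \<in> carrier M" "\<kappa> \<nu> b x = y"
proof -
  have z: "\<zero>\<^bsub>Y \<nu>'\<^esub> \<in> carrier (Y \<nu>')" if "\<nu>' \<in> I" for \<nu>'
  proof -
    interpret alg_module A "Y \<nu>'" by (rule Y[OF that])
    show ?thesis by simp
  qed
  have "\<exists>x\<in>carrier M. \<forall>\<nu>'\<in>I. \<forall>b'\<in>E \<nu>'. \<kappa> \<nu>' b' x = (if \<nu>' = \<nu> then y else \<zero>\<^bsub>Y \<nu>'\<^esub>)"
    using y z by (intro tensor_decompositionD(4)[OF dec]) auto
  then obtain x where "x \<in> carrier M"
    "\<forall>\<nu>'\<in>I. \<forall>b'\<in>E \<nu>'. \<kappa> \<nu>' b' x = (if \<nu>' = \<nu> then y else \<zero>\<^bsub>Y \<nu>'\<^esub>)" by (rule bexE)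
  then show thesis using \<nu> by (intro that[of x]) auto
qed

subsection \<open>Existence of a decomposition\<close>

text \<open>The multiplicity space of \<open>D\<close> in \<open>M\<close>. Homomorphisms are taken
  for the action recorded in \<open>M'\<close>, while \<open>M\<close> supplies the remaining
  action. Extensionality makes two of them equal once they agree on the carrier of
  \<open>D\<close>.\<close>

definition hom_space ::
  "(complex, 'c) module \<Rightarrow> ('c, 'd) module \<Rightarrow> ('c, 'm) module \<Rightarrow> ('a, 'm) module \<Rightarrow>
    ('a, 'd \<Rightarrow> 'm) module"
  where "hom_space C D M' M =
    \<lparr>carrier = module_hom C D M' \<inter> extensional (carrier D), monoid.mult = undefined, one = undefined,
     ring.zero = (\<lambda>d\<in>carrier D. \<zero>\<^bsub>M\<^esub>),
     add = (\<lambda>f g. \<lambda>d\<in>carrier D. f d \<oplus>\<^bsub>M\<^esub> g d),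
     module.smult = (\<lambda>a f. \<lambda>d\<in>carrier D. a \<odot>\<^bsub>M\<^esub> f d)\<rparr>"

locale commuting_actions = M: alg_module A M + M': alg_module C M'
  for A :: "(complex, 'a) module" and M :: "('a, 'm) module"
    and C :: "(complex, 'c) module" and M' :: "('c, 'm) module" +
  assumes carrier_eq: "carrier M' = carrier M" and add_eq: "add M' = add M"
    and zero_eq: "\<zero>\<^bsub>M'\<^esub> = \<zero>\<^bsub>M\<^esub>"
    and commute: "\<lbrakk>a \<in> carrier A; c \<in> carrier C; x \<in> carrier M\<rbrakk> \<Longrightarrow>
      a \<odot>\<^bsub>M\<^esub> (c \<odot>\<^bsub>M'\<^esub> x) = c \<odot>\<^bsub>M'\<^esub> (a \<odot>\<^bsub>M\<^esub> x)"
    and cscale_eq: "x \<in> carrier M \<Longrightarrow> cscale C M' z x = cscale A M z x"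
begin

lemma finsum_eq: "finsum M' f J = finsum M f J"
  by (simp add: finsum_def finprod_def carrier_eq add_eq zero_eq)

lemma smult'_closed [simp]: "c \<in> carrier C \<Longrightarrow> x \<in> carrier M \<Longrightarrow> c \<odot>\<^bsub>M'\<^esub> x \<in> carrier M"
  using M'.Mod.smult_closed[of c x] carrier_eq by simp

lemma hom_space_simps:
  "carrier (hom_space C D M' M) = module_hom C D M' \<inter> extensional (carrier D)"
  "\<zero>\<^bsub>hom_space C D M' M\<^esub> = (\<lambda>d\<in>carrier D. \<zero>\<^bsub>M\<^esub>)"
  "f \<oplus>\<^bsub>hom_space C D M' M\<^esub> g = (\<lambda>d\<in>carrier D. f d \<oplus>\<^bsub>M\<^esub> g d)"
  "a \<odot>\<^bsub>hom_space C D M' M\<^esub> f = (\<lambda>d\<in>carrier D. a \<odot>\<^bsub>M\<^esub> f d)"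
  by (simp_all add: hom_space_def)

lemma hom_restrict:
  assumes "alg_module C D" "f \<in> module_hom C D M'"
  shows "restrict f (carrier D) \<in> carrier (hom_space C D M' M)"
proof -
  interpret D: alg_module C D by fact
  show ?thesis using assms(2) by (auto simp: hom_space_simps module_hom_def)
qed

lemma hom_eqI:
  assumes "f \<in> carrier (hom_space C D M' M)" "g \<in> carrier (hom_space C D M' M)"
    and "\<And>d. d \<in> carrier D \<Longrightarrow> f d = g d"
  shows "f = g"
  using assms by (intro extensionalityI[of f "carrier D"]) (auto simp: hom_space_simps)

lemma hom_spaceD:
  assumes "f \<in> carrier (hom_space C D M' M)"
  shows "f \<in> module_hom C D M'" "d \<in> carrier D \<Longrightarrow> f d \<in> carrier M"
  using assms module_homD(1)[of f C D M' d] carrier_eq by (auto simp: hom_space_simps)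

text \<open>That multiplying the values by \<open>a\<close> turns homomorphisms into homomorphisms
  is the commutation of the two actions.\<close>

lemma alg_module_hom_space:
  assumes D: "alg_module C D"
  shows "alg_module A (hom_space C D M' M)"
proof -
  interpret D: alg_module C D by fact
  let ?Y = "hom_space C D M' M"
  have zero_closed: "\<zero>\<^bsub>?Y\<^esub> \<in> carrier ?Y" unfolding hom_space_simps(2)
    using M'.smult_zero
    by (intro hom_restrict[OF D]) (auto simp: module_hom_def carrier_eq add_eq zero_eq)
  have hD: "f d \<in> carrier M" "f (d \<oplus>\<^bsub>D\<^esub> e) = f d \<oplus>\<^bsub>M\<^esub> f e" "f (c \<odot>\<^bsub>D\<^esub> d) = c \<odot>\<^bsub>M'\<^esub> f d"
    if "f \<in> carrier ?Y" "d \<in> carrier D" "e \<in> carrier D" "c \<in> carrier C" for f d e c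
    using module_homD[OF hom_spaceD(1)[OF that(1)]] that carrier_eq add_eq by auto
  have add_closed: "f \<oplus>\<^bsub>?Y\<^esub> g \<in> carrier ?Y" if fg: "f \<in> carrier ?Y" "g \<in> carrier ?Y" for f g
    unfolding hom_space_simps(3)
  proof (rule hom_restrict[OF D])
    show "(\<lambda>d. f d \<oplus>\<^bsub>M\<^esub> g d) \<in> module_hom C D M'" unfolding module_hom_def
    proof (intro CollectI conjI ballI)
      show "(\<lambda>d. f d \<oplus>\<^bsub>M\<^esub> g d) \<in> carrier D \<rightarrow> carrier M'"
        using hom_spaceD(2)[OF fg(1)] hom_spaceD(2)[OF fg(2)] carrier_eq by auto
      fix d e assume "d \<in> carrier D" "e \<in> carrier D"
      then show "f (d \<oplus>\<^bsub>D\<^esub> e) \<oplus>\<^bsub>M\<^esub> g (d \<oplus>\<^bsub>D\<^esub> e) = f d \<oplus>\<^bsub>M\<^esub> g d \<oplus>\<^bsub>M'\<^esub> (f e \<oplus>\<^bsub>M\<^esub> g e)"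
        using hD(1,2)[OF fg(1) _ _ M'.scalar_closed] hD(1,2)[OF fg(2) _ _ M'.scalar_closed]
        by (simp add: add_eq M.Mod.M.a_ac)
    next
      fix c d assume "c \<in> carrier C" "d \<in> carrier D"
      then show "f (c \<odot>\<^bsub>D\<^esub> d) \<oplus>\<^bsub>M\<^esub> g (c \<odot>\<^bsub>D\<^esub> d) = c \<odot>\<^bsub>M'\<^esub> (f d \<oplus>\<^bsub>M\<^esub> g d)"
        using hD[OF fg(1)] hD[OF fg(2)] M'.Mod.smult_r_distr[of c "f d" "g d"] carrier_eq add_eq by simp
    qed
  qed
  have smult_closed: "a \<odot>\<^bsub>?Y\<^esub> f \<in> carrier ?Y" if a: "a \<in> carrier A" and f: "f \<in> carrier ?Y" for a f
    unfolding hom_space_simps(4)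
  proof (rule hom_restrict[OF D])
    show "(\<lambda>d. a \<odot>\<^bsub>M\<^esub> f d) \<in> module_hom C D M'" unfolding module_hom_def
    proof (intro CollectI conjI ballI)
      show "(\<lambda>d. a \<odot>\<^bsub>M\<^esub> f d) \<in> carrier D \<rightarrow> carrier M'" using hom_spaceD(2)[OF f] a carrier_eq by auto
      fix d e assume "d \<in> carrier D" "e \<in> carrier D"
      then show "a \<odot>\<^bsub>M\<^esub> f (d \<oplus>\<^bsub>D\<^esub> e) = a \<odot>\<^bsub>M\<^esub> f d \<oplus>\<^bsub>M'\<^esub> a \<odot>\<^bsub>M\<^esub> f e"
        using hD(1,2)[OF f _ _ M'.scalar_closed] a by (simp add: add_eq M.Mod.smult_r_distr)
    next
      fix c d assume "c \<in> carrier C" "d \<in> carrier D"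
      then show "a \<odot>\<^bsub>M\<^esub> f (c \<odot>\<^bsub>D\<^esub> d) = c \<odot>\<^bsub>M'\<^esub> (a \<odot>\<^bsub>M\<^esub> f d)" using hD[OF f] a commute by simp
    qed
  qed
  have "abelian_group ?Y"
  proof (rule abelian_groupI)
    fix f assume f: "f \<in> carrier ?Y"
    show "\<zero>\<^bsub>?Y\<^esub> \<oplus>\<^bsub>?Y\<^esub> f = f"
      using hom_spaceD(2)[OF f]
      by (intro hom_eqI[OF add_closed[OF zero_closed f] f]) (simp add: hom_space_simps(2,3))
    have n: "(\<ominus>\<^bsub>A\<^esub> \<one>\<^bsub>A\<^esub>) \<odot>\<^bsub>?Y\<^esub> f \<in> carrier ?Y"
      using ring.ring_simprules(3,6)[OF M.ring_algebra] by (intro smult_closed f) auto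
    have "(\<ominus>\<^bsub>A\<^esub> \<one>\<^bsub>A\<^esub>) \<odot>\<^bsub>?Y\<^esub> f \<oplus>\<^bsub>?Y\<^esub> f = \<zero>\<^bsub>?Y\<^esub>"
    proof (rule hom_eqI[OF add_closed[OF n f] zero_closed])
      fix d assume d: "d \<in> carrier D"
      interpret A: ring A by (rule M.ring_algebra)
      have "(\<ominus>\<^bsub>A\<^esub> \<one>\<^bsub>A\<^esub>) \<odot>\<^bsub>M\<^esub> f d \<oplus>\<^bsub>M\<^esub> \<one>\<^bsub>A\<^esub> \<odot>\<^bsub>M\<^esub> f d = \<zero>\<^bsub>M\<^esub>"
        using hom_spaceD(2)[OF f d] by (simp add: M.Mod.smult_l_distr[symmetric] abelian_group.l_neg[OF M.ab_group_algebra])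
      then show "((\<ominus>\<^bsub>A\<^esub> \<one>\<^bsub>A\<^esub>) \<odot>\<^bsub>?Y\<^esub> f \<oplus>\<^bsub>?Y\<^esub> f) d = \<zero>\<^bsub>?Y\<^esub> d"
        using d hom_spaceD(2)[OF f d] by (simp add: hom_space_simps M.Mod.smult_one)
    qed
    then show "\<exists>g\<in>carrier ?Y. g \<oplus>\<^bsub>?Y\<^esub> f = \<zero>\<^bsub>?Y\<^esub>" using n by (rule rev_bexI[rotated])
    fix g assume g: "g \<in> carrier ?Y"
    show "f \<oplus>\<^bsub>?Y\<^esub> g = g \<oplus>\<^bsub>?Y\<^esub> f"
      unfolding hom_space_simps(3) using hom_spaceD(2)[OF f] hom_spaceD(2)[OF g]
      by (intro restrict_ext) (simp add: M.Mod.M.a_comm)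
    fix h assume h: "h \<in> carrier ?Y"
    show "f \<oplus>\<^bsub>?Y\<^esub> g \<oplus>\<^bsub>?Y\<^esub> h = f \<oplus>\<^bsub>?Y\<^esub> (g \<oplus>\<^bsub>?Y\<^esub> h)"
      unfolding hom_space_simps(3) using hom_spaceD(2)[OF f] hom_spaceD(2)[OF g] hom_spaceD(2)[OF h]
      by (intro restrict_ext) (simp add: M.Mod.M.a_assoc)
  qed (use zero_closed add_closed in auto)
  moreover have "left_module_axioms A ?Y" unfolding left_module_axioms_def
  proof (intro conjI allI impI)
    fix a f assume a: "a \<in> carrier A" and f: "f \<in> carrier ?Y"
    note fD = hom_spaceD(2)[OF f]
    show "a \<odot>\<^bsub>?Y\<^esub> f \<in> carrier ?Y" by (rule smult_closed[OF a f])
    { fix b assume b: "b \<in> carrier A"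
      show "(a \<oplus>\<^bsub>A\<^esub> b) \<odot>\<^bsub>?Y\<^esub> f = a \<odot>\<^bsub>?Y\<^esub> f \<oplus>\<^bsub>?Y\<^esub> b \<odot>\<^bsub>?Y\<^esub> f"
        unfolding hom_space_simps(3,4) using fD a b by (intro restrict_ext) (simp add: M.Mod.smult_l_distr)
      show "(a \<otimes>\<^bsub>A\<^esub> b) \<odot>\<^bsub>?Y\<^esub> f = a \<odot>\<^bsub>?Y\<^esub> (b \<odot>\<^bsub>?Y\<^esub> f)"
        unfolding hom_space_simps(4) using fD a b by (intro restrict_ext) (simp add: M.Mod.smult_assoc) }
    fix g assume g: "g \<in> carrier ?Y"
    show "a \<odot>\<^bsub>?Y\<^esub> (f \<oplus>\<^bsub>?Y\<^esub> g) = a \<odot>\<^bsub>?Y\<^esub> f \<oplus>\<^bsub>?Y\<^esub> a \<odot>\<^bsub>?Y\<^esub> g"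
      unfolding hom_space_simps(3,4) using fD hom_spaceD(2)[OF g] a
      by (intro restrict_ext) (simp add: M.Mod.smult_r_distr)
  next
    fix f assume f: "f \<in> carrier ?Y"
    show "\<one>\<^bsub>A\<^esub> \<odot>\<^bsub>?Y\<^esub> f = f"
      using hom_spaceD(2)[OF f] ring.ring_simprules(6)[OF M.ring_algebra]
      by (intro hom_eqI[OF smult_closed[OF _ f] f]) (simp_all add: hom_space_simps(4) M.Mod.smult_one)
  qed
  ultimately show ?thesis
    using M.Alg.complex_algebra_axioms M.ring_algebra by (simp add: alg_module_def left_module_def)
qed

text \<open>
  With \<open>e \<nu> b d \<in> C\<close> acting as \<open>v \<mapsto> b\<^sup>*(v) d\<close> on \<open>D \<nu>\<close> and as zero on the other simple modules, the
  coordinates of \<open>x\<close> are the homomorphisms \<open>d \<mapsto> e \<nu> b d x\<close>.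
\<close>

lemma exists_tensor_decomposition:
  assumes D: "\<And>\<nu>. \<nu> \<in> I \<Longrightarrow> simple_module C (D \<nu>) \<and> fin_dim C (D \<nu>)"
    and noniso: "\<And>\<nu> \<nu>'. \<nu> \<in> I \<Longrightarrow> \<nu>' \<in> I \<Longrightarrow> isomorphic C (D \<nu>) (D \<nu>') \<Longrightarrow> \<nu> = \<nu>'"
    and fin: "finite I"
    and faithful: "\<And>c. c \<in> carrier C \<Longrightarrow>
      (\<And>\<nu> v. \<nu> \<in> I \<Longrightarrow> v \<in> carrier (D \<nu>) \<Longrightarrow> c \<odot>\<^bsub>D \<nu>\<^esub> v = \<zero>\<^bsub>D \<nu>\<^esub>) \<Longrightarrow> c = \<zero>\<^bsub>C\<^esub>"
    and E: "\<And>\<nu>. \<nu> \<in> I \<Longrightarrow> dual_basis C (D \<nu>) (E \<nu>) (\<delta> \<nu>)"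
  shows "\<exists>\<kappa>. tensor_decomposition A M C M' I (\<lambda>\<nu>. hom_space C (D \<nu>) M' M) D E \<delta> \<kappa>"
proof -
  interpret CR: ring C by (rule M'.ring_algebra)
  note C_finsum = abelian_monoid.finsum_closed[OF abelian_group.axioms(1)[OF M'.ab_group_algebra]]
  have Dm: "alg_module C (D \<nu>)" if "\<nu> \<in> I" for \<nu>
    using simple_alg_module[OF M'.Alg.complex_algebra_axioms] D[OF that] by blast
  have Dz: "\<zero>\<^bsub>D \<nu>\<^esub> \<in> carrier (D \<nu>)" if "\<nu> \<in> I" for \<nu>
  proof -
    interpret alg_module C "D \<nu>" by (rule Dm[OF that])
    show ?thesis by simp
  qed
  \<comment> \<open>Faithfulness for differences: identities in \<open>C\<close> may be checked on
    the modules D \<nu>.\<close>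
  have faith_eq: "c = c'" if c: "c \<in> carrier C" "c' \<in> carrier C"
    and eq: "\<And>\<nu> v. \<nu> \<in> I \<Longrightarrow> v \<in> carrier (D \<nu>) \<Longrightarrow> c \<odot>\<^bsub>D \<nu>\<^esub> v = c' \<odot>\<^bsub>D \<nu>\<^esub> v" for c c'
  proof -
    have "c \<ominus>\<^bsub>C\<^esub> c' = \<zero>\<^bsub>C\<^esub>"
    proof (rule faithful)
      fix \<nu> v assume \<nu>: "\<nu> \<in> I" "v \<in> carrier (D \<nu>)"
      interpret Dn: alg_module C "D \<nu>" by (rule Dm[OF \<nu>(1)])
      show "(c \<ominus>\<^bsub>C\<^esub> c') \<odot>\<^bsub>D \<nu>\<^esub> v = \<zero>\<^bsub>D \<nu>\<^esub>"
        using eq[OF \<nu>] c \<nu>(2) by (simp add: Dn.diff_smult Dn.Mod.M.minus_eq_zero_iff)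
    qed (use c in simp)
    then show ?thesis using c by (simp add: abelian_group.minus_eq_zero_iff[OF M'.ab_group_algebra])
  qed
  define R1 where "R1 \<nu> b d \<nu>' v = (if \<nu>' = \<nu> then cscale C (D \<nu>) (\<delta> \<nu> b v) d else \<zero>\<^bsub>D \<nu>'\<^esub>)" for \<nu> b d \<nu>' v
  have "\<exists>c. c \<in> carrier C \<and> (\<forall>\<nu>'\<in>I. \<forall>v\<in>carrier (D \<nu>'). c \<odot>\<^bsub>D \<nu>'\<^esub> v = R1 \<nu> b d \<nu>' v)"
    if \<nu>: "\<nu> \<in> I" and b: "b \<in> E \<nu>" and d: "d \<in> carrier (D \<nu>)" for \<nu> b d
  proof -
    interpret Dn: alg_module C "D \<nu>" by (rule Dm[OF \<nu>])
    note ED = dual_basisD[OF E[OF \<nu>]]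
    have sim: "simple_module C (D \<nu>)" and fd: "fin_dim C (D \<nu>)" using D[OF \<nu>] by auto
    have lin: "linear_map C (D \<nu>) C (D \<nu>) (\<lambda>v. cscale C (D \<nu>) (\<delta> \<nu> b v) d)"
      using d linear_formD[OF ED(3)[OF b]]
      by (auto simp: linear_map_def additive_map_def Dn.sc_add_left Dn.sc_mult)
    obtain c where c: "c \<in> carrier C" "\<And>v. v \<in> carrier (D \<nu>) \<Longrightarrow> c \<odot>\<^bsub>D \<nu>\<^esub> v = cscale C (D \<nu>) (\<delta> \<nu> b v) d"
      "\<And>j w. j \<in> I - {\<nu>} \<Longrightarrow> w \<in> carrier (D j) \<Longrightarrow> c \<odot>\<^bsub>D j\<^esub> w = \<zero>\<^bsub>D j\<^esub>"
    proof (rule Dn.density_separating[OF sim fd lin, of "I - {\<nu>}" D])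
      show "simple_module C (D j) \<and> fin_dim C (D j) \<and> \<not> isomorphic C (D j) (D \<nu>)" if "j \<in> I - {\<nu>}" for j
        using D noniso \<nu> that by auto
    qed (use fin in auto)
    then show ?thesis by (intro exI[of _ c]) (auto simp: R1_def)
  qed
  then have "\<exists>e. \<forall>\<nu> b d. \<nu> \<in> I \<longrightarrow> b \<in> E \<nu> \<longrightarrow> d \<in> carrier (D \<nu>) \<longrightarrow> e \<nu> b d \<in> carrier C \<and>
      (\<forall>\<nu>'\<in>I. \<forall>v\<in>carrier (D \<nu>'). e \<nu> b d \<odot>\<^bsub>D \<nu>'\<^esub> v = R1 \<nu> b d \<nu>' v)"
    by (intro exI[of _ "\<lambda>\<nu> b d. SOME c. c \<in> carrier C \<and> (\<forall>\<nu>'\<in>I. \<forall>v\<in>carrier (D \<nu>'). c \<odot>\<^bsub>D \<nu>'\<^esub> v = R1 \<nu> b d \<nu>' v)"]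
      allI impI) (rule someI_ex)
  then obtain e where e: "\<And>\<nu> b d. \<nu> \<in> I \<Longrightarrow> b \<in> E \<nu> \<Longrightarrow> d \<in> carrier (D \<nu>) \<Longrightarrow> e \<nu> b d \<in> carrier C \<and>
      (\<forall>\<nu>'\<in>I. \<forall>v\<in>carrier (D \<nu>'). e \<nu> b d \<odot>\<^bsub>D \<nu>'\<^esub> v = R1 \<nu> b d \<nu>' v)" by blast
  have ec: "e \<nu> b d \<in> carrier C" if "\<nu> \<in> I" "b \<in> E \<nu>" "d \<in> carrier (D \<nu>)" for \<nu> b d using e[OF that] by simp
  have ea: "e \<nu> b d \<odot>\<^bsub>D \<nu>'\<^esub> v = R1 \<nu> b d \<nu>' v"
    if "\<nu> \<in> I" "b \<in> E \<nu>" "d \<in> carrier (D \<nu>)" "\<nu>' \<in> I" "v \<in> carrier (D \<nu>')" for \<nu> b d \<nu>' v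
    using e[OF that(1-3)] that(4,5) by simp
  \<comment> \<open>Together with \<open>e_smult\<close> this says that d \<mapsto> e \<nu> b d is a
    homomorphism of left modules from D \<nu> to \<open>C\<close>, which is why the coordinates of x
    are homomorphisms.\<close>
  have e_add: "e \<nu> b (d \<oplus>\<^bsub>D \<nu>\<^esub> d') = e \<nu> b d \<oplus>\<^bsub>C\<^esub> e \<nu> b d'"
    if \<nu>: "\<nu> \<in> I" "b \<in> E \<nu>" and d: "d \<in> carrier (D \<nu>)" "d' \<in> carrier (D \<nu>)" for \<nu> b d d'
  proof (rule faith_eq)
    interpret Dn: alg_module C "D \<nu>" by (rule Dm[OF \<nu>(1)])
    have dd: "d \<oplus>\<^bsub>D \<nu>\<^esub> d' \<in> carrier (D \<nu>)" using d by simp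
    show "e \<nu> b (d \<oplus>\<^bsub>D \<nu>\<^esub> d') \<in> carrier C" by (rule ec[OF \<nu> dd])
    show "e \<nu> b d \<oplus>\<^bsub>C\<^esub> e \<nu> b d' \<in> carrier C" using ec[OF \<nu>] d by simp
    fix \<nu>' v assume \<nu>': "\<nu>' \<in> I" and v: "v \<in> carrier (D \<nu>')"
    interpret D': alg_module C "D \<nu>'" by (rule Dm[OF \<nu>'])
    show "e \<nu> b (d \<oplus>\<^bsub>D \<nu>\<^esub> d') \<odot>\<^bsub>D \<nu>'\<^esub> v = (e \<nu> b d \<oplus>\<^bsub>C\<^esub> e \<nu> b d') \<odot>\<^bsub>D \<nu>'\<^esub> v"
      using ea[OF \<nu> _ \<nu>' v] ec[OF \<nu>] d dd v
      by (simp add: D'.Mod.smult_l_distr R1_def Dn.sc_add_right)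
  qed
  have e_smult: "e \<nu> b (c \<odot>\<^bsub>D \<nu>\<^esub> d) = c \<otimes>\<^bsub>C\<^esub> e \<nu> b d"
    if \<nu>: "\<nu> \<in> I" "b \<in> E \<nu>" and d: "d \<in> carrier (D \<nu>)" and c: "c \<in> carrier C" for \<nu> b d c
  proof (rule faith_eq)
    interpret Dn: alg_module C "D \<nu>" by (rule Dm[OF \<nu>(1)])
    have dd: "c \<odot>\<^bsub>D \<nu>\<^esub> d \<in> carrier (D \<nu>)" using d c by simp
    show "e \<nu> b (c \<odot>\<^bsub>D \<nu>\<^esub> d) \<in> carrier C" by (rule ec[OF \<nu> dd])
    show "c \<otimes>\<^bsub>C\<^esub> e \<nu> b d \<in> carrier C" using ec[OF \<nu> d] c by simp
    fix \<nu>' v assume \<nu>': "\<nu>' \<in> I" and v: "v \<in> carrier (D \<nu>')"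
    interpret D': alg_module C "D \<nu>'" by (rule Dm[OF \<nu>'])
    show "e \<nu> b (c \<odot>\<^bsub>D \<nu>\<^esub> d) \<odot>\<^bsub>D \<nu>'\<^esub> v = (c \<otimes>\<^bsub>C\<^esub> e \<nu> b d) \<odot>\<^bsub>D \<nu>'\<^esub> v"
      using ea[OF \<nu> _ \<nu>' v] ec[OF \<nu>] d dd v c
      by (simp add: D'.Mod.smult_assoc R1_def Dn.smult_sc)
  qed
  \<comment> \<open>Right multiplication by \<open>c\<close> transforms these elements as
    precomposition with \<open>c\<close> transforms the coordinate forms: \<delta> \<nu> b (c v) is
    the sum of \<delta> \<nu> b (c b') * \<delta> \<nu> b' v. This gives the rule for the
    coordinates of c x.\<close>
  have e_mult: "e \<nu> b d \<otimes>\<^bsub>C\<^esub> c = (\<Oplus>\<^bsub>C\<^esub>b'\<in>E \<nu>. \<delta> \<nu> b (c \<odot>\<^bsub>D \<nu>\<^esub> b') \<odot>\<^bsub>C\<^esub> e \<nu> b' d)"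
    if \<nu>: "\<nu> \<in> I" "b \<in> E \<nu>" and d: "d \<in> carrier (D \<nu>)" and c: "c \<in> carrier C" for \<nu> b d c
  proof (rule faith_eq)
    interpret Dn: alg_module C "D \<nu>" by (rule Dm[OF \<nu>(1)])
    note ED = dual_basisD[OF E[OF \<nu>(1)]]
    have cl: "(\<lambda>b'. \<delta> \<nu> b (c \<odot>\<^bsub>D \<nu>\<^esub> b') \<odot>\<^bsub>C\<^esub> e \<nu> b' d) \<in> E \<nu> \<rightarrow> carrier C" using ec[OF \<nu>(1) _ d] by auto
    show "e \<nu> b d \<otimes>\<^bsub>C\<^esub> c \<in> carrier C" using ec[OF \<nu> d] c by simp
    show "(\<Oplus>\<^bsub>C\<^esub>b'\<in>E \<nu>. \<delta> \<nu> b (c \<odot>\<^bsub>D \<nu>\<^esub> b') \<odot>\<^bsub>C\<^esub> e \<nu> b' d) \<in> carrier C" by (rule C_finsum[OF cl])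
    fix \<nu>' v assume \<nu>': "\<nu>' \<in> I" and v: "v \<in> carrier (D \<nu>')"
    interpret D': alg_module C "D \<nu>'" by (rule Dm[OF \<nu>'])
    have cv: "c \<odot>\<^bsub>D \<nu>'\<^esub> v \<in> carrier (D \<nu>')" using c v by simp
    have "(\<Oplus>\<^bsub>C\<^esub>b'\<in>E \<nu>. \<delta> \<nu> b (c \<odot>\<^bsub>D \<nu>\<^esub> b') \<odot>\<^bsub>C\<^esub> e \<nu> b' d) \<odot>\<^bsub>D \<nu>'\<^esub> v
        = (\<Oplus>\<^bsub>D \<nu>'\<^esub>b'\<in>E \<nu>. (\<delta> \<nu> b (c \<odot>\<^bsub>D \<nu>\<^esub> b') \<odot>\<^bsub>C\<^esub> e \<nu> b' d) \<odot>\<^bsub>D \<nu>'\<^esub> v)"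
      by (rule D'.finsum_smult[OF v cl])
    also have "\<dots> = (\<Oplus>\<^bsub>D \<nu>'\<^esub>b'\<in>E \<nu>. cscale C (D \<nu>') (\<delta> \<nu> b (c \<odot>\<^bsub>D \<nu>\<^esub> b')) (R1 \<nu> b' d \<nu>' v))"
      using ea[OF \<nu>(1) _ d \<nu>' v] ec[OF \<nu>(1) _ d] v d
      by (intro D'.Mod.M.finsum_cong') (auto simp: D'.smult_sc_left R1_def)
    also have "\<dots> = R1 \<nu> b d \<nu>' (c \<odot>\<^bsub>D \<nu>'\<^esub> v)"
    proof (cases "\<nu>' = \<nu>")
      case True
      have lin: "linear_form C (D \<nu>) (\<lambda>v. \<delta> \<nu> b (c \<odot>\<^bsub>D \<nu>\<^esub> v))"
        by (rule Dn.linear_form_smult[OF ED(3)[OF \<nu>(2)] c])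
      have "v \<in> carrier (D \<nu>)" using v True by simp
      then have "\<delta> \<nu> b (c \<odot>\<^bsub>D \<nu>\<^esub> v) = \<delta> \<nu> b (c \<odot>\<^bsub>D \<nu>\<^esub> (\<Oplus>\<^bsub>D \<nu>\<^esub>b'\<in>E \<nu>. cscale C (D \<nu>) (\<delta> \<nu> b' v) b'))"
        using ED(5)[of v] by simp
      also have "\<dots> = (\<Sum>b'\<in>E \<nu>. \<delta> \<nu> b (c \<odot>\<^bsub>D \<nu>\<^esub> cscale C (D \<nu>) (\<delta> \<nu> b' v) b'))"
        using ED(2) by (intro Dn.linear_form_finsum[OF lin]) auto
      also have "\<dots> = (\<Sum>b'\<in>E \<nu>. \<delta> \<nu> b (c \<odot>\<^bsub>D \<nu>\<^esub> b') * \<delta> \<nu> b' v)"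
        using ED(2) linear_formD(2)[OF lin] by (intro sum.cong) (auto simp: mult.commute)
      finally have *: "\<delta> \<nu> b (c \<odot>\<^bsub>D \<nu>\<^esub> v) = (\<Sum>b'\<in>E \<nu>. \<delta> \<nu> b (c \<odot>\<^bsub>D \<nu>\<^esub> b') * \<delta> \<nu> b' v)" .
      have "(\<Oplus>\<^bsub>D \<nu>\<^esub>b'\<in>E \<nu>. cscale C (D \<nu>) (\<delta> \<nu> b (c \<odot>\<^bsub>D \<nu>\<^esub> b')) (R1 \<nu> b' d \<nu> v))
          = (\<Oplus>\<^bsub>D \<nu>\<^esub>b'\<in>E \<nu>. cscale C (D \<nu>) (\<delta> \<nu> b (c \<odot>\<^bsub>D \<nu>\<^esub> b') * \<delta> \<nu> b' v) d)"
        using d by (intro Dn.Mod.M.finsum_cong') (auto simp: R1_def Dn.sc_mult)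
      also have "\<dots> = cscale C (D \<nu>) (\<delta> \<nu> b (c \<odot>\<^bsub>D \<nu>\<^esub> v)) d" unfolding * by (rule Dn.finsum_sc_left[OF d])
      finally show ?thesis using True by (simp add: R1_def)
    next
      case False
      then have "(\<Oplus>\<^bsub>D \<nu>'\<^esub>b'\<in>E \<nu>. cscale C (D \<nu>') (\<delta> \<nu> b (c \<odot>\<^bsub>D \<nu>\<^esub> b')) (R1 \<nu> b' d \<nu>' v))
          = (\<Oplus>\<^bsub>D \<nu>'\<^esub>b'\<in>E \<nu>. \<zero>\<^bsub>D \<nu>'\<^esub>)"
        by (intro D'.Mod.M.finsum_cong') (auto simp: R1_def)
      then show ?thesis using False D'.Mod.M.finsum_zero[of "E \<nu>"] by (simp add: R1_def)
    qed
    also have "\<dots> = (e \<nu> b d \<otimes>\<^bsub>C\<^esub> c) \<odot>\<^bsub>D \<nu>'\<^esub> v"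
      using ea[OF \<nu> d \<nu>' cv] ec[OF \<nu> d] c v by (simp add: D'.Mod.smult_assoc)
    finally show "(e \<nu> b d \<otimes>\<^bsub>C\<^esub> c) \<odot>\<^bsub>D \<nu>'\<^esub> v
        = (\<Oplus>\<^bsub>C\<^esub>b'\<in>E \<nu>. \<delta> \<nu> b (c \<odot>\<^bsub>D \<nu>\<^esub> b') \<odot>\<^bsub>C\<^esub> e \<nu> b' d) \<odot>\<^bsub>D \<nu>'\<^esub> v" by (rule sym)
  qed
  let ?K = "SIGMA \<nu>:I. E \<nu>"
  have finK: "finite ?K" using fin dual_basisD(1)[OF E] by auto
  have Ec: "b \<in> carrier (D \<nu>)" if "\<nu> \<in> I" "b \<in> E \<nu>" for \<nu> b using dual_basisD(2)[OF E[OF that(1)] that(2)] .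
  have kcl: "(\<lambda>k. e (fst k) (snd k) (snd k)) \<in> ?K \<rightarrow> carrier C" using ec Ec by auto
  \<comment> \<open>The identity of each D \<nu> is the sum of the rank one operators belonging to
    its basis vectors; the elements for the other indices act as zero.\<close>
  have e_one: "\<one>\<^bsub>C\<^esub> = (\<Oplus>\<^bsub>C\<^esub>k\<in>?K. e (fst k) (snd k) (snd k))"
  proof (rule faith_eq)
    show "(\<Oplus>\<^bsub>C\<^esub>k\<in>?K. e (fst k) (snd k) (snd k)) \<in> carrier C" by (rule C_finsum[OF kcl])
    fix \<nu> v assume \<nu>: "\<nu> \<in> I" and v: "v \<in> carrier (D \<nu>)"
    interpret Dn: alg_module C "D \<nu>" by (rule Dm[OF \<nu>])
    note ED = dual_basisD[OF E[OF \<nu>]]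
    have "(\<Oplus>\<^bsub>C\<^esub>k\<in>?K. e (fst k) (snd k) (snd k)) \<odot>\<^bsub>D \<nu>\<^esub> v
        = (\<Oplus>\<^bsub>D \<nu>\<^esub>k\<in>?K. e (fst k) (snd k) (snd k) \<odot>\<^bsub>D \<nu>\<^esub> v)"
      by (rule Dn.finsum_smult[OF v kcl])
    also have "\<dots> = v"
    proof (rule Dn.eq_by_forms)
      show "(\<Oplus>\<^bsub>D \<nu>\<^esub>k\<in>?K. e (fst k) (snd k) (snd k) \<odot>\<^bsub>D \<nu>\<^esub> v) \<in> carrier (D \<nu>)"
        using ec Ec v by (intro Dn.Mod.M.finsum_closed) auto
      fix f assume f: "linear_form C (D \<nu>) f"
      have "f (\<Oplus>\<^bsub>D \<nu>\<^esub>k\<in>?K. e (fst k) (snd k) (snd k) \<odot>\<^bsub>D \<nu>\<^esub> v)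
          = (\<Sum>k\<in>?K. f (e (fst k) (snd k) (snd k) \<odot>\<^bsub>D \<nu>\<^esub> v))"
        using ec Ec v by (intro Dn.linear_form_finsum[OF f]) auto
      also have "\<dots> = (\<Sum>(\<nu>', b)\<in>?K. if \<nu>' = \<nu> then \<delta> \<nu>' b v * f b else 0)"
        using ea Ec \<nu> v linear_formD(2)[OF f] Dn.linear_form_zero[OF f]
        by (intro sum.cong) (auto simp: R1_def)
      also have "\<dots> = (\<Sum>\<nu>'\<in>I. \<Sum>b\<in>E \<nu>'. if \<nu>' = \<nu> then \<delta> \<nu>' b v * f b else 0)"
        using fin dual_basisD(1)[OF E] by (intro sum.Sigma[symmetric]) auto
      also have "\<dots> = (\<Sum>\<nu>'\<in>I. if \<nu>' = \<nu> then \<Sum>b\<in>E \<nu>'. \<delta> \<nu>' b v * f b else 0)"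
        by (intro sum.cong) auto
      also have "\<dots> = (\<Sum>b\<in>E \<nu>. \<delta> \<nu> b v * f b)" using fin \<nu> by simp
      also have "\<dots> = (\<Sum>b\<in>E \<nu>. f (cscale C (D \<nu>) (\<delta> \<nu> b v) b))"
        using ED(2) linear_formD(2)[OF f] by (intro sum.cong) auto
      also have "\<dots> = f (\<Oplus>\<^bsub>D \<nu>\<^esub>b\<in>E \<nu>. cscale C (D \<nu>) (\<delta> \<nu> b v) b)"
        using ED(2) by (intro Dn.linear_form_finsum[OF f, symmetric]) auto
      also have "\<dots> = f v" using ED(5)[OF v] by simp
      finally show "f (\<Oplus>\<^bsub>D \<nu>\<^esub>k\<in>?K. e (fst k) (snd k) (snd k) \<odot>\<^bsub>D \<nu>\<^esub> v) = f v" .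
    qed (rule v)
    also have "\<dots> = \<one>\<^bsub>C\<^esub> \<odot>\<^bsub>D \<nu>\<^esub> v" using v by (simp add: Dn.Mod.smult_one)
    finally show "\<one>\<^bsub>C\<^esub> \<odot>\<^bsub>D \<nu>\<^esub> v = (\<Oplus>\<^bsub>C\<^esub>k\<in>?K. e (fst k) (snd k) (snd k)) \<odot>\<^bsub>D \<nu>\<^esub> v" by (rule sym)
  qed simp
  define Y where "Y \<nu> = hom_space C (D \<nu>) M' M" for \<nu>
  define \<kappa> where "\<kappa> \<nu> b x = (\<lambda>d\<in>carrier (D \<nu>). e \<nu> b d \<odot>\<^bsub>M'\<^esub> x)" for \<nu> b x
  have Ym: "alg_module A (Y \<nu>)" if "\<nu> \<in> I" for \<nu> unfolding Y_def by (rule alg_module_hom_space[OF Dm[OF that]])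
  have kc: "\<kappa> \<nu> b x \<in> carrier (Y \<nu>)" if \<nu>: "\<nu> \<in> I" "b \<in> E \<nu>" and x: "x \<in> carrier M" for \<nu> b x
    unfolding Y_def \<kappa>_def
  proof (rule hom_restrict[OF Dm[OF \<nu>(1)]])
    show "(\<lambda>d. e \<nu> b d \<odot>\<^bsub>M'\<^esub> x) \<in> module_hom C (D \<nu>) M'"
      using ec[OF \<nu>] x carrier_eq M'.Mod.smult_l_distr[of _ _ x] M'.Mod.smult_assoc[of _ _ x]
      by (auto simp: module_hom_def e_add \<nu> e_smult)
  qed
  have eval: "additive_map (Y \<nu>) M (\<lambda>f. f d)" if "d \<in> carrier (D \<nu>)" for \<nu> d
    using that hom_spaceD(2)[of _ "D \<nu>" d] by (auto simp: additive_map_def Y_def hom_space_simps(3))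
  have cs: "cscale A (Y \<nu>) z f d = cscale A M z (f d)" if "d \<in> carrier (D \<nu>)" for \<nu> z f d
    using that by (simp add: cscale_def Y_def hom_space_simps(4))
  have "tensor_decomposition A M C M' I Y D E \<delta> \<kappa>" unfolding tensor_decomposition_def
  proof (intro conjI ballI allI impI)
    fix \<nu> b assume \<nu>: "\<nu> \<in> I" and b: "b \<in> E \<nu>"
    interpret Dn: alg_module C "D \<nu>" by (rule Dm[OF \<nu>])
    interpret Yn: alg_module A "Y \<nu>" by (rule Ym[OF \<nu>])
    show "\<kappa> \<nu> b \<in> module_hom A M (Y \<nu>)" unfolding module_hom_def
    proof (intro CollectI conjI ballI)
      show "\<kappa> \<nu> b \<in> carrier M \<rightarrow> carrier (Y \<nu>)" using kc \<nu> b by auto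
      fix x assume x: "x \<in> carrier M"
      show "\<kappa> \<nu> b (x \<oplus>\<^bsub>M\<^esub> y) = \<kappa> \<nu> b x \<oplus>\<^bsub>Y \<nu>\<^esub> \<kappa> \<nu> b y" if y: "y \<in> carrier M" for y
        using M'.Mod.smult_r_distr[OF ec[OF \<nu> b], of _ x y] x y carrier_eq add_eq
        by (auto simp: \<kappa>_def Y_def hom_space_simps(3) intro!: restrict_ext)
      show "\<kappa> \<nu> b (a \<odot>\<^bsub>M\<^esub> x) = a \<odot>\<^bsub>Y \<nu>\<^esub> \<kappa> \<nu> b x" if a: "a \<in> carrier A" for a
        using commute[OF a ec[OF \<nu> b] x]
        by (auto simp: \<kappa>_def Y_def hom_space_simps(4) intro!: restrict_ext)
    qed
    fix c x assume c: "c \<in> carrier C" and x: "x \<in> carrier M"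
    let ?f = "\<lambda>b'. cscale A (Y \<nu>) (\<delta> \<nu> b (c \<odot>\<^bsub>D \<nu>\<^esub> b')) (\<kappa> \<nu> b' x)"
    have fcl: "?f \<in> E \<nu> \<rightarrow> carrier (Y \<nu>)" using kc[OF \<nu> _ x] by auto
    have cx: "c \<odot>\<^bsub>M'\<^esub> x \<in> carrier M" using c x by simp
    have x': "x \<in> carrier M'" using x carrier_eq by simp
    show "\<kappa> \<nu> b (c \<odot>\<^bsub>M'\<^esub> x) = (\<Oplus>\<^bsub>Y \<nu>\<^esub>b'\<in>E \<nu>. ?f b')"
    proof (rule hom_eqI[of _ "D \<nu>"])
      show "\<kappa> \<nu> b (c \<odot>\<^bsub>M'\<^esub> x) \<in> carrier (hom_space C (D \<nu>) M' M)" using kc[OF \<nu> b cx] by (simp add: Y_def)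
      show "(\<Oplus>\<^bsub>Y \<nu>\<^esub>b'\<in>E \<nu>. ?f b') \<in> carrier (hom_space C (D \<nu>) M' M)"
        using Yn.Mod.M.finsum_closed[OF fcl] by (simp add: Y_def)
      fix d assume d: "d \<in> carrier (D \<nu>)"
      have ecl: "(\<lambda>b'. \<delta> \<nu> b (c \<odot>\<^bsub>D \<nu>\<^esub> b') \<odot>\<^bsub>C\<^esub> e \<nu> b' d) \<in> E \<nu> \<rightarrow> carrier C" using ec[OF \<nu> _ d] by auto
      have "\<kappa> \<nu> b (c \<odot>\<^bsub>M'\<^esub> x) d = (e \<nu> b d \<otimes>\<^bsub>C\<^esub> c) \<odot>\<^bsub>M'\<^esub> x"
        using d ec[OF \<nu> b d] c x' by (simp add: \<kappa>_def M'.Mod.smult_assoc)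
      also have "\<dots> = (\<Oplus>\<^bsub>M'\<^esub>b'\<in>E \<nu>. (\<delta> \<nu> b (c \<odot>\<^bsub>D \<nu>\<^esub> b') \<odot>\<^bsub>C\<^esub> e \<nu> b' d) \<odot>\<^bsub>M'\<^esub> x)"
        unfolding e_mult[OF \<nu> b d c] by (rule M'.finsum_smult[OF x' ecl])
      also have "\<dots> = (\<Oplus>\<^bsub>M\<^esub>b'\<in>E \<nu>. ?f b' d)"
        unfolding finsum_eq
        using ec[OF \<nu> _ d] x x' d kc[OF \<nu> _ x] hom_spaceD(2)[of _ "D \<nu>" d]
        by (intro M.Mod.M.finsum_cong') (auto simp: cs M'.smult_sc_left cscale_eq \<kappa>_def)
      also have "\<dots> = (\<Oplus>\<^bsub>Y \<nu>\<^esub>b'\<in>E \<nu>. ?f b') d"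
        using additive_map_finsum[OF Yn.ab_group M.ab_group eval[OF d] fcl] by simp
      finally show "\<kappa> \<nu> b (c \<odot>\<^bsub>M'\<^esub> x) d = (\<Oplus>\<^bsub>Y \<nu>\<^esub>b'\<in>E \<nu>. ?f b') d" .
    qed
  next
    fix x x' assume xx: "x \<in> carrier M" "x' \<in> carrier M" and eq: "\<forall>\<nu>\<in>I. \<forall>b\<in>E \<nu>. \<kappa> \<nu> b x = \<kappa> \<nu> b x'"
    \<comment> \<open>An element is recovered from its coordinates by expanding the unit of
      \<open>C\<close>.\<close>
    have *: "z = (\<Oplus>\<^bsub>M'\<^esub>k\<in>?K. \<kappa> (fst k) (snd k) z (snd k))" if z: "z \<in> carrier M" for z
    proof -
      have z': "z \<in> carrier M'" using z carrier_eq by simp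
      have "z = \<one>\<^bsub>C\<^esub> \<odot>\<^bsub>M'\<^esub> z" using z' by (simp add: M'.Mod.smult_one)
      also have "\<dots> = (\<Oplus>\<^bsub>M'\<^esub>k\<in>?K. e (fst k) (snd k) (snd k) \<odot>\<^bsub>M'\<^esub> z)"
        unfolding e_one by (rule M'.finsum_smult[OF z' kcl])
      also have "\<dots> = (\<Oplus>\<^bsub>M'\<^esub>k\<in>?K. \<kappa> (fst k) (snd k) z (snd k))"
        using ec Ec z' by (intro M'.Mod.M.finsum_cong') (auto simp: \<kappa>_def)
      finally show ?thesis .
    qed
    have "(\<Oplus>\<^bsub>M'\<^esub>k\<in>?K. \<kappa> (fst k) (snd k) x (snd k)) = (\<Oplus>\<^bsub>M'\<^esub>k\<in>?K. \<kappa> (fst k) (snd k) x' (snd k))"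
    proof (rule M'.Mod.M.finsum_cong')
      have "\<kappa> \<nu> b x' b \<in> carrier M" if "\<nu> \<in> I" "b \<in> E \<nu>" for \<nu> b
        using ec[OF that] Ec[OF that] xx(2) by (simp add: \<kappa>_def)
      then show "(\<lambda>k. \<kappa> (fst k) (snd k) x' (snd k)) \<in> ?K \<rightarrow> carrier M'" using carrier_eq by auto
    qed (use eq in auto)
    then show "x = x'" using *[OF xx(1)] *[OF xx(2)] by simp
  next
    fix \<eta> assume \<eta>: "\<forall>\<nu>\<in>I. \<forall>b\<in>E \<nu>. \<eta> \<nu> b \<in> carrier (Y \<nu>)"
    have hom: "\<eta> \<nu> b \<in> module_hom C (D \<nu>) M'" if "\<nu> \<in> I" "b \<in> E \<nu>" for \<nu> b
      using \<eta> that hom_spaceD(1) unfolding Y_def by blast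
    have cl: "(\<lambda>k. \<eta> (fst k) (snd k) (snd k)) \<in> ?K \<rightarrow> carrier M'"
      using module_homD(1)[OF hom] Ec by auto
    \<comment> \<open>The element with prescribed coordinates is the image of the sum of the tensors
      \<eta> \<nu> b \<otimes> b under evaluation.\<close>
    define x where "x = (\<Oplus>\<^bsub>M'\<^esub>k\<in>?K. \<eta> (fst k) (snd k) (snd k))"
    have x: "x \<in> carrier M" unfolding x_def using M'.Mod.M.finsum_closed[OF cl] carrier_eq by simp
    have "\<kappa> \<nu> b x = \<eta> \<nu> b" if \<nu>: "\<nu> \<in> I" "b \<in> E \<nu>" for \<nu> b
    proof (rule hom_eqI[of _ "D \<nu>"])
      show "\<kappa> \<nu> b x \<in> carrier (hom_space C (D \<nu>) M' M)" using kc[OF \<nu> x] by (simp add: Y_def)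
      show "\<eta> \<nu> b \<in> carrier (hom_space C (D \<nu>) M' M)" using \<eta> \<nu> by (simp add: Y_def)
      fix d assume d: "d \<in> carrier (D \<nu>)"
      have "\<kappa> \<nu> b x d = (\<Oplus>\<^bsub>M'\<^esub>k\<in>?K. e \<nu> b d \<odot>\<^bsub>M'\<^esub> \<eta> (fst k) (snd k) (snd k))"
        using d M'.smult_finsum[OF ec[OF \<nu> d] cl] by (simp add: \<kappa>_def x_def)
      also have "\<dots> = \<eta> \<nu> b d"
      proof (rule abelian_finsum_delta[OF M'.ab_group finK, of "(\<nu>, b)"])
        fix k assume "k \<in> ?K"
        then obtain \<nu>' b' where k: "k = (\<nu>', b')" "\<nu>' \<in> I" "b' \<in> E \<nu>'" by auto
        interpret Dk: alg_module C "D \<nu>'" by (rule Dm[OF k(2)])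
        interpret D0: alg_module C "D \<nu>" by (rule Dm[OF \<nu>(1)])
        have hz: "\<eta> \<nu>' b' \<zero>\<^bsub>D \<nu>'\<^esub> = \<zero>\<^bsub>M'\<^esub>"
          by (rule additive_map_zero[OF Dk.ab_group M'.ab_group module_hom_additive[OF hom[OF k(2,3)]]])
        have "e \<nu> b d \<odot>\<^bsub>M'\<^esub> \<eta> \<nu>' b' b' = \<eta> \<nu>' b' (e \<nu> b d \<odot>\<^bsub>D \<nu>'\<^esub> b')"
          using module_homD(3)[OF hom[OF k(2,3)] ec[OF \<nu> d] Ec[OF k(2,3)]] by simp
        also have "e \<nu> b d \<odot>\<^bsub>D \<nu>'\<^esub> b' = R1 \<nu> b d \<nu>' b'" by (rule ea[OF \<nu> d k(2) Ec[OF k(2,3)]])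
        also have "\<dots> = (if k = (\<nu>, b) then d else \<zero>\<^bsub>D \<nu>'\<^esub>)"
          using k d \<nu> dual_basisD(4)[OF E[OF \<nu>(1)] \<nu>(2)] D0.sc_one D0.sc_zero_left
          by (auto simp: R1_def)
        finally show "e \<nu> b d \<odot>\<^bsub>M'\<^esub> \<eta> (fst k) (snd k) (snd k) = (if k = (\<nu>, b) then \<eta> \<nu> b d else \<zero>\<^bsub>M'\<^esub>)"
          using k(1) hz by auto
      qed (use \<nu> module_homD(1)[OF hom[OF \<nu>] d] in auto)
      finally show "\<kappa> \<nu> b x d = \<eta> \<nu> b d" .
    qed
    then show "\<exists>x\<in>carrier M. \<forall>\<nu>\<in>I. \<forall>b\<in>E \<nu>. \<kappa> \<nu> b x = \<eta> \<nu> b" using x by (intro bexI[of _ x]) auto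
  qed
  then show ?thesis unfolding Y_def[abs_def] by (intro exI[of _ \<kappa>])
qed

end

subsection \<open>Finite groups acting on algebras\<close>

locale finite_action = R?: ring R + G: group G
  for R :: "(complex, 'r) module" and G :: "'g monoid" and act :: "'g \<Rightarrow> 'r \<Rightarrow> 'r" +
  assumes action: "algebra_action R G act" and finite_group: "finite (carrier G)"
begin

abbreviation "RG \<equiv> fixed_ring R G act"

lemma algR: "complex_algebra R"
  using action by (simp add: algebra_action_def)

lemma act_ring_hom: "g \<in> carrier G \<Longrightarrow> act g \<in> ring_hom R R"
  and act_smult: "g \<in> carrier G \<Longrightarrow> x \<in> carrier R \<Longrightarrow> act g (c \<odot>\<^bsub>R\<^esub> x) = c \<odot>\<^bsub>R\<^esub> act g x"
  using action by (auto simp: algebra_action_def algebra_action_axioms_def)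

lemma act_closed [simp]: "g \<in> carrier G \<Longrightarrow> x \<in> carrier R \<Longrightarrow> act g x \<in> carrier R"
  and act_add: "g \<in> carrier G \<Longrightarrow> x \<in> carrier R \<Longrightarrow> y \<in> carrier R \<Longrightarrow>
    act g (x \<oplus>\<^bsub>R\<^esub> y) = act g x \<oplus>\<^bsub>R\<^esub> act g y"
  and act_mult: "g \<in> carrier G \<Longrightarrow> x \<in> carrier R \<Longrightarrow> y \<in> carrier R \<Longrightarrow>
    act g (x \<otimes>\<^bsub>R\<^esub> y) = act g x \<otimes>\<^bsub>R\<^esub> act g y"
  and act_ring_one [simp]: "g \<in> carrier G \<Longrightarrow> act g \<one>\<^bsub>R\<^esub> = \<one>\<^bsub>R\<^esub>"
  by (rule ring_hom_closed[OF act_ring_hom] ring_hom_add[OF act_ring_hom]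
      ring_hom_mult[OF act_ring_hom] ring_hom_one[OF act_ring_hom]; assumption)+

lemma act_comp: "g \<in> carrier G \<Longrightarrow> h \<in> carrier G \<Longrightarrow> x \<in> carrier R \<Longrightarrow>
    act (g \<otimes>\<^bsub>G\<^esub> h) x = act g (act h x)"
  and act_id [simp]: "x \<in> carrier R \<Longrightarrow> act \<one>\<^bsub>G\<^esub> x = x"
proof -
  interpret act: group_action G "carrier R" act using action by (simp add: algebra_action_def)
  show "g \<in> carrier G \<Longrightarrow> h \<in> carrier G \<Longrightarrow> x \<in> carrier R \<Longrightarrow>
      act (g \<otimes>\<^bsub>G\<^esub> h) x = act g (act h x)"
    by (rule act.composition_rule)
  show "x \<in> carrier R \<Longrightarrow> act \<one>\<^bsub>G\<^esub> x = x" using act.id_eq_one by (simp add: fun_eq_iff restrict_def split: if_splits)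
qed

lemma act_inv [simp]: "g \<in> carrier G \<Longrightarrow> x \<in> carrier R \<Longrightarrow> act (inv\<^bsub>G\<^esub> g) (act g x) = x"
  using act_comp[of "inv\<^bsub>G\<^esub> g" g x] by simp

lemma act_additive: "g \<in> carrier G \<Longrightarrow> additive_map R R (act g)"
  by (auto simp: additive_map_def act_add)

lemma RG_carrier: "carrier RG = {r \<in> carrier R. \<forall>g\<in>carrier G. act g r = r}"
  and RG_simps [simp]: "add RG = add R" "\<zero>\<^bsub>RG\<^esub> = \<zero>\<^bsub>R\<^esub>" "\<one>\<^bsub>RG\<^esub> = \<one>\<^bsub>R\<^esub>"
    "monoid.mult RG = monoid.mult R" "module.smult RG = module.smult R"
  by (simp_all add: fixed_ring_def)

lemma RG_sub: "r \<in> carrier RG \<Longrightarrow> r \<in> carrier R"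
  and RG_fixed: "r \<in> carrier RG \<Longrightarrow> g \<in> carrier G \<Longrightarrow> act g r = r"
  by (auto simp: RG_carrier)

lemma algRG: "complex_algebra RG"
proof -
  interpret AR: complex_algebra R by (rule algR)
  have "subring (carrier RG) R"
    using additive_map_minus[OF R.is_abelian_group R.is_abelian_group act_additive]
    by (intro R.subringI) (auto simp: RG_carrier act_mult act_add)
  then have ring: "ring RG"
    using R.subring_is_ring[of "carrier RG"] by (simp add: fixed_ring_def)
  have "module complex_field RG"
    by (rule moduleI[OF cring_from_type_algebra ring.is_abelian_group[OF ring]])
      (auto simp: RG_carrier act_smult AR.smult_l_distr[simplified] AR.smult_r_distr[simplified]
        AR.smult_assoc1[simplified] AR.smult_one[simplified])
  moreover have "complex_algebra_axioms RG"
    by (auto simp: complex_algebra_axioms_def RG_carrier AR.smult_mult_left AR.smult_mult_right)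
  ultimately show ?thesis using ring by (simp add: complex_algebra_def)
qed

lemma cscale_RG: "cscale RG M = cscale R M"
  by (intro ext) (simp add: cscale_def)

lemma alg_module_RG:
  assumes "alg_module R M"
  shows "alg_module RG M"
proof -
  interpret M: alg_module R M by fact
  have "left_module RG M"
    using M.ab_group complex_algebra_ring[OF algRG]
    by (auto simp: left_module_def left_module_axioms_def RG_carrier M.Mod.smult_l_distr
        M.Mod.smult_r_distr M.Mod.smult_assoc M.Mod.smult_one)
  then show ?thesis using algRG by (simp add: alg_module_def)
qed

subsection \<open>Twisted modules\<close>

lemma twist_simps [simp]:
  "carrier (twist G act g M) = carrier M" "add (twist G act g M) = add M"
  "\<zero>\<^bsub>twist G act g M\<^esub> = \<zero>\<^bsub>M\<^esub>" "r \<odot>\<^bsub>twist G act g M\<^esub> x = act (inv\<^bsub>G\<^esub> g) r \<odot>\<^bsub>M\<^esub> x"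
  "finsum (twist G act g M) f J = finsum M f J"
  by (simp_all add: twist_def finsum_def finprod_def)

text \<open>The group acts linearly and fixes \<one>, so twisting leaves the complex structure
  alone.\<close>

lemma cscale_twist: "g \<in> carrier G \<Longrightarrow> cscale R (twist G act g M) = cscale R M"
proof (intro ext)
  fix c x assume g: "g \<in> carrier G"
  interpret AR: complex_algebra R by (rule algR)
  show "cscale R (twist G act g M) c x = cscale R M c x"
    using g act_smult[of "inv\<^bsub>G\<^esub> g" "\<one>\<^bsub>R\<^esub>" c] by (simp add: cscale_def)
qed

lemma alg_module_twist:
  assumes "alg_module R M" and g: "g \<in> carrier G"
  shows "alg_module R (twist G act g M)"
proof -
  interpret M: alg_module R M by fact
  have "abelian_group (twist G act g M)"
    by (rule abelian_groupI) (auto simp: M.Mod.M.a_ac intro: M.Mod.M.l_neg)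
  then have "left_module R (twist G act g M)"
    using R.ring_axioms g
    by (auto simp: left_module_def left_module_axioms_def M.Mod.smult_l_distr
        M.Mod.smult_r_distr M.Mod.smult_assoc M.Mod.smult_one act_add act_mult)
  then show ?thesis using algR by (simp add: alg_module_def)
qed

lemma fin_dim_twist: "g \<in> carrier G \<Longrightarrow> fin_dim R M \<Longrightarrow> fin_dim R (twist G act g M)"
  by (simp add: fin_dim_def cscale_twist)

lemma simple_twist:
  assumes sim: "simple_module R M" and g: "g \<in> carrier G"
  shows "simple_module R (twist G act g M)"
proof -
  interpret M: alg_module R M by (rule simple_alg_module[OF algR sim])
  interpret T: alg_module R "twist G act g M" by (rule alg_module_twist[OF M.alg_module_axioms g])
  obtain x where x: "x \<in> carrier M" "x \<noteq> \<zero>\<^bsub>M\<^esub>" using M.simple_nonzero[OF sim] .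
  show ?thesis
  proof (rule T.simple_moduleI[of x])
    fix u v assume uv: "u \<in> carrier (twist G act g M)" "u \<noteq> \<zero>\<^bsub>twist G act g M\<^esub>" "v \<in> carrier (twist G act g M)"
    obtain a where "a \<in> carrier R" "a \<odot>\<^bsub>M\<^esub> u = v" using M.simple_generates[OF sim, of u v] uv by auto
    then show "\<exists>a\<in>carrier R. a \<odot>\<^bsub>twist G act g M\<^esub> u = v" using g by (intro bexI[of _ "act g a"]) auto
  qed (use x in auto)
qed

lemma iso_twistD:
  assumes "f \<in> module_iso R M (twist G act g N)"
  shows "bij_betw f (carrier M) (carrier N)" "x \<in> carrier M \<Longrightarrow> f x \<in> carrier N"
    "x \<in> carrier M \<Longrightarrow> y \<in> carrier M \<Longrightarrow> f (x \<oplus>\<^bsub>M\<^esub> y) = f x \<oplus>\<^bsub>N\<^esub> f y"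
    "r \<in> carrier R \<Longrightarrow> x \<in> carrier M \<Longrightarrow> f (r \<odot>\<^bsub>M\<^esub> x) = act (inv\<^bsub>G\<^esub> g) r \<odot>\<^bsub>N\<^esub> f x"
  using assms by (auto simp: module_iso_def module_hom_def)

lemma iso_twistI:
  assumes "bij_betw f (carrier M) (carrier N)"
    "\<And>x y. x \<in> carrier M \<Longrightarrow> y \<in> carrier M \<Longrightarrow> f (x \<oplus>\<^bsub>M\<^esub> y) = f x \<oplus>\<^bsub>N\<^esub> f y"
    "\<And>r x. r \<in> carrier R \<Longrightarrow> x \<in> carrier M \<Longrightarrow> f (r \<odot>\<^bsub>M\<^esub> x) = act (inv\<^bsub>G\<^esub> g) r \<odot>\<^bsub>N\<^esub> f x"
  shows "f \<in> module_iso R M (twist G act g N)"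
  using assms by (auto simp: module_iso_def module_hom_def bij_betw_def)

text \<open>The group elements multiply in this order because the action of inv h is applied after
  that of inv g.\<close>

lemma iso_twist_comp:
  assumes g: "g \<in> carrier G" "h \<in> carrier G" and f: "f \<in> module_iso R M (twist G act g N)"
    and f': "f' \<in> module_iso R N (twist G act h P)"
  shows "(\<lambda>x. f' (f x)) \<in> module_iso R M (twist G act (g \<otimes>\<^bsub>G\<^esub> h) P)"
proof (rule iso_twistI)
  show "bij_betw (\<lambda>x. f' (f x)) (carrier M) (carrier P)"
    using bij_betw_trans[OF iso_twistD(1)[OF f] iso_twistD(1)[OF f']] by (simp add: comp_def)
  show "f' (f (x \<oplus>\<^bsub>M\<^esub> y)) = f' (f x) \<oplus>\<^bsub>P\<^esub> f' (f y)" if "x \<in> carrier M" "y \<in> carrier M" for x y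
    using that iso_twistD(2,3)[OF f] iso_twistD(3)[OF f'] by simp
  show "f' (f (r \<odot>\<^bsub>M\<^esub> x)) = act (inv\<^bsub>G\<^esub> (g \<otimes>\<^bsub>G\<^esub> h)) r \<odot>\<^bsub>P\<^esub> f' (f x)"
    if "r \<in> carrier R" "x \<in> carrier M" for r x
    using that g iso_twistD(2,4)[OF f] iso_twistD(4)[OF f']
    by (simp add: G.inv_mult_group act_comp)
qed

lemma iso_twist_inv:
  assumes M: "alg_module R M" and N: "alg_module R N" and g: "g \<in> carrier G"
    and f: "f \<in> module_iso R M (twist G act g N)"
  shows "inv_into (carrier M) f \<in> module_iso R N (twist G act (inv\<^bsub>G\<^esub> g) M)"
proof -
  let ?k = "inv_into (carrier M) f"
  interpret T: alg_module R "twist G act g N" by (rule alg_module_twist[OF N g])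
  have k: "?k \<in> module_iso R (twist G act g N) M"
    by (rule module_iso_inv[OF M T.alg_module_axioms f])
  then have kh: "?k \<in> module_hom R (twist G act g N) M" by (simp add: module_iso_def)
  show ?thesis
  proof (rule iso_twistI)
    show "bij_betw ?k (carrier N) (carrier M)" using k by (simp add: module_iso_def)
    show "?k (x \<oplus>\<^bsub>N\<^esub> y) = ?k x \<oplus>\<^bsub>M\<^esub> ?k y" if "x \<in> carrier N" "y \<in> carrier N" for x y
      using module_homD(2)[OF kh] that by simp
    show "?k (r \<odot>\<^bsub>N\<^esub> x) = act (inv\<^bsub>G\<^esub> (inv\<^bsub>G\<^esub> g)) r \<odot>\<^bsub>M\<^esub> ?k x"
      if "r \<in> carrier R" "x \<in> carrier N" for r x
      using module_homD(3)[OF kh, of "act g r" x] that g by simp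
  qed
qed

subsection \<open>The trace\<close>

text \<open>Not divided by |G|; on the fixed ring it is therefore multiplication by |G|, see
  \<open>trace_fixed\<close>.\<close>

definition trace :: "'r \<Rightarrow> 'r" where "trace x = (\<Oplus>\<^bsub>R\<^esub>g\<in>carrier G. act g x)"

lemma trace_closed: "x \<in> carrier R \<Longrightarrow> trace x \<in> carrier RG"
proof -
  assume x: "x \<in> carrier R"
  have cl: "(\<lambda>g. act g x) \<in> carrier G \<rightarrow> carrier R" using x by auto
  have "act k (trace x) = trace x" if k: "k \<in> carrier G" for k
  proof -
    have "act k (trace x) = (\<Oplus>\<^bsub>R\<^esub>g\<in>carrier G. act k (act g x))"
      unfolding trace_def
      by (rule additive_map_finsum[OF R.is_abelian_group R.is_abelian_group act_additive[OF k] cl])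
    also have "\<dots> = (\<Oplus>\<^bsub>R\<^esub>g\<in>carrier G. act (k \<otimes>\<^bsub>G\<^esub> g) x)"
      using k x by (intro R.finsum_cong') (auto simp: act_comp)
    also have "\<dots> = (\<Oplus>\<^bsub>R\<^esub>g\<in>(\<lambda>g. k \<otimes>\<^bsub>G\<^esub> g) ` carrier G. act g x)"
      using k x by (intro R.finsum_reindex[symmetric]) (auto simp: inj_on_def)
    also have "(\<lambda>g. k \<otimes>\<^bsub>G\<^esub> g) ` carrier G = carrier G" by (rule G.surj_const_mult[OF k])
    finally show ?thesis by (simp add: trace_def)
  qed
  then show ?thesis using R.finsum_closed[OF cl] by (simp add: RG_carrier trace_def)
qed

lemma trace_add: "x \<in> carrier R \<Longrightarrow> y \<in> carrier R \<Longrightarrow> trace (x \<oplus>\<^bsub>R\<^esub> y) = trace x \<oplus>\<^bsub>R\<^esub> trace y"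
proof -
  assume xy: "x \<in> carrier R" "y \<in> carrier R"
  have "trace (x \<oplus>\<^bsub>R\<^esub> y) = (\<Oplus>\<^bsub>R\<^esub>g\<in>carrier G. act g x \<oplus>\<^bsub>R\<^esub> act g y)"
    unfolding trace_def using xy by (intro R.finsum_cong') (auto simp: act_add)
  then show ?thesis unfolding trace_def using xy R.finsum_addf[of "\<lambda>g. act g x" "carrier G" "\<lambda>g. act g y"] by auto
qed

text \<open>Fixed elements can be pulled out of each summand. This is what puts \<open>J\<close>
  into \<open>L\<close> in the embedding below.\<close>

lemma trace_mult_right:
  "x \<in> carrier R \<Longrightarrow> j \<in> carrier RG \<Longrightarrow> trace (x \<otimes>\<^bsub>R\<^esub> j) = trace x \<otimes>\<^bsub>R\<^esub> j"
proof -
  assume x: "x \<in> carrier R" and j: "j \<in> carrier RG"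
  have "trace (x \<otimes>\<^bsub>R\<^esub> j) = (\<Oplus>\<^bsub>R\<^esub>g\<in>carrier G. act g x \<otimes>\<^bsub>R\<^esub> j)"
    unfolding trace_def using x RG_sub[OF j] RG_fixed[OF j]
    by (intro R.finsum_cong') (auto simp: act_mult)
  also have "\<dots> = trace x \<otimes>\<^bsub>R\<^esub> j" unfolding trace_def
    by (rule R.finsum_ldistr[OF finite_group RG_sub[OF j], symmetric]) (use x in auto)
  finally show ?thesis .
qed

lemma trace_fixed:
  assumes j: "j \<in> carrier RG"
  shows "trace j = of_nat (card (carrier G)) \<odot>\<^bsub>R\<^esub> j"
proof -
  interpret AR: complex_algebra R by (rule algR)
  interpret Reg: alg_module R "regular_module R" by (rule alg_module_regular[OF algR])
  have jc: "j \<in> carrier R" by (rule RG_sub[OF j])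
  have "trace j = (\<Oplus>\<^bsub>R\<^esub>g\<in>carrier G. cscale R (regular_module R) 1 j)"
    unfolding trace_def using RG_fixed[OF j] jc AR.smult_one[simplified, OF jc]
    by (intro R.finsum_cong') auto
  also have "\<dots> = of_nat (card (carrier G)) \<odot>\<^bsub>R\<^esub> j"
    using Reg.finsum_sc_left[of j "\<lambda>_. 1" "carrier G"] jc by simp
  finally show ?thesis .
qed

text \<open>
  The left ideal \<open>L\<close> below is the largest one meeting the fixed ring in \<open>J\<close>, so a maximal left
  ideal \<open>P \<supseteq> L\<close> meets it exactly in the maximal left ideal \<open>J\<close>.
\<close>

lemma simple_RG_module_embeds:
  fixes S :: "('r, 's) module"
  assumes S: "simple_module RG S"
  obtains V :: "('r, 'r set) module" and f
  where "simple_module R V" "f \<in> module_hom RG S V" "inj_on f (carrier S)"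
proof -
  interpret F: ring RG by (rule complex_algebra_ring[OF algRG])
  interpret S: alg_module RG S by (rule simple_alg_module[OF algRG S])
  obtain s0 where s0: "s0 \<in> carrier S" "s0 \<noteq> \<zero>\<^bsub>S\<^esub>" using S.simple_nonzero[OF S] .
  \<comment> \<open>The annihilator of a generator, so that \<open>S\<close> is the quotient of the
    fixed ring by \<open>J\<close>.\<close>
  define J where "J = {a \<in> carrier RG. a \<odot>\<^bsub>S\<^esub> s0 = \<zero>\<^bsub>S\<^esub>}"
  have "left_ideal RG (carrier RG)"
    using ring.ring_simprules(1,2,5)[OF complex_algebra_ring[OF algRG]] by (auto simp: left_ideal_def)
  from S.left_ideal_annihilator[OF this s0(1)] have J: "left_ideal RG J" by (simp add: J_def)
  note JD = left_idealD[OF J, simplified]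
  define L where "L = {x \<in> carrier R. \<forall>r\<in>carrier R. trace (r \<otimes>\<^bsub>R\<^esub> x) \<in> J}"
  have L: "left_ideal R L" unfolding left_ideal_def
  proof (intro conjI ballI)
    have "trace \<zero>\<^bsub>R\<^esub> = \<zero>\<^bsub>R\<^esub>"
      by (rule additive_map_zero[OF R.is_abelian_group R.is_abelian_group])
        (auto simp: additive_map_def trace_add RG_sub trace_closed)
    then show "\<zero>\<^bsub>R\<^esub> \<in> L" using JD(2) by (simp add: L_def)
    fix x assume x: "x \<in> L"
    show "x \<oplus>\<^bsub>R\<^esub> y \<in> L" if "y \<in> L" for y
      using x that JD(3) by (simp add: L_def R.r_distr trace_add)
    show "a \<otimes>\<^bsub>R\<^esub> x \<in> L" if "a \<in> carrier R" for a
      using x that by (simp add: L_def flip: R.m_assoc)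
  qed (auto simp: L_def)
  have JL: "J \<subseteq> L"
  proof
    fix j assume j: "j \<in> J"
    have jc: "j \<in> carrier RG" by (rule JD(1)[OF j])
    show "j \<in> L" unfolding L_def
    proof (intro CollectI conjI ballI)
      show "j \<in> carrier R" by (rule RG_sub[OF jc])
      fix r assume r: "r \<in> carrier R"
      show "trace (r \<otimes>\<^bsub>R\<^esub> j) \<in> J"
        using JD(4)[OF trace_closed[OF r] j] trace_mult_right[OF r jc] by simp
    qed
  qed
  \<comment> \<open>Otherwise the trace of \<one>, which is |G| \<one>, would annihilate
    \<open>s0\<close>, although |G| is a nonzero scalar.\<close>
  have one: "\<one>\<^bsub>R\<^esub> \<notin> L"
  proof
    assume "\<one>\<^bsub>R\<^esub> \<in> L"
    then have "trace \<one>\<^bsub>R\<^esub> \<in> J" by (auto simp: L_def dest!: bspec[of _ _ "\<one>\<^bsub>R\<^esub>"])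
    moreover have o: "\<one>\<^bsub>R\<^esub> \<in> carrier RG" by (simp add: RG_carrier)
    ultimately have "(of_nat (card (carrier G)) \<odot>\<^bsub>R\<^esub> \<one>\<^bsub>R\<^esub>) \<odot>\<^bsub>S\<^esub> s0 = \<zero>\<^bsub>S\<^esub>"
      by (simp add: trace_fixed J_def)
    then have "cscale RG S (of_nat (card (carrier G))) s0 = \<zero>\<^bsub>S\<^esub>" by (simp add: cscale_def)
    moreover have "carrier G \<noteq> {}" using G.one_closed by blast
    then have "card (carrier G) \<noteq> 0" using finite_group by simp
    ultimately show False using S.sc_eq_zero[OF s0(1)] s0(2) by fastforce
  qed
  obtain P where P: "left_ideal R P" "L \<subseteq> P" "\<one>\<^bsub>R\<^esub> \<notin> P"
    "\<And>P'. left_ideal R P' \<Longrightarrow> P \<subseteq> P' \<Longrightarrow> \<one>\<^bsub>R\<^esub> \<notin> P' \<Longrightarrow> P' = P"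
    using exists_maximal_left_ideal[OF L one] by metis
  note PD = left_idealD[OF P(1)]
  interpret Q: quotient_by_left_ideal R P using P(1) by unfold_locales
  let ?V = "quotient_module R P"
  have V: "simple_module R ?V" by (rule Q.simple_quotient[OF algR P(3,4)])
  \<comment> \<open>A fixed element \<open>d\<close> of \<open>P\<close> outside \<open>J\<close>
    has a left multiple b d congruent to \<one> modulo \<open>J\<close>. As \<open>J\<close> lies in
    \<open>P\<close>, this would put \<one> into \<open>P\<close>.\<close>
  have PJ: "d \<in> J" if d: "d \<in> carrier RG" "d \<in> P" for d
  proof (rule ccontr)
    assume "d \<notin> J"
    then have "d \<odot>\<^bsub>S\<^esub> s0 \<noteq> \<zero>\<^bsub>S\<^esub>" using d by (simp add: J_def)
    then obtain b where b: "b \<in> carrier RG" "b \<odot>\<^bsub>S\<^esub> (d \<odot>\<^bsub>S\<^esub> s0) = s0"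
      using S.simple_generates[OF S _ _ s0(1), of "d \<odot>\<^bsub>S\<^esub> s0"] d s0(1) by auto
    have bd: "b \<otimes>\<^bsub>R\<^esub> d \<in> carrier RG" using F.m_closed[OF b(1) d(1)] by simp
    have o: "\<one>\<^bsub>R\<^esub> \<in> carrier RG" by (simp add: RG_carrier)
    have "(\<one>\<^bsub>RG\<^esub> \<ominus>\<^bsub>RG\<^esub> b \<otimes>\<^bsub>RG\<^esub> d) \<odot>\<^bsub>S\<^esub> s0 = \<one>\<^bsub>RG\<^esub> \<odot>\<^bsub>S\<^esub> s0 \<ominus>\<^bsub>S\<^esub> (b \<otimes>\<^bsub>RG\<^esub> d) \<odot>\<^bsub>S\<^esub> s0"
      using o bd by (intro S.diff_smult[OF s0(1)]) auto
    also have "\<dots> = \<zero>\<^bsub>S\<^esub>"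
      using b d s0(1) S.Mod.smult_assoc[OF b(1) d(1) s0(1)] S.Mod.smult_one[OF s0(1)]
      by (simp add: S.Mod.M.minus_eq_zero_iff)
    finally have "\<one>\<^bsub>RG\<^esub> \<ominus>\<^bsub>RG\<^esub> b \<otimes>\<^bsub>RG\<^esub> d \<in> J"
      using F.minus_closed[OF F.one_closed F.m_closed[OF b(1) d(1)]] by (simp add: J_def)
    then have "\<one>\<^bsub>RG\<^esub> \<ominus>\<^bsub>RG\<^esub> b \<otimes>\<^bsub>RG\<^esub> d \<in> P" using JL P(2) by blast
    moreover have "b \<otimes>\<^bsub>R\<^esub> d \<in> P" using PD(4)[OF RG_sub[OF b(1)] d(2)] .
    ultimately have "(\<one>\<^bsub>RG\<^esub> \<ominus>\<^bsub>RG\<^esub> b \<otimes>\<^bsub>RG\<^esub> d) \<oplus>\<^bsub>RG\<^esub> b \<otimes>\<^bsub>RG\<^esub> d \<in> P" using PD(3) by simp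
    moreover have "(\<one>\<^bsub>RG\<^esub> \<ominus>\<^bsub>RG\<^esub> b \<otimes>\<^bsub>RG\<^esub> d) \<oplus>\<^bsub>RG\<^esub> b \<otimes>\<^bsub>RG\<^esub> d = \<one>\<^bsub>RG\<^esub>"
      using F.one_closed F.m_closed[OF b(1) d(1)]
      by (simp only: a_minus_def F.a_assoc F.l_neg F.r_zero F.a_inv_closed)
    ultimately show False using P(3) by simp
  qed
  \<comment> \<open>Read from right to left this makes the map from a s0 to the coset of a well
    defined, from left to right it makes it injective.\<close>
  have eq: "coset_of R P a = coset_of R P a' \<longleftrightarrow> a \<odot>\<^bsub>S\<^esub> s0 = a' \<odot>\<^bsub>S\<^esub> s0"
    if a: "a \<in> carrier RG" "a' \<in> carrier RG" for a a'
  proof -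
    have diff: "a \<ominus>\<^bsub>RG\<^esub> a' = a \<ominus>\<^bsub>R\<^esub> a'"
    proof -
      have "additive_map RG R (\<lambda>x. x)" by (auto simp: additive_map_def RG_sub)
      from additive_map_diff[OF F.is_abelian_group R.is_abelian_group this a] show ?thesis .
    qed
    have c: "a \<ominus>\<^bsub>R\<^esub> a' \<in> carrier RG" using F.minus_closed[OF a] diff by simp
    have "coset_of R P a = coset_of R P a' \<longleftrightarrow> a \<ominus>\<^bsub>R\<^esub> a' \<in> P"
      using a by (intro Q.coset_of_eq_iff RG_sub)
    also have "\<dots> \<longleftrightarrow> a \<ominus>\<^bsub>R\<^esub> a' \<in> J" using PJ[OF c] JL P(2) by blast
    also have "\<dots> \<longleftrightarrow> a \<odot>\<^bsub>S\<^esub> s0 = a' \<odot>\<^bsub>S\<^esub> s0"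
      using S.diff_smult[OF s0(1) a] diff c a s0(1) by (simp add: J_def S.Mod.M.minus_eq_zero_iff)
    finally show ?thesis .
  qed
  have ex: "\<exists>a. a \<in> carrier RG \<and> a \<odot>\<^bsub>S\<^esub> s0 = s" if s: "s \<in> carrier S" for s
  proof -
    obtain a where "a \<in> carrier RG" "a \<odot>\<^bsub>S\<^esub> s0 = s" using S.simple_generates[OF S s0 s] .
    then show ?thesis by (intro exI[of _ a]) simp
  qed
  define rep where "rep s = (SOME a. a \<in> carrier RG \<and> a \<odot>\<^bsub>S\<^esub> s0 = s)" for s
  have rep: "rep s \<in> carrier RG" "rep s \<odot>\<^bsub>S\<^esub> s0 = s" if "s \<in> carrier S" for s
    unfolding rep_def using someI_ex[OF ex[OF that]] by auto
  define f where "f s = coset_of R P (rep s)" for s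
  have f: "f (a \<odot>\<^bsub>S\<^esub> s0) = coset_of R P a" if a: "a \<in> carrier RG" for a
    unfolding f_def using rep[of "a \<odot>\<^bsub>S\<^esub> s0"] a s0(1) eq[of "rep (a \<odot>\<^bsub>S\<^esub> s0)" a] by simp
  have hom: "f \<in> module_hom RG S ?V" unfolding module_hom_def
  proof (intro CollectI conjI ballI)
    show "f \<in> carrier S \<rightarrow> carrier ?V" using rep(1) RG_sub by (auto simp: f_def Q.quotient_carrier)
    fix s assume s: "s \<in> carrier S"
    note rs = rep[OF s]
    show "f (s \<oplus>\<^bsub>S\<^esub> t) = f s \<oplus>\<^bsub>?V\<^esub> f t" if t: "t \<in> carrier S" for t
    proof -
      note rt = rep[OF t]
      have "f (s \<oplus>\<^bsub>S\<^esub> t) = f ((rep s \<oplus>\<^bsub>RG\<^esub> rep t) \<odot>\<^bsub>S\<^esub> s0)"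
        using S.Mod.smult_l_distr[OF rs(1) rt(1) s0(1)] rs(2) rt(2) by simp
      also have "\<dots> = coset_of R P (rep s \<oplus>\<^bsub>R\<^esub> rep t)"
        using f[OF F.a_closed[OF rs(1) rt(1)]] by simp
      also have "\<dots> = f s \<oplus>\<^bsub>?V\<^esub> f t"
        unfolding f_def using Q.quotient_add RG_sub rs(1) rt(1) by simp
      finally show ?thesis .
    qed
    show "f (a \<odot>\<^bsub>S\<^esub> s) = a \<odot>\<^bsub>?V\<^esub> f s" if a: "a \<in> carrier RG" for a
    proof -
      have "f (a \<odot>\<^bsub>S\<^esub> s) = f ((a \<otimes>\<^bsub>RG\<^esub> rep s) \<odot>\<^bsub>S\<^esub> s0)"
        using S.Mod.smult_assoc[OF a rs(1) s0(1)] rs(2) by simp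
      also have "\<dots> = coset_of R P (a \<otimes>\<^bsub>R\<^esub> rep s)"
        using f[OF F.m_closed[OF a rs(1)]] by simp
      also have "\<dots> = a \<odot>\<^bsub>?V\<^esub> f s"
        unfolding f_def using Q.quotient_smult RG_sub rs(1) a by simp
      finally show ?thesis .
    qed
  qed
  have "inj_on f (carrier S)"
  proof (rule inj_onI)
    fix s t assume st: "s \<in> carrier S" "t \<in> carrier S" "f s = f t"
    then show "s = t" using eq[OF rep(1)[OF st(1)] rep(1)[OF st(2)]] rep(2) by (simp add: f_def)
  qed
  then show thesis using that[OF V hom] by blast
qed

end

subsection \<open>Inertia groups and factor sets\<close>

locale clifford = finite_action R G act
  for R :: "(complex, 'r) module" and G :: "'g monoid" and act :: "'g \<Rightarrow> 'r \<Rightarrow> 'r" +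
  fixes M :: "('r, 'm) module" and \<phi> :: "'g \<Rightarrow> 'm \<Rightarrow> 'm"
  assumes sim: "simple_module R M" and fd: "fin_dim R M"
    and phi: "h \<in> inertia R G act M \<Longrightarrow> \<phi> h \<in> module_iso R M (twist G act (inv\<^bsub>G\<^esub> h) M)"
begin

abbreviation "H \<equiv> inertia R G act M"
abbreviation "\<alpha> \<equiv> factor_set R G M \<phi>"

lemma alg_M: "alg_module R M"
  by (rule simple_alg_module[OF algR sim])

sublocale M: alg_module R M by (rule alg_M)

lemma H_carrier: "h \<in> H \<Longrightarrow> h \<in> carrier G"
  by (simp add: inertia_def)

lemma inertia_iff: "h \<in> H \<longleftrightarrow> h \<in> carrier G \<and> (\<exists>f. f \<in> module_iso R M (twist G act h M))"
  by (auto simp: inertia_def isomorphic_def)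

lemma H_subgroup: "subgroup H G"
proof (rule subgroup.intro)
  show "H \<subseteq> carrier G" using H_carrier by blast
  show "\<one>\<^bsub>G\<^esub> \<in> H"
  proof -
    have "id \<in> module_iso R M (twist G act \<one>\<^bsub>G\<^esub> M)" by (rule iso_twistI) auto
    then show ?thesis unfolding inertia_iff by auto
  qed
  fix h assume h: "h \<in> H"
  then obtain f where f: "f \<in> module_iso R M (twist G act h M)" unfolding inertia_iff by auto
  show "inv\<^bsub>G\<^esub> h \<in> H"
    unfolding inertia_iff using iso_twist_inv[OF alg_M alg_M H_carrier[OF h] f] H_carrier[OF h] by auto
  fix k assume k: "k \<in> H"
  then obtain f' where f': "f' \<in> module_iso R M (twist G act k M)" unfolding inertia_iff by auto
  show "h \<otimes>\<^bsub>G\<^esub> k \<in> H"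
    unfolding inertia_iff using iso_twist_comp[OF H_carrier[OF h] H_carrier[OF k] f f'] H_carrier[OF h] H_carrier[OF k] by auto
qed

lemma H_closed: "g \<in> H \<Longrightarrow> h \<in> H \<Longrightarrow> g \<otimes>\<^bsub>G\<^esub> h \<in> H" and H_one: "\<one>\<^bsub>G\<^esub> \<in> H"
  and H_inv: "h \<in> H \<Longrightarrow> inv\<^bsub>G\<^esub> h \<in> H"
  using H_subgroup by (auto simp: subgroup.m_closed subgroup.one_closed subgroup.m_inv_closed)

lemma finite_H: "finite H"
  using finite_subset[OF _ finite_group] H_carrier by blast

lemma phi_bij: "h \<in> H \<Longrightarrow> bij_betw (\<phi> h) (carrier M) (carrier M)"
  and phi_closed: "h \<in> H \<Longrightarrow> x \<in> carrier M \<Longrightarrow> \<phi> h x \<in> carrier M"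
  and phi_add: "h \<in> H \<Longrightarrow> x \<in> carrier M \<Longrightarrow> y \<in> carrier M \<Longrightarrow> \<phi> h (x \<oplus>\<^bsub>M\<^esub> y) = \<phi> h x \<oplus>\<^bsub>M\<^esub> \<phi> h y"
  and phi_smult: "h \<in> H \<Longrightarrow> r \<in> carrier R \<Longrightarrow> x \<in> carrier M \<Longrightarrow> \<phi> h (r \<odot>\<^bsub>M\<^esub> x) = act h r \<odot>\<^bsub>M\<^esub> \<phi> h x"
  using iso_twistD[OF phi[of h]] H_carrier[of h] by auto

lemma phi_linear:
  assumes h: "h \<in> H"
  shows "linear_map R M R M (\<phi> h)"
proof -
  have "act h (c \<odot>\<^bsub>R\<^esub> \<one>\<^bsub>R\<^esub>) = c \<odot>\<^bsub>R\<^esub> \<one>\<^bsub>R\<^esub>" for c using act_smult[OF H_carrier[OF h] R.one_closed] H_carrier[OF h] by simp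
  then show ?thesis
    using phi_closed[OF h] phi_add[OF h] phi_smult[OF h M.scalar_closed]
    by (auto simp: linear_map_def additive_map_def cscale_def)
qed

lemmas phi_sc = linear_mapD(3)[OF phi_linear]

lemma phi_surj:
  assumes "h \<in> H" "x \<in> carrier M"
  obtains y where "y \<in> carrier M" "\<phi> h y = x"
proof -
  have "x \<in> \<phi> h ` carrier M" using phi_bij[OF assms(1)] assms(2) by (simp add: bij_betw_def)
  then show thesis by (rule imageE) (use that in simp)
qed

lemma phi_inj: "h \<in> H \<Longrightarrow> x \<in> carrier M \<Longrightarrow> y \<in> carrier M \<Longrightarrow> \<phi> h x = \<phi> h y \<Longrightarrow> x = y"
  using phi_bij by (auto simp: bij_betw_def inj_on_def)

lemma phi_zero: "h \<in> H \<Longrightarrow> \<phi> h \<zero>\<^bsub>M\<^esub> = \<zero>\<^bsub>M\<^esub>"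
  by (rule additive_map_zero[OF M.ab_group M.ab_group linear_mapD(4)[OF phi_linear]])

lemma sc_inj:
  assumes "x \<in> carrier M" "x \<noteq> \<zero>\<^bsub>M\<^esub>" "cscale R M c x = cscale R M d x"
  shows "c = d"
proof -
  have "cscale R M (c - d) x \<oplus>\<^bsub>M\<^esub> cscale R M d x = cscale R M d x"
    using assms by (simp add: M.sc_add_left[symmetric])
  then have "cscale R M (c - d) x = \<zero>\<^bsub>M\<^esub>" using assms(1) by (simp add: M.Mod.M.add.r_cancel_one)
  then show ?thesis using M.sc_eq_zero[OF assms(1), of "c - d"] assms(2) by simp
qed

text \<open>The composite of \<phi> g and \<phi> h with the inverse of \<phi> (g h) commutes with
  \<open>R\<close>, since acting by h and then by g is acting by g h; by Schur's lemma it is a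
  scalar. The uniqueness required by the description operator in \<open>factor_set\<close> comes
  from a nonzero vector.\<close>

lemma factor_set_mult:
  assumes g: "g \<in> H" and h: "h \<in> H" and x: "x \<in> carrier M"
  shows "\<phi> g (\<phi> h x) = cscale R M (\<alpha> g h) (\<phi> (g \<otimes>\<^bsub>G\<^esub> h) x)"
proof -
  note gh = H_closed[OF g h]
  let ?k = "inv_into (carrier M) (\<phi> (g \<otimes>\<^bsub>G\<^esub> h))"
  have kc: "?k y \<in> carrier M" and pk: "\<phi> (g \<otimes>\<^bsub>G\<^esub> h) (?k y) = y" if "y \<in> carrier M" for y
    using bij_betwE[OF bij_betw_inv_into[OF phi_bij[OF gh]]] bij_betw_inv_into_right[OF phi_bij[OF gh] that] that
    by auto
  have kp: "?k (\<phi> (g \<otimes>\<^bsub>G\<^esub> h) y) = y" if "y \<in> carrier M" for y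
    by (rule bij_betw_inv_into_left[OF phi_bij[OF gh] that])
  have k_add: "?k (y \<oplus>\<^bsub>M\<^esub> z) = ?k y \<oplus>\<^bsub>M\<^esub> ?k z" if "y \<in> carrier M" "z \<in> carrier M" for y z
    using kp[of "?k y \<oplus>\<^bsub>M\<^esub> ?k z"] phi_add[OF gh kc[OF that(1)] kc[OF that(2)]] pk kc that by simp
  have k_smult: "?k (r \<odot>\<^bsub>M\<^esub> y) = act (inv\<^bsub>G\<^esub> (g \<otimes>\<^bsub>G\<^esub> h)) r \<odot>\<^bsub>M\<^esub> ?k y"
    if r: "r \<in> carrier R" and y: "y \<in> carrier M" for r y
  proof -
    let ?r = "act (inv\<^bsub>G\<^esub> (g \<otimes>\<^bsub>G\<^esub> h)) r"
    have ghc: "g \<otimes>\<^bsub>G\<^esub> h \<in> carrier G" by (rule H_carrier[OF gh])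
    have rc: "?r \<in> carrier R" using r ghc by simp
    have "act (g \<otimes>\<^bsub>G\<^esub> h) ?r = r" using act_inv[of "inv\<^bsub>G\<^esub> (g \<otimes>\<^bsub>G\<^esub> h)" r] r ghc by simp
    then have "\<phi> (g \<otimes>\<^bsub>G\<^esub> h) (?r \<odot>\<^bsub>M\<^esub> ?k y) = r \<odot>\<^bsub>M\<^esub> y"
      using phi_smult[OF gh rc kc[OF y]] pk[OF y] by simp
    then show ?thesis using kp[of "?r \<odot>\<^bsub>M\<^esub> ?k y"] rc kc[OF y] by simp
  qed
  have "(\<lambda>y. \<phi> g (\<phi> h (?k y))) \<in> module_hom R M M" unfolding module_hom_def
  proof (intro CollectI conjI ballI)
    show "(\<lambda>y. \<phi> g (\<phi> h (?k y))) \<in> carrier M \<rightarrow> carrier M" using kc phi_closed g h by auto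
    fix y assume y: "y \<in> carrier M"
    show "\<phi> g (\<phi> h (?k (y \<oplus>\<^bsub>M\<^esub> z))) = \<phi> g (\<phi> h (?k y)) \<oplus>\<^bsub>M\<^esub> \<phi> g (\<phi> h (?k z))" if "z \<in> carrier M" for z
      using y that kc g h phi_closed by (simp add: k_add phi_add)
    show "\<phi> g (\<phi> h (?k (r \<odot>\<^bsub>M\<^esub> y))) = r \<odot>\<^bsub>M\<^esub> \<phi> g (\<phi> h (?k y))" if r: "r \<in> carrier R" for r
    proof -
      let ?r = "act (inv\<^bsub>G\<^esub> (g \<otimes>\<^bsub>G\<^esub> h)) r"
      have rc: "?r \<in> carrier R" using r H_carrier[OF gh] by simp
      have "act g (act h ?r) = act (g \<otimes>\<^bsub>G\<^esub> h) ?r" using act_comp H_carrier[OF g] H_carrier[OF h] rc by simp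
      also have "\<dots> = r" using act_inv[of "inv\<^bsub>G\<^esub> (g \<otimes>\<^bsub>G\<^esub> h)" r] r H_carrier[OF gh] by simp
      finally show ?thesis
        using k_smult[OF r y] phi_smult[OF h rc kc[OF y]]
          phi_smult[OF g act_closed[OF H_carrier[OF h] rc] phi_closed[OF h kc[OF y]]] by simp
    qed
  qed
  from M.Schur[OF sim fd this]
  obtain z where z0: "\<And>y. y \<in> carrier M \<Longrightarrow> \<phi> g (\<phi> h (?k y)) = cscale R M z y" by metis
  have z: "\<forall>y\<in>carrier M. \<phi> g (\<phi> h y) = cscale R M z (\<phi> (g \<otimes>\<^bsub>G\<^esub> h) y)"
    using z0[OF phi_closed[OF gh]] kp by simp
  have "\<alpha> g h = z" unfolding factor_set_def
  proof (rule the_equality)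
    fix c assume c: "\<forall>x\<in>carrier M. \<phi> g (\<phi> h x) = cscale R M c (\<phi> (g \<otimes>\<^bsub>G\<^esub> h) x)"
    obtain v where v: "v \<in> carrier M" "v \<noteq> \<zero>\<^bsub>M\<^esub>" using M.simple_nonzero[OF sim] .
    note kv = kc[OF v(1)]
    have "cscale R M c v = cscale R M z v"
      using c[rule_format, OF kv] z[rule_format, OF kv] pk[OF v(1)] by simp
    then show "c = z" by (rule sc_inj[OF v])
  qed (rule z)
  then show ?thesis using z x by simp
qed

lemma factor_set_nonzero:
  assumes g: "g \<in> H" and h: "h \<in> H"
  shows "\<alpha> g h \<noteq> 0"
proof
  assume a: "\<alpha> g h = 0"
  obtain v where v: "v \<in> carrier M" "v \<noteq> \<zero>\<^bsub>M\<^esub>" using M.simple_nonzero[OF sim] .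
  have "\<phi> g (\<phi> h v) = \<zero>\<^bsub>M\<^esub>" using factor_set_mult[OF g h v(1)] a phi_closed[OF H_closed[OF g h] v(1)] by simp
  then have "\<phi> h v = \<zero>\<^bsub>M\<^esub>" using phi_inj[OF g phi_closed[OF h v(1)], of "\<zero>\<^bsub>M\<^esub>"] phi_zero[OF g] by simp
  then have "v = \<zero>\<^bsub>M\<^esub>" using phi_inj[OF h v(1), of "\<zero>\<^bsub>M\<^esub>"] phi_zero[OF h] by simp
  then show False using v(2) by simp
qed

text \<open>Associativity of composition: applying \<phi> k, \<phi> h and \<phi> g in turn to a
  nonzero vector can be collected into a multiple of \<phi> (g h k) in two ways, and the vector so
  obtained is nonzero.\<close>

lemma twisted_alpha: "twisted_group G H \<alpha>"
proof (intro twisted_group.intro twisted_group_axioms.intro)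
  show "group G" by (rule G.group_axioms)
  show "subgroup H G" by (rule H_subgroup)
  show "finite H" by (rule finite_H)
  show "\<alpha> g h \<noteq> 0" if "g \<in> H" "h \<in> H" for g h by (rule factor_set_nonzero[OF that])
  fix g h k assume g: "g \<in> H" and h: "h \<in> H" and k: "k \<in> H"
  note gh = H_closed[OF g h] and hk = H_closed[OF h k]
  have as: "g \<otimes>\<^bsub>G\<^esub> h \<otimes>\<^bsub>G\<^esub> k = g \<otimes>\<^bsub>G\<^esub> (h \<otimes>\<^bsub>G\<^esub> k)" using H_carrier g h k by (simp add: G.m_assoc)
  note ghk = H_closed[OF gh k]
  obtain v where v: "v \<in> carrier M" "v \<noteq> \<zero>\<^bsub>M\<^esub>" using M.simple_nonzero[OF sim] .
  let ?w = "\<phi> (g \<otimes>\<^bsub>G\<^esub> h \<otimes>\<^bsub>G\<^esub> k) v"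
  have w: "?w \<in> carrier M" by (rule phi_closed[OF ghk v(1)])
  have nz: "?w \<noteq> \<zero>\<^bsub>M\<^esub>" using phi_inj[OF ghk v(1), of "\<zero>\<^bsub>M\<^esub>"] phi_zero[OF ghk] v(2) by auto
  have "\<phi> g (\<phi> h (\<phi> k v)) = cscale R M (\<alpha> g h) (\<phi> (g \<otimes>\<^bsub>G\<^esub> h) (\<phi> k v))"
    by (rule factor_set_mult[OF g h phi_closed[OF k v(1)]])
  also have "\<dots> = cscale R M (\<alpha> g h * \<alpha> (g \<otimes>\<^bsub>G\<^esub> h) k) ?w"
    using factor_set_mult[OF gh k v(1)] w by (simp add: M.sc_mult)
  finally have 1: "\<phi> g (\<phi> h (\<phi> k v)) = cscale R M (\<alpha> g h * \<alpha> (g \<otimes>\<^bsub>G\<^esub> h) k) ?w" .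
  have "\<phi> g (\<phi> h (\<phi> k v)) = \<phi> g (cscale R M (\<alpha> h k) (\<phi> (h \<otimes>\<^bsub>G\<^esub> k) v))" using factor_set_mult[OF h k v(1)] by simp
  also have "\<dots> = cscale R M (\<alpha> h k) (\<phi> g (\<phi> (h \<otimes>\<^bsub>G\<^esub> k) v))"
    by (rule phi_sc[OF g phi_closed[OF hk v(1)]])
  also have "\<dots> = cscale R M (\<alpha> h k * \<alpha> g (h \<otimes>\<^bsub>G\<^esub> k)) ?w"
    using factor_set_mult[OF g hk v(1)] w as by (simp add: M.sc_mult)
  finally have "\<alpha> g h * \<alpha> (g \<otimes>\<^bsub>G\<^esub> h) k = \<alpha> h k * \<alpha> g (h \<otimes>\<^bsub>G\<^esub> k)"
    using 1 sc_inj[OF w nz] by simp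
  then show "\<alpha> g h * \<alpha> (g \<otimes>\<^bsub>G\<^esub> h) k = \<alpha> g (h \<otimes>\<^bsub>G\<^esub> k) * \<alpha> h k" by simp
qed

sublocale TW: twisted_group G H \<alpha> by (rule twisted_alpha)

section \<open>The module over the twisted group algebra\<close>

abbreviation "C \<equiv> CH R G act M \<phi>"
abbreviation "C' \<equiv> CH_inv R G act M \<phi>"
abbreviation "CM \<equiv> CH_module R G act M \<phi>"

lemma C_eq: "C = TW.TA" by (simp add: CH_def)

lemma CM_simps [simp]:
  "carrier CM = carrier M" "\<zero>\<^bsub>CM\<^esub> = \<zero>\<^bsub>M\<^esub>" "add CM = add M"
  by (simp_all add: CH_module_def)

lemma CM_smult: "a \<odot>\<^bsub>CM\<^esub> x = (\<Oplus>\<^bsub>M\<^esub>h\<in>H. cscale R M (a h) (\<phi> h x))"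
  by (simp add: CH_module_def)

lemma CM_smult_closed: "x \<in> carrier M \<Longrightarrow> a \<odot>\<^bsub>CM\<^esub> x \<in> carrier M"
  unfolding CM_smult using phi_closed by (intro M.Mod.M.finsum_closed) auto

text \<open>Linear forms turn the action into complex sums over \<open>H\<close>, where
  associativity follows from \<open>pair_mult\<close>; by \<open>eq_by_forms\<close> nothing is
  lost.\<close>

lemma CM_form:
  assumes f: "linear_form R M f" and x: "x \<in> carrier M"
  shows "f (a \<odot>\<^bsub>CM\<^esub> x) = (\<Sum>h\<in>H. a h * f (\<phi> h x))"
proof -
  have "f (a \<odot>\<^bsub>CM\<^esub> x) = (\<Sum>h\<in>H. f (cscale R M (a h) (\<phi> h x)))"
    unfolding CM_smult using phi_closed x by (intro M.linear_form_finsum[OF f]) auto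
  also have "\<dots> = (\<Sum>h\<in>H. a h * f (\<phi> h x))"
    using phi_closed x linear_formD(2)[OF f] by (intro sum.cong) auto
  finally show ?thesis .
qed

text \<open>\<phi> \<one> composed with itself is \<alpha> \<one> \<one> times \<phi> \<one>, and
  \<phi> \<one> is injective. The scalar cancels against the coefficient in the unit of the twisted
  group algebra.\<close>

lemma phi_one: "x \<in> carrier M \<Longrightarrow> \<phi> \<one>\<^bsub>G\<^esub> x = cscale R M (\<alpha> \<one>\<^bsub>G\<^esub> \<one>\<^bsub>G\<^esub>) x"
proof -
  assume x: "x \<in> carrier M"
  have "\<phi> \<one>\<^bsub>G\<^esub> (\<phi> \<one>\<^bsub>G\<^esub> x) = \<phi> \<one>\<^bsub>G\<^esub> (cscale R M (\<alpha> \<one>\<^bsub>G\<^esub> \<one>\<^bsub>G\<^esub>) x)"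
    using factor_set_mult[OF H_one H_one x] phi_sc[OF H_one x] by simp
  then show ?thesis by (rule phi_inj[OF H_one phi_closed[OF H_one x] M.sc_closed[OF x]])
qed

lemma form_phi: "linear_form R M f \<Longrightarrow> h \<in> H \<Longrightarrow> linear_form R M (\<lambda>x. f (\<phi> h x))"
  using phi_closed phi_add phi_sc by (auto simp: linear_form_def)

lemma left_module_CM: "left_module C CM"
proof -
  have ab: "abelian_group CM"
    by (rule abelian_groupI) (auto simp: M.Mod.M.a_ac intro: M.Mod.M.l_neg)
  moreover have "left_module_axioms C CM" unfolding left_module_axioms_def
  proof (intro conjI allI impI)
    fix a x assume a: "a \<in> carrier C" and x: "x \<in> carrier CM"
    then have x: "x \<in> carrier M" by simp
    show "a \<odot>\<^bsub>CM\<^esub> x \<in> carrier CM" using CM_smult_closed[OF x] by simp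
    { fix b assume b: "b \<in> carrier C"
      show "(a \<oplus>\<^bsub>C\<^esub> b) \<odot>\<^bsub>CM\<^esub> x = a \<odot>\<^bsub>CM\<^esub> x \<oplus>\<^bsub>CM\<^esub> b \<odot>\<^bsub>CM\<^esub> x"
      proof (rule M.eq_by_forms)
        fix f assume f: "linear_form R M f"
        show "f ((a \<oplus>\<^bsub>C\<^esub> b) \<odot>\<^bsub>CM\<^esub> x) = f (a \<odot>\<^bsub>CM\<^esub> x \<oplus>\<^bsub>CM\<^esub> b \<odot>\<^bsub>CM\<^esub> x)"
          using linear_formD(1)[OF f CM_smult_closed[OF x] CM_smult_closed[OF x]] x
          by (simp add: CM_form[OF f] C_eq TW.TA_add distrib_right sum.distrib)
      qed (use CM_smult_closed x in auto)
      show "(a \<otimes>\<^bsub>C\<^esub> b) \<odot>\<^bsub>CM\<^esub> x = a \<odot>\<^bsub>CM\<^esub> (b \<odot>\<^bsub>CM\<^esub> x)"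
      proof (rule M.eq_by_forms)
        fix f assume f: "linear_form R M f"
        have "f ((a \<otimes>\<^bsub>C\<^esub> b) \<odot>\<^bsub>CM\<^esub> x) = (\<Sum>k\<in>H. f (\<phi> k x) * (a \<otimes>\<^bsub>C\<^esub> b) k)"
          using CM_form[OF f x] by (simp add: mult.commute)
        \<comment> \<open>\<open>pair_mult\<close> for the weight k \<mapsto> f (\<phi> k
          x).\<close>
        also have "\<dots> = (\<Sum>g\<in>H. \<Sum>h\<in>H. f (\<phi> (g \<otimes>\<^bsub>G\<^esub> h) x) * \<alpha> g h * a g * b h)"
          unfolding C_eq by (rule TW.pair_mult)
        also have "\<dots> = (\<Sum>g\<in>H. a g * (\<Sum>h\<in>H. b h * f (\<phi> g (\<phi> h x))))"
        proof (intro sum.cong refl)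
          fix g assume g: "g \<in> H"
          show "(\<Sum>h\<in>H. f (\<phi> (g \<otimes>\<^bsub>G\<^esub> h) x) * \<alpha> g h * a g * b h) = a g * (\<Sum>h\<in>H. b h * f (\<phi> g (\<phi> h x)))"
            unfolding sum_distrib_left
          proof (intro sum.cong refl)
            fix h assume h: "h \<in> H"
            have "f (\<phi> g (\<phi> h x)) = \<alpha> g h * f (\<phi> (g \<otimes>\<^bsub>G\<^esub> h) x)"
              using factor_set_mult[OF g h x] linear_formD(2)[OF f phi_closed[OF H_closed[OF g h] x]] by simp
            then show "f (\<phi> (g \<otimes>\<^bsub>G\<^esub> h) x) * \<alpha> g h * a g * b h = a g * (b h * f (\<phi> g (\<phi> h x)))" by simp
          qed
        qed
        also have "\<dots> = (\<Sum>g\<in>H. a g * f (\<phi> g (b \<odot>\<^bsub>CM\<^esub> x)))"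
          using CM_form[OF form_phi[OF f] x] by simp
        also have "\<dots> = f (a \<odot>\<^bsub>CM\<^esub> (b \<odot>\<^bsub>CM\<^esub> x))" using CM_form[OF f CM_smult_closed[OF x]] by simp
        finally show "f ((a \<otimes>\<^bsub>C\<^esub> b) \<odot>\<^bsub>CM\<^esub> x) = f (a \<odot>\<^bsub>CM\<^esub> (b \<odot>\<^bsub>CM\<^esub> x))" .
      qed (use CM_smult_closed x in auto) }
    fix y assume y: "y \<in> carrier CM"
    then have y: "y \<in> carrier M" by simp
    show "a \<odot>\<^bsub>CM\<^esub> (x \<oplus>\<^bsub>CM\<^esub> y) = a \<odot>\<^bsub>CM\<^esub> x \<oplus>\<^bsub>CM\<^esub> a \<odot>\<^bsub>CM\<^esub> y"
    proof (rule M.eq_by_forms)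
      fix f assume f: "linear_form R M f"
      have "(\<Sum>h\<in>H. a h * f (\<phi> h (x \<oplus>\<^bsub>M\<^esub> y))) = (\<Sum>h\<in>H. a h * f (\<phi> h x) + a h * f (\<phi> h y))"
        using linear_formD(1)[OF form_phi[OF f] x y] by (simp add: distrib_left)
      then show "f (a \<odot>\<^bsub>CM\<^esub> (x \<oplus>\<^bsub>CM\<^esub> y)) = f (a \<odot>\<^bsub>CM\<^esub> x \<oplus>\<^bsub>CM\<^esub> a \<odot>\<^bsub>CM\<^esub> y)"
        using linear_formD(1)[OF f CM_smult_closed[OF x] CM_smult_closed[OF y]] x y
        by (simp add: CM_form[OF f] sum.distrib)
    qed (use CM_smult_closed x y in auto)
  next
    fix x assume "x \<in> carrier CM"
    then have x: "x \<in> carrier M" by simp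
    show "\<one>\<^bsub>C\<^esub> \<odot>\<^bsub>CM\<^esub> x = x"
    proof (rule M.eq_by_forms)
      fix f assume f: "linear_form R M f"
      have "f (\<one>\<^bsub>C\<^esub> \<odot>\<^bsub>CM\<^esub> x) = (\<Sum>h\<in>H. if h = \<one>\<^bsub>G\<^esub> then inverse (\<alpha> \<one>\<^bsub>G\<^esub> \<one>\<^bsub>G\<^esub>) * f (\<phi> h x) else 0)"
        unfolding CM_form[OF f x] by (intro sum.cong) (auto simp: C_eq TW.TA_one)
      also have "\<dots> = inverse (\<alpha> \<one>\<^bsub>G\<^esub> \<one>\<^bsub>G\<^esub>) * f (\<phi> \<one>\<^bsub>G\<^esub> x)" using finite_H H_one by simp
      also have "\<dots> = f x" using phi_one[OF x] linear_formD(2)[OF f x] factor_set_nonzero[OF H_one H_one] by simp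
      finally show "f (\<one>\<^bsub>C\<^esub> \<odot>\<^bsub>CM\<^esub> x) = f x" .
    qed (use CM_smult_closed x in auto)
  qed
  ultimately show ?thesis using TW.TA_ring by (simp add: left_module_def C_eq)
qed

lemma alg_C: "complex_algebra C" using TW.TA_algebra by (simp add: C_eq)

lemma alg_CM: "alg_module C CM" using left_module_CM alg_C by (simp add: alg_module_def)

lemma CM_sc: "x \<in> carrier M \<Longrightarrow> (c \<odot>\<^bsub>C\<^esub> a) \<odot>\<^bsub>CM\<^esub> x = cscale R M c (a \<odot>\<^bsub>CM\<^esub> x)"
proof (rule M.eq_by_forms)
  fix f assume x: "x \<in> carrier M" and f: "linear_form R M f"
  show "f ((c \<odot>\<^bsub>C\<^esub> a) \<odot>\<^bsub>CM\<^esub> x) = f (cscale R M c (a \<odot>\<^bsub>CM\<^esub> x))"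
    using linear_formD(2)[OF f CM_smult_closed[OF x]]
    by (simp add: CM_form[OF f x] C_eq TW.TA_smult sum_distrib_left mult.assoc)
qed (auto simp: CM_smult_closed)

lemma basis_CM:
  assumes h: "h \<in> H" and x: "x \<in> carrier M"
  shows "basis_element h \<odot>\<^bsub>CM\<^esub> x = \<phi> h x"
  unfolding CM_smult
  using h x phi_closed finite_H
  by (intro abelian_finsum_delta[OF M.ab_group finite_H h]) (auto simp: basis_element_def)

text \<open>Moving r past \<phi> h replaces it by its image under h, which is r itself.\<close>

lemma CM_commute:
  assumes r: "r \<in> carrier RG" and x: "x \<in> carrier M"
  shows "r \<odot>\<^bsub>M\<^esub> (a \<odot>\<^bsub>CM\<^esub> x) = a \<odot>\<^bsub>CM\<^esub> (r \<odot>\<^bsub>M\<^esub> x)"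
proof -
  have "r \<odot>\<^bsub>M\<^esub> (a \<odot>\<^bsub>CM\<^esub> x) = (\<Oplus>\<^bsub>M\<^esub>h\<in>H. r \<odot>\<^bsub>M\<^esub> cscale R M (a h) (\<phi> h x))"
    unfolding CM_smult using RG_sub[OF r] phi_closed x by (intro M.smult_finsum) auto
  also have "\<dots> = a \<odot>\<^bsub>CM\<^esub> (r \<odot>\<^bsub>M\<^esub> x)"
    unfolding CM_smult using RG_sub[OF r] RG_fixed[OF r] phi_closed x H_carrier
    by (intro M.Mod.M.finsum_cong') (auto simp: phi_smult M.smult_sc)
  finally show ?thesis .
qed

lemma commuting: "commuting_actions RG M C CM"
proof (intro commuting_actions.intro commuting_actions_axioms.intro)
  show "alg_module RG M" by (rule alg_module_RG[OF alg_M])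
  show "alg_module C CM" by (rule alg_CM)
  show "r \<odot>\<^bsub>M\<^esub> (c \<odot>\<^bsub>CM\<^esub> x) = c \<odot>\<^bsub>CM\<^esub> (r \<odot>\<^bsub>M\<^esub> x)"
    if "r \<in> carrier RG" "c \<in> carrier C" "x \<in> carrier M" for r c x
    by (rule CM_commute[OF that(1,3)])
  show "cscale C CM z x = cscale RG M z x" if x: "x \<in> carrier M" for z x
  proof -
    interpret CM: alg_module C CM by (rule alg_CM)
    show ?thesis
      using CM_sc[OF x, of z "\<one>\<^bsub>C\<^esub>"] CM.Mod.smult_one[of x] x
      by (simp add: cscale_RG) (simp add: cscale_def)
  qed
qed simp_all

subsection \<open>The image of the fixed ring\<close>

text \<open>
  By density, \<open>r \<in> R\<close> can be chosen to act as \<open>T / |H|\<close> on \<open>M\<close> and as zero on all twists of \<open>M\<close> that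
  are not isomorphic to \<open>M\<close>.  Then the trace of \<open>r\<close> acts as \<open>(\<Sum>h\<in>H. \<phi> h T (\<phi> h)\<^sup>-\<^sup>1) / |H| = T\<close>.
\<close>

lemma fixed_ring_density:
  fixes W :: "'j \<Rightarrow> ('r, 'm) module"
  assumes T: "linear_map R M R M T"
    and comm: "\<And>h x. h \<in> H \<Longrightarrow> x \<in> carrier M \<Longrightarrow> T (\<phi> h x) = \<phi> h (T x)"
    and J: "finite J" "\<And>j. j \<in> J \<Longrightarrow> simple_module R (W j) \<and> fin_dim R (W j)"
    and noniso: "\<And>j g. j \<in> J \<Longrightarrow> g \<in> carrier G \<Longrightarrow> \<not> isomorphic R (twist G act g (W j)) M"
  obtains r where "r \<in> carrier RG" "\<And>x. x \<in> carrier M \<Longrightarrow> r \<odot>\<^bsub>M\<^esub> x = T x"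
    "\<And>j w. j \<in> J \<Longrightarrow> w \<in> carrier (W j) \<Longrightarrow> r \<odot>\<^bsub>W j\<^esub> w = \<zero>\<^bsub>W j\<^esub>"
proof -
  \<comment> \<open>Each of the |H| summands of the trace indexed by \<open>H\<close> will
    contribute c times T x.\<close>
  define c :: complex where "c = inverse (of_nat (card H))"
  have Hne: "H \<noteq> {}" using H_one by blast
  then have c: "of_nat (card H) * c = 1" using finite_H by (simp add: c_def)
  note TD = linear_mapD[OF T]
  have lin: "linear_map R M R M (\<lambda>x. cscale R M c (T x))"
    using TD by (auto simp: linear_map_def additive_map_def M.sc_add_right M.sc_mult[symmetric] mult.commute)
  \<comment> \<open>The modules on which r has to vanish: (g, None) stands for a twist of
    \<open>M\<close>, (g, Some j) for a twist of W j. \<open>K\<close> leaves out the twists of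
    \<open>M\<close> by \<open>H\<close>, which are the ones isomorphic to \<open>M\<close>. All
    twists of W j are included, so that every conjugate of r annihilates W j.\<close>
  define V where "V = (\<lambda>(g, u). twist G act g (case u of None \<Rightarrow> M | Some j \<Rightarrow> W j))"
  define K where "K = carrier G \<times> (insert None (Some ` J)) - H \<times> {None}"
  have finK: "finite K" using finite_group J(1) by (simp add: K_def)
  have V: "simple_module R (V k) \<and> fin_dim R (V k) \<and> \<not> isomorphic R (V k) M" if k: "k \<in> K" for k
  proof -
    obtain g u where gu: "k = (g, u)" "g \<in> carrier G" "u = None \<and> g \<notin> H \<or> (\<exists>j\<in>J. u = Some j)"
      using k by (auto simp: K_def)
    show ?thesis
    proof (cases u)
      case None
      then have "g \<notin> H" using gu by auto
      have "\<not> isomorphic R (twist G act g M) M"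
      proof
        assume "isomorphic R (twist G act g M) M"
        then have "isomorphic R M (twist G act g M)"
          by (rule isomorphic_sym[OF alg_module_twist[OF alg_M gu(2)] alg_M])
        then have "g \<in> H" unfolding inertia_def using gu(2) by blast
        then show False using \<open>g \<notin> H\<close> by contradiction
      qed
      then show ?thesis using None gu sim fd simple_twist[OF sim gu(2)] fin_dim_twist[OF gu(2) fd]
        by (simp add: V_def)
    next
      case (Some j)
      then have j: "j \<in> J" using gu by auto
      then show ?thesis using Some gu(1,2) J(2)[OF j] noniso[OF j gu(2)] simple_twist[of "W j" g] fin_dim_twist[of g "W j"]
        by (simp add: V_def)
    qed
  qed
  obtain r where r: "r \<in> carrier R" "\<And>x. x \<in> carrier M \<Longrightarrow> r \<odot>\<^bsub>M\<^esub> x = cscale R M c (T x)"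
    "\<And>k w. k \<in> K \<Longrightarrow> w \<in> carrier (V k) \<Longrightarrow> r \<odot>\<^bsub>V k\<^esub> w = \<zero>\<^bsub>V k\<^esub>"
  proof (rule M.density_separating[OF sim fd lin finK, of V])
    show "simple_module R (V k) \<and> fin_dim R (V k) \<and> \<not> isomorphic R (V k) M" if "k \<in> K" for k
      by (rule V[OF that])
    fix r assume "r \<in> carrier R" "\<And>v. v \<in> carrier M \<Longrightarrow> r \<odot>\<^bsub>M\<^esub> v = cscale R M c (T v)"
      "\<And>k w. k \<in> K \<Longrightarrow> w \<in> carrier (V k) \<Longrightarrow> r \<odot>\<^bsub>V k\<^esub> w = \<zero>\<^bsub>V k\<^esub>"
    then show thesis by (rule that)
  qed
  have acl: "(\<lambda>g. act g r) \<in> carrier G \<rightarrow> carrier R" using r(1) by auto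
  \<comment> \<open>The conjugate of r by g acts on \<open>M\<close> as r acts on the twist by inv
    g.\<close>
  have zero_M: "act g r \<odot>\<^bsub>M\<^esub> x = \<zero>\<^bsub>M\<^esub>" if g: "g \<in> carrier G" "g \<notin> H" and x: "x \<in> carrier M" for g x
  proof -
    have "inv\<^bsub>G\<^esub> g \<notin> H" using H_inv[of "inv\<^bsub>G\<^esub> g"] g by auto
    then have "(inv\<^bsub>G\<^esub> g, None) \<in> K" using g by (simp add: K_def)
    from r(3)[OF this, of x] show ?thesis using x g by (simp add: V_def)
  qed
  \<comment> \<open>For h in \<open>H\<close> the conjugate of r acts as r transported by \<phi> h,
    and \<open>T\<close> commutes with \<phi> h.\<close>
  have T_M: "act h r \<odot>\<^bsub>M\<^esub> x = cscale R M c (T x)" if h: "h \<in> H" and x: "x \<in> carrier M" for h x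
  proof -
    obtain y where y: "y \<in> carrier M" "\<phi> h y = x" using phi_surj[OF h x] .
    have "act h r \<odot>\<^bsub>M\<^esub> x = \<phi> h (r \<odot>\<^bsub>M\<^esub> y)" using phi_smult[OF h r(1) y(1)] y(2) by simp
    also have "\<dots> = cscale R M c (\<phi> h (T y))" using r(2)[OF y(1)] phi_sc[OF h TD(1)[OF y(1)]] by simp
    finally show ?thesis using comm[OF h y(1)] y(2) by simp
  qed
  show thesis
  proof (rule that[OF trace_closed[OF r(1)]])
    fix x assume x: "x \<in> carrier M"
    have "trace r \<odot>\<^bsub>M\<^esub> x = (\<Oplus>\<^bsub>M\<^esub>g\<in>carrier G. act g r \<odot>\<^bsub>M\<^esub> x)"
      unfolding trace_def by (rule M.finsum_smult[OF x acl])
    also have "\<dots> = (\<Oplus>\<^bsub>M\<^esub>g\<in>carrier G. cscale R M (if g \<in> H then c else 0) (T x))"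
      using T_M zero_M TD(1)[OF x] x by (intro M.Mod.M.finsum_cong') auto
    also have "\<dots> = cscale R M (\<Sum>g\<in>carrier G. if g \<in> H then c else 0) (T x)"
      by (rule M.finsum_sc_left[OF TD(1)[OF x]])
    also have "(\<Sum>g\<in>carrier G. if g \<in> H then c else 0) = (\<Sum>g\<in>carrier G \<inter> H. c)"
      by (rule sum.inter_restrict[OF finite_group, symmetric])
    also have "carrier G \<inter> H = H" using H_carrier by blast
    finally show "trace r \<odot>\<^bsub>M\<^esub> x = T x" using TD(1)[OF x] c by simp
  next
    fix j w assume j: "j \<in> J" and w: "w \<in> carrier (W j)"
    interpret W: alg_module R "W j" using simple_alg_module[OF algR] J(2)[OF j] by blast
    have "trace r \<odot>\<^bsub>W j\<^esub> w = (\<Oplus>\<^bsub>W j\<^esub>g\<in>carrier G. act g r \<odot>\<^bsub>W j\<^esub> w)"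
      unfolding trace_def by (rule W.finsum_smult[OF w acl])
    also have "\<dots> = (\<Oplus>\<^bsub>W j\<^esub>g\<in>carrier G. \<zero>\<^bsub>W j\<^esub>)"
    proof (rule W.Mod.M.finsum_cong')
      fix g assume g: "g \<in> carrier G"
      then have "(inv\<^bsub>G\<^esub> g, Some j) \<in> K" using j by (simp add: K_def)
      from r(3)[OF this, of w] show "act g r \<odot>\<^bsub>W j\<^esub> w = \<zero>\<^bsub>W j\<^esub>" using w g by (simp add: V_def)
    qed auto
    finally show "trace r \<odot>\<^bsub>W j\<^esub> w = \<zero>\<^bsub>W j\<^esub>" by (simp add: W.Mod.M.finsum_zero)
  qed
qed

end

subsection \<open>The decomposition of a simple module\<close>

context clifford
begin

abbreviation "D N \<nu> \<equiv> dual_module H C' (N \<nu>)"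

text \<open>The results on anti-isomorphic algebras, with the algebra of the inverse factor set in
  the place of \<open>A\<close>. It is itself a twisted group algebra, hence semisimple and finite
  dimensional.\<close>

lemma dual_simples:
  fixes N :: "'i \<Rightarrow> ('g \<Rightarrow> complex, 'n) module"
  assumes cs: "complete_simples C' I N"
  shows "complete_simples C I (D N)" and "finite I"
    and "\<And>\<nu>. \<nu> \<in> I \<Longrightarrow> simple_module C (D N \<nu>) \<and> fin_dim C (D N \<nu>)"
    and "\<And>c. c \<in> carrier C \<Longrightarrow>
      (\<And>\<nu> v. \<nu> \<in> I \<Longrightarrow> v \<in> carrier (D N \<nu>) \<Longrightarrow> c \<odot>\<^bsub>D N \<nu>\<^esub> v = \<zero>\<^bsub>D N \<nu>\<^esub>) \<Longrightarrow> c = \<zero>\<^bsub>C\<^esub>"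
proof -
  interpret TI: twisted_group G H "\<lambda>g h. inverse (\<alpha> g h)" by (rule TW.twisted_group_inverse)
  have C'_eq: "C' = TI.TA" by (simp add: CH_inv_def)
  interpret anti: anti_isomorphic_algebras C' C TI.invert_basis
    unfolding C'_eq C_eq by (rule TI.anti_isomorphic) simp
  have fdA: "fin_dim C' (regular_module C')" unfolding C'_eq by (rule TI.TA_fin_dim)
  have fdC: "fin_dim C (regular_module C)" unfolding C_eq by (rule TW.TA_fin_dim)
  have ss: "left_ideals_idempotent C'" unfolding C'_eq by (rule TI.TA_left_ideals_idempotent)
  have algC': "complex_algebra C'" unfolding C'_eq by (rule TI.TA_algebra)
  have dual: "dual_along C C' TI.invert_basis (N \<nu>) (D N \<nu>)" if "\<nu> \<in> I" for \<nu>
    using TI.dual_along_dual_module[of "N \<nu>" \<alpha>] simple_alg_module[OF algC' complete_simplesD(1)[OF cs that]]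
    unfolding C'_eq C_eq .
  show csD: "complete_simples C I (D N)" by (rule anti.complete_simples_dual[OF cs ss fdA fdC dual])
  show "finite I" by (rule complete_simples_finite[OF algC' fdA cs])
  show "simple_module C (D N \<nu>) \<and> fin_dim C (D N \<nu>)" if "\<nu> \<in> I" for \<nu>
    using complete_simplesD(1)[OF csD that]
      alg_module.simple_fin_dim[OF simple_alg_module[OF alg_C complete_simplesD(1)[OF csD that]] fdC] by blast
  show "c = \<zero>\<^bsub>C\<^esub>" if "c \<in> carrier C"
    "\<And>\<nu> v. \<nu> \<in> I \<Longrightarrow> v \<in> carrier (D N \<nu>) \<Longrightarrow> c \<odot>\<^bsub>D N \<nu>\<^esub> v = \<zero>\<^bsub>D N \<nu>\<^esub>" for c
    by (rule anti.dual_faithful[OF cs ss dual that])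
qed

text \<open>D N \<nu> is nonzero, so its basis is nonempty. Hence every index has at least one
  coordinate map, through which Y \<nu> is reached from \<open>M\<close>.\<close>

lemma dual_bases:
  assumes cs: "complete_simples C' I N"
  obtains E \<delta> where "\<And>\<nu>. \<nu> \<in> I \<Longrightarrow> dual_basis C (D N \<nu>) (E \<nu>) (\<delta> \<nu>)" "\<And>\<nu>. \<nu> \<in> I \<Longrightarrow> E \<nu> \<noteq> {}"
proof -
  have "\<exists>B. \<nu> \<in> I \<longrightarrow> dual_basis C (D N \<nu>) (fst B) (snd B) \<and> fst B \<noteq> {}" for \<nu>
  proof (cases "\<nu> \<in> I")
    case True
    have s: "simple_module C (D N \<nu>)" and f: "fin_dim C (D N \<nu>)" using dual_simples(3)[OF cs True] by auto
    interpret Dn: alg_module C "D N \<nu>" by (rule simple_alg_module[OF alg_C s])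
    obtain B \<delta> where B: "dual_basis C (D N \<nu>) B \<delta>" using Dn.exists_dual_basis[OF f] .
    obtain x where x: "x \<in> carrier (D N \<nu>)" "x \<noteq> \<zero>\<^bsub>D N \<nu>\<^esub>" using Dn.simple_nonzero[OF s] .
    have "B \<noteq> {}" using dual_basisD(5)[OF B x(1)] x(2) by auto
    then show ?thesis using B by (intro exI[of _ "(B, \<delta>)"]) simp
  qed simp
  then obtain B where B: "\<And>\<nu>. \<nu> \<in> I \<Longrightarrow> dual_basis C (D N \<nu>) (fst (B \<nu>)) (snd (B \<nu>)) \<and> fst (B \<nu>) \<noteq> {}"
    by metis
  show thesis by (rule that[of "\<lambda>\<nu>. fst (B \<nu>)" "\<lambda>\<nu>. snd (B \<nu>)"]) (use B in auto)
qed

lemma tensor_sum_components: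
  assumes cs: "complete_simples C' I N"
    and E: "\<And>\<nu>. \<nu> \<in> I \<Longrightarrow> dual_basis C (D N \<nu>) (E \<nu>) (\<delta> \<nu>)"
    and Y: "\<And>\<nu>. \<nu> \<in> I \<Longrightarrow> alg_module RG (Y \<nu>)"
  shows "tensor_sum RG M C CM I Y (D N) E \<delta>"
proof (rule tensor_sum.intro)
  show "tensor_coordinates RG (Y \<nu>) C (D N \<nu>) (E \<nu>) (\<delta> \<nu>)" if "\<nu> \<in> I" for \<nu>
  proof (intro tensor_coordinates.intro tensor_coordinates_axioms.intro)
    show "alg_module RG (Y \<nu>)" by (rule Y[OF that])
    show "alg_module C (D N \<nu>)" using simple_alg_module[OF alg_C] dual_simples(3)[OF cs that] by blast
    show "dual_basis C (D N \<nu>) (E \<nu>) (\<delta> \<nu>)" by (rule E[OF that])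
  qed
  show "finite I" by (rule dual_simples(2)[OF cs])
  show "alg_module RG M" by (rule alg_module_RG[OF alg_M])
  show "alg_module C CM" by (rule alg_CM)
qed simp_all

text \<open>The type of \<open>Y\<close> is that of maps from the dual of N \<nu> to
  \<open>M\<close>, as the multiplicity spaces are spaces of homomorphisms.\<close>

lemma exists_clifford_decomposition:
  fixes N :: "'i \<Rightarrow> ('g \<Rightarrow> complex, 'n) module"
  assumes cs: "complete_simples C' I N"
  shows "\<exists>Y :: 'i \<Rightarrow> ('r, ('n \<Rightarrow> complex) \<Rightarrow> 'm) module. clifford_decomposition R G act M \<phi> I N Y"
proof -
  interpret CA: commuting_actions RG M C CM by (rule commuting)
  obtain E \<delta> where E: "\<And>\<nu>. \<nu> \<in> I \<Longrightarrow> dual_basis C (D N \<nu>) (E \<nu>) (\<delta> \<nu>)"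
    using dual_bases[OF cs] by metis
  let ?Y = "\<lambda>\<nu>. hom_space C (D N \<nu>) CM M :: ('r, ('n \<Rightarrow> complex) \<Rightarrow> 'm) module"
  have "\<exists>\<kappa>. tensor_decomposition RG M C CM I ?Y (D N) E \<delta> \<kappa>"
    by (rule CA.exists_tensor_decomposition[OF dual_simples(3)[OF cs] complete_simplesD(2)[OF dual_simples(1)[OF cs]]
          dual_simples(2)[OF cs] dual_simples(4)[OF cs] E])
  then obtain \<kappa> where \<kappa>: "tensor_decomposition RG M C CM I ?Y (D N) E \<delta> \<kappa>" ..
  have Y: "alg_module RG (?Y \<nu>)" if "\<nu> \<in> I" for \<nu>
    using simple_alg_module[OF alg_C] dual_simples(3)[OF cs that] by (intro CA.alg_module_hom_space) blast
  interpret TS: tensor_sum RG M C CM I ?Y "D N" E \<delta> by (rule tensor_sum_components[OF cs E Y])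
  have "clifford_decomposition R G act M \<phi> I N ?Y"
    using TS.iso_of_decomposition[OF \<kappa>] Y
    by (simp add: clifford_decomposition_def Let_def alg_module_def)
  then show ?thesis by (intro exI[of _ ?Y])
qed

section \<open>Components of an arbitrary decomposition\<close>

lemma clifford_decomposition_modules:
  "clifford_decomposition R G act M \<phi> I N Y \<Longrightarrow> \<nu> \<in> I \<Longrightarrow> alg_module RG (Y \<nu>)"
  using algRG by (simp add: clifford_decomposition_def Let_def alg_module_def)

lemma clifford_coordinates:
  assumes cs: "complete_simples C' I N" and dec: "clifford_decomposition R G act M \<phi> I N Y"
  obtains E \<delta> \<kappa> where "\<And>\<nu>. \<nu> \<in> I \<Longrightarrow> E \<nu> \<noteq> {}" "tensor_decomposition RG M C CM I Y (D N) E \<delta> \<kappa>"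
proof -
  obtain E \<delta> where E: "\<And>\<nu>. \<nu> \<in> I \<Longrightarrow> dual_basis C (D N \<nu>) (E \<nu>) (\<delta> \<nu>)" "\<And>\<nu>. \<nu> \<in> I \<Longrightarrow> E \<nu> \<noteq> {}"
    using dual_bases[OF cs] by metis
  interpret TS: tensor_sum RG M C CM I Y "D N" E \<delta>
    by (rule tensor_sum_components[OF cs E(1) clifford_decomposition_modules[OF dec]])
  obtain F where "F \<in> module_iso RG M TS.Sl" "F \<in> module_iso C CM TS.Sr"
    using dec unfolding clifford_decomposition_def Let_def by blast
  from TS.decomposition_of_iso[OF this] obtain \<kappa> where "tensor_decomposition RG M C CM I Y (D N) E \<delta> \<kappa>" ..
  then show thesis using that[of E \<delta> \<kappa>] E(2) by simp
qed

text \<open>\<open>L\<close> extends to an operator \<open>T\<close> on \<open>M\<close> that is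
  zero on the other components and commutes with \<open>C\<close>, hence with all \<phi> h, and
  \<open>fixed_ring_density\<close> realizes \<open>T\<close> by an element of the fixed ring. Since
  every element of a component is a coordinate of some x, the action on the components is as stated.
  The family \<open>W\<close> serves the comparison of different orbits in (c).\<close>

lemma realize_on_component:
  fixes W :: "'j \<Rightarrow> ('r, 'm) module"
  assumes cs: "complete_simples C' I N" and dec: "clifford_decomposition R G act M \<phi> I N Y"
    and \<nu>0: "\<nu>\<^sub>0 \<in> I" and L: "linear_map RG (Y \<nu>\<^sub>0) RG (Y \<nu>\<^sub>0) L"
    and J: "finite J" "\<And>j. j \<in> J \<Longrightarrow> simple_module R (W j) \<and> fin_dim R (W j)"
    and noniso: "\<And>j g. j \<in> J \<Longrightarrow> g \<in> carrier G \<Longrightarrow> \<not> isomorphic R (twist G act g (W j)) M"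
  obtains r where "r \<in> carrier RG" "\<And>y. y \<in> carrier (Y \<nu>\<^sub>0) \<Longrightarrow> r \<odot>\<^bsub>Y \<nu>\<^sub>0\<^esub> y = L y"
    "\<And>\<nu> y. \<nu> \<in> I \<Longrightarrow> \<nu> \<noteq> \<nu>\<^sub>0 \<Longrightarrow> y \<in> carrier (Y \<nu>) \<Longrightarrow> r \<odot>\<^bsub>Y \<nu>\<^esub> y = \<zero>\<^bsub>Y \<nu>\<^esub>"
    "\<And>j w. j \<in> J \<Longrightarrow> w \<in> carrier (W j) \<Longrightarrow> r \<odot>\<^bsub>W j\<^esub> w = \<zero>\<^bsub>W j\<^esub>"
proof -
  note Y = clifford_decomposition_modules[OF dec]
  obtain E \<delta> \<kappa> where E: "\<And>\<nu>. \<nu> \<in> I \<Longrightarrow> E \<nu> \<noteq> {}"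
    and \<kappa>: "tensor_decomposition RG M C CM I Y (D N) E \<delta> \<kappa>"
    using clifford_coordinates[OF cs dec] by metis
  obtain T where T: "linear_map RG M RG M T"
    "\<And>c x. c \<in> carrier C \<Longrightarrow> x \<in> carrier M \<Longrightarrow> T (c \<odot>\<^bsub>CM\<^esub> x) = c \<odot>\<^bsub>CM\<^esub> T x"
    "\<And>x b. x \<in> carrier M \<Longrightarrow> b \<in> E \<nu>\<^sub>0 \<Longrightarrow> \<kappa> \<nu>\<^sub>0 b (T x) = L (\<kappa> \<nu>\<^sub>0 b x)"
    "\<And>x \<nu> b. x \<in> carrier M \<Longrightarrow> \<nu> \<in> I \<Longrightarrow> \<nu> \<noteq> \<nu>\<^sub>0 \<Longrightarrow> b \<in> E \<nu> \<Longrightarrow> \<kappa> \<nu> b (T x) = \<zero>\<^bsub>Y \<nu>\<^esub>"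
  proof (rule decomposition_operator[OF alg_module_RG[OF alg_M] alg_CM _ Y \<kappa> \<nu>0 L])
    fix T assume "linear_map RG M RG M T"
      "\<And>c x. c \<in> carrier C \<Longrightarrow> x \<in> carrier M \<Longrightarrow> T (c \<odot>\<^bsub>CM\<^esub> x) = c \<odot>\<^bsub>CM\<^esub> T x"
      "\<And>x b. x \<in> carrier M \<Longrightarrow> b \<in> E \<nu>\<^sub>0 \<Longrightarrow> \<kappa> \<nu>\<^sub>0 b (T x) = L (\<kappa> \<nu>\<^sub>0 b x)"
      "\<And>x \<nu> b. x \<in> carrier M \<Longrightarrow> \<nu> \<in> I \<Longrightarrow> \<nu> \<noteq> \<nu>\<^sub>0 \<Longrightarrow> b \<in> E \<nu> \<Longrightarrow> \<kappa> \<nu> b (T x) = \<zero>\<^bsub>Y \<nu>\<^esub>"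
    then show thesis by (rule that)
  qed simp_all
  have TR: "linear_map R M R M T" using T(1) by (simp add: linear_map_def cscale_RG)
  \<comment> \<open>Commuting with \<open>C\<close> includes commuting with the basis elements, and
    these act as \<phi> h.\<close>
  have comm: "T (\<phi> h x) = \<phi> h (T x)" if h: "h \<in> H" and x: "x \<in> carrier M" for h x
    using T(2)[of "basis_element h" x] TW.basis_closed[OF h] h x linear_mapD(1)[OF TR x]
    by (simp add: C_eq basis_CM)
  obtain r where r: "r \<in> carrier RG" "\<And>x. x \<in> carrier M \<Longrightarrow> r \<odot>\<^bsub>M\<^esub> x = T x"
    "\<And>j w. j \<in> J \<Longrightarrow> w \<in> carrier (W j) \<Longrightarrow> r \<odot>\<^bsub>W j\<^esub> w = \<zero>\<^bsub>W j\<^esub>"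
  proof (rule fixed_ring_density[OF TR comm J noniso])
    fix r assume "r \<in> carrier RG" "\<And>x. x \<in> carrier M \<Longrightarrow> r \<odot>\<^bsub>M\<^esub> x = T x"
      "\<And>j w. j \<in> J \<Longrightarrow> w \<in> carrier (W j) \<Longrightarrow> r \<odot>\<^bsub>W j\<^esub> w = \<zero>\<^bsub>W j\<^esub>"
    then show thesis by (rule that)
  qed
  have lift: "\<exists>b x. b \<in> E \<nu> \<and> x \<in> carrier M \<and> \<kappa> \<nu> b x = y \<and> r \<odot>\<^bsub>Y \<nu>\<^esub> y = \<kappa> \<nu> b (T x)"
    if \<nu>: "\<nu> \<in> I" and y: "y \<in> carrier (Y \<nu>)" for \<nu> y
  proof -
    obtain b where b: "b \<in> E \<nu>" using E[OF \<nu>] by blast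
    obtain x where x: "x \<in> carrier M" "\<kappa> \<nu> b x = y" using decomposition_lift[OF Y \<kappa> \<nu> b y] .
    have "\<kappa> \<nu> b (T x) = r \<odot>\<^bsub>Y \<nu>\<^esub> y"
      using module_homD(3)[OF tensor_decompositionD(1)[OF \<kappa> \<nu> b] r(1) x(1)] r(2)[OF x(1)] x(2) by simp
    then show ?thesis using b x by (intro exI[of _ b] exI[of _ x]) simp
  qed
  show thesis
  proof (rule that[OF r(1)])
    fix y assume y: "y \<in> carrier (Y \<nu>\<^sub>0)"
    then obtain b x where "b \<in> E \<nu>\<^sub>0" "x \<in> carrier M" "\<kappa> \<nu>\<^sub>0 b x = y" "r \<odot>\<^bsub>Y \<nu>\<^sub>0\<^esub> y = \<kappa> \<nu>\<^sub>0 b (T x)"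
      using lift[OF \<nu>0 y] by (elim exE conjE)
    then show "r \<odot>\<^bsub>Y \<nu>\<^sub>0\<^esub> y = L y" using T(3) by simp
  next
    fix \<nu> y assume \<nu>: "\<nu> \<in> I" "\<nu> \<noteq> \<nu>\<^sub>0" and y: "y \<in> carrier (Y \<nu>)"
    then obtain b x where "b \<in> E \<nu>" "x \<in> carrier M" "\<kappa> \<nu> b x = y" "r \<odot>\<^bsub>Y \<nu>\<^esub> y = \<kappa> \<nu> b (T x)"
      using lift[OF \<nu>(1) y] by (elim exE conjE)
    then show "r \<odot>\<^bsub>Y \<nu>\<^esub> y = \<zero>\<^bsub>Y \<nu>\<^esub>" using T(4) \<nu> by simp
  qed (rule r(3))
qed

text \<open>Coordinate maps are homomorphisms over the fixed ring and onto. In (c) this carries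
  annihilation from a simple \<open>R\<close>-module to all its components.\<close>

lemma component_annihilated:
  assumes cs: "complete_simples C' I N" and dec: "clifford_decomposition R G act M \<phi> I N Y"
    and \<nu>: "\<nu> \<in> I" and r: "r \<in> carrier RG" "\<And>x. x \<in> carrier M \<Longrightarrow> r \<odot>\<^bsub>M\<^esub> x = \<zero>\<^bsub>M\<^esub>"
    and y: "y \<in> carrier (Y \<nu>)"
  shows "r \<odot>\<^bsub>Y \<nu>\<^esub> y = \<zero>\<^bsub>Y \<nu>\<^esub>"
proof -
  note Y = clifford_decomposition_modules[OF dec]
  interpret Yn: alg_module RG "Y \<nu>" by (rule Y[OF \<nu>])
  obtain E \<delta> \<kappa> where E: "\<And>\<nu>. \<nu> \<in> I \<Longrightarrow> E \<nu> \<noteq> {}"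
    and \<kappa>: "tensor_decomposition RG M C CM I Y (D N) E \<delta> \<kappa>"
    using clifford_coordinates[OF cs dec] by metis
  obtain b where b: "b \<in> E \<nu>" using E[OF \<nu>] by blast
  obtain x where x: "x \<in> carrier M" "\<kappa> \<nu> b x = y" using decomposition_lift[OF Y \<kappa> \<nu> b y] .
  note hom = tensor_decompositionD(1)[OF \<kappa> \<nu> b]
  have "r \<odot>\<^bsub>Y \<nu>\<^esub> y = \<kappa> \<nu> b (r \<odot>\<^bsub>M\<^esub> x)" using module_homD(3)[OF hom r(1) x(1)] x(2) by simp
  also have "\<dots> = \<zero>\<^bsub>Y \<nu>\<^esub>"
    using r(2)[OF x(1)] additive_map_zero[OF M.ab_group Yn.ab_group module_hom_additive[OF hom]] by simp
  finally show ?thesis .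
qed

text \<open>Given a nonzero y and any z, choose a form with f y = 1. The operator u \<mapsto> f(u) z
  is realized by an element of the fixed ring, which sends y to z.\<close>

lemma component_simple:
  assumes cs: "complete_simples C' I N" and dec: "clifford_decomposition R G act M \<phi> I N Y"
    and \<nu>: "\<nu> \<in> I" and nz: "carrier (Y \<nu>) \<noteq> {\<zero>\<^bsub>Y \<nu>\<^esub>}"
  shows "simple_module RG (Y \<nu>)"
proof -
  interpret Yn: alg_module RG "Y \<nu>" by (rule clifford_decomposition_modules[OF dec \<nu>])
  have "\<zero>\<^bsub>Y \<nu>\<^esub> \<in> carrier (Y \<nu>)" by simp
  then obtain y0 where y0: "y0 \<in> carrier (Y \<nu>)" "y0 \<noteq> \<zero>\<^bsub>Y \<nu>\<^esub>" using nz by blast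
  show ?thesis
  proof (rule Yn.simple_moduleI[OF y0])
    fix y z assume y: "y \<in> carrier (Y \<nu>)" "y \<noteq> \<zero>\<^bsub>Y \<nu>\<^esub>" and z: "z \<in> carrier (Y \<nu>)"
    obtain f where f: "linear_form RG (Y \<nu>) f" "f y = 1" using Yn.exists_linear_form[OF y] .
    have L: "linear_map RG (Y \<nu>) RG (Y \<nu>) (\<lambda>u. cscale RG (Y \<nu>) (f u) z)"
      using z linear_formD[OF f(1)]
      by (auto simp: linear_map_def additive_map_def Yn.sc_add_left Yn.sc_mult)
    obtain r where "r \<in> carrier RG" "\<And>u. u \<in> carrier (Y \<nu>) \<Longrightarrow> r \<odot>\<^bsub>Y \<nu>\<^esub> u = cscale RG (Y \<nu>) (f u) z"
    proof (rule realize_on_component[OF cs dec \<nu> L, of "{}" "\<lambda>_. M"])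
      fix r assume "r \<in> carrier RG" "\<And>u. u \<in> carrier (Y \<nu>) \<Longrightarrow> r \<odot>\<^bsub>Y \<nu>\<^esub> u = cscale RG (Y \<nu>) (f u) z"
      then show thesis by (rule that)
    qed simp_all
    then show "\<exists>r\<in>carrier RG. r \<odot>\<^bsub>Y \<nu>\<^esub> y = z" using y(1) z f(2) by (intro bexI[of _ r]) simp_all
  qed
qed

text \<open>Coordinates separate points, so some \<kappa> \<nu> b is nonzero at f s. Composed with f
  it is a nonzero homomorphism between simple modules.\<close>

lemma submodule_isomorphic_component:
  fixes S :: "('r, 's) module"
  assumes cs: "complete_simples C' I N" and dec: "clifford_decomposition R G act M \<phi> I N Y"
    and S: "simple_module RG S" and f: "f \<in> module_hom RG S M" and s: "s \<in> carrier S" "f s \<noteq> \<zero>\<^bsub>M\<^esub>"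
  shows "\<exists>\<nu>\<in>I. isomorphic RG S (Y \<nu>)"
proof -
  note Y = clifford_decomposition_modules[OF dec]
  interpret S: alg_module RG S by (rule simple_alg_module[OF algRG S])
  interpret MG: alg_module RG M by (rule alg_module_RG[OF alg_M])
  obtain E \<delta> \<kappa> where \<kappa>: "tensor_decomposition RG M C CM I Y (D N) E \<delta> \<kappa>"
    using clifford_coordinates[OF cs dec] by metis
  note \<kappa>D = tensor_decompositionD[OF \<kappa>]
  have fs: "f s \<in> carrier M" by (rule module_homD(1)[OF f s(1)])
  obtain \<nu> b where \<nu>: "\<nu> \<in> I" "b \<in> E \<nu>" and ne: "\<kappa> \<nu> b (f s) \<noteq> \<kappa> \<nu> b \<zero>\<^bsub>M\<^esub>"
    using \<kappa>D(3)[OF fs, of "\<zero>\<^bsub>M\<^esub>"] s(2) by auto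
  interpret Yn: alg_module RG "Y \<nu>" by (rule Y[OF \<nu>(1)])
  note hom = \<kappa>D(1)[OF \<nu>]
  have nz: "\<kappa> \<nu> b (f s) \<noteq> \<zero>\<^bsub>Y \<nu>\<^esub>"
    using ne additive_map_zero[OF MG.ab_group Yn.ab_group module_hom_additive[OF hom]] by simp
  have "simple_module RG (Y \<nu>)"
    using component_simple[OF cs dec \<nu>(1)] module_homD(1)[OF hom fs] nz by auto
  from simple_hom_iso[OF S.alg_module_axioms Yn.alg_module_axioms S this module_hom_comp[OF f hom] s(1) nz]
  show ?thesis using \<nu>(1) unfolding isomorphic_def by blast
qed

end

text \<open>Types are not quantified inside a formula. Therefore existence is stated for one element
  type of \<open>Y\<close>, that of the constructed multiplicity spaces, while the remaining claims
  hold for every decomposition over the arbitrary type 'x.\<close>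

theorem theoremA13:
  fixes R :: "(complex, 'r) module"
    and G :: "'g monoid"
    and act :: "'g \<Rightarrow> 'r \<Rightarrow> 'r"
    and \<Lambda> :: "'l set"
    and M :: "'l \<Rightarrow> ('r, 'm) module"
    and \<phi> :: "'l \<Rightarrow> 'g \<Rightarrow> 'm \<Rightarrow> 'm"
    and I :: "'l \<Rightarrow> 'i set"
    and N :: "'l \<Rightarrow> 'i \<Rightarrow> ('g \<Rightarrow> complex, 'n) module"
  assumes action: "algebra_action R G act"
    and finite_group: "finite (carrier G)"
    and simple: "\<And>l. l \<in> \<Lambda> \<Longrightarrow> simple_module R (M l) \<and> fin_dim R (M l)"
    and intertwiners: "\<And>l h. \<lbrakk>l \<in> \<Lambda>; h \<in> inertia R G act (M l)\<rbrakk> \<Longrightarrow>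
          \<phi> l h \<in> module_iso R (M l) (twist G act (inv\<^bsub>G\<^esub> h) (M l))"
    and index: "\<And>l. l \<in> \<Lambda> \<Longrightarrow> complete_simples (CH_inv R G act (M l) (\<phi> l)) (I l) (N l)"
  shows
    "(\<forall>l\<in>\<Lambda>.
        left_module (fixed_ring R G act) (M l) \<and>
        left_module (CH R G act (M l) (\<phi> l)) (CH_module R G act (M l) (\<phi> l)) \<and>
        (\<forall>r\<in>carrier (fixed_ring R G act). \<forall>a\<in>carrier (CH R G act (M l) (\<phi> l)). \<forall>x\<in>carrier (M l).
           r \<odot>\<^bsub>M l\<^esub> (a \<odot>\<^bsub>CH_module R G act (M l) (\<phi> l)\<^esub> x) =
           a \<odot>\<^bsub>CH_module R G act (M l) (\<phi> l)\<^esub> (r \<odot>\<^bsub>M l\<^esub> x)) \<and>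
        complete_simples (CH R G act (M l) (\<phi> l)) (I l)
          (\<lambda>\<nu>. dual_module (inertia R G act (M l)) (CH_inv R G act (M l) (\<phi> l)) (N l \<nu>)) \<and>
        (\<exists>Y :: 'i \<Rightarrow> ('r, ('n \<Rightarrow> complex) \<Rightarrow> 'm) module.
           clifford_decomposition R G act (M l) (\<phi> l) (I l) (N l) Y)) \<and>
     (\<forall>Y :: 'l \<Rightarrow> 'i \<Rightarrow> ('r, 'x) module.
        (\<forall>l\<in>\<Lambda>. clifford_decomposition R G act (M l) (\<phi> l) (I l) (N l) (Y l)) \<longrightarrow>
        (\<forall>l\<in>\<Lambda>. \<forall>\<mu>\<in>I l. carrier (Y l \<mu>) \<noteq> {\<zero>\<^bsub>Y l \<mu>\<^esub>} \<longrightarrow>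
           simple_module (fixed_ring R G act) (Y l \<mu>)) \<and>
        (covers_simples R G act \<Lambda> M \<longrightarrow>
           (\<forall>S :: ('r, 's) module.
              simple_module (fixed_ring R G act) S \<and> fin_dim (fixed_ring R G act) S \<and>
              only_in_fin_dim_simples R G act S \<longrightarrow>
              (\<exists>l\<in>\<Lambda>. \<exists>\<mu>\<in>I l. isomorphic (fixed_ring R G act) S (Y l \<mu>)))) \<and>
        (distinct_orbits R G act \<Lambda> M \<longrightarrow>
           (\<forall>l\<in>\<Lambda>. \<forall>l'\<in>\<Lambda>. \<forall>\<mu>\<in>I l. \<forall>\<mu>'\<in>I l'.
              carrier (Y l \<mu>) \<noteq> {\<zero>\<^bsub>Y l \<mu>\<^esub>} \<and> carrier (Y l' \<mu>') \<noteq> {\<zero>\<^bsub>Y l' \<mu>'\<^esub>} \<and>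
              (l, \<mu>) \<noteq> (l', \<mu>') \<longrightarrow>
              \<not> isomorphic (fixed_ring R G act) (Y l \<mu>) (Y l' \<mu>'))))"
proof -
  let ?RG = "fixed_ring R G act"
  interpret finite_action R G act
    using action finite_group complex_algebra_ring[of R]
    by (simp add: finite_action_def finite_action_axioms_def algebra_action_def)
  have cl: "clifford R G act (M l) (\<phi> l)" if "l \<in> \<Lambda>" for l
    using finite_action_axioms simple[OF that] intertwiners[OF that]
    by (simp add: clifford_def clifford_axioms_def)
  have first: "left_module ?RG (M l) \<and>
        left_module (CH R G act (M l) (\<phi> l)) (CH_module R G act (M l) (\<phi> l)) \<and>
        (\<forall>r\<in>carrier ?RG. \<forall>a\<in>carrier (CH R G act (M l) (\<phi> l)). \<forall>x\<in>carrier (M l).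
           r \<odot>\<^bsub>M l\<^esub> (a \<odot>\<^bsub>CH_module R G act (M l) (\<phi> l)\<^esub> x) =
           a \<odot>\<^bsub>CH_module R G act (M l) (\<phi> l)\<^esub> (r \<odot>\<^bsub>M l\<^esub> x)) \<and>
        complete_simples (CH R G act (M l) (\<phi> l)) (I l)
          (\<lambda>\<nu>. dual_module (inertia R G act (M l)) (CH_inv R G act (M l) (\<phi> l)) (N l \<nu>)) \<and>
        (\<exists>Y :: 'i \<Rightarrow> ('r, ('n \<Rightarrow> complex) \<Rightarrow> 'm) module.
           clifford_decomposition R G act (M l) (\<phi> l) (I l) (N l) Y)" if l: "l \<in> \<Lambda>" for l
  proof -
    interpret clifford R G act "M l" "\<phi> l" by (rule cl[OF l])
    show ?thesis
    proof (intro conjI ballI)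
      show "left_module ?RG (M l)" using alg_module_RG[OF alg_M] by (simp add: alg_module_def)
      show "left_module (CH R G act (M l) (\<phi> l)) (CH_module R G act (M l) (\<phi> l))" by (rule left_module_CM)
      show "complete_simples (CH R G act (M l) (\<phi> l)) (I l)
          (\<lambda>\<nu>. dual_module (inertia R G act (M l)) (CH_inv R G act (M l) (\<phi> l)) (N l \<nu>))"
        by (rule dual_simples(1)[OF index[OF l]])
      show "\<exists>Y :: 'i \<Rightarrow> ('r, ('n \<Rightarrow> complex) \<Rightarrow> 'm) module.
           clifford_decomposition R G act (M l) (\<phi> l) (I l) (N l) Y"
        by (rule exists_clifford_decomposition[OF index[OF l]])
    qed (rule CM_commute)
  qed
  { fix Y :: "'l \<Rightarrow> 'i \<Rightarrow> ('r, 'x) module"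
    assume dec: "\<forall>l\<in>\<Lambda>. clifford_decomposition R G act (M l) (\<phi> l) (I l) (N l) (Y l)"
    have Ym: "alg_module ?RG (Y l \<mu>)" if "l \<in> \<Lambda>" "\<mu> \<in> I l" for l \<mu>
      by (rule clifford.clifford_decomposition_modules[OF cl[OF that(1)] bspec[OF dec that(1)] that(2)])
    have a: "simple_module ?RG (Y l \<mu>)" if "l \<in> \<Lambda>" "\<mu> \<in> I l" "carrier (Y l \<mu>) \<noteq> {\<zero>\<^bsub>Y l \<mu>\<^esub>}" for l \<mu>
      by (rule clifford.component_simple[OF cl[OF that(1)] index[OF that(1)] bspec[OF dec that(1)] that(2,3)])
    have b: "\<exists>l\<in>\<Lambda>. \<exists>\<mu>\<in>I l. isomorphic ?RG S (Y l \<mu>)"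
      if cov: "covers_simples R G act \<Lambda> M" and S: "simple_module ?RG S"
        and only: "only_in_fin_dim_simples R G act S" for S :: "('r, 's) module"
    proof -
      obtain V :: "('r, 'r set) module" and f
        where V: "simple_module R V" and f: "f \<in> module_hom ?RG S V" "inj_on f (carrier S)"
        using simple_RG_module_embeds[OF S] .
      \<comment> \<open>Finite dimensionality is what brings \<open>V\<close> within reach of
        \<open>covers_simples\<close>.\<close>
      have "fin_dim R V" using only V f unfolding only_in_fin_dim_simples_def by blast
      then obtain l g k where l: "l \<in> \<Lambda>" and g: "g \<in> carrier G"
        and k: "k \<in> module_iso R V (twist G act g (M l))"
        using cov V unfolding covers_simples_def isomorphic_def by blast
      interpret V: alg_module R V by (rule simple_alg_module[OF algR V])
      interpret VG: alg_module ?RG V by (rule alg_module_RG[OF V.alg_module_axioms])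
      interpret S: alg_module ?RG S by (rule simple_alg_module[OF algRG S])
      interpret Ml: alg_module R "M l" using simple_alg_module[OF algR] simple[OF l] by blast
      note kD = iso_twistD[OF k]
      \<comment> \<open>On fixed elements the twist by g is invisible, so \<open>k\<close> is a
        homomorphism to M l itself over the fixed ring.\<close>
      have kh: "k \<in> module_hom ?RG V (M l)"
        unfolding module_hom_def using kD(2,3,4) RG_sub RG_fixed g by auto
      obtain s where s: "s \<in> carrier S" "s \<noteq> \<zero>\<^bsub>S\<^esub>" using S.simple_nonzero[OF S] .
      have f0: "f \<zero>\<^bsub>S\<^esub> = \<zero>\<^bsub>V\<^esub>"
        by (rule additive_map_zero[OF S.ab_group V.ab_group module_hom_additive[OF f(1)]])
      have k0: "k \<zero>\<^bsub>V\<^esub> = \<zero>\<^bsub>M l\<^esub>"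
        by (rule additive_map_zero[OF V.ab_group Ml.ab_group module_hom_additive[OF kh]])
      have "f s \<noteq> \<zero>\<^bsub>V\<^esub>" using inj_onD[OF f(2) _ s(1), of "\<zero>\<^bsub>S\<^esub>"] f0 s(2) by auto
      then have "k (f s) \<noteq> \<zero>\<^bsub>M l\<^esub>"
        using inj_onD[OF bij_betw_imp_inj_on[OF kD(1)] _ module_homD(1)[OF f(1) s(1)], of "\<zero>\<^bsub>V\<^esub>"] k0 by auto
      then show ?thesis
        using clifford.submodule_isomorphic_component[OF cl[OF l] index[OF l] bspec[OF dec l] S
            module_hom_comp[OF f(1) kh] s(1)] l by (intro bexI[of _ l])
    qed
    have c: "\<not> isomorphic ?RG (Y l \<mu>) (Y l' \<mu>')"
      if orb: "distinct_orbits R G act \<Lambda> M" and l: "l \<in> \<Lambda>" "l' \<in> \<Lambda>" and \<mu>: "\<mu> \<in> I l" "\<mu>' \<in> I l'"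
        and nz: "carrier (Y l \<mu>) \<noteq> {\<zero>\<^bsub>Y l \<mu>\<^esub>}" and ne: "(l, \<mu>) \<noteq> (l', \<mu>')" for l l' \<mu> \<mu>'
    proof
      assume iso: "isomorphic ?RG (Y l \<mu>) (Y l' \<mu>')"
      interpret clifford R G act "M l" "\<phi> l" by (rule cl[OF l(1)])
      interpret Y: alg_module ?RG "Y l \<mu>" by (rule Ym[OF l(1) \<mu>(1)])
      have decl: "clifford_decomposition R G act (M l) (\<phi> l) (I l) (N l) (Y l)" using dec l(1) by blast
      have id: "linear_map ?RG (Y l \<mu>) ?RG (Y l \<mu>) id" by (auto simp: linear_map_def additive_map_def)
      \<comment> \<open>Such an r contradicts the assumed isomorphism: acting as zero passes to
        isomorphic modules, so the identity of Y l \<mu> would be zero.\<close>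
      have "\<exists>r\<in>carrier ?RG. (\<forall>y\<in>carrier (Y l \<mu>). r \<odot>\<^bsub>Y l \<mu>\<^esub> y = y) \<and>
          (\<forall>y\<in>carrier (Y l' \<mu>'). r \<odot>\<^bsub>Y l' \<mu>'\<^esub> y = \<zero>\<^bsub>Y l' \<mu>'\<^esub>)"
      proof (cases "l = l'")
        \<comment> \<open>Components of one simple module are told apart inside its decomposition;
          the family of further modules to be annihilated is empty.\<close>
        case True
        then have "\<mu>' \<noteq> \<mu>" using ne by simp
        obtain r where "r \<in> carrier ?RG" "\<And>y. y \<in> carrier (Y l \<mu>) \<Longrightarrow> r \<odot>\<^bsub>Y l \<mu>\<^esub> y = id y"
          "\<And>\<nu> y. \<nu> \<in> I l \<Longrightarrow> \<nu> \<noteq> \<mu> \<Longrightarrow> y \<in> carrier (Y l \<nu>) \<Longrightarrow> r \<odot>\<^bsub>Y l \<nu>\<^esub> y = \<zero>\<^bsub>Y l \<nu>\<^esub>"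
        proof (rule realize_on_component[OF index[OF l(1)] decl \<mu>(1) id, of "{}" M])
          fix r assume "r \<in> carrier ?RG" "\<And>y. y \<in> carrier (Y l \<mu>) \<Longrightarrow> r \<odot>\<^bsub>Y l \<mu>\<^esub> y = id y"
            "\<And>\<nu> y. \<nu> \<in> I l \<Longrightarrow> \<nu> \<noteq> \<mu> \<Longrightarrow> y \<in> carrier (Y l \<nu>) \<Longrightarrow> r \<odot>\<^bsub>Y l \<nu>\<^esub> y = \<zero>\<^bsub>Y l \<nu>\<^esub>"
          then show thesis by (rule that)
        qed simp_all
        then show ?thesis using True \<open>\<mu>' \<noteq> \<mu>\<close> \<mu>(2) by (intro bexI[of _ r]) auto
      next
        \<comment> \<open>Here r is also made to annihilate M l', which is possible because no twist
          of M l' is isomorphic to M l; annihilation then passes to the component Y l'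
          \<mu>'.\<close>
        case False
        obtain r where r: "r \<in> carrier ?RG" "\<And>y. y \<in> carrier (Y l \<mu>) \<Longrightarrow> r \<odot>\<^bsub>Y l \<mu>\<^esub> y = id y"
          "\<And>j w. j \<in> {l'} \<Longrightarrow> w \<in> carrier (M j) \<Longrightarrow> r \<odot>\<^bsub>M j\<^esub> w = \<zero>\<^bsub>M j\<^esub>"
        proof (rule realize_on_component[OF index[OF l(1)] decl \<mu>(1) id, of "{l'}" M])
          show "\<not> isomorphic R (twist G act g (M j)) (M l)" if j: "j \<in> {l'}" and g: "g \<in> carrier G" for j g
          proof
            assume "isomorphic R (twist G act g (M j)) (M l)"
            moreover have "alg_module R (M l')" using simple_alg_module[OF algR] simple[OF l(2)] by blast
            ultimately have "isomorphic R (M l) (twist G act g (M l'))"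
              using isomorphic_sym[OF alg_module_twist[OF _ g] alg_M] j by auto
            then show False using orb l g False unfolding distinct_orbits_def by blast
          qed
          fix r assume "r \<in> carrier ?RG" "\<And>y. y \<in> carrier (Y l \<mu>) \<Longrightarrow> r \<odot>\<^bsub>Y l \<mu>\<^esub> y = id y"
            "\<And>j w. j \<in> {l'} \<Longrightarrow> w \<in> carrier (M j) \<Longrightarrow> r \<odot>\<^bsub>M j\<^esub> w = \<zero>\<^bsub>M j\<^esub>"
          then show thesis by (rule that)
        qed (use simple[OF l(2)] in auto)
        have "r \<odot>\<^bsub>Y l' \<mu>'\<^esub> y = \<zero>\<^bsub>Y l' \<mu>'\<^esub>" if "y \<in> carrier (Y l' \<mu>')" for y
          by (rule clifford.component_annihilated[OF cl[OF l(2)] index[OF l(2)] bspec[OF dec l(2)] \<mu>(2) r(1) r(3) that])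
            simp
        then show ?thesis using r(1,2) by (intro bexI[of _ r]) auto
      qed
      then obtain r where r: "r \<in> carrier ?RG" "\<forall>y\<in>carrier (Y l \<mu>). r \<odot>\<^bsub>Y l \<mu>\<^esub> y = y"
        "\<forall>y\<in>carrier (Y l' \<mu>'). r \<odot>\<^bsub>Y l' \<mu>'\<^esub> y = \<zero>\<^bsub>Y l' \<mu>'\<^esub>" by blast
      have iso': "isomorphic ?RG (Y l' \<mu>') (Y l \<mu>)"
        by (rule isomorphic_sym[OF Y.alg_module_axioms Ym[OF l(2) \<mu>(2)] iso])
      have "y = \<zero>\<^bsub>Y l \<mu>\<^esub>" if y: "y \<in> carrier (Y l \<mu>)" for y
        using isomorphic_annihilated[OF Ym[OF l(2) \<mu>(2)] Y.alg_module_axioms iso' r(1) _ y] r(2,3) y by simp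
      moreover have "\<zero>\<^bsub>Y l \<mu>\<^esub> \<in> carrier (Y l \<mu>)" by simp
      ultimately show False using nz by blast
    qed
    have 1: "\<forall>l\<in>\<Lambda>. \<forall>\<mu>\<in>I l. carrier (Y l \<mu>) \<noteq> {\<zero>\<^bsub>Y l \<mu>\<^esub>} \<longrightarrow> simple_module ?RG (Y l \<mu>)"
      by (intro ballI impI) (rule a)
    have 2: "covers_simples R G act \<Lambda> M \<longrightarrow>
        (\<forall>S :: ('r, 's) module. simple_module ?RG S \<and> fin_dim ?RG S \<and> only_in_fin_dim_simples R G act S \<longrightarrow>
          (\<exists>l\<in>\<Lambda>. \<exists>\<mu>\<in>I l. isomorphic ?RG S (Y l \<mu>)))"
      by (intro impI allI, elim conjE) (rule b)
    have 3: "distinct_orbits R G act \<Lambda> M \<longrightarrow>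
        (\<forall>l\<in>\<Lambda>. \<forall>l'\<in>\<Lambda>. \<forall>\<mu>\<in>I l. \<forall>\<mu>'\<in>I l'.
          carrier (Y l \<mu>) \<noteq> {\<zero>\<^bsub>Y l \<mu>\<^esub>} \<and> carrier (Y l' \<mu>') \<noteq> {\<zero>\<^bsub>Y l' \<mu>'\<^esub>} \<and>
          (l, \<mu>) \<noteq> (l', \<mu>') \<longrightarrow> \<not> isomorphic ?RG (Y l \<mu>) (Y l' \<mu>'))"
      by (intro impI ballI, elim conjE) (rule c)
    note conjI[OF 1 conjI[OF 2 3]] }
  note components = this
  show ?thesis
    by (rule conjI, rule ballI, erule first, intro allI impI, erule components)
qed

end
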